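(* Up to saturation by the product of all $27$ variables $E_i,F_{ij},G_j$ and all $36$ roots of $\mathrm{E}_6$, the universal Cox ideal $I_{\mathcal{X}}\subset R[E_1,\dots,E_6,F_{12},\dots,F_{56},G_1,\dots,G_6]$, $R=\mathbb{Z}[d_1,\dots,d_6]$, is generated by $270$ trinomials. These are clustered by $\mathbb{Z}^7$-degrees into $27$ groups of $10$ generators, one for each line on the cubic surface. For instance, the $10$ generators of $I_{\mathcal X}$ that correspond to the line $G_1$ involve the $10$ lines that meet $G_1$. They are, for $2\le i<j<k\le 6$, $$(d_j-d_k)(d_1+d_j+d_k)\,E_iF_{1i}-(d_i-d_k)(d_1+d_i+d_k)\,E_jF_{1j}+(d_i-d_j)(d_1+d_i+d_j)\,E_kF_{1k}.$$ The remaining $260$ trinomials are obtained by applying the action of $W(\mathrm{E}_6)$. The variety defined by $I_{\mathcal X}$ in $\mathbb{P}^5\times(\bar K^* )^{27}/(\bar K^* )^7$ is $6$-dimensional. It is the universal family $\mathcal{X}^0$.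
   Context: $K$ is a field of characteristic $0$ with a non-archimedean valuation and $\bar K$ is its algebraic closure. The $36$ roots of $\mathrm{E}_6$ are the linear forms $d_i-d_j$ ($i<j$), $d_i+d_j+d_k$ ($i<j<k$), $d_1+\dots+d_6$ in $d_1,\dots,d_6$; $\mathbb{P}^5$ has homogeneous coordinates $(d_1:\dots:d_6)$. For $d$ in the complement of the $36$ hyperplanes defined by the roots, the six points $v_i=(1:d_i:d_i^3)\in\mathbb{P}^2$ are in general position, and their blow-up is a smooth cubic surface $X$. Its $27$ lines are $E_i$ (exceptional curves), $F_{ij}=F_{ji}$ (lines through points $i,j$) and $G_j$ (conics through the five points other than the $j$-th). $X^0$ is $X$ minus these $27$ lines. $\mathrm{Cox}(X)=\bigoplus_{\mathcal L\in\mathrm{Pic}(X)}H^0(X,\mathcal L)$ is generated by sections cutting out the $27$ lines and is graded by $\mathrm{Pic}(X)=\mathbb{Z}^7$. This grading defines the action of $(\bar K^* )^7$ on $(\bar K^* )^{27}$, and $X^0\subset(\bar K^* )^{27}/(\bar K^* )^7$. $\mathcal{X}$ denotes the universal cubic surface over $R$, and $\mathcal{X}^0$ denotes the corresponding universal family of very affine surfaces, whose fiber over $d$ is $X^0$. The universal Cox ring is $\mathrm{Cox}(\mathcal{X})=R[E_i,F_{ij},G_j]/I_{\mathcal X}$, graded by $\mathbb{Z}^7$; the universal Cox ideal $I_{\mathcal X}$ is the ideal of relations between the generators with the $d_i$ as parameters. Explicitly one may take: $R'$ the localization of $R$ at the roots, $x=(x_1,x_2,x_3)^T$ and $t_1,\dots,t_6$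 indeterminates, $v_i=(1,d_i,d_i^3)^T$, $\varphi_{ij}=\det(v_i,v_j,x)/(d_i-d_j)$. Then $I_{\mathcal X}$ is the kernel of the $R$-algebra map to $R'[x_1,x_2,x_3,t_1^{\pm1},\dots,t_6^{\pm1}]$ given by $E_i\mapsto t_i$, $F_{ij}\mapsto\varphi_{ij}/(t_it_j)$, and, with $a<b<c<e<f$ the elements of $\{1,\dots,6\}\setminus\{j\}$, $$G_j\mapsto\frac{(d_a+d_b+d_f)(d_c+d_e+d_f)\varphi_{ac}\varphi_{be}-(d_a+d_c+d_f)(d_b+d_e+d_f)\varphi_{ab}\varphi_{ce}}{(d_a-d_e)(d_b-d_c)\,t_at_bt_ct_et_f}.$$ Action of the Weyl group $W(\mathrm{E}_6)$: it acts linearly on the $\mathbb{Q}$-span of $d_1,\dots,d_7$, generated by the permutations of $d_1,\dots,d_6$ (fixing $d_7$) and the reflection $d_i\mapsto d_i-\frac23(d_1+d_2+d_3)$ for $i\le3$, $d_i\mapsto d_i+\frac13(d_1+d_2+d_3)$ for $4\le i\le7$. It preserves the span of $d_1,\dots,d_6$ and permutes, up to sign, both the $36$ roots above and the $27$ forms $d_i-d_7$, $d_i+d_j+d_7$ ($i<j$), $\sum_{i=1}^7d_i-d_j$ (with indices $i,j$ of the $27$ forms in $\{1,\dots,6\}$). It acts on the $27$ variables by the resulting signed permutations via the identification $d_i-d_7\leftrightarrow E_i$, $d_i+d_j+d_7\leftrightarrow F_{ij}$, $\sum_{i=1}^7d_i-d_j\leftrightarrow G_j$, and on coefficients via its action on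 $d_1,\dots,d_6$. "Generated up to saturation" means that the ideals agree after saturating with respect to the product of all the $27$ variables and $36$ roots.
   Formalization: The dimension is 7, not 6 (a 5-dimensional base in P^5 plus 2-dimensional fibres). "It is the universal family" is read as: the variety equals the family over the complement of the 36 hyperplanes and is its Zariski closure, since it also has points over the hyperplanes. *)

theory Defs
  imports
    "HOL-Analysis.Determinants"
    "HOL-Library.Poly_Mapping"
    "HOL-Library.Extended_Real"
    "HOL-Computational_Algebra.Fraction_Field"
    "HOL-Algebra.Algebraic_Closure_Type"
begin

unbundle no Formal_Power_Series.fps_syntax

section \<open>Polynomials\<close>

text \<open>
  A polynomial over \<^typ>\<open>'r\<close> in variables \<^typ>\<open>'v\<close> is a \<^typ>\<open>('v \<Rightarrow>\<^sub>0 nat) \<Rightarrow>\<^sub>0 'r\<close>.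
  \<open>peval c x\<close> is the substitution of \<open>x\<close> for the variables and \<open>c\<close> for the coefficients; it is a
  ring homomorphism whenever \<open>c\<close> is one.
\<close>

definition pvar :: "'v \<Rightarrow> ('v \<Rightarrow>\<^sub>0 nat) \<Rightarrow>\<^sub>0 'r::comm_ring_1" where
  "pvar u = Poly_Mapping.single (Poly_Mapping.single u 1) 1"

definition pconst :: "'r \<Rightarrow> ('v \<Rightarrow>\<^sub>0 nat) \<Rightarrow>\<^sub>0 'r::comm_ring_1" where
  "pconst a = Poly_Mapping.single 0 a"

definition peval ::
  "('r::comm_ring_1 \<Rightarrow> 'b::comm_ring_1) \<Rightarrow> ('v \<Rightarrow> 'b) \<Rightarrow> (('v \<Rightarrow>\<^sub>0 nat) \<Rightarrow>\<^sub>0 'r) \<Rightarrow> 'b" where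
  "peval c x p =
     (\<Sum>m\<in>Poly_Mapping.keys p. c (Poly_Mapping.lookup p m) *
        (\<Prod>u\<in>Poly_Mapping.keys m. x u ^ Poly_Mapping.lookup m u))"

definition ideal_generated :: "'a::comm_ring_1 set \<Rightarrow> 'a set" where
  "ideal_generated B = module.span (*) B"

definition saturation :: "'a::comm_ring_1 set \<Rightarrow> 'a \<Rightarrow> 'a set" where
  "saturation I g = {f. \<exists>n. g ^ n * f \<in> I}"


section \<open>Points, roots and lines\<close>

datatype idx = I1 | I2 | I3 | I4 | I5 | I6

fun idx_nat :: "idx \<Rightarrow> nat" where
  "idx_nat I1 = 1" | "idx_nat I2 = 2" | "idx_nat I3 = 3"
| "idx_nat I4 = 4" | "idx_nat I5 = 5" | "idx_nat I6 = 6"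

lemma idx_nat_inject: "idx_nat i = idx_nat j \<longleftrightarrow> i = j"
  by (cases i; cases j) simp_all

instantiation idx :: linorder
begin
definition less_eq_idx :: "idx \<Rightarrow> idx \<Rightarrow> bool" where "i \<le> j \<longleftrightarrow> idx_nat i \<le> idx_nat j"
definition less_idx :: "idx \<Rightarrow> idx \<Rightarrow> bool" where "i < j \<longleftrightarrow> idx_nat i < idx_nat j"
instance
  by standard (auto simp: less_eq_idx_def less_idx_def idx_nat_inject)
end

lemma UNIV_idx: "UNIV = {I1, I2, I3, I4, I5, I6}"
  using idx.exhaust by blast

instance idx :: finite
  by standard (simp add: UNIV_idx)

typedef idx_pair = "{(i, j). i < (j::idx)}"
  by (rule exI[of _ "(I1, I2)"]) (simp add: less_idx_def)

datatype line = E idx | F_pair idx_pair | G idx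

definition F :: "idx \<Rightarrow> idx \<Rightarrow> line" where \<comment> \<open>only meaningful for \<open>i \<noteq> j\<close>\<close>
  "F i j = F_pair (Abs_idx_pair (min i j, max i j))"

instance line :: finite
proof
  have "UNIV \<subseteq> range E \<union> F_pair ` range Abs_idx_pair \<union> range G"
  proof
    fix l :: line
    show "l \<in> range E \<union> F_pair ` range Abs_idx_pair \<union> range G"
      by (cases l) (auto intro: Rep_idx_pair_inverse[symmetric])
  qed
  then show "finite (UNIV :: line set)"
    by (rule finite_subset) simp
qed

type_synonym 'a dpoly = "(idx \<Rightarrow>\<^sub>0 nat) \<Rightarrow>\<^sub>0 'a"
type_synonym 'a lpoly = "(line \<Rightarrow>\<^sub>0 nat) \<Rightarrow>\<^sub>0 'a dpoly"

text \<open>\<open>R\<close> is \<^typ>\<open>int dpoly\<close>, and the ring containing the universal Cox ideal is \<^typ>\<open>int lpoly\<close>.\<close>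

definition roots :: "'a::comm_ring_1 ^ idx \<Rightarrow> 'a set" where
  "roots \<delta> = {\<delta> $ i - \<delta> $ j | i j. i < j}
           \<union> {\<delta> $ i + \<delta> $ j + \<delta> $ k | i j k. i < j \<and> j < k}
           \<union> {\<Sum>i\<in>UNIV. \<delta> $ i}"

text \<open>The product of all 27 variables and all 36 roots.\<close>

definition saturating_element :: "int lpoly" where
  "saturating_element = (\<Prod>l\<in>UNIV. pvar l) * (\<Prod>r\<in>roots (\<chi> i. pvar i). pconst r)"


section \<open>The grading by the Picard group\<close>

text \<open>
  \<open>Pic(X)\<close> is \<^typ>\<open>int ^ (idx option)\<close>: coordinate \<^term>\<open>None\<close> is the coefficient of the pullback
  of the hyperplane class, \<^term>\<open>Some i\<close> that of the \<open>i\<close>-th exceptional class.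
\<close>

definition pic :: "line \<Rightarrow> int ^ (idx option)" where
  "pic l = (case l of
      E i \<Rightarrow> axis (Some i) 1
    | F_pair q \<Rightarrow> (case Rep_idx_pair q of (i, j) \<Rightarrow>
        axis None 1 - axis (Some i) 1 - axis (Some j) 1)
    | G j \<Rightarrow> axis None 2 - (\<Sum>i\<in>UNIV - {j}. axis (Some i) 1))"

definition anticanonical :: "int ^ (idx option)" where
  "anticanonical = axis None 3 - (\<Sum>i\<in>UNIV. axis (Some i) 1)"

definition intersection_number :: "int ^ (idx option) \<Rightarrow> int ^ (idx option) \<Rightarrow> int" where
  "intersection_number a b = a $ None * b $ None - (\<Sum>i\<in>UNIV. a $ Some i * b $ Some i)"

definition meets :: "line \<Rightarrow> line \<Rightarrow> bool" where
  "meets l m \<longleftrightarrow> intersection_number (pic l) (pic m) = 1"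

definition monom_degree :: "(line \<Rightarrow>\<^sub>0 nat) \<Rightarrow> int ^ (idx option)" where
  "monom_degree m =
     (\<Sum>l\<in>Poly_Mapping.keys m. of_nat (Poly_Mapping.lookup m l) *s pic l)"

definition pic_homogeneous :: "int ^ (idx option) \<Rightarrow> 'a::zero lpoly \<Rightarrow> bool" where
  "pic_homogeneous D f \<longleftrightarrow> (\<forall>m\<in>Poly_Mapping.keys f. monom_degree m = D)"

definition occurring_lines :: "'a::zero lpoly \<Rightarrow> line set" where
  "occurring_lines f = (\<Union>m\<in>Poly_Mapping.keys f. Poly_Mapping.keys m)"


section \<open>The universal Cox ideal\<close>

text \<open>
  The generating sections of the Cox ring, for parameters \<open>\<delta>\<close> in a field mapped by \<open>c\<close> to the ring
  in which the plane coordinates \<open>x\<close>, the units \<open>t\<close> and their inverses \<open>t'\<close> live. The same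
  formulas serve for the universal ideal (indeterminate arguments) and for the Cox coordinates of
  points of a cubic surface (arguments in the algebraic closure).
\<close>

definition cubic_point :: "'b::comm_ring_1 \<Rightarrow> 'b ^ 3" where
  "cubic_point a = vector [1, a, a ^ 3]"

definition \<phi> ::
  "('q::field \<Rightarrow> 'b::comm_ring_1) \<Rightarrow> 'q ^ idx \<Rightarrow> 'b ^ 3 \<Rightarrow> idx \<Rightarrow> idx \<Rightarrow> 'b" where
  "\<phi> c \<delta> x i j =
     c (1 / (\<delta> $ i - \<delta> $ j)) *
     det (vector [cubic_point (c (\<delta> $ i)), cubic_point (c (\<delta> $ j)), x] :: 'b ^ 3 ^ 3)"

definition cox_section ::
  "('q::field \<Rightarrow> 'b::comm_ring_1) \<Rightarrow> 'q ^ idx \<Rightarrow> 'b ^ 3 \<Rightarrow> (idx \<Rightarrow> 'b) \<Rightarrow> (idx \<Rightarrow> 'b) \<Rightarrow> line \<Rightarrow> 'b"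
  where
  "cox_section c \<delta> x t t' l = (case l of
      E i \<Rightarrow> t i
    | F_pair q \<Rightarrow> (case Rep_idx_pair q of (i, j) \<Rightarrow> \<phi> c \<delta> x i j * t' i * t' j)
    | G j \<Rightarrow>
       (let s = sorted_list_of_set (UNIV - {j});
            a = s ! 0; b = s ! 1; k = s ! 2; e = s ! 3; f = s ! 4
        in c (1 / ((\<delta> $ a - \<delta> $ e) * (\<delta> $ b - \<delta> $ k))) *
           (c ((\<delta> $ a + \<delta> $ b + \<delta> $ f) * (\<delta> $ k + \<delta> $ e + \<delta> $ f))
              * \<phi> c \<delta> x a k * \<phi> c \<delta> x b e
          - c ((\<delta> $ a + \<delta> $ k + \<delta> $ f) * (\<delta> $ b + \<delta> $ e + \<delta> $ f))
              * \<phi> c \<delta> x a b * \<phi> c \<delta> x k e)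
           * (t' a * t' b * t' k * t' e * t' f)))"

text \<open>
  The target \<open>R'[x\<^sub>1, x\<^sub>2, x\<^sub>3, t\<^sub>1\<^sup>\<plusminus>\<^sup>1, \<dots>, t\<^sub>6\<^sup>\<plusminus>\<^sup>1]\<close> is regarded as a subring of the Laurent
  polynomials in \<open>t\<close> over \<open>Frac(R)[x\<^sub>1, x\<^sub>2, x\<^sub>3]\<close>, which does not change the kernel: the only
  denominators introduced by \<^const>\<open>cox_section\<close> are products of roots.
\<close>

type_synonym cox_target = "(idx \<Rightarrow>\<^sub>0 int) \<Rightarrow>\<^sub>0 ((3 \<Rightarrow>\<^sub>0 nat) \<Rightarrow>\<^sub>0 int dpoly fract)"

definition target_scalar :: "int dpoly fract \<Rightarrow> cox_target" where
  "target_scalar q = Poly_Mapping.single 0 (pconst q)"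

definition cox_map :: "int lpoly \<Rightarrow> cox_target" where
  "cox_map = peval (\<lambda>r. target_scalar (Fract r 1))
     (cox_section target_scalar (\<chi> i. Fract (pvar i) 1)
        (\<chi> k. Poly_Mapping.single 0 (pvar k))
        (\<lambda>i. Poly_Mapping.single (Poly_Mapping.single i 1) 1)
        (\<lambda>i. Poly_Mapping.single (Poly_Mapping.single i (-1)) 1))"

definition cox_ideal :: "int lpoly set" where
  "cox_ideal = {f. cox_map f = 0}"


section \<open>The Weyl group action\<close>

text \<open>
  The span of \<open>d\<^sub>1, \<dots>, d\<^sub>7\<close> is \<^typ>\<open>rat ^ (idx option)\<close>, with \<open>d\<^sub>7\<close> indexed by \<^term>\<open>None\<close>.
  Generators have finite order, so closure under composition yields the generated group.
\<close>

definition dform :: "idx option \<Rightarrow> rat ^ (idx option)" where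
  "dform k = axis k 1"

definition linear_extension ::
  "(idx option \<Rightarrow> rat ^ (idx option)) \<Rightarrow> rat ^ (idx option) \<Rightarrow> rat ^ (idx option)" where
  "linear_extension g y = (\<Sum>k\<in>UNIV. (y $ k) *s g k)"

definition weyl_reflection :: "rat ^ (idx option) \<Rightarrow> rat ^ (idx option)" where
  "weyl_reflection = linear_extension (\<lambda>k.
     let s = dform (Some I1) + dform (Some I2) + dform (Some I3)
     in if k \<in> {Some I1, Some I2, Some I3} then dform k - (2/3) *s s else dform k + (1/3) *s s)"

inductive_set weyl_E6 :: "(rat ^ (idx option) \<Rightarrow> rat ^ (idx option)) set" where
  id: "id \<in> weyl_E6"
| perm: "w \<in> weyl_E6 \<Longrightarrow> bij \<sigma>
    \<Longrightarrow> linear_extension (\<lambda>k. dform (map_option \<sigma> k)) \<circ> w \<in> weyl_E6"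
| refl: "w \<in> weyl_E6 \<Longrightarrow> weyl_reflection \<circ> w \<in> weyl_E6"

definition line_form :: "line \<Rightarrow> rat ^ (idx option)" where
  "line_form l = (case l of
      E i \<Rightarrow> dform (Some i) - dform None
    | F_pair q \<Rightarrow> (case Rep_idx_pair q of (i, j) \<Rightarrow> dform (Some i) + dform (Some j) + dform None)
    | G j \<Rightarrow> (\<Sum>k\<in>UNIV. dform k) - dform (Some j))"

text \<open>
  The forms \<^term>\<open>line_form l\<close> are pairwise non-proportional, so for \<open>w\<close> in the Weyl group exactly
  one summand below is non-zero.
\<close>

definition weyl_line :: "(rat ^ (idx option) \<Rightarrow> rat ^ (idx option)) \<Rightarrow> line \<Rightarrow> rat lpoly" where
  "weyl_line w l = (\<Sum>m\<in>UNIV.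
     if w (line_form l) = line_form m then pvar m
     else if w (line_form l) = - line_form m then - pvar m else 0)"

text \<open>
  Elements of the group preserve the span of \<open>d\<^sub>1, \<dots>, d\<^sub>6\<close>, so the image of \<open>d\<^sub>i\<close> with \<open>i \<le> 6\<close> has no
  \<open>d\<^sub>7\<close>-component. The reflection has denominators, hence the action is on polynomials over \<open>\<rat>\<close>.
\<close>

definition weyl_coeff ::
  "(rat ^ (idx option) \<Rightarrow> rat ^ (idx option)) \<Rightarrow> rat dpoly \<Rightarrow> rat dpoly" where
  "weyl_coeff w = peval pconst
     (\<lambda>i. \<Sum>k\<in>UNIV. pconst (w (dform (Some i)) $ Some k) * pvar k)"

definition weyl_act ::
  "(rat ^ (idx option) \<Rightarrow> rat ^ (idx option)) \<Rightarrow> rat lpoly \<Rightarrow> rat lpoly" where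
  "weyl_act w = peval (\<lambda>r. pconst (weyl_coeff w r)) (weyl_line w)"

definition rational :: "int lpoly \<Rightarrow> rat lpoly" where
  "rational = Poly_Mapping.map (Poly_Mapping.map of_int)"

definition weyl_orbit :: "int lpoly set \<Rightarrow> int lpoly set" where
  "weyl_orbit A = {f. \<exists>w\<in>weyl_E6. \<exists>g\<in>A. rational f = weyl_act w (rational g)}"

definition G1_trinomial :: "idx \<Rightarrow> idx \<Rightarrow> idx \<Rightarrow> int lpoly" where
  "G1_trinomial i j k =
     (let d = pvar :: idx \<Rightarrow> int dpoly in
        pconst ((d j - d k) * (d I1 + d j + d k)) * pvar (E i) * pvar (F I1 i)
      - pconst ((d i - d k) * (d I1 + d i + d k)) * pvar (E j) * pvar (F I1 j)
      + pconst ((d i - d j) * (d I1 + d i + d j)) * pvar (E k) * pvar (F I1 k))"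

definition G1_trinomials :: "int lpoly set" where
  "G1_trinomials = {G1_trinomial i j k | i j k. I2 \<le> i \<and> i < j \<and> j < k}"


section \<open>The ambient space and its Zariski topology\<close>

definition proj_class :: "'a::field ^ 'n \<Rightarrow> ('a ^ 'n) set" where
  "proj_class x = {c *s x | c. c \<noteq> 0}"

definition torus_orbit :: "(line \<Rightarrow> 'a::field) \<Rightarrow> (line \<Rightarrow> 'a) set" where
  "torus_orbit z =
     {\<lambda>l. (\<Prod>k\<in>UNIV. s k powi (pic l $ k)) * z l | s :: idx option \<Rightarrow> 'a. \<forall>k. s k \<noteq> 0}"

text \<open>
  Points of \<open>\<PP>\<^sup>5 \<times> (K\<^sup>*)\<^sup>2\<^sup>7/(K\<^sup>*)\<^sup>7\<close>. Vanishing of bihomogeneous polynomials does not depend on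
  representatives; \<^const>\<open>cox_ideal\<close> is generated by bihomogeneous polynomials.
\<close>

type_synonym 'a ambient_point = "('a ^ idx) set \<times> (line \<Rightarrow> 'a) set"

definition variety ::
  "('c::comm_ring_1 \<Rightarrow> 'a::field) \<Rightarrow> 'c lpoly set \<Rightarrow> 'a ambient_point set" where
  "variety c P = {(proj_class \<delta>, torus_orbit z) | \<delta> z.
     \<delta> \<noteq> 0 \<and> (\<forall>l. z l \<noteq> 0) \<and> (\<forall>f\<in>P. peval (peval c (($) \<delta>)) z f = 0)}"

definition bihomogeneous :: "'a::zero lpoly \<Rightarrow> bool" where
  "bihomogeneous f \<longleftrightarrow>
     (\<exists>n D. pic_homogeneous D f \<and>
        (\<forall>m\<in>Poly_Mapping.keys f. \<forall>u\<in>Poly_Mapping.keys (Poly_Mapping.lookup f m).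
           (\<Sum>i\<in>UNIV. Poly_Mapping.lookup u i) = n))"

definition zariski_closed :: "'a::field ambient_point set \<Rightarrow> bool" where
  "zariski_closed Z \<longleftrightarrow> (\<exists>P. (\<forall>f\<in>P. bihomogeneous f) \<and> Z = variety (\<lambda>a. a) P)"

definition zariski_closure :: "'a::field ambient_point set \<Rightarrow> 'a ambient_point set" where
  "zariski_closure A = \<Inter> {Z. zariski_closed Z \<and> A \<subseteq> Z}"

definition zariski_closed_in :: "'a::field ambient_point set \<Rightarrow> 'a ambient_point set \<Rightarrow> bool" where
  "zariski_closed_in Y Z \<longleftrightarrow> (\<exists>C. zariski_closed C \<and> Z = Y \<inter> C)"

definition irreducible_closed_in ::
  "'a::field ambient_point set \<Rightarrow> 'a ambient_point set \<Rightarrow> bool" where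
  "irreducible_closed_in Y Z \<longleftrightarrow> zariski_closed_in Y Z \<and> Z \<noteq> {} \<and>
     (\<forall>Z1 Z2. zariski_closed_in Y Z1 \<and> zariski_closed_in Y Z2 \<and> Z = Z1 \<union> Z2
        \<longrightarrow> Z = Z1 \<or> Z = Z2)"

text \<open>Dimension of \<open>Y\<close> as a topological space.\<close>

definition krull_dim :: "'a::field ambient_point set \<Rightarrow> enat" where
  "krull_dim Y = Sup {enat n | n. \<exists>C :: nat \<Rightarrow> 'a ambient_point set.
     (\<forall>i\<le>n. irreducible_closed_in Y (C i)) \<and> (\<forall>i<n. C i \<subset> C (Suc i))}"


section \<open>Cubic surfaces and the universal family\<close>

definition dot :: "'a::field ^ 3 \<Rightarrow> 'a ^ 3 \<Rightarrow> 'a" where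
  "dot l x = (\<Sum>k\<in>UNIV. l $ k * x $ k)"

abbreviation blown_up_point :: "'a::field ^ idx \<Rightarrow> idx \<Rightarrow> 'a ^ 3" where
  "blown_up_point \<delta> i \<equiv> cubic_point (\<delta> $ i)"

text \<open>
  The blow-up of the plane in six distinct points \<open>v\<^sub>i\<close>: a point of it consists of a point \<open>p\<close> of the
  plane and, for each \<open>i\<close>, a line through \<open>v\<^sub>i\<close> and \<open>p\<close>. For \<open>p \<noteq> v\<^sub>i\<close> that line is determined by
  \<open>p\<close>; for \<open>p = v\<^sub>i\<close> it is the tangent direction parametrized by the exceptional curve.
  Lines are given by their dual coordinates.
\<close>

type_synonym 'a surface_point = "('a ^ 3) set \<times> (idx \<Rightarrow> ('a ^ 3) set)"

definition cubic_surface :: "'a::field ^ idx \<Rightarrow> 'a surface_point set" where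
  "cubic_surface \<delta> = {(proj_class x, \<lambda>i. proj_class (l i)) | x l.
     x \<noteq> 0 \<and> (\<forall>i. l i \<noteq> 0 \<and> dot (l i) (blown_up_point \<delta> i) = 0 \<and> dot (l i) x = 0)}"

text \<open>
  The 27 lines. For the strict transform of a plane line or smooth conic, the direction at a
  blown-up point on the curve is required to be the tangent direction.
  The conic of a symmetric matrix \<open>Q\<close> has tangent line \<open>Q v\<close> at its point \<open>v\<close>.
\<close>

definition surface_line :: "'a::field ^ idx \<Rightarrow> line \<Rightarrow> 'a surface_point set" where
  "surface_line \<delta> m = (case m of
      E i \<Rightarrow> {(p, L) \<in> cubic_surface \<delta>. p = proj_class (blown_up_point \<delta> i)}
    | F_pair q \<Rightarrow> (case Rep_idx_pair q of (i, j) \<Rightarrow>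
        {(p, L) \<in> cubic_surface \<delta>. \<exists>h. h \<noteq> 0 \<and>
           dot h (blown_up_point \<delta> i) = 0 \<and> dot h (blown_up_point \<delta> j) = 0 \<and>
           (\<forall>x\<in>p. dot h x = 0) \<and>
           (\<forall>k. p = proj_class (blown_up_point \<delta> k) \<longrightarrow> L k = proj_class h)})
    | G j \<Rightarrow>
        {(p, L) \<in> cubic_surface \<delta>. \<exists>Q :: 'a ^ 3 ^ 3. Q \<noteq> 0 \<and> transpose Q = Q \<and>
           (\<forall>i. i \<noteq> j \<longrightarrow> dot (blown_up_point \<delta> i) (Q *v blown_up_point \<delta> i) = 0) \<and>
           (\<forall>x\<in>p. dot x (Q *v x) = 0) \<and>
           (\<forall>k. p = proj_class (blown_up_point \<delta> k)
              \<longrightarrow> L k = proj_class (Q *v blown_up_point \<delta> k))})"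

definition very_affine_surface :: "'a::field ^ idx \<Rightarrow> 'a surface_point set" where
  "very_affine_surface \<delta> = cubic_surface \<delta> - (\<Union>m. surface_line \<delta> m)"

text \<open>
  The embedding of the very affine surface in the quotient torus by the generators of the Cox
  ring. Changing the representative \<open>x\<close>, or the values \<open>1\<close> for the sections of the exceptional
  curves (which do not meet this surface), stays within the same orbit.
\<close>

definition cox_embedding :: "'a::field ^ idx \<Rightarrow> 'a surface_point \<Rightarrow> (line \<Rightarrow> 'a) set" where
  "cox_embedding \<delta> P =
     (\<Union>x\<in>fst P. torus_orbit (cox_section (\<lambda>a. a) \<delta> x (\<lambda>_. 1) (\<lambda>_. 1)))"

definition universal_family :: "'a::field ambient_point set" where
  "universal_family =
     {(proj_class \<delta>, cox_embedding \<delta> P) | \<delta> P. 0 \<notin> roots \<delta> \<and> P \<in> very_affine_surface \<delta>}"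

definition root_complement :: "('a::field ^ idx) set set" where
  "root_complement = {proj_class \<delta> | \<delta>. 0 \<notin> roots \<delta>}"

definition nonarchimedean_valuation :: "('k::field \<Rightarrow> ereal) \<Rightarrow> bool" where
  "nonarchimedean_valuation val \<longleftrightarrow>
     val 0 = \<infinity> \<and> (\<forall>x. x \<noteq> 0 \<longrightarrow> \<bar>val x\<bar> \<noteq> \<infinity>) \<and>
     (\<forall>x y. val (x * y) = val x + val y) \<and>
     (\<forall>x y. val (x + y) \<ge> min (val x) (val y))"

end

theory Submission
  imports Defs
begin

text \<open>
  Attached to each line \<open>l\<close> are the five pairs of lines that form a tritangent triangle with \<open>l\<close>; any
  three of the corresponding quadratic monomials satisfy one linear relation over \<open>R\<close>, which gives the
  270 trinomials. The Weyl group permutes lines, pairs and relations up to sign, and acts transitively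
  on the lines.

  For the saturation: modulo the trinomials, and once roots and variables are invertible, every variable
  is expressed through \<open>E\<^sub>1, \<dots>, E\<^sub>6, F\<^sub>1\<^sub>2, F\<^sub>1\<^sub>3, F\<^sub>2\<^sub>3\<close>. The sections take arbitrary values on
  these nine variables, so no nonzero polynomial in them lies in the Cox ideal.

  The same elimination shows that, over the root complement, the points of the variety are exactly the
  values of the sections on the very affine surfaces. The vanishing ideal of this family is bihomogeneous
  and defined over the rationals, so its closure is the whole variety. The dimension is bounded below
  by a chain of closed sets that are irreducible because any two of their points are joined by a line in
  parameter space, and above by counting parameters: in a chain of length 8 the eight separating
  polynomials and eight coordinates with independent degrees would be 16 polynomials in 15 parameters,
  and an algebraic relation between them contradicts irreducibility.
\<close>

section \<open>Substitution into polynomials, and independence of characters\<close>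

section \<open>Evaluation homomorphisms\<close>

text \<open>The relations come from geometry: the tritangent planes through a line \<open>l\<close>
  lie in the pencil of planes through \<open>l\<close>, so the five products of two sections belong
  to a two-dimensional space, the sections of class \<open>anticanonical - pic l\<close>. Cohomology
  is avoided by an explicit parameter of the pencil. Attach to each line the form
  \<open>d_7 + aform\<close>. The two \<open>aform\<close> values have the same sum for all pairs of
  \<open>l\<close>, so the products of the two forms differ only in their part without
  \<open>d_7\<close>, which is \<open>qform\<close>; the products of sections are affine in
  \<open>qform\<close>. A Weyl element moves \<open>d_7\<close>. This shifts \<open>qform\<close> by
  a constant, which the differences in a trinomial do not see. The points
  \<open>(1 : a : a^3)\<close> form a cuspidal cubic with additive group law: three distinct ones
  are collinear, and six lie on a conic, iff the parameters sum to zero. This is where the roots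
  come from. The given sections have denominators. Written in elementary symmetric functions they
  are polynomial and make sense in every commutative ring: over rational functions for the Cox
  ideal, in one variable along a segment, in 15 variables for the dimension.\<close>

definition rhom :: "('a::comm_ring_1 \<Rightarrow> 'b::comm_ring_1) \<Rightarrow> bool" where
  "rhom h \<longleftrightarrow> h 1 = 1 \<and> (\<forall>a b. h (a + b) = h a + h b) \<and> (\<forall>a b. h (a * b) = h a * h b)"

lemma rhomI:
  "h 1 = 1 \<Longrightarrow> (\<And>a b. h (a + b) = h a + h b) \<Longrightarrow> (\<And>a b. h (a * b) = h a * h b) \<Longrightarrow> rhom h"
  unfolding rhom_def by blast

lemma
  assumes "rhom h"
  shows rhom_one: "h 1 = 1" and rhom_add: "h (a + b) = h a + h b"
    and rhom_mult: "h (a * b) = h a * h b"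
  using assms unfolding rhom_def by blast+

lemma rhom_zero: assumes "rhom h" shows "h 0 = 0"
  using rhom_add[OF assms, of 0 0] by simp

lemma rhom_minus: assumes "rhom h" shows "h (- a) = - h a"
  using rhom_add[OF assms, of a "-a"] rhom_zero[OF assms] by (simp add: eq_neg_iff_add_eq_0 add.commute)

lemma rhom_diff: assumes "rhom h" shows "h (a - b) = h a - h b"
  using rhom_add[OF assms, of a "-b"] rhom_minus[OF assms, of b] by simp

lemma rhom_power: assumes "rhom h" shows "h (a ^ n) = h a ^ n"
  by (induction n) (simp_all add: rhom_one[OF assms] rhom_mult[OF assms])

lemma rhom_sum: assumes "rhom h" shows "h (sum f A) = (\<Sum>x\<in>A. h (f x))"
  by (induction A rule: infinite_finite_induct)
     (simp_all add: rhom_zero[OF assms] rhom_add[OF assms])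

lemma rhom_prod: assumes "rhom h" shows "h (prod f A) = (\<Prod>x\<in>A. h (f x))"
  by (induction A rule: infinite_finite_induct)
     (simp_all add: rhom_one[OF assms] rhom_mult[OF assms])

lemma rhom_of_nat: assumes "rhom h" shows "h (of_nat n) = of_nat n"
  by (induction n) (simp_all add: rhom_zero[OF assms] rhom_one[OF assms] rhom_add[OF assms])

lemma rhom_of_int': assumes "rhom h" shows "h (of_int n) = of_int n"
  by (cases n rule: int_cases2) (simp_all add: rhom_of_nat[OF assms] rhom_minus[OF assms])

lemma rhom_numeral: assumes "rhom h" shows "h (numeral n) = numeral n"
  using rhom_of_nat[OF assms, of "numeral n"] by simp

lemmas rhom_simps = rhom_zero rhom_one rhom_add rhom_mult rhom_minus rhom_diff rhom_power
  rhom_sum rhom_prod rhom_of_nat rhom_of_int' rhom_numeral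

lemma rhom_comp: "rhom g \<Longrightarrow> rhom h \<Longrightarrow> rhom (\<lambda>a. g (h a))"
  unfolding rhom_def by simp

lemma rhom_id [simp, intro]: "rhom (\<lambda>a. a)"
  unfolding rhom_def by simp

lemma rhom_of_int [simp, intro]: "rhom of_int"
  unfolding rhom_def by simp

lemma rhom_of_rat [simp, intro]: "rhom (of_rat :: rat \<Rightarrow> 'a::field_char_0)"
  unfolding rhom_def by (simp add: of_rat_add of_rat_mult)

lemma rhom_poly [simp, intro]: "rhom (\<lambda>p. poly p (a::'a::comm_ring_1))"
  unfolding rhom_def by simp

lemma rhom_Fract [simp, intro]: "rhom (\<lambda>a::'a::idom. Fract a 1)"
  unfolding rhom_def by (simp add: One_fract_def)

lemma rhom_single0 [simp, intro]:
  "rhom (Poly_Mapping.single (0::'m::comm_monoid_add) :: 'a::comm_ring_1 \<Rightarrow> _)"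
  unfolding rhom_def by (simp add: single_add mult_single)

lemma rhom_pconst [simp, intro]: "rhom pconst"
  unfolding rhom_def pconst_def by (simp add: single_add mult_single)

lemma poly_mapping_sum_single:
  "(p :: 'm \<Rightarrow>\<^sub>0 'a::comm_monoid_add) = (\<Sum>m\<in>Poly_Mapping.keys p. Poly_Mapping.single m (Poly_Mapping.lookup p m))"
proof (rule poly_mapping_eqI)
  fix k
  have "(\<Sum>m\<in>Poly_Mapping.keys p. Poly_Mapping.lookup (Poly_Mapping.single m (Poly_Mapping.lookup p m)) k)
     = (\<Sum>m\<in>Poly_Mapping.keys p. if m = k then Poly_Mapping.lookup p m else 0)"
    by (intro sum.cong) (auto simp: lookup_single when_def)
  also have "\<dots> = Poly_Mapping.lookup p k"
    by (simp add: in_keys_iff)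
  finally show "Poly_Mapping.lookup p k
      = Poly_Mapping.lookup (\<Sum>m\<in>Poly_Mapping.keys p. Poly_Mapping.single m (Poly_Mapping.lookup p m)) k"
    by (simp add: lookup_sum)
qed

lemma poly_mapping_single_induct [case_names single add]:
  fixes p :: "'m \<Rightarrow>\<^sub>0 'a::comm_monoid_add"
  assumes single: "\<And>m a. P (Poly_Mapping.single m a)" and add: "\<And>p q. P p \<Longrightarrow> P q \<Longrightarrow> P (p + q)"
  shows "P p"
proof -
  have P0: "P 0" using single[of undefined 0] by simp
  have "P (\<Sum>m\<in>A. Poly_Mapping.single m (f m))" if "finite A" for A and f :: "'m \<Rightarrow> 'a"
    using that by (induction A rule: finite_induct) (auto intro: P0 single add)
  from this[OF finite_keys] show ?thesis
    by (subst poly_mapping_sum_single)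
qed

text \<open>Evaluation on a monoid algebra with an arbitrary map \<open>ch\<close> on exponents. It
  covers polynomials (\<open>peval\<close>), Laurent polynomials (\<open>target_eval\<close>) and
  maps acting on coefficients alike.\<close>

definition meval :: "('r::comm_ring_1 \<Rightarrow> 'b::comm_ring_1) \<Rightarrow> ('m \<Rightarrow> 'b) \<Rightarrow> ('m \<Rightarrow>\<^sub>0 'r) \<Rightarrow> 'b" where
  "meval c ch p = (\<Sum>m\<in>Poly_Mapping.keys p. c (Poly_Mapping.lookup p m) * ch m)"

lemma meval_superset:
  assumes "rhom c" "finite A" "Poly_Mapping.keys p \<subseteq> A"
  shows "meval c ch p = (\<Sum>m\<in>A. c (Poly_Mapping.lookup p m) * ch m)"
  unfolding meval_def using assms
  by (intro sum.mono_neutral_left) (auto simp: in_keys_iff rhom_zero)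

lemma meval_single: "rhom c \<Longrightarrow> meval c ch (Poly_Mapping.single m a) = c a * ch m"
  by (simp add: meval_superset[of c "{m}"])

lemma meval_add:
  assumes "rhom c" shows "meval c ch (p + q) = meval c ch p + meval c ch q"
proof -
  let ?A = "Poly_Mapping.keys p \<union> Poly_Mapping.keys q"
  have "Poly_Mapping.keys (p + q) \<subseteq> ?A" by (rule keys_add)
  then show ?thesis
    using assms
    by (simp add: meval_superset[of c ?A] lookup_add rhom_add distrib_right sum.distrib)
qed

lemma rhom_meval:
  fixes ch :: "'m::comm_monoid_add \<Rightarrow> 'b::comm_ring_1"
  assumes c: "rhom c" and ch: "ch 0 = 1" "\<And>m n. ch (m + n) = ch m * ch n"
  shows "rhom (meval c ch)"
proof (rule rhomI)
  show "meval c ch 1 = 1"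
    using meval_single[OF c, of ch 0 1] by (simp add: rhom_one[OF c] ch)
  show "meval c ch (p + q) = meval c ch p + meval c ch q" for p q
    by (rule meval_add[OF c])
  show "meval c ch (p * q) = meval c ch p * meval c ch q" for p q
  proof (induction p rule: poly_mapping_single_induct)
    case (single m a)
    show ?case
      by (induction q rule: poly_mapping_single_induct)
         (simp_all add: mult_single meval_single[OF c] meval_add[OF c] rhom_mult[OF c] ch algebra_simps)
  next
    case (add p p')
    then show ?case by (simp add: meval_add[OF c] algebra_simps)
  qed
qed

definition monom_val :: "('v \<Rightarrow> 'b::comm_ring_1) \<Rightarrow> ('v \<Rightarrow>\<^sub>0 nat) \<Rightarrow> 'b" where
  "monom_val x m = (\<Prod>u\<in>Poly_Mapping.keys m. x u ^ Poly_Mapping.lookup m u)"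

lemma peval_meval: "peval c x = meval c (monom_val x)"
  by (simp add: fun_eq_iff peval_def meval_def monom_val_def)

lemma monom_val_superset:
  assumes "finite A" "Poly_Mapping.keys m \<subseteq> A"
  shows "monom_val x m = (\<Prod>u\<in>A. x u ^ Poly_Mapping.lookup m u)"
  unfolding monom_val_def using assms
  by (intro prod.mono_neutral_left) (auto simp: in_keys_iff)

lemma monom_val_finite: "monom_val x m = (\<Prod>u\<in>UNIV. x (u::'v::finite) ^ Poly_Mapping.lookup m u)"
  by (rule monom_val_superset) auto

lemma monom_val_0 [simp]: "monom_val x 0 = 1"
  by (simp add: monom_val_def)

lemma monom_val_add: "monom_val x (m + n) = monom_val x m * monom_val x n"
proof -
  let ?A = "Poly_Mapping.keys m \<union> Poly_Mapping.keys n"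
  have "Poly_Mapping.keys (m + n) \<subseteq> ?A" by (rule keys_add)
  then show ?thesis
    by (simp add: monom_val_superset[of ?A] lookup_add power_add prod.distrib)
qed

lemma monom_val_single: "monom_val x (Poly_Mapping.single u n) = x u ^ n"
  by (simp add: monom_val_superset[of "{u}"])

lemma monom_val_mult: "monom_val (\<lambda>u. x u * y u) m = monom_val x m * monom_val y m"
  by (simp add: monom_val_def power_mult_distrib prod.distrib)

lemma rhom_peval [simp, intro]: "rhom c \<Longrightarrow> rhom (peval c x)"
  unfolding peval_meval by (rule rhom_meval) (auto simp: monom_val_add)

lemma peval_pconst: "rhom c \<Longrightarrow> peval c x (pconst a) = c a"
  by (simp add: peval_meval pconst_def meval_single)

lemma peval_pvar: "rhom c \<Longrightarrow> peval c x (pvar u) = x u"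
  by (simp add: peval_meval pvar_def meval_single monom_val_single rhom_one)

lemma peval_comp:
  assumes "rhom h"
  shows "h (peval c x p) = peval (\<lambda>a. h (c a)) (\<lambda>u. h (x u)) p"
  unfolding peval_def by (simp add: rhom_simps[OF assms])

lemma single_eq_const_monom:
  fixes a :: "'b::comm_ring_1"
  shows "Poly_Mapping.single m a = pconst a * monom_val pvar (m :: 'v \<Rightarrow>\<^sub>0 nat)"
proof -
  have *: "Poly_Mapping.single m 1 = (monom_val pvar m :: ('v \<Rightarrow>\<^sub>0 nat) \<Rightarrow>\<^sub>0 'b)" for m :: "'v \<Rightarrow>\<^sub>0 nat"
  proof (induction m rule: poly_mapping_single_induct)
    case (single u n)
    have "(pvar u :: ('v \<Rightarrow>\<^sub>0 nat) \<Rightarrow>\<^sub>0 'b) ^ n = Poly_Mapping.single (Poly_Mapping.single u n) 1"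
      by (induction n) (simp_all add: pvar_def mult_single single_add[symmetric])
    then show ?case by (simp add: monom_val_single)
  next
    case (add p q)
    then show ?case using mult_single[of p "1::'b" q 1] by (simp add: monom_val_add)
  qed
  show ?thesis unfolding *[symmetric] pconst_def by (simp add: mult_single)
qed

lemma mpoly_induct [case_names const var add mult]:
  fixes p :: "('v \<Rightarrow>\<^sub>0 nat) \<Rightarrow>\<^sub>0 'r::comm_ring_1"
  assumes const: "\<And>a. P (pconst a)" and var: "\<And>u. P (pvar u)"
    and add: "\<And>p q. P p \<Longrightarrow> P q \<Longrightarrow> P (p + q)" and mult: "\<And>p q. P p \<Longrightarrow> P q \<Longrightarrow> P (p * q)"
  shows "P p"
proof (induction p rule: poly_mapping_single_induct)
  case (single m a)
  have one: "P 1" using const[of 1] by (simp add: rhom_one)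
  have "P (monom_val pvar m)"
  proof -
    have *: "P (pvar u ^ n)" for u n
      by (induction n) (auto intro: one var mult)
    have "P (\<Prod>u\<in>A. pvar u ^ Poly_Mapping.lookup m u)" if "finite A" for A
      using that by (induction A rule: finite_induct) (auto intro: one mult *)
    then show ?thesis by (simp add: monom_val_def)
  qed
  then show ?case by (auto simp: single_eq_const_monom intro: const mult)
qed (rule add)

lemma peval_id: "peval pconst pvar p = p"
  by (induction p rule: mpoly_induct)
     (simp_all add: peval_pconst peval_pvar rhom_add rhom_mult)

section \<open>Independence of characters\<close>

text \<open>Dedekind's argument: the relation at \<open>f x y\<close> minus \<open>ch k y\<close>
  times the relation at \<open>x\<close> no longer contains \<open>ch k\<close>. The multiplication
  lives on a set \<open>Y\<close> because it is applied to tori inside function spaces and to pairs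
  of a scalar and a torus element.\<close>

lemma independence_of_characters:
  fixes ch :: "'m \<Rightarrow> 'g \<Rightarrow> 'a::idom"
  assumes "finite S" and e: "e \<in> Y" "\<And>m. m \<in> S \<Longrightarrow> ch m e = 1"
    and closed: "\<And>x y. x \<in> Y \<Longrightarrow> y \<in> Y \<Longrightarrow> f x y \<in> Y"
    and mult: "\<And>m x y. m \<in> S \<Longrightarrow> x \<in> Y \<Longrightarrow> y \<in> Y \<Longrightarrow> ch m (f x y) = ch m x * ch m y"
    and distinct: "\<And>m n. m \<in> S \<Longrightarrow> n \<in> S \<Longrightarrow> m \<noteq> n \<Longrightarrow> \<exists>y\<in>Y. ch m y \<noteq> ch n y"
    and zero: "\<And>x. x \<in> Y \<Longrightarrow> (\<Sum>m\<in>S. a m * ch m x) = 0"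
    and mem: "m \<in> S"
  shows "a m = 0"
  using assms(1,2) e(2) mult distinct zero mem
proof (induction S arbitrary: a m rule: finite_induct)
  case (insert k S)
  have *: "a m * (ch m y - ch k y) = 0" if "m \<in> S" "y \<in> Y" for m y
  proof (rule insert.IH[where a = "\<lambda>m. a m * (ch m y - ch k y)"])
    fix x assume x: "x \<in> Y"
    have "(\<Sum>m\<in>S. a m * (ch m y - ch k y) * ch m x)
        = (\<Sum>m\<in>insert k S. a m * (ch m y - ch k y) * ch m x)"
      using insert.hyps by simp
    also have "\<dots> = (\<Sum>m\<in>insert k S. a m * ch m (f x y)) - ch k y * (\<Sum>m\<in>insert k S. a m * ch m x)"
      unfolding sum_distrib_left sum_subtractf[symmetric]
    proof (rule sum.cong[OF HOL.refl])
      fix m assume "m \<in> insert k S"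
      from insert.prems(3)[OF this x that(2)]
      show "a m * (ch m y - ch k y) * ch m x = a m * ch m (f x y) - ch k y * (a m * ch m x)"
        by (simp only:) (simp add: algebra_simps)
    qed
    also have "\<dots> = 0"
      using insert.prems(5) closed x that by simp
    finally show "(\<Sum>m\<in>S. a m * (ch m y - ch k y) * ch m x) = 0" .
  qed (use insert.prems that e in auto)
  have S0: "a m = 0" if "m \<in> S" for m
  proof -
    have "m \<noteq> k" using insert.hyps that by auto
    then obtain y where "y \<in> Y" "ch m y \<noteq> ch k y" using insert.prems(4)[of m k] \<open>m \<in> S\<close> by auto
    then show ?thesis using *[OF that] by auto
  qed
  have "(\<Sum>m\<in>insert k S. a m * ch m e) = 0" using insert.prems(5) e by blast
  then have "a k = 0" using insert.hyps S0 insert.prems(2)[of k] by simp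
  then show ?case using S0 insert.prems by auto
qed simp

text \<open>Monomials are characters of the torus, and points with one coordinate 2 and all others 1
  already tell them apart in characteristic 0.\<close>

lemma peval_eq_0_on_torus:
  fixes c :: "'r::comm_ring_1 \<Rightarrow> 'a::{idom,ring_char_0}" and p :: "('v \<Rightarrow>\<^sub>0 nat) \<Rightarrow>\<^sub>0 'r"
  assumes c: "rhom c" "inj c" and zero: "\<And>x. (\<And>u. x u \<noteq> 0) \<Longrightarrow> peval c x p = 0"
  shows "p = 0"
proof (rule ccontr)
  assume "p \<noteq> 0"
  then obtain m where m: "m \<in> Poly_Mapping.keys p" by (metis keys_eq_empty ex_in_conv)
  have "c (Poly_Mapping.lookup p m) = 0"
  proof (rule independence_of_characters[where S = "Poly_Mapping.keys p" and e = "\<lambda>_. 1"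
        and Y = "{x. \<forall>u. x u \<noteq> 0}" and f = "\<lambda>x y u. x u * y u" and ch = "\<lambda>m x. monom_val x m"])
    fix m n :: "'v \<Rightarrow>\<^sub>0 nat" assume "m \<noteq> n"
    then obtain u where u: "Poly_Mapping.lookup m u \<noteq> Poly_Mapping.lookup n u"
      by (metis poly_mapping_eqI)
    let ?y = "(\<lambda>_. 1)(u := (2::'a))"
    have val: "monom_val ?y m = 2 ^ Poly_Mapping.lookup m u" for m :: "'v \<Rightarrow>\<^sub>0 nat"
    proof -
      have "monom_val ?y m = (\<Prod>v\<in>insert u (Poly_Mapping.keys m). ?y v ^ Poly_Mapping.lookup m v)"
        by (rule monom_val_superset) auto
      also have "\<dots> = (\<Prod>v\<in>insert u (Poly_Mapping.keys m). if v = u then 2 ^ Poly_Mapping.lookup m u else 1)"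
        by (intro prod.cong) auto
      finally show ?thesis by (simp only: prod.delta finite_insert finite_keys) simp
    qed
    have "(2::'a) ^ Poly_Mapping.lookup m u \<noteq> 2 ^ Poly_Mapping.lookup n u"
    proof
      assume "(2::'a) ^ Poly_Mapping.lookup m u = 2 ^ Poly_Mapping.lookup n u"
      then have "of_nat (2 ^ Poly_Mapping.lookup m u) = (of_nat (2 ^ Poly_Mapping.lookup n u) :: 'a)"
        by simp
      then show False using u by (simp only: of_nat_eq_iff) simp
    qed
    then have "monom_val ?y m \<noteq> monom_val ?y n" by (simp only: val not_False_eq_True)
    moreover have "?y \<in> {x. \<forall>u. x u \<noteq> 0}" by simp
    ultimately show "\<exists>y\<in>{x::'v \<Rightarrow> 'a. \<forall>u. x u \<noteq> 0}. monom_val y m \<noteq> monom_val y n" by blast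
  qed (use m zero in \<open>auto simp: monom_val_mult peval_meval meval_def monom_val_def\<close>)
  then have "Poly_Mapping.lookup p m = 0"
    using c injD[OF c(2), of _ 0] by (simp add: rhom_zero)
  then show False using m by (simp add: in_keys_iff)
qed

text \<open>Lets the generic point, with values in the fraction field of R, be treated like a point
  over any other field of characteristic 0.\<close>

instance fract :: ("{idom,ring_char_0}") field_char_0
proof
  have eq: "of_nat n = (Fract (of_nat n) 1 :: 'a fract)" for n
    by (rule rhom_of_nat[OF rhom_Fract, symmetric])
  show "inj (of_nat :: nat \<Rightarrow> 'a fract)"
    by (rule injI) (simp add: eq eq_fract)
qed

section \<open>The 27 lines: tritangent triangles and their classes\<close>

section \<open>Lines and tritangent planes\<close>

lemma F_eq_F_pair: "i < j \<Longrightarrow> F i j = F_pair (Abs_idx_pair (i, j))"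
  by (simp add: F_def min_def max_def less_le_not_le)

lemma Rep_Abs_idx_pair: "i < j \<Longrightarrow> Rep_idx_pair (Abs_idx_pair (i, j)) = (i, j)"
  by (rule Abs_idx_pair_inverse) simp

lemma line_cases [case_names E F G]:
  obtains i where "l = E i" | i j where "i < j" "l = F i j" | j where "l = G j"
proof (cases l)
  case (F_pair q)
  obtain i j where ij: "Rep_idx_pair q = (i, j)" by fastforce
  then have "i < j" using Rep_idx_pair[of q] by simp
  moreover from this have "l = F i j"
    using ij F_pair by (simp add: F_eq_F_pair) (metis Rep_idx_pair_inverse)
  ultimately show ?thesis using that by blast
qed (use that in auto)

lemma F_commute: "F i j = F j i"
  by (simp add: F_def min.commute max.commute)

lemma F_eq_iff_less: "i < j \<Longrightarrow> k < l \<Longrightarrow> F i j = F k l \<longleftrightarrow> i = k \<and> j = l"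
  by (auto simp: F_eq_F_pair Abs_idx_pair_inject)

lemma F_eq_iff:
  assumes "i \<noteq> j" "k \<noteq> l"
  shows "F i j = F k l \<longleftrightarrow> (i = k \<and> j = l) \<or> (i = l \<and> j = k)"
proof -
  consider "i < j" "k < l" | "j < i" "k < l" | "i < j" "l < k" | "j < i" "l < k"
    using assms by (metis neq_iff)
  then show ?thesis
    by cases (metis F_eq_iff_less F_commute less_asym)+
qed

lemma line_distinct [simp]:
  "F i j \<noteq> E k" "F i j \<noteq> G k" "E k \<noteq> F i j" "G k \<noteq> F i j"
  by (simp_all add: F_def)

lemma UNIV_eq_six: "distinct [i, j, k, l, m, n] \<Longrightarrow> (UNIV :: idx set) = {i, j, k, l, m, n}"
proof -
  assume d: "distinct [i, j, k, l, m, n]"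
  have "card (UNIV :: idx set) = 6" by (simp add: UNIV_idx)
  moreover have "card (set [i, j, k, l, m, n]) = 6"
    using distinct_card[OF d] by simp
  ultimately have "set [i, j, k, l, m, n] = UNIV"
    by (intro card_subset_eq) auto
  then show ?thesis by simp
qed

definition idxs :: "idx list" where "idxs = [I1, I2, I3, I4, I5, I6]"

lemma set_idxs [simp]: "set idxs = UNIV"
  by (auto simp: idxs_def UNIV_idx)

lemma distinct_idxs [simp]: "distinct idxs"
  by (simp add: idxs_def)

text \<open>The triangles are \<open>E_i F_ij G_j\<close> and three \<open>F\<close> whose index
  pairs partition the six indices. A list is used because positions in it later fix the sign of each
  trinomial; at \<open>G I1\<close> the order is that of \<open>G1_trinomial\<close>.\<close>

definition pairs :: "line \<Rightarrow> (line \<times> line) list" where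
  "pairs l = (case l of
      E i \<Rightarrow> map (\<lambda>j. (F i j, G j)) (filter (\<lambda>j. j \<noteq> i) idxs)
    | F_pair q \<Rightarrow> (case Rep_idx_pair q of (i, j) \<Rightarrow>
        let s = filter (\<lambda>k. k \<noteq> i \<and> k \<noteq> j) idxs; k = s ! 0; l = s ! 1; m = s ! 2; n = s ! 3
        in [(E i, G j), (E j, G i), (F k l, F m n), (F k m, F l n), (F k n, F l m)])
    | G j \<Rightarrow> map (\<lambda>i. (E i, F j i)) (filter (\<lambda>i. i \<noteq> j) idxs))"

lemma pairs_E: "pairs (E i) = map (\<lambda>j. (F i j, G j)) (filter (\<lambda>j. j \<noteq> i) idxs)"
  and pairs_G: "pairs (G j) = map (\<lambda>i. (E i, F j i)) (filter (\<lambda>i. i \<noteq> j) idxs)"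
  by (simp_all add: pairs_def)

lemma four_others:
  assumes "i \<noteq> j"
  obtains k l m n where "filter (\<lambda>k. k \<noteq> i \<and> k \<noteq> j) idxs = [k, l, m, n]"
    "distinct [i, j, k, l, m, n]"
  using assms by (cases i; cases j) (simp_all add: idxs_def)

lemma pairs_F:
  assumes "i < j" "filter (\<lambda>k. k \<noteq> i \<and> k \<noteq> j) idxs = [k, l, m, n]"
  shows "pairs (F i j) = [(E i, G j), (E j, G i), (F k l, F m n), (F k m, F l n), (F k n, F l m)]"
  using assms by (simp add: pairs_def F_eq_F_pair Rep_Abs_idx_pair Let_def numeral_eq_Suc)

lemma pairs_F_elim:
  assumes "i < j"
  obtains k l m n where "distinct [i, j, k, l, m, n]"
    "pairs (F i j) = [(E i, G j), (E j, G i), (F k l, F m n), (F k m, F l n), (F k n, F l m)]"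
proof -
  from assms have "i \<noteq> j" by simp
  then obtain k l m n where "filter (\<lambda>k. k \<noteq> i \<and> k \<noteq> j) idxs = [k, l, m, n]"
    "distinct [i, j, k, l, m, n]" by (rule four_others)
  then show ?thesis using that pairs_F[OF assms] by blast
qed

lemma length_pairs: "length (pairs l) = 5"
proof (cases l rule: line_cases)
  case (E i) then show ?thesis by (cases i) (simp_all add: pairs_E idxs_def)
next
  case (F i j)
  obtain k l' m n where "pairs l = [(E i, G j), (E j, G i), (F k l', F m n), (F k m, F l' n), (F k n, F l' m)]"
    using pairs_F_elim[OF F(1)] F(2) by metis
  then show ?thesis by simp
next
  case (G j) then show ?thesis by (cases j) (simp_all add: pairs_G idxs_def)
qed

definition pair_lines :: "line \<Rightarrow> line list" where
  "pair_lines l = map fst (pairs l) @ map snd (pairs l)"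

lemma distinct_pair_lines: "distinct (pair_lines l)"
proof (cases l rule: line_cases)
  case (E i) then show ?thesis
    by (cases i) (simp_all add: pair_lines_def pairs_E idxs_def F_eq_iff)
next
  case (F i j)
  obtain k l' m n where "distinct [i, j, k, l', m, n]"
    "pairs l = [(E i, G j), (E j, G i), (F k l', F m n), (F k m, F l' n), (F k n, F l' m)]"
    using pairs_F_elim[OF F(1)] F(2) by metis
  then show ?thesis by (auto simp: pair_lines_def F_eq_iff)
next
  case (G j) then show ?thesis
    by (cases j) (simp_all add: pair_lines_def pairs_G idxs_def F_eq_iff)
qed

lemma set_pair_lines: "set (pair_lines l) = (\<Union>p\<in>set (pairs l). {fst p, snd p})"
  by (auto simp: pair_lines_def)

lemma distinct_pairs: "distinct (pairs l)"
  using distinct_pair_lines[of l] by (simp add: pair_lines_def distinct_map)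

lemma card_line: "CARD(line) = 27"
proof -
  let ?Fs = "[F I1 I2, F I1 I3, F I1 I4, F I1 I5, F I1 I6, F I2 I3, F I2 I4, F I2 I5, F I2 I6, F I3 I4, F I3 I5, F I3 I6, F I4 I5, F I4 I6, F I5 I6]"
  have "l \<in> set (map E idxs @ map G idxs @ ?Fs)" for l
  proof (cases l rule: line_cases)
    case (F i j)
    then show ?thesis by (cases i; cases j) (simp_all add: less_idx_def)
  qed auto
  then have "UNIV = set (map E idxs @ map G idxs @ ?Fs)" by blast
  moreover have "distinct (map E idxs @ map G idxs @ ?Fs)"
    unfolding idxs_def by (simp add: F_eq_iff_less less_idx_def)
  ultimately have "CARD(line) = length (map E idxs @ map G idxs @ ?Fs)"
    using distinct_card by metis
  then show ?thesis by (simp add: idxs_def)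
qed

section \<open>The Picard grading\<close>

lemma pic_E: "pic (E i) = axis (Some i) 1"
  and pic_G: "pic (G j) = axis None 2 - (\<Sum>i\<in>UNIV - {j}. axis (Some i) 1)"
  by (simp_all add: pic_def)

lemma pic_F: "i \<noteq> j \<Longrightarrow> pic (F i j) = axis None 1 - axis (Some i) 1 - axis (Some j) 1"
proof (induction i j rule: linorder_wlog)
  case (le i j)
  then have "i < j" by simp
  then show ?case by (simp add: pic_def F_eq_F_pair Rep_Abs_idx_pair)
next
  case (sym i j)
  then show ?case by (simp add: F_commute)
qed

lemma axis_nth: "axis a c $ b = (if a = b then c else (0::int))"
  by (simp add: axis_def)

lemma pic_nth:
  "pic (E i) $ None = 0" "pic (E i) $ Some k = of_bool (k = i)"
  "pic (G i) $ None = 2" "pic (G i) $ Some k = of_bool (k = i) - 1"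
  by (auto simp: pic_E pic_G axis_nth)

lemma pic_F_nth: "i \<noteq> j \<Longrightarrow> pic (F i j) $ None = 1"
  "i \<noteq> j \<Longrightarrow> pic (F i j) $ Some k = - of_bool (k = i) - of_bool (k = j)"
  by (auto simp: pic_F axis_nth)

lemma anticanonical_nth: "anticanonical $ None = 3" "anticanonical $ Some k = - 1"
  by (auto simp: anticanonical_def axis_nth)

lemma all_option_iff: "(\<forall>k. P k) \<longleftrightarrow> P None \<and> (\<forall>i. P (Some i))"
  by (metis option.exhaust)

text \<open>The three lines of a triangle form a plane section, and plane sections are
  anticanonical.\<close>

lemma pic_pairs:
  assumes "(m, n) \<in> set (pairs l)"
  shows "pic m + pic n = anticanonical - pic l"
proof (cases l rule: line_cases)
  case (E i)
  then show ?thesis using assms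
    by (auto simp: pairs_E vec_eq_iff all_option_iff pic_nth pic_F_nth anticanonical_nth)
next
  case (F i j)
  obtain k a b c where d: "distinct [i, j, k, a, b, c]"
    and p: "pairs l = [(E i, G j), (E j, G i), (F k a, F b c), (F k b, F a c), (F k c, F a b)]"
    using pairs_F_elim[OF F(1)] F(2) by metis
  have *: "x = i \<or> x = j \<or> x = k \<or> x = a \<or> x = b \<or> x = c" for x
    using UNIV_eq_six[OF d] by blast
  have "pic m $ x + pic n $ x + pic l $ x = anticanonical $ x" for x
  proof (cases x)
    case None
    then show ?thesis using assms d unfolding F(2)
      by (auto simp: p[unfolded F(2)] pic_nth pic_F_nth anticanonical_nth)
  next
    case (Some y)
    then show ?thesis using assms d *[of y] unfolding F(2)
      by (elim disjE) (auto simp: p[unfolded F(2)] pic_nth pic_F_nth anticanonical_nth)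
  qed
  then show ?thesis by (simp add: vec_eq_iff algebra_simps)
next
  case (G j)
  then show ?thesis using assms
    by (auto simp: pairs_G vec_eq_iff all_option_iff pic_nth pic_F_nth anticanonical_nth)
qed

lemma inj_pic: "pic l = pic m \<Longrightarrow> l = m"
proof -
  assume eq: "pic l = pic m"
  then have N: "pic l $ None = pic m $ None" and S: "\<And>k. pic l $ Some k = pic m $ Some k"
    by simp_all
  show ?thesis
  proof (cases l rule: line_cases)
    case (E i)
    then show ?thesis using N S[of i] by (cases m rule: line_cases) (auto simp: pic_nth pic_F_nth split: if_splits)
  next
    case (F i j)
    then show ?thesis using N S[of i] S[of j]
      by (cases m rule: line_cases) (auto simp: pic_nth pic_F_nth F_eq_iff F_commute of_bool_def split: if_splits)
  next
    case (G i)
    then show ?thesis using N S[of i] by (cases m rule: line_cases) (auto simp: pic_nth pic_F_nth split: if_splits)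
  qed
qed

lemma inj_anticanonical_minus_pic: "inj (\<lambda>l. anticanonical - pic l)"
  by (rule injI) (simp add: inj_pic)

lemma intersection_number_add:
  "intersection_number a (b + c) = intersection_number a b + intersection_number a c"
  by (simp add: intersection_number_def algebra_simps sum.distrib)

lemma intersection_number_commute: "intersection_number a b = intersection_number b a"
  by (simp add: intersection_number_def mult.commute)

lemma sum_of_bool_mult [simp]:
  "(\<Sum>i\<in>UNIV. of_bool (i = a) * f i) = (f (a::'i::finite) :: int)"
  "(\<Sum>i\<in>UNIV. f i * of_bool (i = a)) = f a"
  by (simp_all add: of_bool_def if_distrib[of "\<lambda>x. x * _"] if_distrib[of "\<lambda>x. _ * x"] cong: if_cong)

lemma sum_of_bool_UNIV [simp]: "(\<Sum>i\<in>UNIV. of_bool (i = (a::'i::finite))) = (1::int)"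
  using sum_of_bool_mult(1)[of a "\<lambda>_. 1"] by simp

lemma card_idx: "CARD(idx) = 6"
  by (simp add: UNIV_idx)

lemma intersection_number_pic:
  "intersection_number (pic (E i)) (pic (E k)) = - of_bool (i = k)"
  "k \<noteq> l \<Longrightarrow> intersection_number (pic (E i)) (pic (F k l)) = of_bool (i = k) + of_bool (i = l)"
  "intersection_number (pic (E i)) (pic (G k)) = 1 - of_bool (i = k)"
  "i \<noteq> j \<Longrightarrow> k \<noteq> l \<Longrightarrow> intersection_number (pic (F i j)) (pic (F k l))
     = 1 - of_bool (i = k) - of_bool (i = l) - of_bool (j = k) - of_bool (j = l)"
  "i \<noteq> j \<Longrightarrow> intersection_number (pic (F i j)) (pic (G k)) = of_bool (i = k) + of_bool (j = k)"
  "intersection_number (pic (G i)) (pic (G k)) = - of_bool (i = k)"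
  by (simp_all add: intersection_number_def pic_nth pic_F_nth algebra_simps sum.distrib
      sum_subtractf sum_negf card_idx)

lemma intersection_number_line:
  "intersection_number (pic l) (pic l) = -1"
  "intersection_number (pic l) (pic m) \<le> 1"
  "intersection_number (pic l) anticanonical = 1"
proof -
  show "intersection_number (pic l) (pic l) = -1"
    by (cases l rule: line_cases) (auto simp: intersection_number_pic)
  show "intersection_number (pic l) (pic m) \<le> 1"
    using intersection_number_commute[of "pic l" "pic m"]
    by (cases l rule: line_cases; cases m rule: line_cases)
       (auto simp: intersection_number_pic of_bool_def split: if_splits)
  show "intersection_number (pic l) anticanonical = 1"
    by (cases l rule: line_cases)
       (auto simp: intersection_number_def pic_nth pic_F_nth anticanonical_nth sum.distrib sum_subtractf sum_negf card_idx)
qed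

text \<open>Intersecting the anticanonical relation with \<open>l\<close> gives
  \<open>l.m + l.n = 2\<close>, and neither summand exceeds 1.\<close>

lemma pair_lines_subset_meets: "set (pair_lines l) \<subseteq> {m. meets l m}"
proof -
  have "intersection_number (pic l) (pic m) = 1 \<and> intersection_number (pic l) (pic n) = 1"
    if "(m, n) \<in> set (pairs l)" for m n
  proof -
    have "intersection_number (pic l) (pic m) + intersection_number (pic l) (pic n)
       + intersection_number (pic l) (pic l) = 1"
      using pic_pairs[OF that] intersection_number_line(3)[of l]
      by (simp add: intersection_number_add[symmetric] algebra_simps)
    then show ?thesis
      using intersection_number_line(1)[of l] intersection_number_line(2)[of l m]
        intersection_number_line(2)[of l n] by linarith
  qed
  then show ?thesis by (auto simp: pair_lines_def meets_def)
qed

lemma meets_subset_pair_lines: assumes "meets l m" shows "m \<in> set (pair_lines l)"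
proof (cases l rule: line_cases)
  case (E i)
  with assms show ?thesis
    by (cases m rule: line_cases)
       (force simp: meets_def intersection_number_pic pair_lines_def pairs_E F_commute of_bool_def split: if_splits)+
next
  case (F i j)
  obtain k a b c where d: "distinct [i, j, k, a, b, c]"
    and p: "pairs l = [(E i, G j), (E j, G i), (F k a, F b c), (F k b, F a c), (F k c, F a b)]"
    using pairs_F_elim[OF F(1)] F(2) by metis
  have *: "x = i \<or> x = j \<or> x = k \<or> x = a \<or> x = b \<or> x = c" for x
    using UNIV_eq_six[OF d] by blast
  have "intersection_number (pic m) (pic l) = 1" "intersection_number (pic l) (pic m) = 1"
    using assms by (simp_all add: meets_def intersection_number_commute)
  then show ?thesis
  proof (cases m rule: line_cases)
    case m: (F x y)
    then have "x \<noteq> i" "x \<noteq> j" "y \<noteq> i" "y \<noteq> j" "x \<noteq> y"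
      using \<open>intersection_number (pic m) (pic l) = 1\<close> F
      by (auto simp: intersection_number_pic of_bool_def split: if_splits)
    then show ?thesis using *[of x] *[of y] m d
      by (auto simp: pair_lines_def p F_commute)
  qed (use F in \<open>auto simp: intersection_number_pic pair_lines_def p[unfolded F(2)] of_bool_def split: if_splits\<close>)
next
  case (G j)
  have "intersection_number (pic m) (pic l) = 1"
    using assms by (simp add: meets_def intersection_number_commute)
  with G show ?thesis
    by (cases m rule: line_cases)
       (force simp: intersection_number_pic pair_lines_def pairs_G F_commute of_bool_def split: if_splits)+
qed

lemma meets_iff: "{m. meets l m} = set (pair_lines l)"
  using pair_lines_subset_meets meets_subset_pair_lines by blast

lemma card_meets: "card {m. meets l m} = 10"
  by (simp add: meets_iff distinct_card[OF distinct_pair_lines]) (simp add: pair_lines_def length_pairs)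

text \<open>Intersecting with \<open>l\<close> shows that \<open>l\<close> meets \<open>m\<close>;
  the partner of \<open>m\<close> then has the class of \<open>n\<close>. Triangles are thereby
  described by a linear condition, which is the form in which the Weyl group preserves them.\<close>

lemma pairs_if_pic_sum:
  assumes "pic l + pic m + pic n = anticanonical"
  shows "(m, n) \<in> set (pairs l) \<or> (n, m) \<in> set (pairs l)"
proof -
  have "intersection_number (pic l) (pic l) + intersection_number (pic l) (pic m)
      + intersection_number (pic l) (pic n) = 1"
    using intersection_number_line(3)[of l] assms
    by (simp add: intersection_number_add[symmetric])
  then have "meets l m"
    using intersection_number_line(1)[of l] intersection_number_line(2)[of l m]
        intersection_number_line(2)[of l n] unfolding meets_def by linarith
  then obtain m' where "(m, m') \<in> set (pairs l) \<or> (m', m) \<in> set (pairs l)"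
    using meets_iff[of l] unfolding set_pair_lines by fastforce
  moreover from this have "pic m + pic m' = anticanonical - pic l"
    using pic_pairs[of m m' l] pic_pairs[of m' m l] by (auto simp: add.commute)
  then have "pic m' = pic n"
    using assms by (metis add.assoc add_diff_cancel_left' add_left_cancel)
  ultimately show ?thesis using inj_pic by blast
qed

section \<open>The trinomials and polynomial formulas for the sections\<close>

section \<open>Trinomials\<close>

text \<open>
  The form attached to a line, normalized to have \<open>d\<^sub>7\<close>-coefficient \<open>1\<close>, is \<open>d\<^sub>7 + aform \<delta> l\<close>. The
  Weyl group permutes these normalized forms without signs, provided the variable \<open>E\<^sub>i\<close> is replaced
  by its negative, which is what \<open>sval\<close> does.
\<close>

definition aform :: "(idx \<Rightarrow> 'b::comm_ring_1) \<Rightarrow> line \<Rightarrow> 'b" where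
  "aform \<delta> l = (case l of
      E i \<Rightarrow> - \<delta> i
    | F_pair q \<Rightarrow> (case Rep_idx_pair q of (i, j) \<Rightarrow> \<delta> i + \<delta> j)
    | G j \<Rightarrow> (\<Sum>i\<in>UNIV. \<delta> i) - \<delta> j)"

definition sval :: "(line \<Rightarrow> 'b::comm_ring_1) \<Rightarrow> line \<Rightarrow> 'b" where
  "sval z l = (case l of E i \<Rightarrow> - z l | _ \<Rightarrow> z l)"

definition qform :: "(idx \<Rightarrow> 'b::comm_ring_1) \<Rightarrow> line \<times> line \<Rightarrow> 'b" where
  "qform \<delta> p = aform \<delta> (fst p) * aform \<delta> (snd p)"

definition qval :: "(line \<Rightarrow> 'b::comm_ring_1) \<Rightarrow> line \<times> line \<Rightarrow> 'b" where
  "qval z p = sval z (fst p) * sval z (snd p)"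

text \<open>
  For pairs belonging to the same line, the difference of two values of \<open>qform\<close> is up to sign a product
  of two roots, as in the coefficients of \<^const>\<open>G1_trinomial\<close>.
\<close>

definition trinomial ::
  "(idx \<Rightarrow> 'b::comm_ring_1) \<Rightarrow> (line \<Rightarrow> 'b) \<Rightarrow> line \<times> line \<Rightarrow> line \<times> line \<Rightarrow> line \<times> line \<Rightarrow> 'b" where
  "trinomial \<delta> z p q r = (qform \<delta> q - qform \<delta> r) * qval z p - (qform \<delta> p - qform \<delta> r) * qval z q
     + (qform \<delta> p - qform \<delta> q) * qval z r"

lemma aform_simps:
  "aform \<delta> (E i) = - \<delta> i"
  "i \<noteq> j \<Longrightarrow> aform \<delta> (F i j) = \<delta> i + \<delta> j"
  "aform \<delta> (G j) = (\<Sum>i\<in>UNIV. \<delta> i) - \<delta> j"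
proof -
  show "aform \<delta> (F i j) = \<delta> i + \<delta> j" if "i \<noteq> j"
    using that
  proof (induction i j rule: linorder_wlog)
    case (le i j)
    then have "i < j" by simp
    then show ?case by (simp add: aform_def F_eq_F_pair Rep_Abs_idx_pair)
  next
    case (sym i j)
    then show ?case by (simp add: F_commute add.commute)
  qed
qed (simp_all add: aform_def)

lemma sval_simps [simp]:
  "sval z (E i) = - z (E i)" "sval z (F i j) = z (F i j)" "sval z (G j) = z (G j)"
  by (simp_all add: sval_def F_def)

lemma
  assumes "rhom h"
  shows rhom_aform: "h (aform \<delta> l) = aform (\<lambda>i. h (\<delta> i)) l"
    and rhom_sval: "h (sval z l) = sval (\<lambda>l. h (z l)) l"
  by (cases l rule: line_cases; simp add: aform_simps rhom_simps[OF assms])+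

lemma
  assumes "rhom h"
  shows rhom_qform: "h (qform \<delta> p) = qform (\<lambda>i. h (\<delta> i)) p"
    and rhom_qval: "h (qval z p) = qval (\<lambda>l. h (z l)) p"
    and rhom_trinomial: "h (trinomial \<delta> z p q r) = trinomial (\<lambda>i. h (\<delta> i)) (\<lambda>l. h (z l)) p q r"
  by (simp_all add: qform_def qval_def trinomial_def rhom_simps[OF assms]
      rhom_aform[OF assms] rhom_sval[OF assms])

text \<open>Up to sign \<open>trinomial\<close> is the determinant with rows
  \<open>(1, qform, qval)\<close> for the three pairs, so affine dependence of \<open>qval\<close>
  on \<open>qform\<close> kills it. This also explains the alternating signs in
  \<open>trinomial_swap\<close>.\<close>

lemma trinomial_eq_0:
  assumes "\<And>p. p \<in> set (pairs l) \<Longrightarrow> qval z p = a + b * qform \<delta> p"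
    and "p \<in> set (pairs l)" "q \<in> set (pairs l)" "r \<in> set (pairs l)"
  shows "trinomial \<delta> z p q r = 0"
  using assms by (simp add: trinomial_def algebra_simps)

lemma trinomial_swap:
  "trinomial \<delta> z q p r = - trinomial \<delta> z p q r" "trinomial \<delta> z p r q = - trinomial \<delta> z p q r"
  by (simp_all add: trinomial_def algebra_simps)

lemma three_others:
  assumes "distinct [i, j, k :: idx]"
  obtains a b c where "distinct [i, j, k, a, b, c]"
proof -
  have "card (UNIV - {i, j, k}) = 3"
    using assms by (simp add: card_Diff_subset card_idx)
  then obtain a b c where "UNIV - {i, j, k} = {a, b, c}" "a \<noteq> b" "b \<noteq> c" "a \<noteq> c"
    by (auto simp: card_3_iff)
  then have "distinct [i, j, k, a, b, c]" using assms by auto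
  then show ?thesis using that by blast
qed

lemma sum_UNIV_six:
  assumes "distinct [i, j, k, l, m, n :: idx]"
  shows "(\<Sum>x\<in>UNIV. f x) = f i + f j + f k + f l + f m + (f n :: 'b::comm_monoid_add)"
  using assms by (simp add: UNIV_eq_six[OF assms] add.assoc)

definition uroot :: "(idx \<Rightarrow> 'b::comm_ring_1) \<Rightarrow> 'b \<Rightarrow> bool" where
  "uroot \<delta> r \<longleftrightarrow> r \<in> roots (\<chi> i. \<delta> i) \<or> - r \<in> roots (\<chi> i. \<delta> i)"

lemma uroot_diff: "i \<noteq> j \<Longrightarrow> uroot \<delta> (\<delta> i - \<delta> j)"
  unfolding uroot_def roots_def by (cases "i < j") (auto simp: not_less order.order_iff_strict)

lemma uroot_sum3: assumes "distinct [i, j, k]" shows "uroot \<delta> (\<delta> i + \<delta> j + \<delta> k)"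
proof -
  have *: "\<delta> a + \<delta> b + \<delta> c \<in> roots (\<chi> i. \<delta> i)" if "a < b" "b < c" for a b c
    using that unfolding roots_def by auto
  consider "i < j" "j < k" | "i < k" "k < j" | "j < i" "i < k" | "j < k" "k < i" | "k < i" "i < j"
    | "k < j" "j < i"
    using assms by (metis distinct_length_2_or_more linorder_neq_iff)
  then show ?thesis
    unfolding uroot_def
    by cases (use *[of i j k] *[of i k j] *[of j i k] *[of j k i] *[of k i j] *[of k j i]
        in \<open>auto simp: ac_simps\<close>)
qed

lemma uroot_sum: "uroot \<delta> (\<Sum>i\<in>UNIV. \<delta> i)"
  unfolding uroot_def roots_def by simp

lemma uroot_minus: "uroot \<delta> (- r) \<longleftrightarrow> uroot \<delta> r"
  unfolding uroot_def by auto

lemma finite_roots: "finite (roots \<delta>)"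
proof -
  have "roots \<delta> \<subseteq> (\<Union>i j. {\<delta> $ i - \<delta> $ j}) \<union> (\<Union>i j k. {\<delta> $ i + \<delta> $ j + \<delta> $ k})
      \<union> {\<Sum>i\<in>UNIV. \<delta> $ i}"
    unfolding roots_def by (intro Un_mono; blast)
  then show ?thesis by (rule finite_subset) simp
qed

text \<open>The product runs over a set, so roots that become equal under a specialization are
  counted once. For this reason a homomorphism is only ever compared with \<open>root_prod\<close>
  through vanishing, not through equality of the two products.\<close>

definition root_prod :: "(idx \<Rightarrow> 'b::comm_ring_1) \<Rightarrow> 'b" where
  "root_prod \<delta> = (\<Prod>r\<in>roots (\<chi> i. \<delta> i). r)"

lemma uroot_dvd: "uroot \<delta> r \<Longrightarrow> r dvd root_prod \<delta>"
proof -
  have *: "a dvd root_prod \<delta>" if "a \<in> roots (\<chi> i. \<delta> i)" for a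
    unfolding root_prod_def using dvd_prodI[OF finite_roots that, of "\<lambda>r. r"] by simp
  show "r dvd root_prod \<delta>" if "uroot \<delta> r"
    using that unfolding uroot_def
  proof
    assume "- r \<in> roots (\<chi> i. \<delta> i)"
    from *[OF this] show ?thesis by simp
  qed (rule *)
qed

lemma qform_diff:
  assumes "p \<in> set (pairs l)" "q \<in> set (pairs l)" "p \<noteq> q"
  shows "\<exists>r s. uroot \<delta> r \<and> uroot \<delta> s \<and> qform \<delta> p - qform \<delta> q = r * s"
proof (cases l rule: line_cases)
  case (E i)
  then obtain j k where p: "p = (F i j, G j)" "q = (F i k, G k)" and d: "distinct [i, j, k]"
    using assms by (auto simp: pairs_E)
  then obtain a b c where d6: "distinct [i, j, k, a, b, c]" by (metis three_others)
  then have "distinct [a, b, c]" by simp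
  moreover have "qform \<delta> p - qform \<delta> q = (\<delta> j - \<delta> k) * (\<delta> a + \<delta> b + \<delta> c)"
    using d by (simp add: p qform_def aform_simps sum_UNIV_six[OF d6] algebra_simps)
  ultimately show ?thesis using uroot_sum3[of a b c] uroot_diff[of j k] d by fastforce
next
  case (G j)
  then obtain i k where p: "p = (E i, F j i)" "q = (E k, F j k)" and d: "distinct [i, j, k]"
    using assms by (auto simp: pairs_G)
  have "j \<noteq> i" "j \<noteq> k" using d by auto
  then have "qform \<delta> p - qform \<delta> q = (\<delta> k - \<delta> i) * (\<delta> i + \<delta> j + \<delta> k)"
    by (simp add: p qform_def aform_simps algebra_simps)
  then show ?thesis using uroot_sum3[of i j k] uroot_diff[of k i] d by fastforce
next
  case (F i j)
  obtain k a b c where d: "distinct [i, j, k, a, b, c]"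
    and p: "pairs l = [(E i, G j), (E j, G i), (F k a, F b c), (F k b, F a c), (F k c, F a b)]"
    using pairs_F_elim[OF F(1)] F(2) by metis
  have "qform \<delta> (E i, G j) - qform \<delta> (E j, G i) = (\<delta> j - \<delta> i) * (\<Sum>i\<in>UNIV. \<delta> i)"
    by (simp add: qform_def aform_simps algebra_simps)
  then have EE: "\<exists>r s. uroot \<delta> r \<and> uroot \<delta> s \<and> qform \<delta> (E i, G j) - qform \<delta> (E j, G i) = r * s"
    using uroot_diff[of j i] uroot_sum d by (metis distinct_length_2_or_more)
  have EF: "\<exists>r s. uroot \<delta> r \<and> uroot \<delta> s \<and> qform \<delta> (E i, G j) - qform \<delta> (F x y, F u v) = r * s"
    if "distinct [i, j, x, y, u, v]" for i j x y u v
  proof -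
    have "distinct [i, x, y]" "distinct [i, u, v]" using that by auto
    then have "uroot \<delta> (- (\<delta> i + \<delta> x + \<delta> y))" "uroot \<delta> (\<delta> i + \<delta> u + \<delta> v)"
      unfolding uroot_minus by (auto intro!: uroot_sum3)
    moreover have "qform \<delta> (E i, G j) - qform \<delta> (F x y, F u v)
        = - (\<delta> i + \<delta> x + \<delta> y) * (\<delta> i + \<delta> u + \<delta> v)"
      using that by (simp add: qform_def aform_simps sum_UNIV_six[OF that] algebra_simps)
    ultimately show ?thesis by blast
  qed
  \<comment> \<open>Two different splittings of four indices into two pairs, both written with the
    same first index. The difference of the two products factors into two differences of
    parameters.\<close>
  have FF: "\<exists>r s. uroot \<delta> r \<and> uroot \<delta> s \<and> qform \<delta> (F x y, F u v) - qform \<delta> (F x' y', F u' v') = r * s"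
    if "distinct [x, y, u, v]" "{x, y, u, v} = {x', y', u', v'}" "x = x'" "y \<noteq> y'" "distinct [x', y', u', v']"
    for x y u v x' y' u' v'
  proof -
    have "y' = u \<and> (u' = y \<and> v' = v \<or> u' = v \<and> v' = y) \<or> y' = v \<and> (u' = y \<and> v' = u \<or> u' = u \<and> v' = y)"
    proof -
      have "y' \<in> {x, y, u, v}" "u' \<in> {x, y, u, v}" "v' \<in> {x, y, u, v}"
        unfolding that(2) by auto
      then show ?thesis using that(1,3-) by auto
    qed
    then have "qform \<delta> (F x y, F u v) - qform \<delta> (F x' y', F u' v')
        = (if y' = u then (\<delta> v - \<delta> x) * (\<delta> y - \<delta> u) else (\<delta> u - \<delta> x) * (\<delta> y - \<delta> v))"
      using that by (elim disjE conjE) (simp_all add: qform_def aform_simps algebra_simps)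
    moreover have "uroot \<delta> (\<delta> v - \<delta> x)" "uroot \<delta> (\<delta> u - \<delta> x)" "uroot \<delta> (\<delta> y - \<delta> u)" "uroot \<delta> (\<delta> y - \<delta> v)"
      using \<open>distinct [x, y, u, v]\<close> by (auto intro!: uroot_diff)
    ultimately show ?thesis by (cases "y' = u") auto
  qed
  have sym: "\<exists>r s. uroot \<delta> r \<and> uroot \<delta> s \<and> qform \<delta> q - qform \<delta> p = r * s"
    if *: "\<exists>r s. uroot \<delta> r \<and> uroot \<delta> s \<and> qform \<delta> p - qform \<delta> q = r * s" for p q
  proof -
    obtain r s where "uroot \<delta> r" "uroot \<delta> s" "qform \<delta> p - qform \<delta> q = r * s" using * by blast
    moreover have "qform \<delta> q - qform \<delta> p = - (qform \<delta> p - qform \<delta> q)" by simp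
    ultimately have "uroot \<delta> (- r)" "uroot \<delta> s" "qform \<delta> q - qform \<delta> p = (- r) * s"
      by (simp_all add: uroot_minus)
    then show ?thesis by blast
  qed
  have F1: "\<exists>r s. uroot \<delta> r \<and> uroot \<delta> s \<and> qform \<delta> (F k a, F b c) - qform \<delta> (F k b, F a c) = r * s"
    and F2: "\<exists>r s. uroot \<delta> r \<and> uroot \<delta> s \<and> qform \<delta> (F k a, F b c) - qform \<delta> (F k c, F a b) = r * s"
    and F3: "\<exists>r s. uroot \<delta> r \<and> uroot \<delta> s \<and> qform \<delta> (F k b, F a c) - qform \<delta> (F k c, F a b) = r * s"
    by (rule FF; use d in auto)+
  have E1: "\<exists>r s. uroot \<delta> r \<and> uroot \<delta> s \<and> qform \<delta> (E i, G j) - qform \<delta> f = r * s"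
    "\<exists>r s. uroot \<delta> r \<and> uroot \<delta> s \<and> qform \<delta> (E j, G i) - qform \<delta> f = r * s"
    if "f = (F k a, F b c) \<or> f = (F k b, F a c) \<or> f = (F k c, F a b)" for f
    using that by (elim disjE; hypsubst; intro EF; use d in auto)+
  have mem: "p = (E i, G j) \<or> p = (E j, G i) \<or> p = (F k a, F b c) \<or> p = (F k b, F a c) \<or> p = (F k c, F a b)"
    "q = (E i, G j) \<or> q = (E j, G i) \<or> q = (F k a, F b c) \<or> q = (F k b, F a c) \<or> q = (F k c, F a b)"
    using assms p by auto
  define R where "R p q \<longleftrightarrow> (\<exists>r s. uroot \<delta> r \<and> uroot \<delta> s \<and> qform \<delta> p - qform \<delta> q = r * s)" for p q
  have R: "R (E i, G j) (E j, G i)" "R (F k a, F b c) (F k b, F a c)" "R (F k a, F b c) (F k c, F a b)"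
    "R (F k b, F a c) (F k c, F a b)"
    "R (E i, G j) (F k a, F b c)" "R (E i, G j) (F k b, F a c)" "R (E i, G j) (F k c, F a b)"
    "R (E j, G i) (F k a, F b c)" "R (E j, G i) (F k b, F a c)" "R (E j, G i) (F k c, F a b)"
    using EE F1 F2 F3 E1 unfolding R_def by blast+
  have R': "R q p" if "R p q" for p q
    using sym that unfolding R_def by blast
  have "R p q"
    using mem assms(3) by (elim disjE; simp add: R R[THEN R'])
  then show ?thesis unfolding R_def .
qed

text \<open>Inverting the roots thus makes the coefficients of all trinomials invertible. Each of
  the two root factors divides \<open>root_prod\<close>; the square spares a proof that they are
  different.\<close>

lemma qform_diff_dvd:
  assumes "p \<in> set (pairs l)" "q \<in> set (pairs l)" "p \<noteq> q"
  shows "qform \<delta> p - qform \<delta> q dvd root_prod \<delta> ^ 2"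
  using qform_diff[OF assms, of \<delta>] by (auto simp: power2_eq_square intro!: mult_dvd_mono uroot_dvd)

section \<open>Polynomial formulas for the generating sections\<close>

text \<open>Elementary symmetric functions as coefficients of a generating product, which makes the
  recursion over inserted indices immediate.\<close>

definition esym :: "idx set \<Rightarrow> nat \<Rightarrow> (idx \<Rightarrow> 'b::comm_ring_1) \<Rightarrow> 'b" where
  "esym S k \<delta> = coeff (\<Prod>i\<in>S. [:1, \<delta> i:]) k"

lemma esym_empty: "esym {} k \<delta> = of_bool (k = 0)"
  by (cases k) (auto simp: esym_def)

lemma esym_insert:
  "i \<notin> S \<Longrightarrow> esym (insert i S) 0 \<delta> = esym S 0 \<delta>"
  "i \<notin> S \<Longrightarrow> esym (insert i S) (Suc k) \<delta> = esym S (Suc k) \<delta> + \<delta> i * esym S k \<delta>"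
  by (simp_all add: esym_def)

lemma rhom_esym: assumes "rhom h" shows "h (esym S k \<delta>) = esym S k (\<lambda>i. h (\<delta> i))"
proof -
  have "finite S" by simp
  then show ?thesis
  proof (induction S arbitrary: k rule: finite_induct)
    case (insert i S)
    then show ?case by (cases k) (simp_all add: esym_insert rhom_simps[OF assms])
  qed (simp add: esym_empty of_bool_def rhom_simps[OF assms])
qed

lemma esym_0: "esym S 0 \<delta> = 1"
proof -
  have "finite S" by simp
  then show ?thesis by (induction S rule: finite_induct) (simp_all add: esym_empty esym_insert)
qed

lemma esym_1: "esym S (Suc 0) \<delta> = (\<Sum>i\<in>S. \<delta> i)"
proof -
  have "finite S" by simp
  then show ?thesis by (induction S rule: finite_induct) (simp_all add: esym_empty esym_insert esym_0)
qed

lemma esym_large: "card S < k \<Longrightarrow> esym S k \<delta> = 0"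
proof -
  have "finite S" by simp
  then show "card S < k \<Longrightarrow> esym S k \<delta> = 0"
  proof (induction S arbitrary: k rule: finite_induct)
    case (insert i S)
    then show ?case by (cases k) (simp_all add: esym_insert)
  qed (simp add: esym_empty)
qed

text \<open>The form \<open>\<phi>\<close> with its denominator cancelled: the determinant is
  divisible by the difference of the two parameters.\<close>

definition sphi :: "(idx \<Rightarrow> 'b::comm_ring_1) \<Rightarrow> 'b ^ 3 \<Rightarrow> idx \<Rightarrow> idx \<Rightarrow> 'b" where
  "sphi \<delta> x i j = x $ 2 * (\<delta> i ^ 2 + \<delta> i * \<delta> j + \<delta> j ^ 2) - x $ 1 * (\<delta> i * \<delta> j * (\<delta> i + \<delta> j)) - x $ 3"

text \<open>
  With elementary symmetric functions \<open>e\<^sub>k\<close> of five parameters, this takes at \<open>(1, a, a\<^sup>3)\<close> the value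
  \<open>- (a + e\<^sub>1)\<close> times the product of \<open>a - d\<^sub>i\<close>, the sextic with these five roots and no \<open>a\<^sup>5\<close>-term.
\<close>

definition conic_poly :: "'b \<Rightarrow> 'b \<Rightarrow> 'b \<Rightarrow> 'b \<Rightarrow> 'b \<Rightarrow> 'b \<Rightarrow> 'b \<Rightarrow> 'b \<Rightarrow> 'b::comm_ring_1" where
  "conic_poly e1 e2 e3 e4 e5 x y w =
     e1 * e5 * x^2 + (e5 - e1 * e4) * x * y + (e3 - e1 * e2) * x * w + (e1 * e3 - e4) * y^2
     + (e1^2 - e2) * y * w - w^2"

definition sconic :: "(idx \<Rightarrow> 'b::comm_ring_1) \<Rightarrow> 'b ^ 3 \<Rightarrow> idx \<Rightarrow> 'b" where
  "sconic \<delta> x j = (let e = (\<lambda>k. esym (UNIV - {j}) k \<delta>) in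
     conic_poly (e 1) (e 2) (e 3) (e 4) (e 5) (x $ 1) (x $ 2) (x $ 3))"

text \<open>\<open>cox_section\<close> without denominators: it is defined over every commutative
  ring and commutes with all homomorphisms, even where roots vanish.\<close>

definition psec ::
  "(idx \<Rightarrow> 'b::comm_ring_1) \<Rightarrow> 'b ^ 3 \<Rightarrow> (idx \<Rightarrow> 'b) \<Rightarrow> (idx \<Rightarrow> 'b) \<Rightarrow> line \<Rightarrow> 'b" where
  "psec \<delta> x t t' l = (case l of
      E i \<Rightarrow> t i
    | F_pair q \<Rightarrow> (case Rep_idx_pair q of (i, j) \<Rightarrow> sphi \<delta> x i j * t' i * t' j)
    | G j \<Rightarrow> sconic \<delta> x j * (\<Prod>i\<in>UNIV - {j}. t' i))"

lemma sphi_commute: "sphi \<delta> x i j = sphi \<delta> x j i"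
  by (simp add: sphi_def algebra_simps)

lemma psec_simps:
  "psec \<delta> x t t' (E i) = t i"
  "i \<noteq> j \<Longrightarrow> psec \<delta> x t t' (F i j) = sphi \<delta> x i j * t' i * t' j"
  "psec \<delta> x t t' (G j) = sconic \<delta> x j * (\<Prod>i\<in>UNIV - {j}. t' i)"
proof -
  show "psec \<delta> x t t' (F i j) = sphi \<delta> x i j * t' i * t' j" if "i \<noteq> j"
    using that
  proof (induction i j rule: linorder_wlog)
    case (le i j)
    then have "i < j" by simp
    then show ?case by (simp add: psec_def F_eq_F_pair Rep_Abs_idx_pair)
  next
    case (sym i j)
    then show ?case by (simp add: F_commute sphi_commute mult.commute mult.left_commute)
  qed
qed (simp_all add: psec_def)

lemma rhom_conic_poly: "rhom h \<Longrightarrow> h (conic_poly a b c d e x y w)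
    = conic_poly (h a) (h b) (h c) (h d) (h e) (h x) (h y) (h w)"
  by (simp add: conic_poly_def rhom_simps)

lemma rhom_psec:
  assumes "rhom h"
  shows "h (psec \<delta> x t t' l) = psec (\<lambda>i. h (\<delta> i)) (\<chi> k. h (x $ k)) (\<lambda>i. h (t i)) (\<lambda>i. h (t' i)) l"
  by (cases l rule: line_cases)
     (simp_all add: psec_simps sphi_def sconic_def Let_def rhom_conic_poly[OF assms]
       rhom_esym[OF assms] rhom_simps[OF assms])

text \<open>Slope and, below, intercept of the products \<open>F_ij G_j\<close> as functions of
  \<open>qform\<close>, for the pencil through \<open>E_i\<close>. Only \<open>u = d_i\<close> and
  the elementary symmetric functions of the other five parameters may occur: this is what makes the
  two coefficients independent of \<open>j\<close>.\<close>

definition FG_slope :: "'b \<Rightarrow> 'b \<Rightarrow> 'b \<Rightarrow> 'b \<Rightarrow> 'b \<Rightarrow> 'b \<Rightarrow> 'b \<Rightarrow> 'b \<Rightarrow> 'b \<Rightarrow> 'b::comm_ring_1" where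
  "FG_slope u e1 e2 e3 e4 e5 x y w =
    2 * e1 * u * w * y^2 - e1 * u^2 * w * x * y + e1 * u^3 * w * x^2 - e1 * u^3 * y^3 - e1 * w^2
     * x - 2 * e2 * u * w * x * y + e2 * u^2 * w * x^2 + e2 * w * y^2 + e3 * u * w * x^2 + e3 *
     u * y^3 - e3 * u^2 * x * y^2 - e3 * w * x * y - 2 * e4 * u * x * y^2 + e4 * u^2 * x^2 * y +
     e4 * y^3 + 2 * e5 * u * x^2 * y - e5 * u^2 * x^3 - e5 * x * y^2 - 2 * u * w^2 * x + u^2 * w
     * y^2 + u^4 * w * x^2 - u^4 * y^3 + w^2 * y"

definition FG_offset :: "'b \<Rightarrow> 'b \<Rightarrow> 'b \<Rightarrow> 'b \<Rightarrow> 'b \<Rightarrow> 'b \<Rightarrow> 'b \<Rightarrow> 'b \<Rightarrow> 'b \<Rightarrow> 'b::comm_ring_1" where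
  "FG_offset u e1 e2 e3 e4 e5 x y w =
    - 2 * e1 * e2 * u * w * y^2 + e1 * e2 * u^2 * w * x * y - e1 * e2 * u^3 * w * x^2 + e1 * e2
     * u^3 * y^3 + e1 * e2 * w^2 * x + 2 * e1 * e3 * u * w * x * y - e1 * e3 * u^2 * w * x^2 -
     e1 * e3 * w * y^2 - e1 * e4 * u * w * x^2 - e1 * e4 * u * y^3 + e1 * e4 * u^2 * x * y^2 +
     e1 * e4 * w * x * y + 2 * e1 * e5 * u * x * y^2 - e1 * e5 * u^2 * x^2 * y - e1 * e5 * y^3 -
     2 * e1 * u * w^2 * y + 4 * e1 * u^2 * w^2 * x - 2 * e1 * u^3 * w * y^2 - 2 * e1 * u^5 * w *
     x^2 + 2 * e1 * u^5 * y^3 + 2 * e1^2 * u * w^2 * x - e1^2 * u^2 * w * y^2 - e1^2 * u^4 * w *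
     x^2 + e1^2 * u^4 * y^3 - e1^2 * w^2 * y - 3 * e2 * u^2 * w * y^2 + 2 * e2 * u^3 * w * x * y
     - e2 * u^4 * w * x^2 + e2 * u^4 * y^3 + e2 * w^2 * y + 3 * e3 * u^2 * w * x * y - e3 * u^3
     * w * x^2 - e3 * u^3 * y^3 - e3 * w^2 * x - e4 * u^2 * w * x^2 - 2 * e4 * u^2 * y^3 + 2 *
     e4 * u^3 * x * y^2 + e4 * w * y^2 + e5 * u * w * x^2 - e5 * u * y^3 + 3 * e5 * u^2 * x *
     y^2 - 2 * e5 * u^3 * x^2 * y - e5 * w * x * y - 3 * u^2 * w^2 * y + 2 * u^3 * w^2 * x - u^6
     * w * x^2 + u^6 * y^3 + w^3"

text \<open>Here \<open>u\<close> and \<open>v\<close> are the parameters of \<open>i\<close> and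
  \<open>j\<close>, and the \<open>s_k\<close> are the symmetric functions of the other four; the
  last factor is \<open>qform\<close> of \<open>(F i j, G j)\<close>. The conic omits
  \<open>v\<close>, hence its arguments \<open>s_k + u * s_(k-1)\<close>.\<close>

lemma FG_identity:
  fixes u v x y w :: "'b::idom"
  assumes "e1 = s1 + v" "e2 = s2 + v * s1" "e3 = s3 + v * s2" "e4 = s4 + v * s3" "e5 = v * s4"
  shows "(y * (u^2 + u * v + v^2) - x * (u * v * (u + v)) - w)
      * conic_poly (s1 + u) (s2 + u * s1) (s3 + u * s2) (s4 + u * s3) (u * s4) x y w
    = FG_offset u e1 e2 e3 e4 e5 x y w + FG_slope u e1 e2 e3 e4 e5 x y w * ((u + v) * (s1 + u))"
  unfolding conic_poly_def FG_slope_def FG_offset_def assms by Groebner_Basis.algebra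

text \<open>Slope and, below, intercept for the pencil through \<open>F_ij\<close>, in the symmetric
  functions of the four remaining parameters. One choice has to serve both \<open>E_i G_j\<close>
  and the products of two \<open>F\<close>.\<close>

definition EG_slope :: "'b \<Rightarrow> 'b \<Rightarrow> 'b \<Rightarrow> 'b \<Rightarrow> 'b \<Rightarrow> 'b \<Rightarrow> 'b \<Rightarrow> 'b::comm_ring_1" where
  "EG_slope s1 s2 s3 s4 x y w = s4 * x^2 + s2 * y^2 + w * y - s1 * w * x - s3 * x * y"

definition EG_offset :: "'b \<Rightarrow> 'b \<Rightarrow> 'b \<Rightarrow> 'b \<Rightarrow> 'b \<Rightarrow> 'b \<Rightarrow> 'b \<Rightarrow> 'b::comm_ring_1" where
  "EG_offset s1 s2 s3 s4 x y w = s1 * s2 * w * x - s1 * s3 * y^2 + s1 * s4 * x * y - s1^2 * w * y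
     + s2 * w * y - s3 * w * x + s4 * y^2 + w^2"

lemma EG_identity:
  fixes u x y w :: "'b::idom"
  shows "- conic_poly (s1 + u) (s2 + u * s1) (s3 + u * s2) (s4 + u * s3) (u * s4) x y w
    = EG_offset s1 s2 s3 s4 x y w + EG_slope s1 s2 s3 s4 x y w * (- u * (s1 + u))"
  unfolding conic_poly_def EG_offset_def EG_slope_def by Groebner_Basis.algebra

lemma FF_identity:
  fixes k a b c x y w :: "'b::idom"
  assumes "s1 = k + a + b + c" "s2 = k * a + k * b + k * c + a * b + a * c + b * c"
    "s3 = k * a * b + k * a * c + k * b * c + a * b * c" "s4 = k * a * b * c"
  shows "(y * (k^2 + k * a + a^2) - x * (k * a * (k + a)) - w) * (y * (b^2 + b * c + c^2) - x * (b * c * (b + c)) - w)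
    = EG_offset s1 s2 s3 s4 x y w + EG_slope s1 s2 s3 s4 x y w * ((k + a) * (b + c))"
  unfolding EG_offset_def EG_slope_def assms by Groebner_Basis.algebra

lemma sconic_conic_poly:
  fixes \<delta> :: "idx \<Rightarrow> 'b::comm_ring_1"
  assumes "i \<noteq> j"
  defines "s \<equiv> (\<lambda>k. esym (UNIV - {i, j}) k \<delta>)"
  shows "sconic \<delta> x j = conic_poly (s 1 + \<delta> i) (s 2 + \<delta> i * s 1) (s 3 + \<delta> i * s 2) (s 4 + \<delta> i * s 3)
    (\<delta> i * s 4) (x $ 1) (x $ 2) (x $ 3)"
    and "(\<Sum>i\<in>UNIV. \<delta> i) - \<delta> j = s 1 + \<delta> i"
    and "esym (UNIV - {j}) 1 \<delta> = s 1 + \<delta> i" and "esym (UNIV - {j}) 2 \<delta> = s 2 + \<delta> i * s 1"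
    and "esym (UNIV - {j}) 3 \<delta> = s 3 + \<delta> i * s 2" and "esym (UNIV - {j}) 4 \<delta> = s 4 + \<delta> i * s 3"
    and "esym (UNIV - {j}) 5 \<delta> = \<delta> i * s 4"
proof -
  have U: "UNIV - {j} = insert i (UNIV - {i, j})" using assms by auto
  have ins: "esym (UNIV - {j}) (Suc k) \<delta> = s (Suc k) + \<delta> i * s k" for k
    unfolding U s_def by (simp add: esym_insert)
  have "card (UNIV - {i, j}) = 4" using assms by (simp add: card_Diff_subset card_idx)
  \<comment> \<open>Only four indices are left, so the fifth symmetric function of five indices
    reduces to \<open>\<delta> i * s 4\<close>.\<close>
  then have s5: "s 5 = 0" unfolding s_def by (intro esym_large) simp
  have s0: "s 0 = 1" unfolding s_def by (rule esym_0)
  show e: "esym (UNIV - {j}) 1 \<delta> = s 1 + \<delta> i" "esym (UNIV - {j}) 2 \<delta> = s 2 + \<delta> i * s 1"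
    "esym (UNIV - {j}) 3 \<delta> = s 3 + \<delta> i * s 2" "esym (UNIV - {j}) 4 \<delta> = s 4 + \<delta> i * s 3"
    "esym (UNIV - {j}) 5 \<delta> = \<delta> i * s 4"
    using ins[of 0] ins[of 1] ins[of 2] ins[of 3] ins[of 4] s0 s5 by (simp_all add: numeral_eq_Suc)
  show "sconic \<delta> x j = conic_poly (s 1 + \<delta> i) (s 2 + \<delta> i * s 1) (s 3 + \<delta> i * s 2) (s 4 + \<delta> i * s 3)
    (\<delta> i * s 4) (x $ 1) (x $ 2) (x $ 3)"
    unfolding sconic_def Let_def e ..
  have "(\<Sum>i\<in>UNIV. \<delta> i) - \<delta> j = esym (UNIV - {j}) 1 \<delta>"
    using esym_1[of "UNIV - {j}" \<delta>] by (simp add: sum_diff1)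
  then show "(\<Sum>i\<in>UNIV. \<delta> i) - \<delta> j = s 1 + \<delta> i" using e(1) by simp
qed

text \<open>The explicit pencil: \<open>qform\<close> is its parameter, and \<open>a\<close>,
  \<open>b\<close> depend on \<open>l\<close> and on the point but not on the pair. After the torus
  factors common to all pairs are split off, each type of line reduces to one polynomial
  identity.\<close>

lemma psec_relation:
  fixes \<delta> :: "idx \<Rightarrow> 'b::idom"
  assumes tt: "\<And>i. t i * t' i = 1"
  shows "\<exists>a b. \<forall>p\<in>set (pairs l). qval (psec \<delta> x t t') p = a + b * qform \<delta> p"
proof (cases l rule: line_cases)
  case (G j)
  have "qval (psec \<delta> x t t') (E i, F j i)
      = t' j * (x $ 3 - x $ 2 * \<delta> j ^ 2) + t' j * (x $ 2 - x $ 1 * \<delta> j) * qform \<delta> (E i, F j i)"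
    if "i \<noteq> j" for i
  proof -
    have "qval (psec \<delta> x t t') (E i, F j i) = - (t i * t' i) * (t' j * sphi \<delta> x j i)"
      using that by (simp add: qval_def psec_simps ac_simps)
    also have "\<dots> = - (t' j * sphi \<delta> x j i)" by (simp add: tt)
    finally show ?thesis using that
      by (simp add: sphi_def qform_def aform_simps algebra_simps power2_eq_square)
  qed
  then show ?thesis using G by (auto simp: pairs_G)
next
  case (E i)
  \<comment> \<open>The torus factor shared by all pairs: \<open>F i j\<close> contributes
    \<open>t' i * t' j\<close>, and \<open>G j\<close> every factor except
    \<open>t' j\<close>.\<close>
  define P where "P = t' i * (\<Prod>k\<in>UNIV. t' k)"
  define e where "e k = esym (UNIV - {i}) k \<delta>" for k
  define a where "a = FG_offset (\<delta> i) (e 1) (e 2) (e 3) (e 4) (e 5) (x $ 1) (x $ 2) (x $ 3)"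
  define b where "b = FG_slope (\<delta> i) (e 1) (e 2) (e 3) (e 4) (e 5) (x $ 1) (x $ 2) (x $ 3)"
  have "qval (psec \<delta> x t t') (F i j, G j) = a * P + (b * P) * qform \<delta> (F i j, G j)"
    if "j \<noteq> i" for j
  proof -
    have "(\<Prod>k\<in>UNIV. t' k) = t' j * (\<Prod>k\<in>UNIV - {j}. t' k)"
      by (rule prod.remove) auto
    then have "qval (psec \<delta> x t t') (F i j, G j) = (sphi \<delta> x i j * sconic \<delta> x j) * P"
      using that by (simp add: qval_def psec_simps P_def ac_simps)
    also have "sphi \<delta> x i j * sconic \<delta> x j = a + b * ((\<delta> i + \<delta> j) * (esym (UNIV - {i, j}) 1 \<delta> + \<delta> i))"
      unfolding a_def b_def sphi_def sconic_conic_poly(1)[OF that[symmetric]]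
      by (rule FG_identity)
         (use sconic_conic_poly(3-)[OF that, of \<delta>] in \<open>simp_all add: e_def insert_commute\<close>)
    also have "(\<delta> i + \<delta> j) * (esym (UNIV - {i, j}) 1 \<delta> + \<delta> i) = qform \<delta> (F i j, G j)"
      using that sconic_conic_poly(2)[of i j \<delta>] by (simp add: qform_def aform_simps)
    finally show ?thesis by (simp add: algebra_simps)
  qed
  then show ?thesis using E by (auto simp: pairs_E)
next
  case (F i j)
  then have ij: "i \<noteq> j" by simp
  obtain k a b c where d: "distinct [i, j, k, a, b, c]"
    and p: "pairs l = [(E i, G j), (E j, G i), (F k a, F b c), (F k b, F a c), (F k c, F a b)]"
    using pairs_F_elim[OF F(1)] F(2) by metis
  define P where "P = (\<Prod>k\<in>UNIV - {i, j}. t' k)"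
  define s where "s k = esym (UNIV - {i, j}) k \<delta>" for k
  define A where "A = EG_offset (s 1) (s 2) (s 3) (s 4) (x $ 1) (x $ 2) (x $ 3)"
  define B where "B = EG_slope (s 1) (s 2) (s 3) (s 4) (x $ 1) (x $ 2) (x $ 3)"
  have EG: "qval (psec \<delta> x t t') (E u, G v) = A * P + (B * P) * qform \<delta> (E u, G v)"
    if uv: "u \<noteq> v" "{u, v} = {i, j}" for u v
  proof -
    have U: "UNIV - {v} = insert u (UNIV - {i, j})" using that by auto
    have "(\<Prod>k\<in>UNIV - {v}. t' k) = t' u * P"
      unfolding U P_def using that by (subst prod.insert) auto
    then have "qval (psec \<delta> x t t') (E u, G v) = (t u * t' u) * (- sconic \<delta> x v * P)"
      by (simp add: qval_def psec_simps ac_simps)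
    also have "\<dots> = - sconic \<delta> x v * P" by (simp add: tt)
    also have "- sconic \<delta> x v = A + B * (- \<delta> u * (s 1 + \<delta> u))"
      unfolding sconic_conic_poly(1)[OF uv(1)] uv(2) A_def B_def s_def by (rule EG_identity)
    also have "- \<delta> u * (s 1 + \<delta> u) = qform \<delta> (E u, G v)"
      using sconic_conic_poly(2)[OF uv(1), of \<delta>] uv(2) by (simp add: qform_def aform_simps s_def)
    finally show ?thesis by (simp add: algebra_simps)
  qed
  have U4: "UNIV - {i, j} = {k, a, b, c}" using d UNIV_eq_six[OF d] by auto
  have s: "s 1 = \<delta> k + \<delta> a + \<delta> b + \<delta> c"
    "s 2 = \<delta> k * \<delta> a + \<delta> k * \<delta> b + \<delta> k * \<delta> c + \<delta> a * \<delta> b + \<delta> a * \<delta> c + \<delta> b * \<delta> c"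
    "s 3 = \<delta> k * \<delta> a * \<delta> b + \<delta> k * \<delta> a * \<delta> c + \<delta> k * \<delta> b * \<delta> c + \<delta> a * \<delta> b * \<delta> c"
    "s 4 = \<delta> k * \<delta> a * \<delta> b * \<delta> c"
    unfolding s_def U4 using d
    by (simp_all add: numeral_eq_Suc esym_insert esym_0 esym_empty algebra_simps)
  have FF: "qval (psec \<delta> x t t') (F k' a', F b' c') = A * P + (B * P) * qform \<delta> (F k' a', F b' c')"
    if "k' = k" "a' = a \<and> b' = b \<and> c' = c \<or> a' = b \<and> b' = a \<and> c' = c \<or> a' = c \<and> b' = a \<and> c' = b"
    for k' a' b' c'
  proof -
    have d': "distinct [k', a', b', c']" using that d by auto
    have "P = t' k' * t' a' * t' b' * t' c'"
      unfolding P_def U4 using d that by (auto simp: ac_simps)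
    then have "qval (psec \<delta> x t t') (F k' a', F b' c') = (sphi \<delta> x k' a' * sphi \<delta> x b' c') * P"
      using d' by (simp add: qval_def psec_simps ac_simps)
    also have "sphi \<delta> x k' a' * sphi \<delta> x b' c' = A + B * ((\<delta> k' + \<delta> a') * (\<delta> b' + \<delta> c'))"
      unfolding sphi_def A_def B_def
      by (rule FF_identity) (use that in \<open>auto simp: s s(1)[unfolded One_nat_def] algebra_simps\<close>)
    also have "(\<delta> k' + \<delta> a') * (\<delta> b' + \<delta> c') = qform \<delta> (F k' a', F b' c')"
      using d' by (simp add: qform_def aform_simps)
    finally show ?thesis by (simp add: algebra_simps)
  qed
  have "list_all (\<lambda>p. qval (psec \<delta> x t t') p = A * P + (B * P) * qform \<delta> p) (pairs l)"
    unfolding p list.pred_inject by (intro conjI TrueI EG FF) (use ij in auto)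
  then show ?thesis unfolding list_all_iff by blast
qed

lemma trinomial_psec:
  fixes \<delta> :: "idx \<Rightarrow> 'b::idom"
  assumes "\<And>i. t i * t' i = 1"
    and "p \<in> set (pairs l)" "q \<in> set (pairs l)" "r \<in> set (pairs l)"
  shows "trinomial \<delta> (psec \<delta> x t t') p q r = 0"
proof -
  obtain a b where "\<forall>p\<in>set (pairs l). qval (psec \<delta> x t t') p = a + b * qform \<delta> p"
    using psec_relation[of t t', OF assms(1)] by blast
  then show ?thesis by (intro trinomial_eq_0[OF _ assms(2-)]) blast
qed

lemma det_cubic_points:
  "det (vector [cubic_point a, cubic_point b, x] :: 'b::comm_ring_1 ^ 3 ^ 3)
    = (a - b) * (x $ 2 * (a^2 + a * b + b^2) - x $ 1 * (a * b * (a + b)) - x $ 3)"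
  by (simp add: det_3 cubic_point_def algebra_simps power2_eq_square power3_eq_cube)

text \<open>The line pairs \<open>p a k * p b e\<close> and \<open>p a b * p k e\<close> span the
  conics through the points of \<open>a, b, k, e\<close>; the two coefficients make the combination
  vanish at the point of \<open>f\<close> as well. The other side is the symmetric equation of the
  same conic.\<close>

lemma conic_of_five_points:
  fixes a b k e f x y w :: "'b::idom"
  defines "p \<equiv> (\<lambda>i j. y * (i^2 + i * j + j^2) - x * (i * j * (i + j)) - w)"
  shows "(a + b + f) * (k + e + f) * p a k * p b e - (a + k + f) * (b + e + f) * p a b * p k e
    = (a - e) * (b - k) * conic_poly (a + b + k + e + f)
        (a*b + a*k + a*e + a*f + b*k + b*e + b*f + k*e + k*f + e*f)
        (a*b*k + a*b*e + a*b*f + a*k*e + a*k*f + a*e*f + b*k*e + b*k*f + b*e*f + k*e*f)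
        (a*b*k*e + a*b*k*f + a*b*e*f + a*k*e*f + b*k*e*f) (a*b*k*e*f) x y w"
  unfolding p_def conic_poly_def by Groebner_Basis.algebra

lemma sorted_list_of_others:
  fixes j :: idx
  obtains a b k e f where "sorted_list_of_set (UNIV - {j}) = [a, b, k, e, f]"
    "distinct [j, a, b, k, e, f]"
proof -
  have "sorted_list_of_set (UNIV - {j}) = filter (\<lambda>i. i \<noteq> j) idxs"
  proof -
    have "UNIV - {j} = set (filter (\<lambda>i. i \<noteq> j) idxs)" by auto
    moreover have "sorted idxs" by (simp add: idxs_def less_eq_idx_def)
    ultimately show ?thesis
      using sorted_list_of_set.idem_if_sorted_distinct sorted_filter[of id idxs, simplified]
      by (metis distinct_filter distinct_idxs list.map_ident)
  qed
  then show ?thesis using that by (cases j) (simp_all add: idxs_def)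
qed

text \<open>All denominators of \<open>cox_section\<close> are products of roots up to sign and
  cancel off the root hyperplanes. Both the universal ideal and the embedding of the surfaces reach
  the polynomial formulas through this lemma.\<close>

lemma cox_section_eq_psec:
  fixes \<delta> :: "'q::field ^ idx" and c :: "'q \<Rightarrow> 'b::idom"
  assumes c: "rhom c" and \<delta>: "0 \<notin> roots \<delta>"
  shows "cox_section c \<delta> x t t' l = psec (\<lambda>i. c (\<delta> $ i)) x t t' l"
proof -
  have inv: "c (1 / a) * c a = 1" if "a \<noteq> 0" for a
    using that rhom_mult[OF c, of "1 / a" a] rhom_one[OF c] by simp
  have diff: "\<delta> $ i - \<delta> $ j \<noteq> 0" if "i \<noteq> j" for i j
    using uroot_diff[OF that, of "($) \<delta>"] \<delta> by (auto simp: uroot_def)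
  have phi: "\<phi> c \<delta> x i j = sphi (\<lambda>i. c (\<delta> $ i)) x i j" if "i \<noteq> j" for i j
  proof -
    have "\<phi> c \<delta> x i j = (c (1 / (\<delta> $ i - \<delta> $ j)) * c (\<delta> $ i - \<delta> $ j)) * sphi (\<lambda>i. c (\<delta> $ i)) x i j"
      unfolding \<phi>_def det_cubic_points sphi_def by (simp add: rhom_diff[OF c] mult.assoc)
    then show ?thesis using inv diff[OF that] by simp
  qed
  show ?thesis
  proof (cases l rule: line_cases)
    case (E i)
    then show ?thesis by (simp add: cox_section_def psec_simps)
  next
    case (F i j)
    then show ?thesis using phi[of i j]
      by (simp add: cox_section_def psec_def F_eq_F_pair Rep_Abs_idx_pair)
  next
    case (G j)
    obtain a b k e f where s: "sorted_list_of_set (UNIV - {j}) = [a, b, k, e, f]"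
      and d: "distinct [j, a, b, k, e, f]" by (rule sorted_list_of_others)
    have U: "UNIV - {j} = {a, b, k, e, f}" using d UNIV_eq_six[OF d] by auto
    let ?d = "\<lambda>i. c (\<delta> $ i)"
    let ?D = "(\<delta> $ a - \<delta> $ e) * (\<delta> $ b - \<delta> $ k)"
    have D: "c (1 / ?D) * c ?D = 1"
      using d by (intro inv) (simp add: diff[simplified])
    have es: "esym (UNIV - {j}) 1 ?d = ?d a + ?d b + ?d k + ?d e + ?d f"
      "esym (UNIV - {j}) 2 ?d = ?d a * ?d b + ?d a * ?d k + ?d a * ?d e + ?d a * ?d f + ?d b * ?d k + ?d b * ?d e + ?d b * ?d f + ?d k * ?d e + ?d k * ?d f + ?d e * ?d f"
      "esym (UNIV - {j}) 3 ?d = ?d a * ?d b * ?d k + ?d a * ?d b * ?d e + ?d a * ?d b * ?d f + ?d a * ?d k * ?d e + ?d a * ?d k * ?d f + ?d a * ?d e * ?d f + ?d b * ?d k * ?d e + ?d b * ?d k * ?d f + ?d b * ?d e * ?d f + ?d k * ?d e * ?d f"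
      "esym (UNIV - {j}) 4 ?d = ?d a * ?d b * ?d k * ?d e + ?d a * ?d b * ?d k * ?d f + ?d a * ?d b * ?d e * ?d f + ?d a * ?d k * ?d e * ?d f + ?d b * ?d k * ?d e * ?d f"
      "esym (UNIV - {j}) 5 ?d = ?d a * ?d b * ?d k * ?d e * ?d f"
      unfolding U using d
      by (simp_all add: numeral_eq_Suc esym_insert esym_0 esym_empty algebra_simps)
    have "cox_section c \<delta> x t t' l = c (1 / ?D) * (c ?D * sconic ?d x j) * (\<Prod>i\<in>UNIV - {j}. t' i)"
    proof -
      have "c ((\<delta> $ a + \<delta> $ b + \<delta> $ f) * (\<delta> $ k + \<delta> $ e + \<delta> $ f)) * sphi ?d x a k * sphi ?d x b e
          - c ((\<delta> $ a + \<delta> $ k + \<delta> $ f) * (\<delta> $ b + \<delta> $ e + \<delta> $ f)) * sphi ?d x a b * sphi ?d x k e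
          = c ?D * sconic ?d x j"
        unfolding sconic_def Let_def es sphi_def rhom_simps[OF c] by (rule conic_of_five_points)
      moreover have "(\<Prod>i\<in>UNIV - {j}. t' i) = t' a * t' b * t' k * t' e * t' f"
        unfolding U using d by (simp add: ac_simps)
      moreover have "[a, b, k, e, f] ! 0 = a" "[a, b, k, e, f] ! 1 = b" "[a, b, k, e, f] ! 2 = k"
        "[a, b, k, e, f] ! 3 = e" "[a, b, k, e, f] ! 4 = f"
        by (simp_all add: numeral_eq_Suc)
      moreover have "\<phi> c \<delta> x a k = sphi ?d x a k" "\<phi> c \<delta> x b e = sphi ?d x b e"
        "\<phi> c \<delta> x a b = sphi ?d x a b" "\<phi> c \<delta> x k e = sphi ?d x k e"
        using d by (auto intro!: phi)
      ultimately show ?thesis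
        by (simp only: G cox_section_def line.case s Let_def)
    qed
    also have "\<dots> = sconic ?d x j * (\<Prod>i\<in>UNIV - {j}. t' i)"
      using D by (simp flip: mult.assoc)
    finally show ?thesis by (simp add: G psec_simps)
  qed
qed

section \<open>The 270 trinomials\<close>

text \<open>Polymorphic in the coefficients, because the ideal lives over the integers while the
  Weyl reflection needs rational coefficients.\<close>

definition tripoly :: "line \<times> line \<Rightarrow> line \<times> line \<Rightarrow> line \<times> line \<Rightarrow> 'a::comm_ring_1 lpoly" where
  "tripoly = trinomial (\<lambda>i. pconst (pvar i)) pvar"

text \<open>Increasing positions select one of the two signs for each of the
  \<open>5 choose 3 = 10\<close> triples.\<close>

definition trinomials_at :: "line \<Rightarrow> int lpoly set" where
  "trinomials_at l = {tripoly (pairs l ! a) (pairs l ! b) (pairs l ! c) | a b c. a < b \<and> b < c \<and> c < 5}"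

definition all_trinomials :: "int lpoly set" where
  "all_trinomials = (\<Union>l. trinomials_at l)"

definition pair_monom :: "line \<times> line \<Rightarrow> line \<Rightarrow>\<^sub>0 nat" where
  "pair_monom p = Poly_Mapping.single (fst p) 1 + Poly_Mapping.single (snd p) 1"

definition pair_sign :: "line \<times> line \<Rightarrow> 'b::comm_ring_1" where
  "pair_sign p = qval (\<lambda>_. 1) p"

lemma sval_sign: "sval z l = sval (\<lambda>_. 1) l * z l"
  by (cases l rule: line_cases) simp_all

lemma pair_sign: "(pair_sign p :: 'b::comm_ring_1) = 1 \<or> (pair_sign p :: 'b) = -1"
  by (cases "fst p" rule: line_cases; cases "snd p" rule: line_cases) (simp_all add: pair_sign_def qval_def)

lemma qval_pvar: "qval pvar p = Poly_Mapping.single (pair_monom p) (pair_sign p :: 'b::comm_ring_1)"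
proof -
  have "qval pvar p = (pconst (pair_sign p) * (pvar (fst p) * pvar (snd p)) :: (line \<Rightarrow>\<^sub>0 nat) \<Rightarrow>\<^sub>0 'b)"
    unfolding pair_sign_def rhom_qval[OF rhom_pconst] rhom_one[OF rhom_pconst]
    by (simp add: qval_def sval_sign[of pvar] ac_simps)
  then show ?thesis by (simp add: pvar_def pconst_def mult_single pair_monom_def)
qed

lemma keys_pair_monom: "Poly_Mapping.keys (pair_monom p) = {fst p, snd p}"
  by (auto simp: pair_monom_def in_keys_iff lookup_add lookup_single when_def split: if_splits)

lemma pair_unique:
  assumes "p \<in> set (pairs l)" "q \<in> set (pairs l)" "{fst p, snd p} \<inter> {fst q, snd q} \<noteq> {}"
  shows "p = q"
proof -
  have d: "distinct (map fst (pairs l))" "distinct (map snd (pairs l))"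
    and disj: "set (map fst (pairs l)) \<inter> set (map snd (pairs l)) = {}"
    using distinct_pair_lines[of l] by (simp_all add: pair_lines_def)
  have "inj_on fst (set (pairs l))" "inj_on snd (set (pairs l))"
    using d by (auto simp: distinct_map)
  moreover have "fst p \<noteq> snd q" "snd p \<noteq> fst q"
    using disj assms(1,2) by force+
  ultimately show ?thesis using assms by (auto dest: inj_onD)
qed

lemma pair_monom_inj: "p \<in> set (pairs l) \<Longrightarrow> q \<in> set (pairs l) \<Longrightarrow> pair_monom p = pair_monom q \<Longrightarrow> p = q"
  using pair_unique[of p l q] keys_pair_monom[of p] keys_pair_monom[of q] by auto

lemma roots_hom:
  assumes "rhom h" "r \<in> roots (\<chi> i. \<delta> i)"
  shows "h r \<in> roots (\<chi> i. h (\<delta> i))"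
  using assms(2) unfolding roots_def by (auto simp: rhom_simps[OF assms(1)])

text \<open>A point off all 36 hyperplanes: distinct powers of 2 have non-zero differences, and the
  remaining roots take positive integer values.\<close>

lemma generic_roots: "(0 :: 'b::{idom,ring_char_0}) \<notin> roots (\<chi> i. of_nat (2 ^ idx_nat i))"
proof
  assume "(0 :: 'b) \<in> roots (\<chi> i. of_nat (2 ^ idx_nat i))"
  then consider i j where "i < j" "(of_nat (2 ^ idx_nat i) - of_nat (2 ^ idx_nat j) :: 'b) = 0"
    | i j k where "(of_nat (2 ^ idx_nat i) + of_nat (2 ^ idx_nat j) + of_nat (2 ^ idx_nat k) :: 'b) = 0"
    | "(\<Sum>i\<in>UNIV. of_nat (2 ^ idx_nat i) :: 'b) = 0"
    unfolding roots_def vec_lambda_beta by fastforce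
  then show False
  proof cases
    case (1 i j)
    then have "(of_nat (2 ^ idx_nat i) :: 'b) = of_nat (2 ^ idx_nat j)" by simp
    then have "(2::nat) ^ idx_nat i = 2 ^ idx_nat j" by (simp only: of_nat_eq_iff)
    then show False using 1 by (simp add: less_idx_def)
  next
    case (2 i j k)
    then have "(of_nat (2 ^ idx_nat i + 2 ^ idx_nat j + 2 ^ idx_nat k) :: 'b) = of_nat 0"
      by simp
    then have "(2::nat) ^ idx_nat i + 2 ^ idx_nat j + 2 ^ idx_nat k = 0"
      by (simp only: of_nat_eq_iff)
    then show False by simp
  next
    case 3
    then have "(of_nat (\<Sum>i\<in>UNIV. 2 ^ idx_nat i) :: 'b) = of_nat 0" by simp
    then have "(\<Sum>i\<in>UNIV. (2::nat) ^ idx_nat i) = 0" by (simp only: of_nat_eq_iff)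
    then show False by simp
  qed
qed

lemma root_prod_pvar_nonzero: "root_prod pvar \<noteq> (0 :: 'b::{idom,ring_char_0} dpoly)"
proof -
  have "0 \<notin> roots (\<chi> i. (pvar i :: 'b dpoly))"
  proof
    assume "0 \<in> roots (\<chi> i. (pvar i :: 'b dpoly))"
    from roots_hom[OF rhom_peval[OF rhom_id] this, of "\<lambda>i. of_nat (2 ^ idx_nat i)"]
    have "(0 :: 'b) \<in> roots (\<chi> i. of_nat (2 ^ idx_nat i))"
      by (simp add: peval_pvar rhom_zero[OF rhom_peval[OF rhom_id]] del: of_nat_power)
    then show False using generic_roots by blast
  qed
  then show ?thesis unfolding root_prod_def by (simp add: finite_roots)
qed

lemma qform_pvar_diff:
  assumes "p \<in> set (pairs l)" "q \<in> set (pairs l)" "p \<noteq> q"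
  shows "qform pvar p - qform pvar q \<noteq> (0 :: 'b::{idom,ring_char_0} dpoly)"
  using qform_diff_dvd[OF assms, of "pvar :: idx \<Rightarrow> 'b dpoly"] root_prod_pvar_nonzero[where 'b = 'b] by auto

lemma tripoly_single:
  "tripoly p q r = Poly_Mapping.single (pair_monom p) ((qform pvar q - qform pvar r) * pair_sign p)
     + Poly_Mapping.single (pair_monom q) (- (qform pvar p - qform pvar r) * pair_sign q)
     + Poly_Mapping.single (pair_monom r) ((qform pvar p - qform pvar q) * pair_sign r)"
  unfolding tripoly_def trinomial_def rhom_qform[OF rhom_pconst, symmetric] qval_pvar
  by (simp add: pconst_def mult_single single_diff[symmetric] single_uminus[symmetric] algebra_simps
      single_add[symmetric])

lemma keys_tripoly:
  assumes "p \<in> set (pairs l)" "q \<in> set (pairs l)" "r \<in> set (pairs l)" "distinct [p, q, r]"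
  shows "Poly_Mapping.keys (tripoly p q r :: 'b::{idom,ring_char_0} lpoly)
      = {pair_monom p, pair_monom q, pair_monom r}"
proof -
  have m: "pair_monom p \<noteq> pair_monom q" "pair_monom p \<noteq> pair_monom r" "pair_monom q \<noteq> pair_monom r"
    using pair_monom_inj[OF assms(1,2)] pair_monom_inj[OF assms(1,3)] pair_monom_inj[OF assms(2,3)]
      assms(4) by auto
  have s: "pair_sign p \<noteq> (0 :: 'b dpoly)" for p using pair_sign[of p, where 'b = "'b dpoly"] by auto
  have "qform pvar q - qform pvar r \<noteq> (0 :: 'b dpoly)" "qform pvar p - qform pvar r \<noteq> (0 :: 'b dpoly)"
    "qform pvar p - qform pvar q \<noteq> (0 :: 'b dpoly)"
    using qform_pvar_diff[OF assms(2,3)] qform_pvar_diff[OF assms(1,3)] qform_pvar_diff[OF assms(1,2)]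
      assms(4) by auto
  then show ?thesis
    unfolding tripoly_single using m s[of p] s[of q] s[of r]
    by (auto simp: in_keys_iff lookup_add lookup_single when_def split: if_splits)
qed

lemma nth_pairs: "a < 5 \<Longrightarrow> pairs l ! a \<in> set (pairs l)"
  by (simp add: length_pairs)

lemma nth_pairs_eq: "a < 5 \<Longrightarrow> b < 5 \<Longrightarrow> pairs l ! a = pairs l ! b \<longleftrightarrow> a = b"
  by (simp add: nth_eq_iff_index_eq distinct_pairs length_pairs)

lemma keys_trinomials_at:
  assumes "a < b" "b < c" "c < 5"
  shows "Poly_Mapping.keys (tripoly (pairs l ! a) (pairs l ! b) (pairs l ! c) :: 'b::{idom,ring_char_0} lpoly)
    = (\<lambda>a. pair_monom (pairs l ! a)) ` {a, b, c}"
proof -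
  have "distinct [pairs l ! a, pairs l ! b, pairs l ! c]"
    using assms by (simp add: nth_pairs_eq)
  then show ?thesis using keys_tripoly[of "pairs l ! a" l "pairs l ! b" "pairs l ! c"] assms
    by (simp add: nth_pairs)
qed

lemma inj_pair_monom_nth: "inj_on (\<lambda>a. pair_monom (pairs l ! a)) {..<5}"
  by (rule inj_onI) (metis lessThan_iff nth_pairs nth_pairs_eq pair_monom_inj)

lemma sorted_triple_unique:
  fixes a b c :: nat
  assumes "{a, b, c} = {a', b', c'}" "a < b" "b < c" "a' < b'" "b' < c'"
  shows "a = a' \<and> b = b' \<and> c = c'"
proof -
  have *: "sorted_list_of_set {a, b, c} = [a, b, c]" if "a < b" "b < c" for a b c :: nat
  proof -
    have "sorted_list_of_set (set [a, b, c]) = [a, b, c]"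
      using that by (intro sorted_list_of_set.idem_if_sorted_distinct) auto
    then show ?thesis by simp
  qed
  have "[a, b, c] = [a', b', c']"
    using *[OF assms(2,3)] *[OF assms(4,5)] assms(1) by metis
  then show ?thesis by simp
qed

lemma trinomials_at_keys_unique:
  assumes "f \<in> trinomials_at l" "g \<in> trinomials_at l" "Poly_Mapping.keys f = Poly_Mapping.keys g"
  shows "f = g"
proof -
  obtain a b c where f: "f = tripoly (pairs l ! a) (pairs l ! b) (pairs l ! c)" "a < b" "b < c" "c < 5"
    using assms(1) unfolding trinomials_at_def by blast
  obtain a' b' c' where g: "g = tripoly (pairs l ! a') (pairs l ! b') (pairs l ! c')" "a' < b'" "b' < c'" "c' < 5"
    using assms(2) unfolding trinomials_at_def by blast
  have "{a, b, c} = {a', b', c'}"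
    using assms(3) f g by (intro inj_on_image_eq_iff[OF inj_pair_monom_nth[of l], THEN iffD1])
      (auto simp: keys_trinomials_at)
  then show ?thesis using sorted_triple_unique f g by metis
qed

lemma card_keys_trinomials_at:
  assumes "f \<in> trinomials_at l"
  shows "card (Poly_Mapping.keys f) = 3"
proof -
  from assms obtain a b c where f: "f = tripoly (pairs l ! a) (pairs l ! b) (pairs l ! c)" "a < b" "b < c" "c < 5"
    unfolding trinomials_at_def by blast
  have "inj_on (\<lambda>a. pair_monom (pairs l ! a)) {a, b, c}"
    using f by (intro inj_on_subset[OF inj_pair_monom_nth]) auto
  then show ?thesis using f by (simp add: keys_trinomials_at[OF f(2-), unfolded image_insert image_empty]
        card_image flip: keys_trinomials_at)
qed

lemma card_sorted_triples: "card {(a, b, c). a < b \<and> b < c \<and> c < (5::nat)} = 10"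
proof -
  let ?L = "\<lambda>n. filter (\<lambda>(a, b, c). a < b \<and> b < c) (List.product [0..<n] (List.product [0..<n] [0..<n]))"
  have "{(a, b, c). a < b \<and> b < c \<and> c < n} = set (?L n)" for n :: nat by auto
  moreover have "distinct (?L n)" for n by (simp add: distinct_product)
  ultimately have "card {(a, b, c). a < b \<and> b < c \<and> c < (5::nat)} = length (?L 5)"
    by (simp only: distinct_card)
  also have "\<dots> = 10" by code_simp
  finally show ?thesis .
qed

text \<open>The support of a trinomial recovers its triple of positions, so the ten are pairwise
  different.\<close>

lemma card_trinomials_at: "card (trinomials_at l) = 10"
proof -
  let ?f = "\<lambda>(a, b, c). tripoly (pairs l ! a) (pairs l ! b) (pairs l ! c) :: int lpoly"
  let ?S = "{(a, b, c). a < b \<and> b < c \<and> c < (5::nat)}"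
  have "trinomials_at l = ?f ` ?S"
    unfolding trinomials_at_def by (auto simp: image_def Bex_def split_paired_Ex)
  moreover have "inj_on ?f ?S"
  proof (rule inj_onI)
    fix x y
    assume x: "x \<in> ?S" and y: "y \<in> ?S" and xy: "?f x = ?f y"
    obtain a b c a' b' c' where abc: "x = (a, b, c)" "y = (a', b', c')"
      by (metis prod_cases3)
    have *: "tripoly (pairs l ! a) (pairs l ! b) (pairs l ! c)
        = (tripoly (pairs l ! a') (pairs l ! b') (pairs l ! c') :: int lpoly)"
      "a < b" "b < c" "c < 5" "a' < b'" "b' < c'" "c' < 5"
      using x y xy unfolding abc by simp_all
    then have "(\<lambda>a. pair_monom (pairs l ! a)) ` {a, b, c} = (\<lambda>a. pair_monom (pairs l ! a)) ` {a', b', c'}"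
      by (metis keys_trinomials_at)
    then have "{a, b, c} = {a', b', c'}"
      using * by (intro inj_on_image_eq_iff[OF inj_pair_monom_nth[of l], THEN iffD1]) auto
    then show "x = y" using sorted_triple_unique * unfolding abc by metis
  qed
  ultimately show ?thesis by (simp add: card_image card_sorted_triples)
qed

lemma monom_degree_pair:
  assumes p: "p \<in> set (pairs l)"
  shows "monom_degree (pair_monom p) = anticanonical - pic l"
proof -
  from p have "fst p \<noteq> snd p" using distinct_pair_lines[of l] by (force simp: pair_lines_def)
  then have "monom_degree (pair_monom p) = pic (fst p) + pic (snd p)"
    unfolding monom_degree_def keys_pair_monom
    by (simp add: pair_monom_def lookup_add lookup_single)
  then show ?thesis using pic_pairs[of "fst p" "snd p" l] p by simp
qed

lemma pic_homogeneous_trinomials_at: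
  "f \<in> trinomials_at l \<Longrightarrow> pic_homogeneous (anticanonical - pic l) f"
  unfolding trinomials_at_def pic_homogeneous_def
  by (auto simp: keys_trinomials_at monom_degree_pair nth_pairs)

lemma trinomials_at_degree_unique:
  assumes "f \<in> trinomials_at l" "pic_homogeneous (anticanonical - pic m) f"
  shows "l = m"
proof -
  have "Poly_Mapping.keys f \<noteq> {}" using card_keys_trinomials_at[OF assms(1)] by auto
  then have "anticanonical - pic l = anticanonical - pic m"
    using assms(2) pic_homogeneous_trinomials_at[OF assms(1)] unfolding pic_homogeneous_def by fastforce
  then show ?thesis by (simp add: inj_pic)
qed

lemma cluster_trinomials:
  "{f \<in> all_trinomials. pic_homogeneous (anticanonical - pic l) f} = trinomials_at l"
  using trinomials_at_degree_unique pic_homogeneous_trinomials_at unfolding all_trinomials_def by blast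

lemma card_all_trinomials: "card all_trinomials = 270"
proof -
  have "finite (trinomials_at l)" for l using card_trinomials_at[of l] by (intro card_ge_0_finite) simp
  moreover have "trinomials_at l \<inter> trinomials_at m = {}" if "l \<noteq> m" for l m
    using that trinomials_at_degree_unique pic_homogeneous_trinomials_at by blast
  ultimately have "card all_trinomials = (\<Sum>l\<in>UNIV. card (trinomials_at l))"
    unfolding all_trinomials_def by (intro card_UN_disjoint) auto
  then show ?thesis by (simp add: card_trinomials_at card_line)
qed

lemma occurring_trinomials_at: "(\<Union>f\<in>trinomials_at l. occurring_lines f) = set (pair_lines l)"
proof -
  have "occurring_lines f \<subseteq> set (pair_lines l)" if f': "f \<in> trinomials_at l" for f
  proof -
    obtain a b c where f: "f = tripoly (pairs l ! a) (pairs l ! b) (pairs l ! c)" "a < b" "b < c" "c < 5"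
      using f' unfolding trinomials_at_def by blast
    then have "pairs l ! a \<in> set (pairs l)" "pairs l ! b \<in> set (pairs l)" "pairs l ! c \<in> set (pairs l)"
      by (simp_all add: nth_pairs)
    then show ?thesis unfolding set_pair_lines f(1) occurring_lines_def keys_trinomials_at[OF f(2-)]
      by (simp add: keys_pair_monom) blast
  qed
  moreover have "\<exists>f\<in>trinomials_at l. {fst p, snd p} \<subseteq> occurring_lines f" if p: "p \<in> set (pairs l)" for p
  proof -
    obtain a where a: "p = pairs l ! a" "a < 5" using p by (metis in_set_conv_nth length_pairs)
    \<comment> \<open>Every position lies in an increasing triple: \<open>0, 1, 2\<close> if it is
      below 2, otherwise \<open>0, 1, a\<close>.\<close>
    then obtain b c where bc: "b < c" "c < 5" "\<exists>d<b. a \<in> {d, b, c}"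
    proof (cases "a < 2")
      case True
      then have "\<exists>d<1. a \<in> {d, 1, 2}" by (intro exI[of _ 0]) auto
      then show ?thesis using that[of 1 2] by simp
    next
      case False
      then show ?thesis using that[of 1 a] a by auto
    qed
    then obtain d where "d < b" "a \<in> {d, b, c}" by blast
    then show ?thesis
      using bc a by (intro bexI[of _ "tripoly (pairs l ! d) (pairs l ! b) (pairs l ! c)"])
        (auto simp: occurring_lines_def keys_trinomials_at keys_pair_monom trinomials_at_def)
  qed
  ultimately show ?thesis unfolding set_pair_lines by blast
qed

lemma nth_idxs_less: "a < 6 \<Longrightarrow> b < 6 \<Longrightarrow> idxs ! a < idxs ! b \<longleftrightarrow> a < b"
proof -
  have "idx_nat (idxs ! a) = Suc a" if "a < 6" for a
    using that by (auto simp: idxs_def numeral_eq_Suc less_Suc_eq)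
  then show "a < 6 \<Longrightarrow> b < 6 \<Longrightarrow> idxs ! a < idxs ! b \<longleftrightarrow> a < b" by (simp add: less_idx_def)
qed

lemma pairs_G1_nth: "a < 5 \<Longrightarrow> pairs (G I1) ! a = (E (idxs ! Suc a), F I1 (idxs ! Suc a))"
  by (auto simp: pairs_G idxs_def numeral_eq_Suc less_Suc_eq)

text \<open>The minus signs that \<open>sval\<close> and \<open>aform\<close> carry at
  \<open>E i\<close> cancel, which produces the stated signs exactly.\<close>

lemma tripoly_G1:
  assumes "i \<noteq> I1" "j \<noteq> I1" "k \<noteq> I1"
  shows "tripoly (E i, F I1 i) (E j, F I1 j) (E k, F I1 k) = G1_trinomial i j k"
  using assms
  by (simp add: tripoly_def trinomial_def qform_def qval_def aform_simps G1_trinomial_def Let_def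
      rhom_simps[OF rhom_pconst] algebra_simps)

lemma G1_trinomials_eq: "G1_trinomials = trinomials_at (G I1)"
proof (intro equalityI subsetI)
  fix f assume "f \<in> G1_trinomials"
  then obtain i j k where f: "f = G1_trinomial i j k" "I2 \<le> i" "i < j" "j < k"
    unfolding G1_trinomials_def by blast
  have ex: "\<exists>a<6. i = idxs ! a" for i :: idx
  proof -
    have "length idxs = 6" by (simp add: idxs_def)
    then show ?thesis using set_idxs in_set_conv_nth[of i idxs] by auto
  qed
  obtain a b c where abc: "i = idxs ! a" "j = idxs ! b" "k = idxs ! c" "a < 6" "b < 6" "c < 6"
    using ex by metis
  have "a \<noteq> 0" using f(2) abc(1) by (cases a) (auto simp: idxs_def less_eq_idx_def)
  moreover have "a < b" "b < c" using f abc nth_idxs_less by auto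
  ultimately obtain a' b' c' where "a = Suc a'" "b = Suc b'" "c = Suc c'"
    by (metis not0_implies_Suc not_less0)
  moreover have "i \<noteq> I1" "j \<noteq> I1" "k \<noteq> I1"
    using f(2-) by (auto simp: less_eq_idx_def less_idx_def)
  ultimately have "f = tripoly (pairs (G I1) ! a') (pairs (G I1) ! b') (pairs (G I1) ! c')"
    and "a' < b'" "b' < c'" "c' < 5"
    using f abc \<open>a < b\<close> \<open>b < c\<close> by (simp_all add: pairs_G1_nth tripoly_G1)
  then show "f \<in> trinomials_at (G I1)" unfolding trinomials_at_def by blast
next
  fix f assume "f \<in> trinomials_at (G I1)"
  then obtain a b c where f: "f = tripoly (pairs (G I1) ! a) (pairs (G I1) ! b) (pairs (G I1) ! c)"
    "a < b" "b < c" "c < 5"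
    unfolding trinomials_at_def by blast
  have *: "I2 \<le> idxs ! Suc a \<and> idxs ! Suc a \<noteq> I1" if "a < 5" for a
    using that by (auto simp: idxs_def numeral_eq_Suc less_Suc_eq less_eq_idx_def)
  have "f = G1_trinomial (idxs ! Suc a) (idxs ! Suc b) (idxs ! Suc c)"
    using f * by (simp add: pairs_G1_nth tripoly_G1)
  moreover have "idxs ! Suc a < idxs ! Suc b" "idxs ! Suc b < idxs ! Suc c"
    using f by (auto simp: nth_idxs_less)
  moreover have "I2 \<le> idxs ! Suc a" using * f by simp
  ultimately show "f \<in> G1_trinomials" unfolding G1_trinomials_def by blast
qed

text \<open>The trinomial is alternating in its three pairs, so sorting them costs only a
  sign.\<close>

lemma tripoly_sorted:
  assumes "p \<in> set (pairs l)" "q \<in> set (pairs l)" "r \<in> set (pairs l)" "distinct [p, q, r]"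
  shows "tripoly p q r \<in> trinomials_at l \<or> - tripoly p q r \<in> trinomials_at l"
proof -
  obtain a b c where abc: "p = pairs l ! a" "q = pairs l ! b" "r = pairs l ! c" "a < 5" "b < 5" "c < 5"
    using assms by (metis in_set_conv_nth length_pairs)
  then have "distinct [a, b, c]" using assms(4) by auto
  then consider "a < b" "b < c" | "a < c" "c < b" | "b < a" "a < c" | "b < c" "c < a" | "c < a" "a < b"
    | "c < b" "b < a"
    by (metis distinct_length_2_or_more linorder_neq_iff)
  then have "\<exists>s\<in>{1, -1}. \<exists>a' b' c'. a' < b' \<and> b' < c' \<and> c' < 5 \<and>
      s * tripoly p q r = tripoly (pairs l ! a') (pairs l ! b') (pairs l ! c')"
  proof cases
    case 1 then show ?thesis using abc by (intro bexI[of _ 1] exI[of _ a] exI[of _ b] exI[of _ c]) simp_all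
  next
    case 2
    have "- tripoly p q r = tripoly p r q" unfolding tripoly_def using trinomial_swap by metis
    then show ?thesis using abc 2 by (intro bexI[of _ "-1"] exI[of _ a] exI[of _ c] exI[of _ b]) simp_all
  next
    case 3
    have "- tripoly p q r = tripoly q p r" unfolding tripoly_def using trinomial_swap by metis
    then show ?thesis using abc 3 by (intro bexI[of _ "-1"] exI[of _ b] exI[of _ a] exI[of _ c]) simp_all
  next
    case 4
    have "tripoly p q r = tripoly q r p" unfolding tripoly_def using trinomial_swap by (metis minus_minus)
    then show ?thesis using abc 4 by (intro bexI[of _ 1] exI[of _ b] exI[of _ c] exI[of _ a]) simp_all
  next
    case 5
    have "tripoly p q r = tripoly r p q" unfolding tripoly_def using trinomial_swap by (metis minus_minus)
    then show ?thesis using abc 5 by (intro bexI[of _ 1] exI[of _ c] exI[of _ a] exI[of _ b]) simp_all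
  next
    case 6
    have "- tripoly p q r = tripoly r q p" unfolding tripoly_def using trinomial_swap by (metis minus_minus)
    then show ?thesis using abc 6 by (intro bexI[of _ "-1"] exI[of _ c] exI[of _ b] exI[of _ a]) simp_all
  qed
  then show ?thesis unfolding trinomials_at_def by fastforce
qed

text \<open>Opposite trinomials have the same support, hence the same degree and line, hence the
  same triple; so both are equal, and \<open>f = - f\<close> is impossible in characteristic 0 for a
  non-zero polynomial.\<close>

lemma all_trinomials_inter_uminus: "all_trinomials \<inter> uminus ` all_trinomials = {}"
proof -
  have False if "f \<in> trinomials_at l" "g \<in> trinomials_at m" "f = - g" for f g l m
  proof -
    have k: "Poly_Mapping.keys f = Poly_Mapping.keys g" using that(3) by simp
    have "pic_homogeneous (anticanonical - pic m) f"
      using pic_homogeneous_trinomials_at[OF that(2)] k unfolding pic_homogeneous_def by simp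
    then have "l = m" using trinomials_at_degree_unique that(1) by blast
    then have "f = g" using trinomials_at_keys_unique that k by blast
    then have "f = - f" using that(3) by simp
    then have "Poly_Mapping.lookup f m = - Poly_Mapping.lookup f m" for m by (metis lookup_uminus)
    then have "2 * Poly_Mapping.lookup f m = 0" for m
      by (simp only: mult_2) (metis add.right_inverse)
    then have "f = 0" by (intro poly_mapping_eqI) simp
    then show False using card_keys_trinomials_at[OF that(1)] by simp
  qed
  then show ?thesis unfolding all_trinomials_def by blast
qed

section \<open>The Weyl orbit of the trinomials\<close>

section \<open>The Weyl group\<close>

definition nform :: "line \<Rightarrow> rat ^ (idx option)" where
  "nform l = (case l of E i \<Rightarrow> - line_form l | _ \<Rightarrow> line_form l)"

text \<open>The common sum of the normalized forms over every tritangent triangle, the counterpart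
  of the anticanonical class.\<close>

definition nform_total :: "rat ^ (idx option)" where
  "nform_total = (\<chi> k. if k = None then 3 else 1)"

lemma dform_nth: "dform a $ b = of_bool (a = b)"
  by (simp add: dform_def axis_def)

lemma UNIV_option: "(UNIV :: idx option set) = insert None (range Some)"
  by (auto simp: UNIV_option_conv)

lemma sum_UNIV_option: "(\<Sum>k\<in>UNIV. f k) = f None + (\<Sum>i\<in>UNIV. f (Some (i :: idx)))"
  unfolding UNIV_option by (subst sum.insert) (auto simp: sum.reindex)

lemma line_form_simps:
  "line_form (E i) = dform (Some i) - dform None"
  "i \<noteq> j \<Longrightarrow> line_form (F i j) = dform (Some i) + dform (Some j) + dform None"
  "line_form (G j) = (\<Sum>k\<in>UNIV. dform k) - dform (Some j)"
proof -
  show "line_form (F i j) = dform (Some i) + dform (Some j) + dform None" if "i \<noteq> j"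
    using that
  proof (induction i j rule: linorder_wlog)
    case (le i j)
    then have "i < j" by simp
    then show ?case by (simp add: line_form_def F_eq_F_pair Rep_Abs_idx_pair)
  next
    case (sym i j)
    then show ?case by (simp add: F_commute add.commute)
  qed
qed (simp_all add: line_form_def)

lemma nform_simps:
  "nform (E i) = dform None - dform (Some i)"
  "i \<noteq> j \<Longrightarrow> nform (F i j) = dform (Some i) + dform (Some j) + dform None"
  "nform (G j) = (\<Sum>k\<in>UNIV. dform k) - dform (Some j)"
  using line_form_simps[of i] line_form_simps(2)[of i j] line_form_simps(3)[of j]
  by (simp_all add: nform_def F_def)

lemma nform_nth: "nform l $ None = 1" "nform l $ Some k = of_int (- pic l $ Some k)"
  by (cases l rule: line_cases; auto simp: nform_simps dform_nth pic_nth pic_F_nth of_bool_def)+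

text \<open>A line has anticanonical degree 1. This recovers the hyperplane coefficient of a class
  from the exceptional ones, which are all that \<open>nform\<close> records.\<close>

lemma pic_None: "3 * pic l $ None = 1 - (\<Sum>k\<in>UNIV. pic l $ Some k)"
  by (cases l rule: line_cases) (auto simp: pic_nth pic_F_nth sum_subtractf sum_negf card_idx)

text \<open>Moves the triangle condition from classes, where the Weyl group is not defined here, to
  linear forms, where it acts.\<close>

lemma nform_sum_iff:
  "nform l + nform m + nform n = nform_total \<longleftrightarrow> pic l + pic m + pic n = anticanonical"
proof -
  have "nform l + nform m + nform n = nform_total
      \<longleftrightarrow> (\<forall>k. pic l $ Some k + pic m $ Some k + pic n $ Some k = -1)" (is "_ \<longleftrightarrow> ?S")
  proof -
    have "nform l $ Some k + nform m $ Some k + nform n $ Some k = 1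
        \<longleftrightarrow> pic l $ Some k + pic m $ Some k + pic n $ Some k = -1" for k
    proof -
      have "nform l $ Some k + nform m $ Some k + nform n $ Some k
          = of_int (- (pic l $ Some k + pic m $ Some k + pic n $ Some k))"
        by (simp add: nform_nth)
      then show ?thesis by (simp only: of_int_eq_1_iff) auto
    qed
    then show ?thesis
      by (simp add: vec_eq_iff all_option_iff nform_nth(1) nform_total_def)
  qed
  also have "?S \<longleftrightarrow> pic l + pic m + pic n = anticanonical"
  proof
    assume S: ?S
    have "3 * (pic l $ None + pic m $ None + pic n $ None)
        = 3 - (\<Sum>k\<in>UNIV. pic l $ Some k + pic m $ Some k + pic n $ Some k)"
      using pic_None[of l] pic_None[of m] pic_None[of n] by (simp add: sum.distrib)
    also have "\<dots> = 9" using S by (simp add: card_idx)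
    finally show "pic l + pic m + pic n = anticanonical"
      using S by (simp add: vec_eq_iff all_option_iff anticanonical_nth)
  next
    assume "pic l + pic m + pic n = anticanonical"
    then show ?S by (metis anticanonical_nth(2) vector_add_component)
  qed
  finally show ?thesis .
qed

lemma nform_inj: assumes "nform l = nform m" shows "l = m"
proof (rule inj_pic)
  have S: "pic l $ Some k = pic m $ Some k" for k
    using arg_cong[OF assms, of "\<lambda>v. v $ Some k"] by (simp add: nform_nth)
  then have "3 * pic l $ None = 3 * pic m $ None" by (simp add: pic_None)
  then show "pic l = pic m" using S by (simp add: vec_eq_iff all_option_iff)
qed

definition linear_map :: "(rat ^ (idx option) \<Rightarrow> rat ^ (idx option)) \<Rightarrow> bool" where
  "linear_map w \<longleftrightarrow> (\<forall>a b. w (a + b) = w a + w b) \<and> (\<forall>c a. w (c *s a) = c *s w a)"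

lemma linear_map_simps:
  assumes "linear_map w"
  shows "w (a + b) = w a + w b" "w (c *s a) = c *s w a" "w 0 = 0" "w (- a) = - w a" "w (a - b) = w a - w b"
    "w (sum f A) = (\<Sum>x\<in>A. w (f x))"
proof -
  show add: "w (a + b) = w a + w b" and scale: "w (c *s a) = c *s w a" for a b c
    using assms unfolding linear_map_def by blast+
  show zero: "w 0 = 0" using scale[of 0 0] by simp
  show neg: "w (- a) = - w a" for a
    using scale[of "-1" a] by (simp flip: vector_sneg_minus1)
  show "w (a - b) = w a - w b" using add[of a "- b"] neg[of b] by simp
  show "w (sum f A) = (\<Sum>x\<in>A. w (f x))"
    by (induction A rule: infinite_finite_induct) (simp_all add: zero add)
qed

lemma linear_map_linear_extension: "linear_map (linear_extension g)"
  unfolding linear_map_def linear_extension_def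
  by (auto simp: vec_eq_iff algebra_simps sum.distrib sum_distrib_left)

lemma linear_map_comp: "linear_map v \<Longrightarrow> linear_map w \<Longrightarrow> linear_map (v \<circ> w)"
  by (simp add: linear_map_def)

lemma linear_extension_dform: "linear_extension g (dform k) = g k"
proof -
  have "linear_extension g (dform k) = (\<Sum>j\<in>UNIV. if j = k then g j else 0)"
    unfolding linear_extension_def by (intro sum.cong) (auto simp: dform_nth)
  then show ?thesis by simp
qed

lemma vec_eq_sum_dform: "v = (\<Sum>k\<in>UNIV. (v $ k) *s dform k)"
proof -
  have "(\<Sum>k\<in>UNIV. v $ k * of_bool (k = j)) = v $ j" for j
    by (simp add: of_bool_def if_distrib[of "\<lambda>x. _ * x"] cong: if_cong)
  then show ?thesis by (simp add: vec_eq_iff dform_nth)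
qed

text \<open>An invariant of the generators that is stable under composition. Fixing the
  \<open>d_7\<close>-coordinate of every form preserves the normalization of \<open>nform\<close>
  and the span of \<open>d_1, ..., d_6\<close>.\<close>

definition permutes_nforms :: "(rat ^ (idx option) \<Rightarrow> rat ^ (idx option)) \<Rightarrow> bool" where
  "permutes_nforms w \<longleftrightarrow> linear_map w \<and> w nform_total = nform_total
     \<and> (\<forall>v. w v $ None = v $ None) \<and> (\<forall>l. \<exists>m. w (nform l) = nform m)"

lemma permutes_nforms_comp: "permutes_nforms v \<Longrightarrow> permutes_nforms w \<Longrightarrow> permutes_nforms (v \<circ> w)"
  unfolding permutes_nforms_def by (auto simp: linear_map_comp) metis

lemma nform_total_eq: "nform_total = (\<Sum>k\<in>UNIV. dform k) + 2 *s dform None"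
  by (auto simp: nform_total_def vec_eq_iff dform_nth of_bool_def)

definition perm_action :: "(idx \<Rightarrow> idx) \<Rightarrow> rat ^ (idx option) \<Rightarrow> rat ^ (idx option)" where
  "perm_action \<sigma> = linear_extension (\<lambda>k. dform (map_option \<sigma> k))"

lemma
  assumes "bij \<sigma>"
  shows perm_action_nform: "perm_action \<sigma> (nform (E i)) = nform (E (\<sigma> i))"
      "i \<noteq> j \<Longrightarrow> perm_action \<sigma> (nform (F i j)) = nform (F (\<sigma> i) (\<sigma> j))"
      "perm_action \<sigma> (nform (G j)) = nform (G (\<sigma> j))"
    and permutes_nforms_perm: "permutes_nforms (perm_action \<sigma>)"
proof -
  have lin: "linear_map (perm_action \<sigma>)"
    unfolding perm_action_def by (rule linear_map_linear_extension)
  note d = linear_extension_dform[of "\<lambda>k. dform (map_option \<sigma> k)", folded perm_action_def]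
  have bo: "bij (map_option \<sigma>)"
    using assms by (auto simp: bij_def option.inj_map surj_def) (metis option.exhaust option.simps(8,9))
  have S: "perm_action \<sigma> (\<Sum>k\<in>UNIV. dform k) = (\<Sum>k\<in>UNIV. dform k)"
    unfolding linear_map_simps(6)[OF lin] d by (rule sum.reindex_bij_betw[OF bo])
  have inj: "\<sigma> i = \<sigma> j \<longleftrightarrow> i = j" for i j using assms by (auto simp: bij_def inj_eq)
  show E: "perm_action \<sigma> (nform (E i)) = nform (E (\<sigma> i))" for i
    by (simp add: nform_simps linear_map_simps[OF lin] d)
  show F: "perm_action \<sigma> (nform (F i j)) = nform (F (\<sigma> i) (\<sigma> j))" if "i \<noteq> j" for i j
    using that by (simp add: nform_simps linear_map_simps[OF lin] d inj)
  show G: "perm_action \<sigma> (nform (G j)) = nform (G (\<sigma> j))" for j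
    unfolding nform_simps linear_map_simps(5)[OF lin] S d by simp
  have "\<exists>m. perm_action \<sigma> (nform l) = nform m" for l
    by (cases l rule: line_cases) (use E F G in fastforce)+
  moreover have "perm_action \<sigma> v $ None = v $ None" for v
    by (simp add: perm_action_def linear_extension_def sum_UNIV_option dform_nth)
  ultimately show "permutes_nforms (perm_action \<sigma>)"
    unfolding permutes_nforms_def nform_total_eq linear_map_simps(1,2)[OF lin] S d using lin by simp
qed

text \<open>The reflection acts as the quadratic Cremona transformation centred at the first three
  points: it exchanges \<open>E_i\<close> with \<open>F_jk\<close> inside \<open>{1, 2, 3}\<close>,
  and \<open>G_j\<close> with \<open>F_kl\<close> inside \<open>{4, 5, 6}\<close>, and fixes the
  other 15 lines.\<close>

lemma
  shows reflection_nform: "list_all (\<lambda>(l, m). weyl_reflection (nform l) = nform m)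
   [(E I1, F I2 I3), (E I2, F I1 I3), (E I3, F I1 I2),
    (E I4, E I4), (E I5, E I5), (E I6, E I6),
    (F I1 I2, E I3), (F I1 I3, E I2), (F I1 I4, F I1 I4),
    (F I1 I5, F I1 I5), (F I1 I6, F I1 I6), (F I2 I3, E I1),
    (F I2 I4, F I2 I4), (F I2 I5, F I2 I5), (F I2 I6, F I2 I6),
    (F I3 I4, F I3 I4), (F I3 I5, F I3 I5), (F I3 I6, F I3 I6),
    (F I4 I5, G I6), (F I4 I6, G I5), (F I5 I6, G I4),
    (G I1, G I1), (G I2, G I2), (G I3, G I3),
    (G I4, F I5 I6), (G I5, F I4 I6), (G I6, F I4 I5)]" (is "list_all _ ?tab")
    and permutes_nforms_reflection: "permutes_nforms weyl_reflection"
proof -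
  have lin: "linear_map weyl_reflection"
    unfolding weyl_reflection_def by (rule linear_map_linear_extension)
  have nth: "weyl_reflection v $ None = v $ None"
    "weyl_reflection v $ Some k = v $ Some k + of_bool (k \<in> {I1, I2, I3}) *
       (1/3 * (v $ None + v $ Some I4 + v $ Some I5 + v $ Some I6) - 2/3 * (v $ Some I1 + v $ Some I2 + v $ Some I3))"
    for v k
    by (cases k; simp add: weyl_reflection_def linear_extension_def sum_UNIV_option UNIV_idx dform_nth Let_def
      algebra_simps)+
  \<comment> \<open>In Picard coordinates this is the reflection in
    \<open>H - E_1 - E_2 - E_3\<close>. The equation \<open>pic_None\<close> clears the thirds, so
    the table reduces to integer arithmetic.\<close>
  have iff: "weyl_reflection (nform l) = nform m \<longleftrightarrow> list_all (\<lambda>k. pic m $ Some k = pic l $ Some k -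
      (if k \<in> {I1, I2, I3} then pic l $ None + pic l $ Some I1 + pic l $ Some I2 + pic l $ Some I3 else 0)) idxs"
    for l m
  proof -
    have "(1 - pic l $ Some I4 - pic l $ Some I5 - pic l $ Some I6 + 2 * (pic l $ Some I1 + pic l $ Some I2 + pic l $ Some I3))
        = 3 * (pic l $ None + pic l $ Some I1 + pic l $ Some I2 + pic l $ Some I3)"
      using pic_None[of l] by (simp add: UNIV_idx)
    from arg_cong[OF this, of "of_int :: int \<Rightarrow> rat"]
    have "1/3 * (nform l $ None + nform l $ Some I4 + nform l $ Some I5 + nform l $ Some I6)
        - 2/3 * (nform l $ Some I1 + nform l $ Some I2 + nform l $ Some I3)
        = of_int (pic l $ None + pic l $ Some I1 + pic l $ Some I2 + pic l $ Some I3)"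
      by (simp add: nform_nth field_simps)
    then have "weyl_reflection (nform l) $ Some k = of_int (- (pic l $ Some k -
      (if k \<in> {I1, I2, I3} then pic l $ None + pic l $ Some I1 + pic l $ Some I2 + pic l $ Some I3 else 0)))" for k
      unfolding nth(2) by (simp add: nform_nth(2))
    then have "weyl_reflection (nform l) $ Some k = nform m $ Some k \<longleftrightarrow> pic m $ Some k = pic l $ Some k -
      (if k \<in> {I1, I2, I3} then pic l $ None + pic l $ Some I1 + pic l $ Some I2 + pic l $ Some I3 else 0)" for k
      unfolding nform_nth(2) by (simp only: of_int_eq_iff neg_equal_iff_equal) auto
    then show ?thesis
      by (simp add: vec_eq_iff all_option_iff nth(1) nform_nth(1) list_all_iff)
  qed
  show tab: "list_all (\<lambda>(l, m). weyl_reflection (nform l) = nform m) ?tab"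
    unfolding list.pred_inject prod.case
    by (intro conjI TrueI; simp add: iff idxs_def pic_nth pic_F_nth)
  have "l \<in> fst ` set ?tab" for l
  proof (cases l rule: line_cases)
    case (E i) then show ?thesis by (cases i) simp_all
  next
    case (F i j) then show ?thesis by (cases i; cases j) (simp_all add: less_idx_def)
  next
    case (G j) then show ?thesis by (cases j) simp_all
  qed
  moreover have "\<exists>m. weyl_reflection (nform l) = nform m"
    if "l \<in> fst ` set T" "list_all (\<lambda>(l, m). weyl_reflection (nform l) = nform m) T" for l T
    using that unfolding list_all_iff by fastforce
  ultimately have "\<exists>m. weyl_reflection (nform l) = nform m" for l
    using tab by blast
  moreover have "weyl_reflection nform_total = nform_total"
    by (simp add: vec_eq_iff all_option_iff nth nform_total_def)
  ultimately show "permutes_nforms weyl_reflection"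
    unfolding permutes_nforms_def using lin nth(1) by blast
qed

lemma weyl_E6_perm: "w \<in> weyl_E6 \<Longrightarrow> bij \<sigma> \<Longrightarrow> perm_action \<sigma> \<circ> w \<in> weyl_E6"
  unfolding perm_action_def by (rule weyl_E6.perm)

lemma permutes_nforms_weyl: "w \<in> weyl_E6 \<Longrightarrow> permutes_nforms w"
proof (induction rule: weyl_E6.induct)
  case id
  show ?case by (auto simp: permutes_nforms_def linear_map_def)
next
  case (perm w \<sigma>)
  then show ?case using permutes_nforms_comp permutes_nforms_perm unfolding perm_action_def by blast
next
  case (refl w)
  then show ?case using permutes_nforms_comp permutes_nforms_reflection by blast
qed

lemma weyl_E6_comp: "w \<in> weyl_E6 \<Longrightarrow> v \<in> weyl_E6 \<Longrightarrow> w \<circ> v \<in> weyl_E6"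
proof (induction rule: weyl_E6.induct)
  case id
  then show ?case by simp
next
  case (perm w \<sigma>)
  then show ?case unfolding comp_assoc by (intro weyl_E6.perm)
next
  case (refl w)
  then show ?case unfolding comp_assoc by (intro weyl_E6.refl)
qed

definition line_perm :: "(rat ^ (idx option) \<Rightarrow> rat ^ (idx option)) \<Rightarrow> line \<Rightarrow> line" where
  "line_perm w l = (SOME m. w (nform l) = nform m)"

lemma line_perm: "w \<in> weyl_E6 \<Longrightarrow> w (nform l) = nform (line_perm w l)"
  unfolding line_perm_def
  by (rule someI_ex) (use permutes_nforms_weyl in \<open>auto simp: permutes_nforms_def\<close>)

lemma line_perm_eqI: "w \<in> weyl_E6 \<Longrightarrow> w (nform l) = nform m \<Longrightarrow> line_perm w l = m"
  using line_perm nform_inj by metis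

lemma pairs_iff_nform:
  "(m, n) \<in> set (pairs l) \<or> (n, m) \<in> set (pairs l) \<longleftrightarrow> nform l + nform m + nform n = nform_total"
  unfolding nform_sum_iff using pairs_if_pic_sum[of l m n] pic_pairs[of m n l] pic_pairs[of n m l]
  by (auto simp: algebra_simps)

lemma line_perm_pairs:
  assumes "w \<in> weyl_E6" "(m, n) \<in> set (pairs l)"
  shows "(line_perm w m, line_perm w n) \<in> set (pairs (line_perm w l))
    \<or> (line_perm w n, line_perm w m) \<in> set (pairs (line_perm w l))"
proof -
  have p: "permutes_nforms w" using assms(1) by (rule permutes_nforms_weyl)
  have "w (nform l + nform m + nform n) = w nform_total"
    using assms(2) pairs_iff_nform by metis
  then show ?thesis
    unfolding pairs_iff_nform using p line_perm[OF assms(1)]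
    by (simp add: permutes_nforms_def linear_map_simps)
qed

text \<open>The group is generated without inverses, so injectivity is taken from the generators:
  permutations are invertible and the reflection is an involution.\<close>

lemma inj_weyl: "w \<in> weyl_E6 \<Longrightarrow> inj w"
proof (induction rule: weyl_E6.induct)
    case (perm w \<sigma>)
    have "perm_action (inv_into UNIV \<sigma>) (perm_action \<sigma> v) = v" for v
    proof -
      have lin: "linear_map (perm_action \<sigma>)" for \<sigma>
        unfolding perm_action_def by (rule linear_map_linear_extension)
      have d: "perm_action \<sigma> (dform k) = dform (map_option \<sigma> k)" for \<sigma> k
        unfolding perm_action_def by (rule linear_extension_dform)
      have "map_option (inv_into UNIV \<sigma>) (map_option \<sigma> k) = k" for k
        using perm(2) by (cases k) (auto simp: bij_def)
      then show ?thesis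
        by (subst (1 2) vec_eq_sum_dform[of v]) (simp add: linear_map_simps[OF lin] d)
    qed
    then have "inj (perm_action \<sigma>)" by (metis injI)
    then show ?case using perm.IH unfolding perm_action_def by (rule inj_compose)
  next
    case (refl w)
    have "weyl_reflection (weyl_reflection v) = v" for v
    proof -
      have lin: "linear_map weyl_reflection"
        unfolding weyl_reflection_def by (rule linear_map_linear_extension)
      have "weyl_reflection (weyl_reflection (dform k)) = dform k" for k
        unfolding weyl_reflection_def linear_extension_dform
        by (simp add: Let_def linear_map_simps[OF linear_map_linear_extension] linear_extension_dform)
          (simp add: vec_eq_iff algebra_simps)
      then show ?thesis
        by (subst (1 2) vec_eq_sum_dform[of v]) (simp add: linear_map_simps[OF lin])
    qed
    then have "inj weyl_reflection" by (metis injI)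
    then show ?case using refl.IH by (rule inj_compose)
qed simp

lemma inj_line_perm: "w \<in> weyl_E6 \<Longrightarrow> inj (line_perm w)"
  by (rule injI) (metis inj_weyl injD line_perm nform_inj)

section \<open>The Weyl group acts on the trinomials\<close>

text \<open>All signs in \<open>weyl_line\<close> come from comparing \<open>line_form\<close> with
  the normalized \<open>nform\<close>. Negating the variable of each \<open>E i\<close> absorbs
  them, and a plain permutation remains.\<close>

lemma sval_weyl_line:
  assumes "w \<in> weyl_E6"
  shows "sval (weyl_line w) l = sval pvar (line_perm w l)"
proof -
  define sg :: "line \<Rightarrow> rat" where "sg = sval (\<lambda>_. 1)"
  have sg: "sg l = 1 \<or> sg l = -1" for l
    by (cases l rule: line_cases) (simp_all add: sg_def)
  have lf: "line_form l = sg l *s nform l" for l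
    by (cases l rule: line_cases) (simp_all add: sg_def line_form_simps nform_simps flip: vector_sneg_minus1)
  have lin: "linear_map w" using permutes_nforms_weyl[OF assms] by (simp add: permutes_nforms_def)
  have w: "w (line_form l) = sg l *s nform (line_perm w l)"
    by (simp add: lf linear_map_simps[OF lin] line_perm[OF assms])
  have "(if w (line_form l) = line_form m then pvar m
      else if w (line_form l) = - line_form m then - pvar m else 0)
     = (if m = line_perm w l then (if sg l = sg m then pvar m else - pvar m) else (0 :: rat lpoly))" for m
  proof -
    have "w (line_form l) = line_form m \<longleftrightarrow> m = line_perm w l \<and> sg l = sg m"
      "w (line_form l) = - line_form m \<longleftrightarrow> m = line_perm w l \<and> sg l \<noteq> sg m"
    proof -
      have *: "sg l *s nform (line_perm w l) = c *s nform m \<longleftrightarrow> m = line_perm w l \<and> sg l = c" for c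
      proof
        assume eq: "sg l *s nform (line_perm w l) = c *s nform m"
        then have "(sg l *s nform (line_perm w l)) $ None = (c *s nform m) $ None" by simp
        then have c: "sg l = c" by (simp add: nform_nth)
        then have "nform (line_perm w l) = nform m" using eq sg[of l] by (auto simp: vec_eq_iff)
        then show "m = line_perm w l \<and> sg l = c" using c nform_inj by metis
      qed auto
      show "w (line_form l) = line_form m \<longleftrightarrow> m = line_perm w l \<and> sg l = sg m"
        unfolding w lf[of m] by (rule *)
      have "- line_form m = (- sg m) *s nform m" unfolding lf[of m] by (simp add: vec_eq_iff)
      then show "w (line_form l) = - line_form m \<longleftrightarrow> m = line_perm w l \<and> sg l \<noteq> sg m"
        unfolding w using *[of "- sg m"] sg[of l] sg[of m] by auto
    qed
    then show ?thesis by auto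
  qed
  then have "weyl_line w l = (if sg l = sg (line_perm w l) then pvar (line_perm w l) else - pvar (line_perm w l))"
    unfolding weyl_line_def by simp
  then show ?thesis
    by (cases l rule: line_cases; cases "line_perm w l" rule: line_cases) (simp_all add: sg_def)
qed

text \<open>Because this sum is the same for all pairs of \<open>l\<close>, replacing
  \<open>aform\<close> by \<open>aform - C\<close> changes \<open>qform\<close> by one constant for
  the whole line.\<close>

lemma aform_pairs:
  assumes "(m, n) \<in> set (pairs l)"
  shows "aform \<delta> m + aform \<delta> n = (\<Sum>i\<in>UNIV. \<delta> i) - aform \<delta> l"
proof (cases l rule: line_cases)
  case (F i j)
  obtain k a b c where d: "distinct [i, j, k, a, b, c]"
    and p: "pairs l = [(E i, G j), (E j, G i), (F k a, F b c), (F k b, F a c), (F k c, F a b)]"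
    using pairs_F_elim[OF F(1)] F(2) by metis
  then show ?thesis using assms F
    by (auto simp: p[unfolded F(2)] aform_simps sum_UNIV_six[OF d])
qed (use assms in \<open>auto simp: pairs_E pairs_G aform_simps\<close>)

lemma trinomial_shift:
  assumes "\<And>s. s \<in> {p, q, r} \<Longrightarrow> qform \<delta>' s = qform \<delta> (f s) + c"
    and "\<And>s. s \<in> {p, q, r} \<Longrightarrow> qval z' s = qval z (f s)"
  shows "trinomial \<delta>' z' p q r = trinomial \<delta> z (f p) (f q) (f r)"
  using assms by (simp add: trinomial_def)

lemma tripoly_swap_pair:
  assumes "p' = p \<or> p' = prod.swap p" "q' = q \<or> q' = prod.swap q" "r' = r \<or> r' = prod.swap r"
  shows "tripoly p' q' r' = tripoly p q r"
  using assms by (auto simp: tripoly_def trinomial_def qform_def qval_def mult.commute)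

lemma rhom_pm_map:
  assumes "rhom h"
  shows "rhom (Poly_Mapping.map h :: ('m::comm_monoid_add \<Rightarrow>\<^sub>0 'a::comm_ring_1) \<Rightarrow> ('m \<Rightarrow>\<^sub>0 'b::comm_ring_1))"
proof -
  have h0: "h 0 = 0" by (rule rhom_zero[OF assms])
  have "Poly_Mapping.map h p = meval (\<lambda>a. Poly_Mapping.single 0 (h a)) (\<lambda>m. Poly_Mapping.single m 1) p"
    for p :: "'m \<Rightarrow>\<^sub>0 'a"
  proof (rule poly_mapping_eqI)
    fix k
    have "Poly_Mapping.lookup (meval (\<lambda>a. Poly_Mapping.single 0 (h a)) (\<lambda>m. Poly_Mapping.single m 1) p) k
       = (\<Sum>m\<in>Poly_Mapping.keys p. if m = k then h (Poly_Mapping.lookup p m) else 0)"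
      unfolding meval_def lookup_sum mult_single by (intro sum.cong) (auto simp: lookup_single when_def)
    also have "\<dots> = h (Poly_Mapping.lookup p k)" by (simp add: in_keys_iff h0)
    also have "\<dots> = Poly_Mapping.lookup (Poly_Mapping.map h p) k"
      by (simp add: Poly_Mapping.map.rep_eq when_def h0)
    finally show "Poly_Mapping.lookup (Poly_Mapping.map h p) k = Poly_Mapping.lookup
      (meval (\<lambda>a. Poly_Mapping.single 0 (h a)) (\<lambda>m. Poly_Mapping.single m 1) p) k" by simp
  qed
  then have "(Poly_Mapping.map h :: ('m \<Rightarrow>\<^sub>0 'a) \<Rightarrow> _)
      = meval (\<lambda>a. Poly_Mapping.single 0 (h a)) (\<lambda>m. Poly_Mapping.single m 1)" by blast
  then show ?thesis
    using assms by (simp only:) (intro rhom_meval rhom_comp[OF rhom_single0]; simp add: mult_single)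
qed

lemma pm_map_pconst: "rhom h \<Longrightarrow> Poly_Mapping.map h (pconst a) = pconst (h a)"
  unfolding pconst_def by (simp add: rhom_zero)

lemma pm_map_pvar: "rhom h \<Longrightarrow> Poly_Mapping.map h (pvar u) = pvar u"
  unfolding pvar_def by (simp add: rhom_zero rhom_one)

lemma pm_map_inj:
  assumes "h 0 = 0" "inj h" "Poly_Mapping.map h p = Poly_Mapping.map h q" shows "p = q"
proof (rule poly_mapping_eqI)
  fix k
  have "Poly_Mapping.lookup (Poly_Mapping.map h p) k = Poly_Mapping.lookup (Poly_Mapping.map h q) k"
    using assms(3) by simp
  then show "Poly_Mapping.lookup p k = Poly_Mapping.lookup q k"
    using injD[OF assms(2)] assms(1) by (auto simp: Poly_Mapping.map.rep_eq when_def split: if_splits)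
qed

lemma rhom_rational: "rhom rational"
  unfolding rational_def by (intro rhom_pm_map rhom_of_int)

lemma rational_tripoly: "rational (tripoly p q r) = tripoly p q r"
proof -
  note h = rhom_pm_map[OF rhom_of_int]
  show ?thesis
    unfolding tripoly_def rhom_trinomial[OF rhom_rational]
    by (simp add: rational_def pm_map_pconst[OF h] pm_map_pvar[OF h] pm_map_pvar[OF rhom_of_int])
qed

lemma rational_inj: assumes "rational f = rational g" shows "f = g"
proof -
  have "inj (of_int :: int \<Rightarrow> rat)" by (rule injI) simp
  then have "inj (Poly_Mapping.map (of_int :: int \<Rightarrow> rat) :: int dpoly \<Rightarrow> rat dpoly)"
    by (intro injI) (rule pm_map_inj[of of_int], auto)
  then show ?thesis
    using assms unfolding rational_def
    by (intro pm_map_inj[of "Poly_Mapping.map of_int"]) (auto simp: rhom_zero[OF rhom_pm_map[OF rhom_of_int]])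
qed

text \<open>On coefficients, \<open>w\<close> sends \<open>aform m\<close> to \<open>aform\<close>
  of the image line minus \<open>C\<close>, where \<open>C\<close> comes from the motion of
  \<open>d_7\<close>. By \<open>aform_pairs\<close> all \<open>qform\<close> values at
  \<open>l\<close> shift equally, and the trinomial contains only their differences.\<close>

lemma weyl_act_tripoly:
  assumes w: "w \<in> weyl_E6" and mem: "p \<in> set (pairs l)" "q \<in> set (pairs l)" "r \<in> set (pairs l)"
  defines "f \<equiv> map_prod (line_perm w) (line_perm w)"
  shows "weyl_act w (tripoly p q r) = tripoly (f p) (f q) (f r)"
proof -
  have pw: "permutes_nforms w" using w by (rule permutes_nforms_weyl)
  then have lin: "linear_map w" and None: "\<And>v. w v $ None = v $ None" by (simp_all add: permutes_nforms_def)
  \<comment> \<open>Setting \<open>d_7 = 0\<close> turns a linear form into a polynomial in the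
    other parameters, and \<open>nform\<close> into \<open>aform\<close>.\<close>
  define D :: "rat ^ (idx option) \<Rightarrow> rat dpoly" where "D v = (\<Sum>k\<in>UNIV. pconst (v $ Some k) * pvar k)" for v
  have D_add: "D (u + v) = D u + D v" for u v
    by (simp add: D_def rhom_simps[OF rhom_pconst] algebra_simps sum.distrib)
  have D_scale: "D (c *s v) = pconst c * D v" for c v
    by (simp add: D_def rhom_simps[OF rhom_pconst] sum_distrib_left mult.assoc)
  have D_0: "D 0 = 0" by (simp add: D_def rhom_simps[OF rhom_pconst])
  have D_sum: "D (\<Sum>x\<in>A. g x) = (\<Sum>x\<in>A. D (g x))" for g :: "idx \<Rightarrow> _" and A
    by (induction A rule: infinite_finite_induct) (simp_all add: D_0 D_add)
  have D_dform: "D (dform (Some i)) = pvar i" "D (dform None) = 0" for i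
    by (simp_all add: D_def dform_nth of_bool_def if_distrib[of pconst] if_distrib[of "\<lambda>x. x * _"]
        rhom_simps[OF rhom_pconst] cong: if_cong)
  have D_nform: "D (nform l) = aform pvar l" for l
  proof -
    have neg: "D (u - v) = D u - D v" for u v
      using D_add[of "u - v" v] by simp
    show ?thesis
      by (cases l rule: line_cases)
         (simp_all add: nform_simps aform_simps neg D_add D_dform D_sum sum_UNIV_option)
  qed
  have hc: "rhom (weyl_coeff w)" unfolding weyl_coeff_def by (intro rhom_peval rhom_pconst)
  have wc: "weyl_coeff w (pvar i) = D (w (dform (Some i)))" for i
    unfolding weyl_coeff_def by (simp add: peval_pvar D_def)
  have wD: "weyl_coeff w (D v) = D (w v) - pconst (v $ None) * D (w (dform None))" for v
  proof -
    have "weyl_coeff w (pconst a) = pconst a" for a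
      unfolding weyl_coeff_def by (simp add: peval_pconst)
    then have "weyl_coeff w (D v) = (\<Sum>k\<in>UNIV. D (w ((v $ Some k) *s dform (Some k))))"
      unfolding D_def[of v] by (simp add: rhom_simps[OF hc] wc linear_map_simps[OF lin] D_scale)
    moreover have "D (w v) = D (w ((v $ None) *s dform None)) + (\<Sum>k\<in>UNIV. D (w ((v $ Some k) *s dform (Some k))))"
      by (subst (1) vec_eq_sum_dform[of v])
         (simp add: sum_UNIV_option linear_map_simps[OF lin] D_add D_sum)
    ultimately show ?thesis by (simp add: linear_map_simps[OF lin] D_scale)
  qed
  \<comment> \<open>Since \<open>w\<close> keeps the \<open>d_7\<close>-coordinate, it sends
    \<open>d_7\<close> to \<open>d_7 + C\<close>.\<close>
  define C where "C = D (w (dform None))"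
  have af: "aform (\<lambda>i. weyl_coeff w (pvar i)) m = aform pvar (line_perm w m) - C" for m
    unfolding rhom_aform[OF hc, symmetric] D_nform[symmetric] wD line_perm[OF w] C_def
    by (simp add: nform_nth rhom_simps[OF rhom_pconst])
  have qf: "qform (\<lambda>i. weyl_coeff w (pvar i)) p
      = qform pvar (f p) + (C * C - C * ((\<Sum>i\<in>UNIV. pvar i) - aform pvar (line_perm w l)))"
    if "p \<in> set (pairs l)" for p
  proof -
    have "aform pvar (fst (f p)) + aform pvar (snd (f p)) = (\<Sum>i\<in>UNIV. pvar i) - (aform pvar (line_perm w l) :: rat dpoly)"
      using line_perm_pairs[OF w, of "fst p" "snd p" l] that
      by (simp add: f_def) (metis add.commute aform_pairs)
    then show ?thesis
      by (simp add: qform_def af f_def algebra_simps flip: distrib_left)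
  qed
  have hw: "rhom (weyl_act w)"
    unfolding weyl_act_def by (intro rhom_peval rhom_comp[OF rhom_pconst] hc)
  have "weyl_act w (tripoly p q r)
      = trinomial (\<lambda>i. pconst (weyl_coeff w (pvar i))) (weyl_line w) p q r"
    unfolding tripoly_def rhom_trinomial[OF hw]
    by (simp add: weyl_act_def peval_pconst peval_pvar rhom_comp[OF rhom_pconst] hc)
  also have "\<dots> = tripoly (f p) (f q) (f r)"
  proof -
    define c where "c = C * C - C * ((\<Sum>i\<in>UNIV. pvar i) - aform pvar (line_perm w l))"
    have q: "(qform (\<lambda>i. pconst (weyl_coeff w (pvar i))) s :: rat lpoly) = qform (\<lambda>i. pconst (pvar i)) (f s) + pconst c"
      if "s \<in> set (pairs l)" for s
      using arg_cong[OF qf[OF that], of pconst]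
      by (simp add: c_def rhom_add[OF rhom_pconst] rhom_qform[OF rhom_pconst])
    have z: "qval (weyl_line w) s = qval pvar (f s)" for s
      by (simp add: qval_def sval_weyl_line[OF w] f_def)
    show ?thesis
      unfolding tripoly_def using q mem z by (intro trinomial_shift[where c = "pconst c"]) auto
  qed
  finally show ?thesis .
qed

lemma image_pairs:
  assumes w: "w \<in> weyl_E6" and "p \<in> set (pairs l)"
  defines "f \<equiv> map_prod (line_perm w) (line_perm w)"
  obtains p' where "p' \<in> set (pairs (line_perm w l))" "p' = f p \<or> p' = prod.swap (f p)"
  using line_perm_pairs[OF w, of "fst p" "snd p" l] assms(2) that unfolding f_def by (cases p) auto

text \<open>Over the rationals the image of a trinomial is again of the form \<open>tripoly\<close>,
  so it comes from an integral one, and \<open>rational\<close> is injective. Swapped entries of a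
  pair do not matter, and unsorted pairs cost at most a sign.\<close>

lemma weyl_orbit_subset: "weyl_orbit G1_trinomials \<subseteq> all_trinomials \<union> uminus ` all_trinomials"
proof
  fix f assume "f \<in> weyl_orbit G1_trinomials"
  then obtain w g where w: "w \<in> weyl_E6" and g: "g \<in> trinomials_at (G I1)"
    and f: "rational f = weyl_act w (rational g)"
    unfolding weyl_orbit_def G1_trinomials_eq by blast
  let ?P = "pairs (G I1)"
  obtain a b c where abc: "g = tripoly (?P ! a) (?P ! b) (?P ! c)" "a < b" "b < c" "c < 5"
    using g unfolding trinomials_at_def by blast
  define p q r where pqr: "p = ?P ! a" "q = ?P ! b" "r = ?P ! c"
  have mem: "p \<in> set ?P" "q \<in> set ?P" "r \<in> set ?P" and d: "distinct [p, q, r]"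
    using abc unfolding pqr by (auto intro!: nth_pairs simp: nth_pairs_eq)
  define h where "h = map_prod (line_perm w) (line_perm w)"
  obtain p' where p': "p' \<in> set (pairs (line_perm w (G I1)))" "p' = h p \<or> p' = prod.swap (h p)"
    using image_pairs[OF w mem(1)] unfolding h_def by metis
  obtain q' where q': "q' \<in> set (pairs (line_perm w (G I1)))" "q' = h q \<or> q' = prod.swap (h q)"
    using image_pairs[OF w mem(2)] unfolding h_def by metis
  obtain r' where r': "r' \<in> set (pairs (line_perm w (G I1)))" "r' = h r \<or> r' = prod.swap (h r)"
    using image_pairs[OF w mem(3)] unfolding h_def by metis
  have "rational f = tripoly (h p) (h q) (h r)"
    unfolding f abc(1) rational_tripoly pqr[symmetric] h_def by (rule weyl_act_tripoly[OF w mem])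
  also have "\<dots> = rational (tripoly p' q' r')"
    unfolding rational_tripoly by (rule tripoly_swap_pair[OF p'(2) q'(2) r'(2), symmetric])
  finally have "f = tripoly p' q' r'" by (rule rational_inj)
  moreover have "distinct [p', q', r']"
  proof -
    have "h s' \<noteq> h s \<and> h s' \<noteq> prod.swap (h s)" if "s \<in> set ?P" "s' \<in> set ?P" "s \<noteq> s'" for s s'
      using pair_unique[OF that(1,2)] that(3) inj_line_perm[OF w]
      by (cases s; cases s') (auto simp: h_def inj_eq)
    then show ?thesis using p'(2) q'(2) r'(2) mem d
      by simp (metis swap_swap)
  qed
  ultimately have "f \<in> trinomials_at (line_perm w (G I1)) \<or> - f \<in> trinomials_at (line_perm w (G I1))"
    using tripoly_sorted p'(1) q'(1) r'(1) by blast
  then show "f \<in> all_trinomials \<union> uminus ` all_trinomials"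
  proof
    assume "- f \<in> trinomials_at (line_perm w (G I1))"
    then have "- f \<in> all_trinomials" unfolding all_trinomials_def by blast
    then have "- (- f) \<in> uminus ` all_trinomials" by (rule imageI)
    then show ?thesis by simp
  qed (auto simp: all_trinomials_def)
qed

lemma bij_extension:
  fixes f :: "'a::finite \<Rightarrow> 'a"
  assumes "inj_on f A"
  obtains g where "bij g" "\<And>x. x \<in> A \<Longrightarrow> g x = f x"
proof -
  have "card (- A) = card (- f ` A)"
    using assms by (simp add: card_image Compl_eq_Diff_UNIV card_Diff_subset)
  then obtain h where h: "bij_betw h (- A) (- f ` A)"
    using finite_same_card_bij[of "- A" "- f ` A"] by auto
  have "bij_betw (\<lambda>x. if x \<in> A then f x else h x) (A \<union> - A) (f ` A \<union> - f ` A)"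
  proof (rule bij_betw_combine)
    show "bij_betw (\<lambda>x. if x \<in> A then f x else h x) A (f ` A)"
      using assms by (simp add: bij_betw_def cong: inj_on_cong)
    show "bij_betw (\<lambda>x. if x \<in> A then f x else h x) (- A) (- f ` A)"
      using h by (subst bij_betw_cong[where g = h]) auto
  qed auto
  then show ?thesis using that[of "\<lambda>x. if x \<in> A then f x else h x"] by simp
qed

text \<open>Permutations are transitive within each of the three types of lines, and the reflection
  joins the types by sending \<open>G_4\<close> to \<open>F_56\<close> and \<open>F_23\<close> to
  \<open>E_1\<close>.\<close>

lemma weyl_transitive: "\<exists>w\<in>weyl_E6. line_perm w (G I1) = l"
proof -
  have step: "\<exists>w\<in>weyl_E6. line_perm w (G I1) = l'"
    if ex: "\<exists>w\<in>weyl_E6. line_perm w (G I1) = l" and v: "v (nform l) = nform l'" "\<And>w. w \<in> weyl_E6 \<Longrightarrow> v \<circ> w \<in> weyl_E6"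
    for l l' v
  proof -
    obtain w where w: "w \<in> weyl_E6" "line_perm w (G I1) = l" using ex by blast
    have "(v \<circ> w) (nform (G I1)) = nform l'" using line_perm[OF w(1), of "G I1"] w(2) v(1) by simp
    then show ?thesis using v(2)[OF w(1)] line_perm_eqI by blast
  qed
  have G: "\<exists>w\<in>weyl_E6. line_perm w (G I1) = G j" for j
  proof -
    have "inj_on (\<lambda>_. j) {I1}" by simp
    then obtain \<sigma> where s: "bij \<sigma>" "\<sigma> I1 = j" by (rule bij_extension) auto
    have "\<exists>w\<in>weyl_E6. line_perm w (G I1) = G I1"
      by (intro bexI[of _ id] line_perm_eqI weyl_E6.id) simp
    from step[OF this, of "perm_action \<sigma>"] show ?thesis
      using s perm_action_nform(3)[OF s(1), of I1] weyl_E6_perm by metis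
  qed
  have F: "\<exists>w\<in>weyl_E6. line_perm w (G I1) = F i j" if "i \<noteq> j" for i j
  proof -
    have "inj_on (\<lambda>k. if k = I5 then i else j) {I5, I6}" using that by (auto simp: inj_on_def)
    then obtain \<sigma> where "bij \<sigma>" "\<And>k. k \<in> {I5, I6} \<Longrightarrow> \<sigma> k = (if k = I5 then i else j)"
      by (rule bij_extension) auto
    then have s: "bij \<sigma>" "\<sigma> I5 = i" "\<sigma> I6 = j" by auto
    have "weyl_reflection (nform (G I4)) = nform (F I5 I6)"
      using reflection_nform by simp
    from step[OF G this weyl_E6.refl] have "\<exists>w\<in>weyl_E6. line_perm w (G I1) = F I5 I6" by blast
    from step[OF this, of "perm_action \<sigma>"] show ?thesis
      using s perm_action_nform(2)[OF s(1), of I5 I6] weyl_E6_perm by (metis idx.distinct(29))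
  qed
  have E: "\<exists>w\<in>weyl_E6. line_perm w (G I1) = E j" for j
  proof -
    have "inj_on (\<lambda>_. j) {I1}" by simp
    then obtain \<sigma> where s: "bij \<sigma>" "\<sigma> I1 = j" by (rule bij_extension) auto
    have "weyl_reflection (nform (F I2 I3)) = nform (E I1)"
      using reflection_nform by simp
    from step[OF F this weyl_E6.refl] have "\<exists>w\<in>weyl_E6. line_perm w (G I1) = E I1" by blast
    from step[OF this, of "perm_action \<sigma>"] show ?thesis
      using s perm_action_nform(1)[OF s(1), of I1] weyl_E6_perm by metis
  qed
  show ?thesis using E F G by (cases l rule: line_cases) auto
qed

text \<open>Transitivity brings the line to \<open>G I1\<close>. The stabilizer contains all
  permutations fixing \<open>I1\<close>; these carry three standard pairs to any three pairs in any
  order, so the exact sign is reached and not just the trinomial up to sign.\<close>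

lemma all_trinomials_subset_weyl_orbit: "all_trinomials \<subseteq> weyl_orbit G1_trinomials"
proof
  fix f assume "f \<in> all_trinomials"
  then obtain l where "f \<in> trinomials_at l" unfolding all_trinomials_def by blast
  then obtain a b c where abc: "f = tripoly (pairs l ! a) (pairs l ! b) (pairs l ! c)" "a < b" "b < c" "c < 5"
    unfolding trinomials_at_def by blast
  obtain w where w: "w \<in> weyl_E6" "line_perm w (G I1) = l" using weyl_transitive by blast
  define h where "h = map_prod (line_perm w) (line_perm w)"
  have ex: "\<exists>i. i \<noteq> I1 \<and> (p = h (E i, F I1 i) \<or> p = prod.swap (h (E i, F I1 i)))"
    if "p \<in> set (pairs l)" for p
  proof -
    have "bij (line_perm w)"
      using inj_line_perm[OF w(1)] by (simp add: bij_def finite_UNIV_inj_surj)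
    then obtain m n where mn: "p = (line_perm w m, line_perm w n)"
      by (metis bij_pointE surj_pair)
    have "nform (line_perm w (G I1)) + nform (line_perm w m) + nform (line_perm w n) = nform_total"
      using that mn w(2) pairs_iff_nform by metis
    moreover have pw: "permutes_nforms w" using w(1) by (rule permutes_nforms_weyl)
    ultimately have "w (nform (G I1) + nform m + nform n) = w nform_total"
      using line_perm[OF w(1)] by (simp add: permutes_nforms_def linear_map_simps)
    moreover have "inj w" using w(1) by (rule inj_weyl)
    ultimately have "nform (G I1) + nform m + nform n = nform_total" by (metis injD)
    then have "(m, n) \<in> set (pairs (G I1)) \<or> (n, m) \<in> set (pairs (G I1))"
      using pairs_iff_nform by blast
    then show ?thesis using mn unfolding h_def by (auto simp: pairs_G)
  qed
  have mem: "pairs l ! a \<in> set (pairs l)" "pairs l ! b \<in> set (pairs l)" "pairs l ! c \<in> set (pairs l)"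
    using abc by (simp_all add: nth_pairs)
  obtain i where i: "i \<noteq> I1" "pairs l ! a = h (E i, F I1 i) \<or> pairs l ! a = prod.swap (h (E i, F I1 i))"
    using ex[OF mem(1)] by blast
  obtain j where j: "j \<noteq> I1" "pairs l ! b = h (E j, F I1 j) \<or> pairs l ! b = prod.swap (h (E j, F I1 j))"
    using ex[OF mem(2)] by blast
  obtain k where k: "k \<noteq> I1" "pairs l ! c = h (E k, F I1 k) \<or> pairs l ! c = prod.swap (h (E k, F I1 k))"
    using ex[OF mem(3)] by blast
  have d: "distinct [I1, i, j, k]"
  proof -
    have "pairs l ! a \<noteq> pairs l ! b \<and> pairs l ! a \<noteq> prod.swap (pairs l ! b)"
      "pairs l ! a \<noteq> pairs l ! c \<and> pairs l ! a \<noteq> prod.swap (pairs l ! c)"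
      "pairs l ! b \<noteq> pairs l ! c \<and> pairs l ! b \<noteq> prod.swap (pairs l ! c)"
      using pair_unique[OF mem(1,2)] pair_unique[OF mem(1,3)] pair_unique[OF mem(2,3)] abc(2-)
      by (auto simp: nth_pairs_eq)
    then show ?thesis using i j k by auto
  qed
  \<comment> \<open>Prescribes the images of \<open>I1\<close> to \<open>I4\<close> so that the
    pairs at \<open>I2\<close>, \<open>I3\<close>, \<open>I4\<close> go to the three given pairs in
    the given order.\<close>
  define s0 where "s0 x = (if x = I1 then I1 else if x = I2 then i else if x = I3 then j else k)" for x
  have "inj_on s0 {I1, I2, I3, I4}" using d by (auto simp: inj_on_def s0_def)
  then obtain \<sigma> where bij: "bij \<sigma>" and "\<And>x. x \<in> {I1, I2, I3, I4} \<Longrightarrow> \<sigma> x = s0 x"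
    by (rule bij_extension) auto
  then have \<sigma>: "\<sigma> I1 = I1" "\<sigma> I2 = i" "\<sigma> I3 = j" "\<sigma> I4 = k" by (auto simp: s0_def)
  define v where "v = w \<circ> perm_action \<sigma>"
  have "perm_action \<sigma> \<in> weyl_E6" using weyl_E6_perm[OF weyl_E6.id bij] by simp
  then have v: "v \<in> weyl_E6" unfolding v_def using w(1) weyl_E6_comp by blast
  have pv: "map_prod (line_perm v) (line_perm v) (E x, F I1 x) = h (E (\<sigma> x), F I1 (\<sigma> x))" if "x \<noteq> I1" for x
  proof -
    have "v (nform (E x)) = nform (line_perm w (E (\<sigma> x)))"
      unfolding v_def using perm_action_nform(1)[OF bij] line_perm[OF w(1)] by simp
    moreover have "v (nform (F I1 x)) = nform (line_perm w (F I1 (\<sigma> x)))"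
      unfolding v_def using perm_action_nform(2)[OF bij, of I1 x] line_perm[OF w(1)] that \<sigma>(1) by simp
    ultimately show ?thesis unfolding h_def using line_perm_eqI[OF v] by simp
  qed
  have G: "(E x, F I1 x) \<in> set (pairs (G I1))" if "x \<noteq> I1" for x using that by (auto simp: pairs_G)
  define g :: "int lpoly" where "g = tripoly (E I2, F I1 I2) (E I3, F I1 I3) (E I4, F I1 I4)"
  have "weyl_act v (rational g) = tripoly (h (E i, F I1 i)) (h (E j, F I1 j)) (h (E k, F I1 k))"
    unfolding g_def rational_tripoly
    by (subst weyl_act_tripoly[OF v G G G]) (simp_all add: pv \<sigma> del: map_prod_simp)
  also have "\<dots> = rational f"
    unfolding abc(1) rational_tripoly by (rule tripoly_swap_pair[OF i(2) j(2) k(2), symmetric])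
  finally have "rational f = weyl_act v (rational g)" by simp
  moreover have "g \<in> G1_trinomials"
  proof -
    have "g = G1_trinomial I2 I3 I4" unfolding g_def by (rule tripoly_G1) auto
    moreover have "I2 \<le> I2" "I2 < I3" "I3 < I4" by (simp_all add: less_idx_def)
    ultimately show ?thesis unfolding G1_trinomials_def by blast
  qed
  ultimately show "f \<in> weyl_orbit G1_trinomials" unfolding weyl_orbit_def using v by blast
qed

section \<open>Elimination modulo the trinomials, and saturation\<close>

section \<open>Reduction modulo the trinomials\<close>

text \<open>
  Lines whose variables are expressed, modulo the trinomials and after inverting roots and the
  variables \<open>E\<^sub>i\<close>, through \<open>E\<^sub>1, \<dots>, E\<^sub>6\<close> and \<open>F\<^sub>1\<^sub>2, F\<^sub>1\<^sub>3, F\<^sub>2\<^sub>3\<close>; these turn out to be all lines.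
\<close>

definition base_lines :: "line set" where
  "base_lines = range E \<union> {F I1 I2, F I1 I3, F I2 I3}"

text \<open>A step solves one trinomial for its third product \<open>E k * m\<close>. Every step can
  be arranged with some \<open>E k\<close> there, so besides the roots only the six \<open>E\<close>
  variables have to be inverted.\<close>

inductive_set reachable :: "line set" where
  base: "l \<in> base_lines \<Longrightarrow> l \<in> reachable"
| step: "p \<in> set (pairs l) \<Longrightarrow> q \<in> set (pairs l) \<Longrightarrow> (E k, m) \<in> set (pairs l)
    \<Longrightarrow> distinct [p, q, (E k, m)]
    \<Longrightarrow> fst p \<in> reachable \<Longrightarrow> snd p \<in> reachable \<Longrightarrow> fst q \<in> reachable \<Longrightarrow> snd q \<in> reachable
    \<Longrightarrow> m \<in> reachable"

text \<open>In the pencil of \<open>G j\<close> the pairs are \<open>(E k, F j k)\<close>, so two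
  known \<open>F j a\<close>, \<open>F j b\<close> yield all \<open>F j k\<close>: first for
  \<open>j = 1, 2\<close>, then for every \<open>j\<close>. In the pencil of \<open>F i j\<close>
  two products of \<open>F\<close> variables then yield the \<open>G\<close> variables.\<close>

lemma reachable_UNIV: "l \<in> reachable"
proof -
  have E: "E i \<in> reachable" for i by (intro reachable.base) (simp add: base_lines_def)
  have G_mem: "(E i, F j i) \<in> set (pairs (G j))" if "i \<noteq> j" for i j
    using that by (auto simp: pairs_G)
  have step: "F j k \<in> reachable" if "F j a \<in> reachable" "F j b \<in> reachable" "distinct [a, b, k]" "j \<noteq> a" "j \<noteq> b" "j \<noteq> k"
    for j a b k
    using that
    by (intro reachable.step[OF G_mem[of a j] G_mem[of b j] G_mem[of k j]]) (auto intro: E)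
  have b: "F I1 I2 \<in> reachable" "F I1 I3 \<in> reachable" "F I2 I3 \<in> reachable"
    "F I2 I1 \<in> reachable" "F I3 I1 \<in> reachable" "F I3 I2 \<in> reachable"
    by (auto simp: F_commute[of I2 I1] F_commute[of I3 I1] F_commute[of I3 I2] base_lines_def intro!: reachable.base)
  have F1: "F I1 k \<in> reachable" if "k \<noteq> I1" for k
    using step[of I1 I2 I3 k] b that by (cases "k = I2 \<or> k = I3") auto
  have F2: "F I2 k \<in> reachable" if "k \<noteq> I2" for k
    using step[of I2 I1 I3 k] b that by (cases "k = I1 \<or> k = I3") auto
  have F: "F i j \<in> reachable" if "i \<noteq> j" for i j
  proof (cases "i = I1 \<or> i = I2 \<or> j = I1 \<or> j = I2")
    case True
    then show ?thesis using F1 F2 that by (metis F_commute)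
  next
    case False
    then show ?thesis using step[of i I1 I2 j] F1[of i] F2[of i] that F_commute[of i] by auto
  qed
  have G: "G j \<in> reachable" for j
  proof -
    obtain i where "i \<noteq> j" using card_idx by (metis idx.distinct(1))
    then consider "i < j" | "j < i" by fastforce
    then show ?thesis
    proof cases
      case 1
      then obtain k a b c where d: "distinct [i, j, k, a, b, c]"
        and p: "pairs (F i j) = [(E i, G j), (E j, G i), (F k a, F b c), (F k b, F a c), (F k c, F a b)]"
        by (rule pairs_F_elim)
      show ?thesis
        by (rule reachable.step[where l = "F i j" and p = "(F k a, F b c)" and q = "(F k b, F a c)" and k = i])
           (use d in \<open>auto simp: p F_eq_iff intro: F\<close>)
    next
      case 2
      then obtain k a b c where d: "distinct [j, i, k, a, b, c]"
        and p: "pairs (F j i) = [(E j, G i), (E i, G j), (F k a, F b c), (F k b, F a c), (F k c, F a b)]"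
        by (rule pairs_F_elim)
      show ?thesis
        by (rule reachable.step[where l = "F j i" and p = "(F k a, F b c)" and q = "(F k b, F a c)" and k = i])
           (use d in \<open>auto simp: p F_eq_iff intro: F\<close>)
    qed
  qed
  show ?thesis using E F G by (cases l rule: line_cases) auto
qed

definition satisfies_trinomials :: "(idx \<Rightarrow> 'b::comm_ring_1) \<Rightarrow> (line \<Rightarrow> 'b) \<Rightarrow> bool" where
  "satisfies_trinomials \<delta> z \<longleftrightarrow>
     (\<forall>l. \<forall>p\<in>set (pairs l). \<forall>q\<in>set (pairs l). \<forall>r\<in>set (pairs l). trinomial \<delta> z p q r = 0)"

lemma root_prod_nonzero:
  "(root_prod \<delta> :: 'b::idom) \<noteq> 0 \<longleftrightarrow> 0 \<notin> roots (\<chi> i. \<delta> i)"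
  by (auto simp: root_prod_def finite_roots)

lemma roots_image:
  assumes "rhom h"
  shows "roots (\<chi> i. h (\<delta> i)) \<subseteq> h ` roots (\<chi> i. \<delta> i)"
proof
  fix r assume "r \<in> roots (\<chi> i. h (\<delta> i))"
  then consider i j where "i < j" "r = h (\<delta> i) - h (\<delta> j)"
    | i j k where "i < j" "j < k" "r = h (\<delta> i) + h (\<delta> j) + h (\<delta> k)"
    | "r = (\<Sum>i\<in>UNIV. h (\<delta> i))"
    unfolding roots_def vec_lambda_beta by blast
  then show "r \<in> h ` roots (\<chi> i. \<delta> i)"
  proof cases
    case (1 i j)
    then show ?thesis
      by (intro image_eqI[of _ _ "\<delta> i - \<delta> j"]) (auto simp: rhom_diff[OF assms] roots_def)
  next
    case (2 i j k)
    then show ?thesis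
      by (intro image_eqI[of _ _ "\<delta> i + \<delta> j + \<delta> k"]) (auto simp: rhom_add[OF assms] roots_def)
  next
    case 3
    then show ?thesis
      by (intro image_eqI[of _ _ "\<Sum>i\<in>UNIV. \<delta> i"]) (auto simp: rhom_sum[OF assms] roots_def)
  qed
qed

lemma rhom_root_prod_nonzero:
  fixes h :: "'a::comm_ring_1 \<Rightarrow> 'b::idom"
  assumes "rhom h" "0 \<notin> roots (\<chi> i. h (\<delta> i))"
  shows "h (root_prod \<delta>) \<noteq> 0"
proof -
  have "h r \<noteq> 0" if "r \<in> roots (\<chi> i. \<delta> i)" for r
    using roots_hom[OF assms(1) that] assms(2) by auto
  then show ?thesis unfolding root_prod_def by (simp add: rhom_prod[OF assms(1)] finite_roots)
qed

text \<open>Elimination at a point: along each step of \<open>reachable\<close> the coefficient of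
  the third product is non-zero off the root hyperplanes, and \<open>E k\<close> is non-zero, so the
  new coordinate is forced.\<close>

lemma satisfies_trinomials_unique:
  fixes \<delta> :: "idx \<Rightarrow> 'b::field"
  assumes roots: "0 \<notin> roots (\<chi> i. \<delta> i)"
    and z: "satisfies_trinomials \<delta> z" and z': "satisfies_trinomials \<delta> z'"
    and E: "\<And>i. z (E i) \<noteq> 0" and eq: "\<And>l. l \<in> base_lines \<Longrightarrow> z l = z' l"
  shows "z = z'"
proof
  fix l
  show "z l = z' l"
    using reachable_UNIV[of l]
  proof (induction rule: reachable.induct)
    case (base l)
    then show ?case by (rule eq)
  next
    case (step p l q k m)
    have "qform \<delta> p - qform \<delta> q dvd root_prod \<delta> ^ 2"
      using step by (intro qform_diff_dvd) auto
    then have nz: "qform \<delta> p - qform \<delta> q \<noteq> 0"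
      using roots root_prod_nonzero[of \<delta>] by auto
    have sv: "sval z n = sval z' n" if "z n = z' n" for n
      using that by (simp add: sval_sign[of z] sval_sign[of z'])
    have "qval z p = qval z' p" "qval z q = qval z' q"
      using step.IH by (simp_all add: qval_def sv)
    moreover have "trinomial \<delta> z p q (E k, m) = 0" "trinomial \<delta> z' p q (E k, m) = 0"
      using z z' step.hyps unfolding satisfies_trinomials_def by blast+
    ultimately have "(qform \<delta> p - qform \<delta> q) * qval z (E k, m) = (qform \<delta> p - qform \<delta> q) * qval z' (E k, m)"
      unfolding trinomial_def by (simp only: add_eq_0_iff)
    then have "qval z (E k, m) = qval z' (E k, m)" using nz by simp
    then have "z (E k) * sval z m = z (E k) * sval z' m"
      using eq[of "E k"] by (simp add: qval_def base_lines_def)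
    then have "sval z m = sval z' m" using E by simp
    then show ?case by (cases m rule: line_cases) simp_all
  qed
qed

lemma module_mult: "Modules.module ((*) :: 'a::comm_ring_1 \<Rightarrow> 'a \<Rightarrow> 'a)"
  by unfold_locales (simp_all add: algebra_simps)

lemma
  shows ideal_generated_base: "f \<in> B \<Longrightarrow> f \<in> ideal_generated B"
    and ideal_generated_0: "0 \<in> ideal_generated B"
    and ideal_generated_add: "f \<in> ideal_generated B \<Longrightarrow> g \<in> ideal_generated B \<Longrightarrow> f + g \<in> ideal_generated B"
    and ideal_generated_diff: "f \<in> ideal_generated B \<Longrightarrow> g \<in> ideal_generated B \<Longrightarrow> f - g \<in> ideal_generated B"
    and ideal_generated_uminus: "f \<in> ideal_generated B \<Longrightarrow> - f \<in> ideal_generated B"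
    and ideal_generated_mult: "f \<in> ideal_generated B \<Longrightarrow> h * f \<in> ideal_generated B"
  unfolding ideal_generated_def
  by (blast intro: Modules.module.span_base[OF module_mult] Modules.module.span_zero[OF module_mult]
      Modules.module.span_add[OF module_mult] Modules.module.span_diff[OF module_mult] Modules.module.span_neg[OF module_mult]
      Modules.module.span_scale[OF module_mult])+

lemma ideal_generated_least:
  assumes "f \<in> ideal_generated B" "B \<subseteq> J" "0 \<in> J" "\<And>f g. f \<in> J \<Longrightarrow> g \<in> J \<Longrightarrow> f + g \<in> J"
    "\<And>f h. f \<in> J \<Longrightarrow> h * f \<in> J"
  shows "f \<in> J"
proof -
  have "Modules.module.subspace (*) J"
    using assms(3-) by (auto simp: Modules.module.subspace_def[OF module_mult])
  then show ?thesis
    using Modules.module.span_minimal[OF module_mult assms(2)] assms(1) unfolding ideal_generated_def by blast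
qed

lemma tripoly_in_ideal:
  assumes "p \<in> set (pairs l)" "q \<in> set (pairs l)" "r \<in> set (pairs l)" "distinct [p, q, r]"
  shows "tripoly p q r \<in> ideal_generated all_trinomials"
  using tripoly_sorted[OF assms]
proof
  assume "tripoly p q r \<in> trinomials_at l"
  then show ?thesis by (intro ideal_generated_base) (auto simp: all_trinomials_def)
next
  assume "- tripoly p q r \<in> trinomials_at l"
  then have "- tripoly p q r \<in> ideal_generated all_trinomials"
    by (intro ideal_generated_base) (auto simp: all_trinomials_def)
  from ideal_generated_uminus[OF this] show ?thesis by simp
qed

definition base_polys :: "int lpoly set" where
  "base_polys = {f. occurring_lines f \<subseteq> base_lines}"

lemma occurring_lines_single: "occurring_lines (Poly_Mapping.single m a) \<subseteq> Poly_Mapping.keys m"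
  by (simp add: occurring_lines_def)

lemma
  shows base_polys_const: "pconst a \<in> base_polys"
    and base_polys_var: "l \<in> base_lines \<Longrightarrow> pvar l \<in> base_polys"
    and base_polys_add: "f \<in> base_polys \<Longrightarrow> g \<in> base_polys \<Longrightarrow> f + g \<in> base_polys"
    and base_polys_mult: "f \<in> base_polys \<Longrightarrow> g \<in> base_polys \<Longrightarrow> f * g \<in> base_polys"
proof -
  show "pconst a \<in> base_polys"
    using occurring_lines_single[of 0 a] by (simp add: base_polys_def pconst_def)
  show "l \<in> base_lines \<Longrightarrow> pvar l \<in> base_polys"
    using occurring_lines_single[of "Poly_Mapping.single l 1" 1] by (auto simp: base_polys_def pvar_def)
  show "f \<in> base_polys \<Longrightarrow> g \<in> base_polys \<Longrightarrow> f + g \<in> base_polys"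
    using keys_add[of f g] unfolding base_polys_def occurring_lines_def by blast
  show "f * g \<in> base_polys" if fg: "f \<in> base_polys" "g \<in> base_polys"
  proof -
    have "Poly_Mapping.keys k \<subseteq> base_lines" if k: "k \<in> Poly_Mapping.keys (f * g)" for k
    proof -
      obtain a b where "k = a + b" "a \<in> Poly_Mapping.keys f" "b \<in> Poly_Mapping.keys g"
        using keys_mult[of f g] k by blast
      then show ?thesis
        using fg keys_add[of a b] unfolding base_polys_def occurring_lines_def by blast
    qed
    then show ?thesis unfolding base_polys_def occurring_lines_def by blast
  qed
qed

lemma base_polys_power: "f \<in> base_polys \<Longrightarrow> f ^ n \<in> base_polys"
  using base_polys_const[of 1]
  by (induction n) (auto intro: base_polys_mult simp: rhom_one[OF rhom_pconst])

lemma base_polys_prod: "(\<And>i. i \<in> A \<Longrightarrow> f i \<in> base_polys) \<Longrightarrow> prod f A \<in> base_polys"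
  using base_polys_const[of 1]
  by (induction A rule: infinite_finite_induct)
     (auto intro: base_polys_mult simp: rhom_one[OF rhom_pconst])

text \<open>Only what the elimination divides by. It divides \<open>saturating_element\<close>, so
  saturating by it is enough.\<close>

definition base_saturator :: "int lpoly" where
  "base_saturator = pconst (root_prod pvar) * (\<Prod>i\<in>UNIV. pvar (E i))"

text \<open>In the quotient by the trinomials, localized at \<open>base_saturator\<close>, the class
  of \<open>f\<close> is a fraction with numerator in the nine base variables. The denominator is
  kept as a power on the other side to avoid constructing the localization.\<close>

definition reducible :: "int lpoly \<Rightarrow> bool" where
  "reducible f \<longleftrightarrow>
     (\<exists>n. \<exists>p\<in>base_polys. base_saturator ^ n * f - p \<in> ideal_generated all_trinomials)"

lemma base_saturator_base: "base_saturator \<in> base_polys"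
  unfolding base_saturator_def
  by (intro base_polys_mult base_polys_const base_polys_prod base_polys_var) (simp add: base_lines_def)

lemma reducible_base: "f \<in> base_polys \<Longrightarrow> reducible f"
  unfolding reducible_def by (intro exI[of _ 0] bexI[of _ f]) (auto simp: ideal_generated_0)

lemma reducible_ideal: "f \<in> ideal_generated all_trinomials \<Longrightarrow> reducible f"
  unfolding reducible_def using base_polys_const[of 0]
  by (intro exI[of _ 0] bexI[of _ 0]) (auto simp: rhom_zero[OF rhom_pconst])

lemma reducible_add:
  assumes "reducible f" "reducible g" shows "reducible (f + g)"
proof -
  let ?s = base_saturator
  obtain n p where n: "p \<in> base_polys" "?s ^ n * f - p \<in> ideal_generated all_trinomials"
    using assms(1) unfolding reducible_def by blast
  obtain m q where m: "q \<in> base_polys" "?s ^ m * g - q \<in> ideal_generated all_trinomials"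
    using assms(2) unfolding reducible_def by blast
  have "?s ^ (n + m) * (f + g) - (?s ^ m * p + ?s ^ n * q)
      = ?s ^ m * (?s ^ n * f - p) + ?s ^ n * (?s ^ m * g - q)"
    by (simp add: algebra_simps power_add)
  moreover have "\<dots> \<in> ideal_generated all_trinomials"
    by (intro ideal_generated_add ideal_generated_mult n m)
  moreover have "?s ^ m * p + ?s ^ n * q \<in> base_polys"
    by (intro base_polys_add base_polys_mult base_polys_power base_saturator_base n m)
  ultimately show ?thesis unfolding reducible_def by metis
qed

lemma reducible_mult:
  assumes "reducible f" "reducible g" shows "reducible (f * g)"
proof -
  let ?s = base_saturator
  obtain n p where n: "p \<in> base_polys" "?s ^ n * f - p \<in> ideal_generated all_trinomials"
    using assms(1) unfolding reducible_def by blast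
  obtain m q where m: "q \<in> base_polys" "?s ^ m * g - q \<in> ideal_generated all_trinomials"
    using assms(2) unfolding reducible_def by blast
  have "?s ^ (n + m) * (f * g) - p * q = (?s ^ m * g) * (?s ^ n * f - p) + p * (?s ^ m * g - q)"
    by (simp add: algebra_simps power_add)
  moreover have "\<dots> \<in> ideal_generated all_trinomials"
    by (intro ideal_generated_add ideal_generated_mult n m)
  ultimately show ?thesis unfolding reducible_def using base_polys_mult[OF n(1) m(1)] by metis
qed

lemma reducible_cancel:
  assumes "reducible (u * f)" "u * v = base_saturator ^ k" "v \<in> base_polys"
  shows "reducible f"
proof -
  let ?s = base_saturator
  obtain n p where n: "p \<in> base_polys" "?s ^ n * (u * f) - p \<in> ideal_generated all_trinomials"
    using assms(1) unfolding reducible_def by blast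
  have "?s ^ (n + k) * f - v * p = v * (?s ^ n * (u * f) - p)"
    unfolding power_add assms(2)[symmetric] by (simp add: algebra_simps)
  then show ?thesis unfolding reducible_def
    using ideal_generated_mult[OF n(2), of v] base_polys_mult[OF assms(3) n(1)] by metis
qed

lemma reducible_var: "reducible (pvar l)"
  using reachable_UNIV[of l]
proof (induction rule: reachable.induct)
  case (base l)
  then show ?case by (intro reducible_base base_polys_var)
next
  case (step p l q k m)
  have const: "reducible (pconst a)" for a by (intro reducible_base base_polys_const)
  have minus: "reducible (- f)" if "reducible f" for f
    using reducible_mult[OF const[of "- 1"] that] by (simp add: rhom_simps[OF rhom_pconst])
  have sval: "reducible (sval pvar n)" if "reducible (pvar n)" for n
    using that minus by (cases n rule: line_cases) auto
  have pq: "reducible (qval pvar p)" "reducible (qval pvar q)"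
    unfolding qval_def by (intro reducible_mult sval step.IH)+
  define r where "r = (E k, m)"
  \<comment> \<open>The coefficient of the third product, which divides the square of the root
    product.\<close>
  define a where "a = qform pvar p - (qform pvar q :: int dpoly)"
  have "tripoly p q r \<in> ideal_generated all_trinomials"
    unfolding r_def by (rule tripoly_in_ideal) (use step.hyps in auto)
  then have "reducible (tripoly p q r)" by (rule reducible_ideal)
  moreover have "reducible (- ((qform (\<lambda>i. pconst (pvar i)) q - qform (\<lambda>i. pconst (pvar i)) r) * qval pvar p))"
    "reducible ((qform (\<lambda>i. pconst (pvar i)) p - qform (\<lambda>i. pconst (pvar i)) r) * qval pvar q)"
    unfolding rhom_qform[OF rhom_pconst, symmetric] rhom_diff[OF rhom_pconst, symmetric]
    by (intro minus reducible_mult const pq)+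
  ultimately have "reducible (tripoly p q r
      + - ((qform (\<lambda>i. pconst (pvar i)) q - qform (\<lambda>i. pconst (pvar i)) r) * qval pvar p)
      + (qform (\<lambda>i. pconst (pvar i)) p - qform (\<lambda>i. pconst (pvar i)) r) * qval pvar q)"
    by (intro reducible_add)
  also have "tripoly p q r
      + - ((qform (\<lambda>i. pconst (pvar i)) q - qform (\<lambda>i. pconst (pvar i)) r) * qval pvar p)
      + (qform (\<lambda>i. pconst (pvar i)) p - qform (\<lambda>i. pconst (pvar i)) r) * qval pvar q
     = pconst a * qval pvar r"
    unfolding tripoly_def trinomial_def a_def rhom_diff[OF rhom_pconst] rhom_qform[OF rhom_pconst]
    by simp
  finally have red: "reducible (pconst a * qval pvar r)" .
  have "a dvd root_prod pvar ^ 2"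
    unfolding a_def using step.hyps by (intro qform_diff_dvd) auto
  then obtain b where b: "root_prod pvar ^ 2 = a * b" by (auto simp: dvd_def)
  let ?P = "\<Prod>i\<in>UNIV. pvar (E i) :: int lpoly"
  have P: "?P \<in> base_polys" by (intro base_polys_prod base_polys_var) (simp add: base_lines_def)
  have "reducible (qval pvar r)"
  proof (rule reducible_cancel[OF red])
    show "pconst a * (pconst b * ?P ^ 2) = base_saturator ^ 2"
      unfolding base_saturator_def power_mult_distrib rhom_power[OF rhom_pconst, symmetric] b
      by (simp add: rhom_mult[OF rhom_pconst] mult.assoc)
    show "pconst b * ?P ^ 2 \<in> base_polys"
      by (intro base_polys_mult base_polys_const base_polys_power P)
  qed
  then have red: "reducible (pvar (E k) * sval pvar m)"
    using minus[of "qval pvar r"] by (simp add: qval_def r_def)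
  have "reducible (sval pvar m)"
  proof (rule reducible_cancel[OF red])
    have "?P = pvar (E k) * (\<Prod>i\<in>UNIV - {k}. pvar (E i))" by (rule prod.remove) auto
    then show "pvar (E k) * (pconst (root_prod pvar) * (\<Prod>i\<in>UNIV - {k}. pvar (E i))) = base_saturator ^ 1"
      by (simp add: base_saturator_def ac_simps)
    show "pconst (root_prod pvar) * (\<Prod>i\<in>UNIV - {k}. pvar (E i)) \<in> base_polys"
      by (intro base_polys_mult base_polys_const base_polys_prod base_polys_var) (simp add: base_lines_def)
  qed
  then show ?case using minus by (cases m rule: line_cases) fastforce+
qed

lemma reducible: "reducible f"
  by (induction f rule: mpoly_induct)
     (auto intro: reducible_base base_polys_const reducible_var reducible_add reducible_mult)

section \<open>The Cox ideal in terms of points\<close>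

abbreviation eval_at :: "(idx \<Rightarrow> 'a::field) \<Rightarrow> (line \<Rightarrow> 'a) \<Rightarrow> int lpoly \<Rightarrow> 'a" where
  "eval_at \<delta> z \<equiv> peval (peval of_int \<delta>) z"

abbreviation section_at :: "(idx \<Rightarrow> 'a::field) \<Rightarrow> 'a ^ 3 \<Rightarrow> (idx \<Rightarrow> 'a) \<Rightarrow> line \<Rightarrow> 'a" where
  "section_at \<delta> x t \<equiv> psec \<delta> x t (\<lambda>i. inverse (t i))"

lemma eval_at_tripoly: "eval_at \<delta> z (tripoly p q r) = trinomial \<delta> z p q r"
  unfolding tripoly_def rhom_trinomial[OF rhom_peval[OF rhom_peval[OF rhom_of_int]]]
  by (simp add: peval_pconst peval_pvar)

lemma satisfies_trinomials_section: "(\<And>i. t i \<noteq> 0) \<Longrightarrow> satisfies_trinomials \<delta> (section_at \<delta> x t)"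
  unfolding satisfies_trinomials_def by (auto intro!: trinomial_psec)

lemma eval_at_ideal_generated:
  assumes "satisfies_trinomials \<delta> z" "f \<in> ideal_generated all_trinomials"
  shows "eval_at \<delta> z f = 0"
proof -
  note h = rhom_simps[OF rhom_peval[OF rhom_peval[OF rhom_of_int]]]
  have "f \<in> {f. eval_at \<delta> z f = 0}"
  proof (rule ideal_generated_least[OF assms(2)])
    show "all_trinomials \<subseteq> {f. eval_at \<delta> z f = 0}"
    proof
      fix g assume "g \<in> all_trinomials"
      then obtain l a b c where "g = tripoly (pairs l ! a) (pairs l ! b) (pairs l ! c)" "a < b" "b < c" "c < 5"
        unfolding all_trinomials_def trinomials_at_def by blast
      moreover from this have "pairs l ! a \<in> set (pairs l)" "pairs l ! b \<in> set (pairs l)" "pairs l ! c \<in> set (pairs l)"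
        by (simp_all add: nth_pairs)
      ultimately show "g \<in> {f. eval_at \<delta> z f = 0}"
        using assms(1) by (simp add: eval_at_tripoly satisfies_trinomials_def)
    qed
  qed (simp_all add: h)
  then show ?thesis by simp
qed

lemma eval_at_base_saturator:
  assumes "0 \<notin> roots (\<chi> i. \<delta> i)" "\<And>i. z (E i) \<noteq> 0"
  shows "eval_at \<delta> z base_saturator \<noteq> 0"
proof -
  note r = rhom_peval[OF rhom_of_int]
  have "peval of_int \<delta> (root_prod pvar) \<noteq> 0"
    using assms(1) by (intro rhom_root_prod_nonzero[OF r]) (simp add: peval_pvar)
  then show ?thesis
    unfolding base_saturator_def using assms(2)
    by (simp add: rhom_simps[OF rhom_peval[OF r]] peval_pconst r peval_pvar)
qed

lemma peval_cong:
  assumes "\<And>m u. m \<in> Poly_Mapping.keys p \<Longrightarrow> u \<in> Poly_Mapping.keys m \<Longrightarrow> x u = y u"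
  shows "peval c x p = peval c y p"
  unfolding peval_def using assms by (intro sum.cong HOL.refl arg_cong2[where f = "(*)"] prod.cong) auto

text \<open>The first three points are not collinear, so the equations of the three sides of their
  triangle are linear coordinates on the space of \<open>x\<close>; the values of the
  \<open>E\<close> variables serve as \<open>t\<close>.\<close>

lemma solve_base_sections:
  fixes \<delta> :: "idx \<Rightarrow> 'a::field"
  assumes roots: "0 \<notin> roots (\<chi> i. \<delta> i)" and E: "\<And>i. z (E i) \<noteq> 0"
  obtains x where "\<And>l. l \<in> base_lines \<Longrightarrow> section_at \<delta> x (\<lambda>i. z (E i)) l = z l"
proof -
  define u v w where "u = \<delta> I1" and "v = \<delta> I2" and "w = \<delta> I3"
  have nz: "r \<noteq> 0" if "uroot \<delta> r" for r
    using that roots unfolding uroot_def by auto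
  have n: "u - v \<noteq> 0" "u - w \<noteq> 0" "v - w \<noteq> 0" "u + v + w \<noteq> 0"
    unfolding u_def v_def w_def by (intro nz uroot_diff uroot_sum3; simp)+
  define c where "c i j = z (F i j) * z (E i) * z (E j)" for i j
  \<comment> \<open>Subtracting two of the three linear equations removes \<open>x_3\<close>:
    \<open>A\<close> and \<open>B\<close> are the values thus forced on \<open>x2 - x1 * u\<close>
    and \<open>x2 - x1 * v\<close>.\<close>
  define A where "A = (c I1 I2 - c I1 I3) / ((v - w) * (u + v + w))"
  define B where "B = (c I1 I2 - c I2 I3) / ((u - w) * (u + v + w))"
  define x1 where "x1 = (B - A) / (u - v)"
  define x2 where "x2 = A + x1 * u"
  define x3 where "x3 = x2 * (u^2 + u * v + v^2) - x1 * (u * v * (u + v)) - c I1 I2"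
  define x :: "'a ^ 3" where "x = vector [x1, x2, x3]"
  have x: "x $ 1 = x1" "x $ 2 = x2" "x $ 3 = x3" by (simp_all add: x_def)
  have A: "A * ((v - w) * (u + v + w)) = c I1 I2 - c I1 I3" unfolding A_def using n by simp
  have B: "B * ((u - w) * (u + v + w)) = c I1 I2 - c I2 I3" unfolding B_def using n by simp
  have x1: "x1 * (u - v) = B - A" unfolding x1_def using n by simp
  have 12: "sphi \<delta> x I1 I2 = c I1 I2"
    by (simp add: sphi_def x x3_def u_def v_def)
  have "sphi \<delta> x I1 I2 - sphi \<delta> x I1 I3 = (x2 - x1 * u) * ((v - w) * (u + v + w))"
    unfolding sphi_def u_def[symmetric] v_def[symmetric] w_def[symmetric] x
    by (simp add: algebra_simps power2_eq_square)
  also have "x2 - x1 * u = A" by (simp add: x2_def)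
  finally have 13: "sphi \<delta> x I1 I3 = c I1 I3" using 12 A by simp
  have "sphi \<delta> x I1 I2 - sphi \<delta> x I2 I3 = (x2 - x1 * v) * ((u - w) * (u + v + w))"
    unfolding sphi_def u_def[symmetric] v_def[symmetric] w_def[symmetric] x
    by (simp add: algebra_simps power2_eq_square)
  also have "x2 - x1 * v = B" using x1 by (simp add: x2_def algebra_simps)
  finally have 23: "sphi \<delta> x I2 I3 = c I2 I3" using 12 B by simp
  have "section_at \<delta> x (\<lambda>i. z (E i)) l = z l" if "l \<in> base_lines" for l
    using that E unfolding base_lines_def by (auto simp: psec_simps 12 13 23 c_def field_simps)
  then show ?thesis by (rule that)
qed

text \<open>For fixed parameters the nine base coordinates of the sections fill a whole torus, by
  \<open>solve_base_sections\<close>, so the specialized polynomial vanishes on that torus.\<close>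

lemma base_poly_coeffs_vanish:
  fixes \<delta> :: "idx \<Rightarrow> 'a::field_char_0"
  assumes p: "p \<in> base_polys" and roots: "0 \<notin> roots (\<chi> i. \<delta> i)"
    and zero: "\<And>x t. (\<And>i. t i \<noteq> 0) \<Longrightarrow> eval_at \<delta> (section_at \<delta> x t) p = 0"
  shows "peval of_int \<delta> (Poly_Mapping.lookup p m) = 0"
proof -
  let ?c = "peval of_int \<delta> :: int dpoly \<Rightarrow> 'a"
  have c: "rhom ?c" by (intro rhom_peval rhom_of_int)
  have map: "peval (\<lambda>a. a) z (Poly_Mapping.map ?c p) = peval ?c z p" for z
  proof -
    have "peval (\<lambda>a. a) z (Poly_Mapping.map ?c q) = peval ?c z q" for q :: "int lpoly"
      by (induction q rule: mpoly_induct)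
         (simp_all add: pm_map_pconst[OF c] pm_map_pvar[OF c] peval_pconst peval_pvar c
           rhom_simps[OF rhom_pm_map[OF c]] rhom_simps[OF rhom_peval[OF c]] rhom_simps[OF rhom_peval[OF rhom_id]])
    then show ?thesis .
  qed
  have "Poly_Mapping.map ?c p = 0"
  proof (rule peval_eq_0_on_torus[OF rhom_id])
    show "inj (\<lambda>a::'a. a)" by simp
    fix z :: "line \<Rightarrow> 'a" assume z: "\<And>u. z u \<noteq> 0"
    obtain x where x: "\<And>l. l \<in> base_lines \<Longrightarrow> section_at \<delta> x (\<lambda>i. z (E i)) l = z l"
      using solve_base_sections[OF roots, of z] z by blast
    have "peval ?c z p = peval ?c (section_at \<delta> x (\<lambda>i. z (E i))) p"
      using p x unfolding base_polys_def occurring_lines_def by (intro peval_cong) (blast intro: sym)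
    also have "\<dots> = 0" using z by (intro zero)
    finally show "peval (\<lambda>a. a) z (Poly_Mapping.map ?c p) = 0" unfolding map .
  qed
  then have "Poly_Mapping.lookup (Poly_Mapping.map ?c p) m = 0" by simp
  then show ?thesis by (auto simp: Poly_Mapping.map.rep_eq when_def rhom_zero[OF c] split: if_splits)
qed

abbreviation generic_point :: "idx \<Rightarrow> int dpoly fract" where
  "generic_point i \<equiv> Fract (pvar i) 1"

text \<open>Presents the inclusion of R into its fraction field as evaluation at a point, so that
  the generic fibre falls under the lemmas about points.\<close>

lemma Fract_eq_peval: "Fract r 1 = peval of_int generic_point (r :: int dpoly)"
proof -
  have h: "rhom (\<lambda>a::int. Fract (pconst a :: int dpoly) 1)"
    by (intro rhom_comp[OF rhom_Fract] rhom_pconst)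
  have "Fract (peval pconst pvar r) 1 = peval (\<lambda>a. Fract (pconst a) 1) generic_point r"
    by (rule peval_comp[OF rhom_Fract])
  moreover have "Fract (pconst a :: int dpoly) 1 = of_int a" for a :: int
    using rhom_of_int'[OF h, of a] by simp
  ultimately show ?thesis by (simp add: peval_id)
qed

lemma generic_point_roots: "0 \<notin> roots (\<chi> i. generic_point i)"
proof
  assume "0 \<in> roots (\<chi> i. generic_point i)"
  moreover have "roots (\<chi> i. generic_point i) \<subseteq> (\<lambda>r. Fract r 1) ` roots (\<chi> i. pvar i)"
    by (rule roots_image) simp
  ultimately obtain r :: "int dpoly" where "r \<in> roots (\<chi> i. pvar i)" "Fract r 1 = 0" by auto
  then have "(0 :: int dpoly) \<in> roots (\<chi> i. pvar i)" by (simp add: Zero_fract_def eq_fract)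
  then show False
    using root_prod_pvar_nonzero[where 'b = int] root_prod_nonzero[of "pvar :: idx \<Rightarrow> int dpoly"] by blast
qed

section \<open>The Cox ideal\<close>

definition target_eval :: "int dpoly fract ^ 3 \<Rightarrow> (idx \<Rightarrow> int dpoly fract) \<Rightarrow> cox_target \<Rightarrow> int dpoly fract" where
  "target_eval x t = meval (peval (\<lambda>a. a) (($) x)) (\<lambda>m. \<Prod>i\<in>UNIV. t i powi Poly_Mapping.lookup m i)"

lemma rhom_target_eval:
  assumes "\<And>i. t i \<noteq> 0" shows "rhom (target_eval x t)"
  unfolding target_eval_def
  by (intro rhom_meval rhom_peval rhom_id)
     (simp_all add: lookup_add power_int_add assms prod.distrib)

lemma prod_powi_single:
  "(\<Prod>i\<in>UNIV. t (i::idx) powi Poly_Mapping.lookup (Poly_Mapping.single k n) i) = (t k :: 'a::field) powi n"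
proof -
  have "(\<Prod>i\<in>UNIV. t i powi Poly_Mapping.lookup (Poly_Mapping.single k n) i)
      = (\<Prod>i\<in>UNIV. if i = k then t k powi n else 1)"
    by (intro prod.cong) (auto simp: lookup_single when_def)
  then show ?thesis by simp
qed

lemma target_eval_single:
  "target_eval x t (Poly_Mapping.single 0 p) = peval (\<lambda>a. a) (($) x) p"
  "target_eval x t (Poly_Mapping.single (Poly_Mapping.single k n) 1) = t k powi n"
  using rhom_one[OF rhom_peval[OF rhom_id], of "($) x"]
  by (simp_all add: target_eval_def meval_single prod_powi_single)

lemma target_eval_cox_map:
  assumes t: "\<And>i. t i \<noteq> 0"
  shows "target_eval x t (cox_map f) = eval_at generic_point (section_at generic_point x t) f"
proof -
  note h = rhom_target_eval[OF t, of x]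
  have ts: "rhom target_scalar"
    unfolding target_scalar_def by (intro rhom_comp[OF rhom_single0] rhom_pconst)
  have sc: "target_eval x t (target_scalar q) = q" for q
    by (simp add: target_scalar_def target_eval_single peval_pconst)
  have "target_eval x t (cox_map f)
    = peval (\<lambda>r. Fract r 1) (\<lambda>l. target_eval x t (cox_section target_scalar (\<chi> i. Fract (pvar i) 1)
        (\<chi> k. Poly_Mapping.single 0 (pvar k))
        (\<lambda>i. Poly_Mapping.single (Poly_Mapping.single i 1) 1)
        (\<lambda>i. Poly_Mapping.single (Poly_Mapping.single i (-1)) 1) l)) f"
    unfolding cox_map_def peval_comp[OF h] sc ..
  also have "\<dots> = eval_at generic_point (section_at generic_point x t) f"
  proof (rule arg_cong2[where f = "\<lambda>c z. peval c z f"])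
    show "(\<lambda>r. Fract r 1) = (peval of_int generic_point :: int dpoly \<Rightarrow> _)"
      using Fract_eq_peval by blast
    show "(\<lambda>l. target_eval x t (cox_section target_scalar (\<chi> i. Fract (pvar i) 1)
        (\<chi> k. Poly_Mapping.single 0 (pvar k))
        (\<lambda>i. Poly_Mapping.single (Poly_Mapping.single i 1) 1)
        (\<lambda>i. Poly_Mapping.single (Poly_Mapping.single i (-1)) 1) l))
      = section_at generic_point x t"
      unfolding cox_section_eq_psec[OF ts generic_point_roots] rhom_psec[OF h]
      by (simp add: sc target_eval_single peval_pvar power_int_minus vec_lambda_eta del: single_numeral)
  qed
  finally show ?thesis .
qed

lemma power_int_two_inject:
  assumes "(2 :: 'a::field_char_0) powi m = 2 powi n" shows "m = n"
proof -
  have *: "\<not> m < n" if "(2 :: 'a) powi m = 2 powi n" for m n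
  proof
    assume "m < n"
    define k where "k = nat (n - m)"
    have "(2 :: 'a) powi n = 2 powi m * 2 powi (n - m)" by (simp flip: power_int_add)
    then have "(2 :: 'a) powi (n - m) = 1" using that by simp
    then have "of_nat (2 ^ k) = (of_nat 1 :: 'a)"
      using \<open>m < n\<close> by (simp add: k_def power_int_def)
    then have "(2::nat) ^ k = 1" by (simp only: of_nat_eq_iff)
    then show False using \<open>m < n\<close> by (simp add: k_def)
  qed
  from *[OF assms] *[OF assms[symmetric]] show ?thesis by simp
qed

lemma laurent_coeffs_zero:
  fixes a :: "(idx \<Rightarrow>\<^sub>0 int) \<Rightarrow> 'a::field_char_0"
  assumes "finite S" "\<And>t. (\<And>i. t i \<noteq> 0) \<Longrightarrow> (\<Sum>m\<in>S. a m * (\<Prod>i\<in>UNIV. t i powi Poly_Mapping.lookup m i)) = 0"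
    "m \<in> S"
  shows "a m = 0"
proof (rule independence_of_characters[where S = S and e = "\<lambda>_. 1"
      and Y = "{t. \<forall>i. t i \<noteq> 0}" and f = "\<lambda>x y i. x i * y i"
      and ch = "\<lambda>m t. \<Prod>i\<in>UNIV. t i powi Poly_Mapping.lookup m i"])
  fix m n :: "idx \<Rightarrow>\<^sub>0 int" assume "m \<noteq> n"
  then obtain k where k: "Poly_Mapping.lookup m k \<noteq> Poly_Mapping.lookup n k"
    by (metis poly_mapping_eqI)
  define y where "y = (\<lambda>i. if i = k then 2 else 1 :: 'a)"
  have "(\<Prod>i\<in>UNIV. y i powi Poly_Mapping.lookup m i) = 2 powi Poly_Mapping.lookup m k" for m
  proof -
    have "(\<Prod>i\<in>UNIV. y i powi Poly_Mapping.lookup m i) = (\<Prod>i\<in>UNIV. if i = k then 2 powi Poly_Mapping.lookup m k else 1)"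
      by (intro prod.cong) (auto simp: y_def)
    then show ?thesis by simp
  qed
  then show "\<exists>y\<in>{t. \<forall>i. t i \<noteq> (0::'a)}. (\<Prod>i\<in>UNIV. y i powi Poly_Mapping.lookup m i)
      \<noteq> (\<Prod>i\<in>UNIV. y i powi Poly_Mapping.lookup n i)"
    using k power_int_two_inject by (intro bexI[of _ y]) (auto simp: y_def)
qed (use assms in \<open>auto simp: power_int_mult_distrib prod.distrib\<close>)

text \<open>Independence of the Laurent monomials in \<open>t\<close> isolates each coefficient, and
  a polynomial in \<open>x\<close> vanishing everywhere over this infinite field is zero.\<close>

lemma cox_target_eq_0:
  fixes a :: cox_target
  assumes "\<And>x t. (\<And>i. t i \<noteq> 0) \<Longrightarrow> target_eval x t a = 0"
  shows "a = 0"
proof (rule poly_mapping_eqI)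
  fix m
  have "Poly_Mapping.lookup a m = 0"
  proof (cases "m \<in> Poly_Mapping.keys a")
    case True
    have "peval (\<lambda>a. a) (($) x) (Poly_Mapping.lookup a m) = 0" for x
      by (rule laurent_coeffs_zero[OF finite_keys[of a] _ True])
         (use assms[of _ x] in \<open>simp add: target_eval_def meval_def\<close>)
    then have "peval (\<lambda>a. a) x (Poly_Mapping.lookup a m) = 0" for x
      using vec_lambda_inverse[of x] by (metis UNIV_I)
    then show ?thesis by (intro peval_eq_0_on_torus[OF rhom_id]) auto
  qed (simp add: in_keys_iff)
  then show "Poly_Mapping.lookup a m = Poly_Mapping.lookup 0 m" by simp
qed

text \<open>Trades the kernel of \<open>cox_map\<close> for vanishing at points over the fraction
  field; later arguments use only this description.\<close>

lemma cox_ideal_iff: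
  "f \<in> cox_ideal \<longleftrightarrow> (\<forall>x t. (\<forall>i. t i \<noteq> 0) \<longrightarrow>
     eval_at generic_point (section_at generic_point x t) f = 0)"
proof
  assume "f \<in> cox_ideal"
  then have "cox_map f = 0" by (simp add: cox_ideal_def)
  show "\<forall>x t. (\<forall>i. t i \<noteq> 0) \<longrightarrow>
     eval_at generic_point (section_at generic_point x t) f = 0"
  proof (intro allI impI)
    fix x and t :: "idx \<Rightarrow> int dpoly fract" assume t: "\<forall>i. t i \<noteq> 0"
    then have "target_eval x t (cox_map f) = 0"
      using \<open>cox_map f = 0\<close> rhom_zero[OF rhom_target_eval, of t x] by simp
    then show "eval_at generic_point (section_at generic_point x t) f = 0"
      using t by (simp add: target_eval_cox_map)
  qed
next
  assume "\<forall>x t. (\<forall>i. t i \<noteq> 0) \<longrightarrow>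
     eval_at generic_point (section_at generic_point x t) f = 0"
  then have "cox_map f = 0"
    by (intro cox_target_eq_0) (simp add: target_eval_cox_map)
  then show "f \<in> cox_ideal" by (simp add: cox_ideal_def)
qed

lemma all_trinomials_cox: "ideal_generated all_trinomials \<subseteq> cox_ideal"
proof
  fix f assume "f \<in> ideal_generated all_trinomials"
  then show "f \<in> cox_ideal"
    unfolding cox_ideal_iff using eval_at_ideal_generated satisfies_trinomials_section by blast
qed

lemma eval_at_reduced:
  assumes "base_saturator ^ n * f - p \<in> ideal_generated all_trinomials" "satisfies_trinomials \<delta> z"
  shows "eval_at \<delta> z p = eval_at \<delta> z base_saturator ^ n * eval_at \<delta> z f"
  using eval_at_ideal_generated[OF assms(2,1)]
  by (simp add: rhom_simps[OF rhom_peval[OF rhom_peval[OF rhom_of_int]]])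

text \<open>The remainder \<open>p\<close> of the elimination still vanishes on all sections at the
  generic point. As it involves only independent coordinates, it is zero, and the reduction itself
  becomes the claimed membership.\<close>

theorem cox_ideal_saturation:
  assumes "f \<in> cox_ideal"
  obtains n where "base_saturator ^ n * f \<in> ideal_generated all_trinomials"
proof -
  let ?\<delta> = "generic_point"
  obtain n p where p: "p \<in> base_polys" "base_saturator ^ n * f - p \<in> ideal_generated all_trinomials"
    using reducible[of f] unfolding reducible_def by blast
  have "Poly_Mapping.lookup p m = 0" for m
  proof -
    have "peval of_int generic_point (Poly_Mapping.lookup p m) = 0"
    proof (rule base_poly_coeffs_vanish[OF p(1) generic_point_roots])
      fix x and t :: "idx \<Rightarrow> int dpoly fract" assume t: "\<And>i. t i \<noteq> (0 :: int dpoly fract)"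
      then have "eval_at ?\<delta> (section_at ?\<delta> x t) f = 0" using assms unfolding cox_ideal_iff by blast
      then show "eval_at ?\<delta> (section_at ?\<delta> x t) p = 0"
        unfolding eval_at_reduced[OF p(2) satisfies_trinomials_section[OF t]] by (rule ssubst) simp
    qed
    with Fract_eq_peval have "Fract (Poly_Mapping.lookup p m) 1 = 0" by (rule trans)
    then show ?thesis by (simp add: Zero_fract_def eq_fract)
  qed
  then have "p = 0" by (intro poly_mapping_eqI) simp
  then show ?thesis using that p(2) by simp
qed

text \<open>Passes from the generic fibre to every fibre off the root hyperplanes, over any field:
  the saturator does not vanish there and can be cancelled.\<close>

theorem cox_ideal_vanish:
  fixes \<delta> :: "idx \<Rightarrow> 'a::field"
  assumes "f \<in> cox_ideal" "0 \<notin> roots (\<chi> i. \<delta> i)" "satisfies_trinomials \<delta> z" "\<And>i. z (E i) \<noteq> 0"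
  shows "eval_at \<delta> z f = 0"
proof -
  obtain n where "base_saturator ^ n * f \<in> ideal_generated all_trinomials"
    using cox_ideal_saturation[OF assms(1)] .
  from eval_at_ideal_generated[OF assms(3) this]
  have "eval_at \<delta> z base_saturator ^ n * eval_at \<delta> z f = 0"
    by (simp add: rhom_simps[OF rhom_peval[OF rhom_peval[OF rhom_of_int]]])
  then show ?thesis using eval_at_base_saturator[of \<delta> z, OF assms(2,4)] by simp
qed

text \<open>Points off the root hyperplanes suffice over one field of characteristic 0, because
  multiplying a coefficient of the remainder by \<open>root_prod\<close> makes it vanish at every
  parameter. Taken over the rationals, this is what the descent to rational coefficients
  uses.\<close>

lemma cox_idealI:
  fixes f :: "int lpoly"
  assumes "\<And>\<delta> x t. 0 \<notin> roots (\<chi> i. (\<delta> i :: 'a::field_char_0)) \<Longrightarrow> (\<And>i. t i \<noteq> 0)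
    \<Longrightarrow> eval_at \<delta> (section_at \<delta> x t) f = 0"
  shows "f \<in> cox_ideal"
proof -
  obtain n p where p: "p \<in> base_polys" "base_saturator ^ n * f - p \<in> ideal_generated all_trinomials"
    using reducible[of f] unfolding reducible_def by blast
  have "Poly_Mapping.lookup p m = 0" for m
  proof -
    have "Poly_Mapping.lookup p m * root_prod pvar = 0"
    proof (rule peval_eq_0_on_torus[OF rhom_of_int])
      show "inj (of_int :: int \<Rightarrow> 'a)" by (rule injI) simp
      fix \<delta> :: "idx \<Rightarrow> 'a"
      note h = rhom_peval[OF rhom_of_int, of \<delta>]
      show "peval of_int \<delta> (Poly_Mapping.lookup p m * root_prod pvar) = 0"
      proof (cases "0 \<in> roots (\<chi> i. \<delta> i)")
        case True
        have "peval of_int \<delta> (root_prod pvar) = 0"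
        proof -
          have "roots (\<chi> i. \<delta> i) \<subseteq> peval of_int \<delta> ` roots (\<chi> i. pvar i)"
            using roots_image[OF h, of pvar] by (simp add: peval_pvar)
          then obtain r where "r \<in> roots (\<chi> i. pvar i)" "peval of_int \<delta> r = 0" using True by fastforce
          then show ?thesis unfolding root_prod_def rhom_prod[OF h] by (auto simp: finite_roots)
        qed
        then show ?thesis by (simp add: rhom_mult[OF h])
      next
        case False
        have "peval of_int \<delta> (Poly_Mapping.lookup p m) = 0"
        proof (rule base_poly_coeffs_vanish[OF p(1) False])
          fix x and t :: "idx \<Rightarrow> 'a" assume t: "\<And>i. t i \<noteq> 0"
          show "eval_at \<delta> (section_at \<delta> x t) p = 0"
            using eval_at_reduced[OF p(2) satisfies_trinomials_section[of t \<delta> x]] assms[OF False, of t x] t by simp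
        qed
        then show ?thesis by (simp add: rhom_mult[OF h])
      qed
    qed
    then show ?thesis using root_prod_pvar_nonzero[where 'b = int] by simp
  qed
  then have "p = 0" by (intro poly_mapping_eqI) simp
  then have *: "base_saturator ^ n * f - 0 \<in> ideal_generated all_trinomials" using p(2) by simp
  show ?thesis
    unfolding cox_ideal_iff
  proof (intro allI impI)
    fix x and t :: "idx \<Rightarrow> int dpoly fract" assume t: "\<forall>i. t i \<noteq> (0 :: int dpoly fract)"
    let ?\<delta> = "generic_point"
    let ?z = "section_at ?\<delta> x t"
    have "eval_at ?\<delta> ?z base_saturator ^ n * eval_at ?\<delta> ?z f = 0"
      using eval_at_reduced[OF *, of ?\<delta> ?z] satisfies_trinomials_section[of t ?\<delta> x] t
      by (simp add: rhom_simps[OF rhom_peval[OF rhom_peval[OF rhom_of_int]]])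
    moreover have "eval_at ?\<delta> ?z base_saturator \<noteq> 0"
      using t by (intro eval_at_base_saturator generic_point_roots) (simp add: psec_simps)
    ultimately show "eval_at ?\<delta> ?z f = 0" by simp
  qed
qed

lemma saturation_eq:
  "saturation (ideal_generated all_trinomials) saturating_element = saturation cox_ideal saturating_element"
proof
  show "saturation (ideal_generated all_trinomials) saturating_element \<subseteq> saturation cox_ideal saturating_element"
    using all_trinomials_cox unfolding saturation_def by blast
  show "saturation cox_ideal saturating_element \<subseteq> saturation (ideal_generated all_trinomials) saturating_element"
  proof
    fix f assume "f \<in> saturation cox_ideal saturating_element"
    then obtain n where "saturating_element ^ n * f \<in> cox_ideal" unfolding saturation_def by blast
    then obtain m where m: "base_saturator ^ m * (saturating_element ^ n * f) \<in> ideal_generated all_trinomials"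
      by (rule cox_ideal_saturation)
    have "base_saturator dvd saturating_element"
    proof -
      have "(\<Prod>l\<in>UNIV. pvar l) = (\<Prod>l\<in>range E. pvar l :: int lpoly) * (\<Prod>l\<in>UNIV - range E. pvar l)"
        by (subst mult.commute) (rule prod.subset_diff; simp)
      moreover have "(\<Prod>l\<in>range E. pvar l :: int lpoly) = (\<Prod>i\<in>UNIV. pvar (E i))"
        by (subst prod.reindex) (auto simp: inj_on_def)
      ultimately show ?thesis
        unfolding base_saturator_def saturating_element_def root_prod_def rhom_prod[OF rhom_pconst]
        by (simp add: dvd_def ac_simps) (metis (no_types, lifting) mult.assoc mult.commute)
    qed
    then obtain c where c: "saturating_element = base_saturator * c" by (auto simp: dvd_def)
    have "saturating_element ^ (m + n) * f = (base_saturator * c) ^ m * saturating_element ^ n * f"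
      unfolding c[symmetric] power_add ..
    also have "\<dots> = c ^ m * (base_saturator ^ m * (saturating_element ^ n * f))"
      by (simp add: power_mult_distrib ac_simps)
    finally have "saturating_element ^ (m + n) * f \<in> ideal_generated all_trinomials"
      using ideal_generated_mult[OF m, of "c ^ m"] by simp
    then show "f \<in> saturation (ideal_generated all_trinomials) saturating_element"
      unfolding saturation_def by blast
  qed
qed

section \<open>Bidegrees, points of the quotient, and vanishing ideals\<close>

section \<open>Bihomogeneous polynomials\<close>

abbreviation eval2 :: "(idx \<Rightarrow> 'a::field) \<Rightarrow> (line \<Rightarrow> 'a) \<Rightarrow> 'a lpoly \<Rightarrow> 'a" where
  "eval2 \<delta> z \<equiv> peval (peval (\<lambda>a. a) \<delta>) z"

lemma rhom_eval2: "rhom (eval2 \<delta> z)"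
  by (intro rhom_peval rhom_id)

definition dmonom_degree :: "(idx \<Rightarrow>\<^sub>0 nat) \<Rightarrow> nat" where
  "dmonom_degree u = (\<Sum>i\<in>UNIV. Poly_Mapping.lookup u i)"

text \<open>Iterated polynomials are flattened to one sum over pairs of exponents, so that
  bihomogeneous components become subsums.\<close>

definition coeff2 :: "'r::comm_ring_1 lpoly \<Rightarrow> (line \<Rightarrow>\<^sub>0 nat) \<times> (idx \<Rightarrow>\<^sub>0 nat) \<Rightarrow> 'r" where
  "coeff2 h k = Poly_Mapping.lookup (Poly_Mapping.lookup h (fst k)) (snd k)"

definition keys2 :: "'r::comm_ring_1 lpoly \<Rightarrow> ((line \<Rightarrow>\<^sub>0 nat) \<times> (idx \<Rightarrow>\<^sub>0 nat)) set" where
  "keys2 h = (SIGMA m:Poly_Mapping.keys h. Poly_Mapping.keys (Poly_Mapping.lookup h m))"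

definition bisum ::
  "((line \<Rightarrow>\<^sub>0 nat) \<times> (idx \<Rightarrow>\<^sub>0 nat)) set \<Rightarrow> ((line \<Rightarrow>\<^sub>0 nat) \<times> (idx \<Rightarrow>\<^sub>0 nat) \<Rightarrow> 'r) \<Rightarrow> 'r::comm_ring_1 lpoly" where
  "bisum S c = (\<Sum>k\<in>S. Poly_Mapping.single (fst k) (Poly_Mapping.single (snd k) (c k)))"

definition bidegree :: "(line \<Rightarrow>\<^sub>0 nat) \<times> (idx \<Rightarrow>\<^sub>0 nat) \<Rightarrow> nat \<times> (int ^ (idx option))" where
  "bidegree k = (dmonom_degree (snd k), monom_degree (fst k))"

lemma finite_keys2 [simp]: "finite (keys2 h)"
  by (simp add: keys2_def)

lemma in_keys2_iff: "k \<in> keys2 h \<longleftrightarrow> coeff2 h k \<noteq> 0"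
  by (cases k) (auto simp: keys2_def coeff2_def in_keys_iff)

lemma coeff2_add: "coeff2 (f + g) k = coeff2 f k + coeff2 g k"
  by (simp add: coeff2_def lookup_add)

lemma coeff2_sum: "coeff2 (sum f A) k = (\<Sum>x\<in>A. coeff2 (f x) k)"
  by (simp add: coeff2_def lookup_sum)

lemma coeff2_single: "coeff2 (Poly_Mapping.single m (Poly_Mapping.single u c)) k = (if k = (m, u) then c else 0)"
  by (auto simp: coeff2_def lookup_single when_def)

lemma coeff2_eqI: "(\<And>k. coeff2 f k = coeff2 g k) \<Longrightarrow> f = g"
  unfolding coeff2_def by (intro poly_mapping_eqI) (metis fst_conv snd_conv)

lemma coeff2_bisum: "finite S \<Longrightarrow> coeff2 (bisum S c) k = (if k \<in> S then c k else 0)"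
  by (simp add: bisum_def coeff2_sum coeff2_single)

lemma bisum_coeff2: "bisum (keys2 h) (coeff2 h) = h"
  by (rule coeff2_eqI) (auto simp: coeff2_bisum in_keys2_iff)

lemma peval2_bisum:
  assumes "rhom c"
  shows "peval (peval c \<delta>) z (bisum S a) = (\<Sum>k\<in>S. c (a k) * (monom_val \<delta> (snd k) * monom_val z (fst k)))"
  unfolding bisum_def rhom_sum[OF rhom_peval[OF rhom_peval[OF assms]]]
  by (simp add: peval_meval meval_single assms rhom_meval monom_val_add mult.assoc)

lemma eval2_expand:
  "eval2 \<delta> z h = (\<Sum>k\<in>keys2 h. coeff2 h k * (monom_val \<delta> (snd k) * monom_val z (fst k)))"
  using peval2_bisum[OF rhom_id, of \<delta> z "keys2 h" "coeff2 h"] by (simp add: bisum_coeff2)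

definition bihom :: "nat \<times> (int ^ (idx option)) \<Rightarrow> 'r::comm_ring_1 lpoly \<Rightarrow> bool" where
  "bihom d h \<longleftrightarrow> (\<forall>k\<in>keys2 h. bidegree k = d)"

lemma bihomogeneous_iff: "bihomogeneous h \<longleftrightarrow> (\<exists>d. bihom d h)"
proof -
  have "bihom (n, D) h \<longleftrightarrow> pic_homogeneous D h \<and>
        (\<forall>m\<in>Poly_Mapping.keys h. \<forall>u\<in>Poly_Mapping.keys (Poly_Mapping.lookup h m).
           (\<Sum>i\<in>UNIV. Poly_Mapping.lookup u i) = n)" for n D
  proof -
    have "\<exists>u. u \<in> Poly_Mapping.keys (Poly_Mapping.lookup h m)" if "m \<in> Poly_Mapping.keys h" for m
      using that by (metis ex_in_conv in_keys_iff keys_eq_empty)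
    moreover have "bihom (n, D) h \<longleftrightarrow> (\<forall>m\<in>Poly_Mapping.keys h. \<forall>u\<in>Poly_Mapping.keys (Poly_Mapping.lookup h m).
        (\<Sum>i\<in>UNIV. Poly_Mapping.lookup u i) = n \<and> monom_degree m = D)"
      by (auto simp: bihom_def keys2_def bidegree_def dmonom_degree_def)
    ultimately show ?thesis unfolding pic_homogeneous_def by metis
  qed
  then show ?thesis unfolding bihomogeneous_def by (metis surj_pair)
qed

lemma bihom_0: "bihom d 0"
  by (simp add: bihom_def keys2_def)

lemma bihom_add: "bihom d f \<Longrightarrow> bihom d g \<Longrightarrow> bihom d (f + g)"
  unfolding bihom_def
proof
  fix k assume "\<forall>k\<in>keys2 f. bidegree k = d" "\<forall>k\<in>keys2 g. bidegree k = d" "k \<in> keys2 (f + g)"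
  moreover from this have "k \<in> keys2 f \<or> k \<in> keys2 g" by (auto simp: in_keys2_iff coeff2_add)
  ultimately show "bidegree k = d" by blast
qed

lemma bihom_sum: "(\<And>x. x \<in> A \<Longrightarrow> bihom d (f x)) \<Longrightarrow> bihom d (sum f A)"
  by (induction A rule: infinite_finite_induct) (auto intro: bihom_0 bihom_add)

lemma bihom_single: "bidegree (m, u) = d \<Longrightarrow> bihom d (Poly_Mapping.single m (Poly_Mapping.single u c))"
  by (auto simp: bihom_def in_keys2_iff coeff2_single split: if_splits)

lemma bihom_bisum: "finite S \<Longrightarrow> (\<And>k. k \<in> S \<Longrightarrow> bidegree k = d) \<Longrightarrow> bihom d (bisum S c)"
  unfolding bisum_def by (intro bihom_sum bihom_single) simp

lemma monom_degree_finite: "monom_degree m = (\<Sum>l\<in>UNIV. of_nat (Poly_Mapping.lookup m l) *s pic l)"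
  unfolding monom_degree_def by (intro sum.mono_neutral_left) (auto simp: in_keys_iff)

lemma bidegree_add:
  "bidegree (m + m', u + u') = (fst (bidegree (m, u)) + fst (bidegree (m', u')), snd (bidegree (m, u)) + snd (bidegree (m', u')))"
  by (simp add: bidegree_def dmonom_degree_def monom_degree_finite lookup_add sum.distrib vec_eq_iff algebra_simps)

lemma bihom_mult:
  assumes "bihom d f" "bihom e g"
  shows "bihom (fst d + fst e, snd d + snd e) (f * g)"
proof -
  have "f * g = bisum (keys2 f) (coeff2 f) * bisum (keys2 g) (coeff2 g)" by (simp add: bisum_coeff2)
  also have "bihom (fst d + fst e, snd d + snd e) \<dots>"
    unfolding bisum_def sum_product mult_single
  proof (intro bihom_sum bihom_single)
    fix k k' assume "k \<in> keys2 f" "k' \<in> keys2 g"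
    then have "bidegree (fst k, snd k) = d" "bidegree (fst k', snd k') = e"
      using assms by (auto simp: bihom_def)
    then show "bidegree (fst k + fst k', snd k + snd k') = (fst d + fst e, snd d + snd e)"
      by (simp add: bidegree_add)
  qed
  finally show ?thesis .
qed

lemma bihomogeneous_mult:
  fixes f g :: "'r::comm_ring_1 lpoly"
  shows "bihomogeneous f \<Longrightarrow> bihomogeneous g \<Longrightarrow> bihomogeneous (f * g)"
  unfolding bihomogeneous_iff by (elim exE) (rule exI, rule bihom_mult)

lemma bihom_pvar: "bihom (0, pic l) (pvar l)"
proof -
  have "bidegree (Poly_Mapping.single l 1, 0) = (0, pic l)"
  proof -
    have "(\<Sum>m\<in>UNIV. of_nat (Poly_Mapping.lookup (Poly_Mapping.single l (1::nat)) m) *s pic m)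
        = (\<Sum>m\<in>UNIV. if m = l then pic l else 0)"
      by (intro sum.cong) (auto simp: lookup_single when_def vec_eq_iff)
    then show ?thesis by (simp add: bidegree_def dmonom_degree_def monom_degree_finite)
  qed
  from bihom_single[OF this, of 1] show ?thesis by (simp add: pvar_def)
qed

lemma bihom_pconst_pvar: "bihom (1, 0) (pconst (pvar i))"
proof -
  have "bidegree (0, Poly_Mapping.single i 1) = (1, 0)"
  proof -
    have "(\<Sum>j\<in>UNIV. Poly_Mapping.lookup (Poly_Mapping.single i (1::nat)) j) = (\<Sum>j\<in>UNIV. if j = i then 1 else 0)"
      by (intro sum.cong) (auto simp: lookup_single when_def)
    then show ?thesis by (simp add: bidegree_def dmonom_degree_def monom_degree_def)
  qed
  from bihom_single[OF this, of 1] show ?thesis by (simp add: pvar_def pconst_def)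
qed

lemma bihom_const: "bihom (0, 0) (pconst (pconst a))"
proof -
  have "bidegree (0, 0) = (0, 0)" by (simp add: bidegree_def dmonom_degree_def monom_degree_def)
  from bihom_single[OF this, of a] show ?thesis by (simp add: pconst_def)
qed

definition torus_char :: "(idx option \<Rightarrow> 'a::field) \<Rightarrow> int ^ (idx option) \<Rightarrow> 'a" where
  "torus_char s D = (\<Prod>k\<in>UNIV. s k powi (D $ k))"

lemma torus_char_0: "torus_char s 0 = 1"
  by (simp add: torus_char_def)

lemma torus_char_add: "(\<And>k. s k \<noteq> 0) \<Longrightarrow> torus_char s (D + D') = torus_char s D * torus_char s D'"
  by (simp add: torus_char_def power_int_add prod.distrib)

lemma power_int_of_power: "(x ^ n) powi k = (x powi k) ^ n" for x :: "'a::field"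
  by (induction n) (simp_all add: power_int_mult_distrib)

lemma torus_char_scale: "torus_char s (of_nat n *s D) = torus_char s D ^ n"
  unfolding torus_char_def prod_power_distrib
  by (intro prod.cong HOL.refl) (simp add: power_int_mult power_int_of_power)

lemma torus_char_sum: "(\<And>k. s k \<noteq> 0) \<Longrightarrow> torus_char s (sum f A) = (\<Prod>x\<in>A. torus_char s (f x))"
  by (induction A rule: infinite_finite_induct) (simp_all add: torus_char_0 torus_char_add)

lemma torus_char_nonzero: "(\<And>k. s k \<noteq> 0) \<Longrightarrow> torus_char s D \<noteq> 0"
  by (simp add: torus_char_def)

lemma torus_char_mult: "torus_char (\<lambda>k. s k * t k) D = torus_char s D * torus_char t D"
  by (simp add: torus_char_def power_int_mult_distrib prod.distrib)

lemma monom_val_torus: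
  assumes "\<And>k. s k \<noteq> 0"
  shows "monom_val (\<lambda>l. torus_char s (pic l) * z l) m = torus_char s (monom_degree m) * monom_val z m"
  unfolding monom_val_mult monom_degree_finite torus_char_sum[OF assms] torus_char_scale
  by (simp add: monom_val_finite)

lemma monom_val_scale: "monom_val (\<lambda>i. c * \<delta> i) u = c ^ dmonom_degree u * monom_val \<delta> u"
  by (simp add: monom_val_finite dmonom_degree_def power_mult_distrib prod.distrib power_sum)

lemma eval2_torus_expand:
  assumes "\<And>k. s k \<noteq> 0"
  shows "eval2 (\<lambda>i. c * \<delta> i) (\<lambda>l. torus_char s (pic l) * z l) h
    = (\<Sum>k\<in>keys2 h. coeff2 h k * (monom_val \<delta> (snd k) * monom_val z (fst k))
        * (c ^ fst (bidegree k) * torus_char s (snd (bidegree k))))"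
  unfolding eval2_expand monom_val_torus[OF assms] monom_val_scale bidegree_def by (simp add: ac_simps)

lemma eval2_bihom_torus:
  assumes "bihom d h" "\<And>k. s k \<noteq> 0"
  shows "eval2 (\<lambda>i. c * \<delta> i) (\<lambda>l. torus_char s (pic l) * z l) h
    = c ^ fst d * torus_char s (snd d) * eval2 \<delta> z h"
  unfolding eval2_torus_expand[OF assms(2)] eval2_expand[of \<delta> z] sum_distrib_left
  using assms(1) by (intro sum.cong) (auto simp: bihom_def)

section \<open>Points of the ambient space\<close>

lemma proj_class_self: "x \<in> proj_class x"
  unfolding proj_class_def by (rule CollectI, rule exI[of _ 1]) simp

lemma proj_class_scale: "c \<noteq> 0 \<Longrightarrow> proj_class (c *s x) = proj_class x"
proof (intro equalityI subsetI)
  assume c: "c \<noteq> 0"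
  show "y \<in> proj_class x" if "y \<in> proj_class (c *s x)" for y
    using that c unfolding proj_class_def by (auto simp: vector_smult_assoc)
  show "y \<in> proj_class (c *s x)" if "y \<in> proj_class x" for y
  proof -
    obtain a where "a \<noteq> 0" "y = a *s x" using \<open>y \<in> proj_class x\<close> unfolding proj_class_def by blast
    then have "a / c \<noteq> 0" "y = (a / c) *s (c *s x)" using c by (simp_all add: vector_smult_assoc)
    then show ?thesis unfolding proj_class_def by blast
  qed
qed

lemma proj_class_eq: "proj_class x = proj_class y \<Longrightarrow> \<exists>c. c \<noteq> 0 \<and> y = c *s x"
  using proj_class_self[of y] unfolding proj_class_def by blast

lemma torus_orbit_alt: "torus_orbit z = {\<lambda>l. torus_char s (pic l) * z l | s. \<forall>k. s k \<noteq> 0}"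
  by (simp add: torus_orbit_def torus_char_def)

lemma torus_orbit_self: "z \<in> torus_orbit z"
  unfolding torus_orbit_alt
  by (rule CollectI, rule exI[of _ "\<lambda>_. 1"]) (simp add: torus_char_def)

lemma torus_orbit_scale:
  assumes "\<And>k. s k \<noteq> 0"
  shows "torus_orbit (\<lambda>l. torus_char s (pic l) * z l) = torus_orbit z"
proof (intro equalityI subsetI)
  fix y assume "y \<in> torus_orbit (\<lambda>l. torus_char s (pic l) * z l)"
  then obtain r where "\<forall>k. r k \<noteq> 0" "y = (\<lambda>l. torus_char r (pic l) * (torus_char s (pic l) * z l))"
    unfolding torus_orbit_alt by blast
  then have "\<forall>k. r k * s k \<noteq> 0" "y = (\<lambda>l. torus_char (\<lambda>k. r k * s k) (pic l) * z l)"
    using assms by (simp_all add: torus_char_mult mult.assoc)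
  then show "y \<in> torus_orbit z"
    unfolding torus_orbit_alt by (intro CollectI exI[of _ "\<lambda>k. r k * s k"]) simp
next
  fix y assume "y \<in> torus_orbit z"
  then obtain r where r: "\<forall>k. r k \<noteq> 0" "y = (\<lambda>l. torus_char r (pic l) * z l)"
    unfolding torus_orbit_alt by blast
  have *: "torus_char (\<lambda>k. r k / s k) (pic l) * (torus_char s (pic l) * z l) = torus_char r (pic l) * z l" for l
  proof -
    have "torus_char (\<lambda>k. r k / s k) (pic l) * torus_char s (pic l) = torus_char r (pic l)"
      using assms by (simp flip: torus_char_mult)
    then show ?thesis by (simp flip: mult.assoc)
  qed
  then show "y \<in> torus_orbit (\<lambda>l. torus_char s (pic l) * z l)"
    unfolding torus_orbit_alt
  proof (intro CollectI exI[of _ "\<lambda>k. r k / s k"] conjI)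
    show "y = (\<lambda>l. torus_char (\<lambda>k. r k / s k) (pic l) * (torus_char s (pic l) * z l))"
      unfolding r(2) using * by (intro ext) (rule sym)
  qed (use r assms in simp)
qed

lemma torus_orbit_eq:
  "torus_orbit z = torus_orbit y \<Longrightarrow> \<exists>s. (\<forall>k. s k \<noteq> 0) \<and> y = (\<lambda>l. torus_char s (pic l) * z l)"
  using torus_orbit_self[of y] unfolding torus_orbit_alt by blast

definition pt :: "(idx \<Rightarrow> 'a::field) \<Rightarrow> (line \<Rightarrow> 'a) \<Rightarrow> 'a ambient_point" where
  "pt \<delta> z = (proj_class (\<chi> i. \<delta> i), torus_orbit z)"

definition proper :: "(idx \<Rightarrow> 'a::field) \<Rightarrow> (line \<Rightarrow> 'a) \<Rightarrow> bool" where
  "proper \<delta> z \<longleftrightarrow> \<delta> \<noteq> (\<lambda>_. 0) \<and> (\<forall>l. z l \<noteq> 0)"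

lemma variety_pt:
  fixes c :: "'c::comm_ring_1 \<Rightarrow> 'a::field"
  shows "variety c P = {pt \<delta> z | \<delta> z. proper \<delta> z \<and> (\<forall>f\<in>P. peval (peval c \<delta>) z f = 0)}" (is "_ = ?R")
proof -
  have *: "(\<chi> i. \<delta> i) \<noteq> 0 \<longleftrightarrow> \<delta> \<noteq> (\<lambda>_. 0)" for \<delta> :: "idx \<Rightarrow> 'a"
    by (simp add: vec_eq_iff fun_eq_iff)
  show ?thesis
  proof (intro equalityI subsetI)
    fix p assume "p \<in> variety c P"
    then obtain \<delta> z where "p = (proj_class \<delta>, torus_orbit z)" "\<delta> \<noteq> 0" "\<forall>l. z l \<noteq> 0"
      "\<forall>f\<in>P. peval (peval c (($) \<delta>)) z f = 0"
      unfolding variety_def by blast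
    then have "p = pt (($) \<delta>) z" "proper (($) \<delta>) z" "\<forall>f\<in>P. peval (peval c (($) \<delta>)) z f = 0"
      using *[of "($) \<delta>"] by (simp_all add: pt_def proper_def vec_lambda_eta)
    then show "p \<in> ?R" by blast
  next
    fix p assume "p \<in> ?R"
    then obtain \<delta> z where "p = pt \<delta> z" "proper \<delta> z" "\<forall>f\<in>P. peval (peval c \<delta>) z f = 0"
      by blast
    then show "p \<in> variety c P"
      unfolding variety_def pt_def proper_def *[symmetric]
      by (intro CollectI exI[of _ "\<chi> i. \<delta> i"] exI[of _ z]) (simp add: vec_lambda_inverse)
  qed
qed

lemma pt_scale: "c \<noteq> 0 \<Longrightarrow> (\<And>k. s k \<noteq> 0) \<Longrightarrow> pt (\<lambda>i. c * \<delta> i) (\<lambda>l. torus_char s (pic l) * z l) = pt \<delta> z"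
  using proj_class_scale[of c "\<chi> i. \<delta> i"] torus_orbit_scale[of s z]
  by (simp add: pt_def vector_scalar_mult_def)

lemma pt_eq:
  assumes "pt \<delta> z = pt \<delta>' z'"
  obtains c s where "c \<noteq> 0" "\<And>k. s k \<noteq> 0" "\<delta>' = (\<lambda>i. c * \<delta> i)" "z' = (\<lambda>l. torus_char s (pic l) * z l)"
proof -
  have "proj_class (\<chi> i. \<delta> i) = proj_class (\<chi> i. \<delta>' i)" and orb: "torus_orbit z = torus_orbit z'"
    using assms by (simp_all add: pt_def)
  then obtain c where c: "c \<noteq> 0" "(\<chi> i. \<delta>' i) = c *s (\<chi> i. \<delta> i)"
    using proj_class_eq by blast
  obtain s where s: "\<forall>k. s k \<noteq> 0" "z' = (\<lambda>l. torus_char s (pic l) * z l)"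
    using torus_orbit_eq[OF orb] by blast
  have "\<delta>' = (\<lambda>i. c * \<delta> i)" using c(2) by (simp add: vec_eq_iff fun_eq_iff)
  then show ?thesis using that c s by blast
qed

lemma eval2_pt_invariant:
  assumes "bihomogeneous h" "pt \<delta> z = pt \<delta>' z'"
  shows "eval2 \<delta>' z' h = 0 \<longleftrightarrow> eval2 \<delta> z h = 0"
proof -
  obtain d where "bihom d h" using assms(1) bihomogeneous_iff by blast
  moreover obtain c s where "c \<noteq> 0" "\<And>k. s k \<noteq> 0" "\<delta>' = (\<lambda>i. c * \<delta> i)" "z' = (\<lambda>l. torus_char s (pic l) * z l)"
    using pt_eq[OF assms(2)] by metis
  ultimately show ?thesis by (simp add: eval2_bihom_torus torus_char_nonzero)
qed

lemma pt_in_variety: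
  assumes "\<forall>f\<in>P. bihomogeneous f" "proper \<delta> z"
  shows "pt \<delta> z \<in> variety (\<lambda>a. a) P \<longleftrightarrow> (\<forall>f\<in>P. eval2 \<delta> z f = 0)"
  unfolding variety_pt using eval2_pt_invariant assms by blast

section \<open>The variety of the Cox ideal\<close>

text \<open>The vanishing ideal over the field itself. It is needed next to \<open>cox_ideal\<close>
  because \<open>zariski_closed\<close> speaks of polynomials over the field, while the Cox ideal
  has integer coefficients.\<close>

definition section_ideal :: "'a::field_char_0 lpoly set" where
  "section_ideal = {h. \<forall>\<delta> x t. 0 \<notin> roots (\<chi> i. \<delta> i) \<longrightarrow> (\<forall>i. t i \<noteq> 0) \<longrightarrow> eval2 \<delta> (section_at \<delta> x t) h = 0}"

lemma section_idealD:
  "h \<in> section_ideal \<Longrightarrow> 0 \<notin> roots (\<chi> i. \<delta> i) \<Longrightarrow> (\<And>i. t i \<noteq> 0) \<Longrightarrow> eval2 \<delta> (section_at \<delta> x t) h = 0"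
  by (simp add: section_ideal_def)

lemma eval2_map_of_int:
  "eval2 \<delta> z (Poly_Mapping.map (Poly_Mapping.map of_int) f) = eval_at \<delta> z f"
proof -
  note h = rhom_pm_map[OF rhom_of_int] rhom_pm_map[OF rhom_pm_map[OF rhom_of_int]]
  note e = rhom_peval[OF rhom_peval[OF rhom_id]] rhom_peval[OF rhom_peval[OF rhom_of_int]]
  have const: "eval2 \<delta> z (Poly_Mapping.map (Poly_Mapping.map of_int) (pconst a)) = eval_at \<delta> z (pconst a)" for a
  proof -
    have "peval (\<lambda>a. a) \<delta> (Poly_Mapping.map of_int a) = peval of_int \<delta> a"
      by (induction a rule: mpoly_induct)
         (simp_all add: pm_map_pconst pm_map_pvar peval_pconst peval_pvar
           rhom_add[OF h(1)] rhom_mult[OF h(1)] rhom_add[OF rhom_peval] rhom_mult[OF rhom_peval])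
    then show ?thesis by (simp add: pm_map_pconst[OF h(1)] peval_pconst)
  qed
  show ?thesis
    by (induction f rule: mpoly_induct)
       (simp_all add: const pm_map_pvar[OF h(1)] peval_pvar
         rhom_add[OF h(2)] rhom_mult[OF h(2)] rhom_add[OF e(1)] rhom_mult[OF e(1)] rhom_add[OF e(2)] rhom_mult[OF e(2)])
qed

lemma map_cox_ideal_section_ideal:
  assumes "f \<in> cox_ideal"
  shows "Poly_Mapping.map (Poly_Mapping.map of_int) f \<in> (section_ideal :: 'a::field_char_0 lpoly set)"
  unfolding section_ideal_def
proof (intro CollectI allI impI)
  fix \<delta> :: "idx \<Rightarrow> 'a" and x and t :: "idx \<Rightarrow> 'a"
  assume "0 \<notin> roots (\<chi> i. \<delta> i)" "\<forall>i. t i \<noteq> 0"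
  then show "eval2 \<delta> (section_at \<delta> x t) (Poly_Mapping.map (Poly_Mapping.map of_int) f) = 0"
    unfolding eval2_map_of_int
    by (intro cox_ideal_vanish[OF assms] satisfies_trinomials_section) (simp_all add: psec_simps)
qed

lemma common_denominator:
  assumes "finite (A :: rat set)"
  shows "\<exists>N::int. N \<noteq> 0 \<and> (\<forall>a\<in>A. \<exists>n::int. of_int N * a = of_int n)"
  using assms
proof (induction A rule: finite_induct)
  case empty
  show ?case by (intro exI[of _ 1]) auto
next
  case (insert a A)
  then obtain N where N: "N \<noteq> 0" "\<forall>a\<in>A. \<exists>n::int. of_int N * a = of_int n" by blast
  obtain p q where "quotient_of a = (p, q)" by fastforce
  then have pq: "a = of_int p / of_int q" "q > 0"
    by (simp_all add: quotient_of_div quotient_of_denom_pos)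
  have "\<exists>n::int. of_int (N * q) * b = of_int n" if b: "b \<in> A" for b
  proof -
    obtain n :: int where n: "of_int N * b = of_int n" using N(2) b by blast
    have "of_int (N * q) * b = of_int q * (of_int N * b)"
      by (simp add: algebra_simps)
    also have "\<dots> = of_int (q * n)" unfolding n by (simp only: of_int_mult)
    finally have "of_int (N * q) * b = of_int (q * n)" .
    then show ?thesis by blast
  qed
  moreover have "of_int (N * q) * a = of_int (N * p)" using pq by simp
  ultimately have "\<forall>b\<in>insert a A. \<exists>n::int. of_int (N * q) * b = of_int n" by blast
  moreover have "N * q \<noteq> 0" using N(1) pq(2) by simp
  ultimately show ?case by blast
qed

text \<open>Coordinates with respect to a basis of the field as a rational vector space; finitely
  many elements involve finitely many basis vectors.\<close>

lemma rational_coordinates: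
  fixes C :: "'a::field_char_0 set"
  assumes "finite C"
  obtains B :: "'a set" and \<pi> :: "'a \<Rightarrow> 'a \<Rightarrow> rat" where "finite B"
    "\<And>b x y. \<pi> b (x + y) = \<pi> b x + \<pi> b y" "\<And>b q x. \<pi> b (of_rat q * x) = q * \<pi> b x"
    "\<And>c. c \<in> C \<Longrightarrow> c = (\<Sum>b\<in>B. of_rat (\<pi> b c) * b)"
proof -
  define scale :: "rat \<Rightarrow> 'a \<Rightarrow> 'a" where "scale = (\<lambda>q x. of_rat q * x)"
  interpret vs: vector_space scale
    by unfold_locales (simp_all add: scale_def algebra_simps of_rat_add of_rat_mult)
  define H where "H = vs.extend_basis {}"
  have H: "vs.independent H" "vs.span H = UNIV"
    unfolding H_def using vs.independent_extend_basis vs.span_extend_basis vs.independent_empty by blast+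
  define \<pi> where "\<pi> b x = vs.representation H x b" for b x
  define B where "B = (\<Union>c\<in>C. {b. \<pi> b c \<noteq> 0})"
  have fin: "finite {b. \<pi> b c \<noteq> 0}" for c
    unfolding \<pi>_def by (rule vs.finite_representation)
  show ?thesis
  proof (rule that[of B \<pi>])
    show "finite B" unfolding B_def using assms fin by blast
    show "\<pi> b (x + y) = \<pi> b x + \<pi> b y" for b x y
      unfolding \<pi>_def using H by (simp add: vs.representation_add)
    show "\<pi> b (of_rat q * x) = q * \<pi> b x" for b q x
      unfolding \<pi>_def using H vs.representation_scale[of H x q] by (simp add: scale_def)
    show "c = (\<Sum>b\<in>B. of_rat (\<pi> b c) * b)" if "c \<in> C" for c
    proof -
      have "c = (\<Sum>b | vs.representation H c b \<noteq> 0. scale (vs.representation H c b) b)"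
        using vs.sum_nonzero_representation_eq[of H c] H by simp
      also have "\<dots> = (\<Sum>b\<in>B. of_rat (\<pi> b c) * b)"
        unfolding \<pi>_def[symmetric] unfolding scale_def using that \<open>finite B\<close>
        by (intro sum.mono_neutral_left) (auto simp: B_def)
      finally show ?thesis .
    qed
  qed
qed

text \<open>
  The Cox ideal is defined over the rationals: applying a rational functional to the coefficients of
  a polynomial that vanishes on all sections gives one that vanishes on all rational sections.
\<close>

lemma section_ideal_vanish:
  fixes \<delta> :: "idx \<Rightarrow> 'a::field_char_0"
  assumes h: "h \<in> section_ideal" and cox: "\<And>f. f \<in> cox_ideal \<Longrightarrow> eval_at \<delta> z f = 0"
  shows "eval2 \<delta> z h = 0"
proof -
  obtain B :: "'a set" and \<pi> :: "'a \<Rightarrow> 'a \<Rightarrow> rat" where B: "finite B"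
    and add: "\<And>b x y. \<pi> b (x + y) = \<pi> b x + \<pi> b y" and scale: "\<And>b q x. \<pi> b (of_rat q * x) = q * \<pi> b x"
    and expand: "\<And>c. c \<in> coeff2 h ` keys2 h \<Longrightarrow> c = (\<Sum>b\<in>B. of_rat (\<pi> b c) * b)"
    by (rule rational_coordinates[OF finite_imageI[OF finite_keys2[of h], of "coeff2 h"]]) blast
  have zero: "\<pi> b 0 = 0" for b using add[of b 0 0] by simp
  have \<pi>_sum: "\<pi> b (sum g A) = (\<Sum>x\<in>A. \<pi> b (g x))" for b A and g :: "(line \<Rightarrow>\<^sub>0 nat) \<times> (idx \<Rightarrow>\<^sub>0 nat) \<Rightarrow> 'a"
    by (induction A rule: infinite_finite_induct) (simp_all add: zero add)
  let ?M = "\<lambda>k. monom_val \<delta> (snd k) * monom_val z (fst k)"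
  have comp: "(\<Sum>k\<in>keys2 h. of_rat (\<pi> b (coeff2 h k)) * ?M k) = 0" for b
  proof -
    have "finite ((\<lambda>k. \<pi> b (coeff2 h k)) ` keys2 h)" by simp
    from common_denominator[OF this] obtain N :: int
      where N: "N \<noteq> 0" "\<forall>k\<in>keys2 h. \<exists>n::int. of_int N * \<pi> b (coeff2 h k) = of_int n" by auto
    then obtain n :: "_ \<Rightarrow> int" where n: "\<And>k. k \<in> keys2 h \<Longrightarrow> of_int N * \<pi> b (coeff2 h k) = of_int (n k)"
      by metis
    \<comment> \<open>The \<open>b\<close>-th rational coordinate of \<open>h\<close> with
      denominators cleared. Sections at rational points have rational values, so the functional
      \<open>\<pi> b\<close> can be pulled through the evaluation.\<close>
    define f where "f = bisum (keys2 h) n"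
    have "f \<in> cox_ideal"
    proof (rule cox_idealI)
      fix \<epsilon> :: "idx \<Rightarrow> rat" and x and t :: "idx \<Rightarrow> rat"
      assume roots: "0 \<notin> roots (\<chi> i. \<epsilon> i)" and t: "\<And>i. t i \<noteq> (0::rat)"
      let ?y = "section_at \<epsilon> x t"
      have "0 \<notin> roots (\<chi> i. (of_rat (\<epsilon> i) :: 'a))"
        using roots_image[OF rhom_of_rat[where 'a = 'a], of \<epsilon>] roots by auto
      then have "eval2 (\<lambda>i. of_rat (\<epsilon> i)) (section_at (\<lambda>i. of_rat (\<epsilon> i)) (\<chi> k. of_rat (x $ k)) (\<lambda>i. of_rat (t i))) h = (0 :: 'a)"
        using h t unfolding section_ideal_def by simp
      also have "section_at (\<lambda>i. of_rat (\<epsilon> i)) (\<chi> k. of_rat (x $ k)) (\<lambda>i. of_rat (t i)) = (\<lambda>l. of_rat (?y l) :: 'a)"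
        by (rule ext) (simp add: rhom_psec[OF rhom_of_rat] of_rat_inverse)
      finally have "(\<Sum>k\<in>keys2 h. of_rat (monom_val \<epsilon> (snd k) * monom_val ?y (fst k)) * coeff2 h k) = (0 :: 'a)"
        unfolding eval2_expand monom_val_def
        by (simp add: of_rat_mult of_rat_prod of_rat_power mult.commute)
      then have "\<pi> b (\<Sum>k\<in>keys2 h. of_rat (monom_val \<epsilon> (snd k) * monom_val ?y (fst k)) * coeff2 h k) = 0"
        using zero by simp
      then have 0: "(\<Sum>k\<in>keys2 h. monom_val \<epsilon> (snd k) * monom_val ?y (fst k) * \<pi> b (coeff2 h k)) = 0"
        unfolding \<pi>_sum scale .
      have "eval_at \<epsilon> ?y f = (\<Sum>k\<in>keys2 h. (of_int N * \<pi> b (coeff2 h k)) * (monom_val \<epsilon> (snd k) * monom_val ?y (fst k)))"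
        unfolding f_def peval2_bisum[OF rhom_of_int] by (intro sum.cong) (simp_all add: n)
      also have "\<dots> = of_int N * (\<Sum>k\<in>keys2 h. monom_val \<epsilon> (snd k) * monom_val ?y (fst k) * \<pi> b (coeff2 h k))"
        unfolding sum_distrib_left by (intro sum.cong) (simp_all add: ac_simps)
      finally show "eval_at \<epsilon> ?y f = 0" using 0 by simp
    qed
    from cox[OF this] have "(\<Sum>k\<in>keys2 h. of_int (n k) * ?M k) = 0"
      unfolding f_def peval2_bisum[OF rhom_of_int] .
    moreover have "of_int (n k) = of_int N * (of_rat (\<pi> b (coeff2 h k)) :: 'a)" if "k \<in> keys2 h" for k
      using n[OF that] by (metis of_rat_mult of_rat_of_int_eq)
    ultimately have "of_int N * (\<Sum>k\<in>keys2 h. of_rat (\<pi> b (coeff2 h k)) * ?M k) = 0"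
      unfolding sum_distrib_left by (simp add: mult.assoc)
    then show ?thesis using N(1) by simp
  qed
  have "eval2 \<delta> z h = (\<Sum>k\<in>keys2 h. (\<Sum>b\<in>B. of_rat (\<pi> b (coeff2 h k)) * b) * ?M k)"
    unfolding eval2_expand by (intro sum.cong arg_cong2[where f = "(*)"] HOL.refl expand) auto
  also have "\<dots> = (\<Sum>b\<in>B. b * (\<Sum>k\<in>keys2 h. of_rat (\<pi> b (coeff2 h k)) * ?M k))"
    unfolding sum_distrib_right sum_distrib_left
    by (subst sum.swap) (simp add: ac_simps)
  also have "\<dots> = 0" by (simp add: comp)
  finally show ?thesis .
qed

lemma roots_scale:
  assumes "c \<noteq> (0::'a::field)" shows "0 \<in> roots (\<chi> i. c * \<delta> i) \<longleftrightarrow> 0 \<in> roots (\<chi> i. \<delta> i)"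
proof -
  have "c * a - c * b = 0 \<longleftrightarrow> a - b = 0" "c * a + c * b + c * d = 0 \<longleftrightarrow> a + b + d = 0" for a b d
    using assms by (metis right_diff_distrib mult_eq_0_iff, metis distrib_left mult_eq_0_iff)
  moreover have "(\<Sum>i\<in>UNIV. c * \<delta> i) = 0 \<longleftrightarrow> (\<Sum>i\<in>UNIV. \<delta> i) = 0"
    using assms by (simp flip: sum_distrib_left)
  ultimately show ?thesis unfolding roots_def by (auto simp: eq_commute[of 0])
qed

text \<open>Sections are permuted by the scalings of the parameters and by the Picard torus. This
  symmetry is the source of bihomogeneity of the vanishing ideal and of the normalization
  \<open>t = 1\<close>.\<close>

lemma psec_scale:
  fixes \<delta> :: "idx \<Rightarrow> 'a::field"
  assumes c: "c \<noteq> 0" and s: "\<And>k. s k \<noteq> 0" and t: "\<And>i. t i \<noteq> 0"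
  obtains x' where "(\<lambda>l. torus_char s (pic l) * section_at \<delta> x t l)
    = section_at (\<lambda>i. c * \<delta> i) x' (\<lambda>i. s (Some i) * t i)"
proof -
  define a where "a = s None"
  have a: "a \<noteq> 0" using s by (simp add: a_def)
  \<comment> \<open>In \<open>sphi\<close> the coordinates \<open>x_1\<close>, \<open>x_2\<close>,
    \<open>x_3\<close> carry parameter degrees 3, 2, 0, which these powers of \<open>c\<close>
    compensate. The factor \<open>a\<close> is the torus coordinate of the hyperplane class.\<close>
  define x' :: "'a ^ 3" where "x' = vector [a * x $ 1 / c ^ 3, a * x $ 2 / c ^ 2, a * x $ 3]"
  have x': "x' $ 1 = a * x $ 1 / c ^ 3" "x' $ 2 = a * x $ 2 / c ^ 2" "x' $ 3 = a * x $ 3"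
    by (simp_all add: x'_def)
  have ch: "torus_char s (pic l) = a powi (pic l $ None) * (\<Prod>i\<in>UNIV. s (Some i) powi (pic l $ Some i))" for l
    unfolding torus_char_def UNIV_option by (subst prod.insert) (auto simp: prod.reindex a_def)
  have es: "esym S k (\<lambda>i. c * \<delta> i) = c ^ k * esym S k \<delta>" for S k
  proof -
    have "finite S" by simp
    then show ?thesis
    proof (induction S arbitrary: k rule: finite_induct)
      case (insert i S)
      then show ?case by (cases k) (simp_all add: esym_insert algebra_simps)
    qed (simp add: esym_empty of_bool_def)
  qed
  have sphi: "sphi (\<lambda>i. c * \<delta> i) x' i j = a * sphi \<delta> x i j" for i j
    using c by (simp add: sphi_def x' field_simps power2_eq_square power3_eq_cube)
  have sconic: "sconic (\<lambda>i. c * \<delta> i) x' j = a ^ 2 * sconic \<delta> x j" for j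
    using c by (simp add: sconic_def Let_def conic_poly_def x' es field_simps eval_nat_numeral)
  have tE: "torus_char s (pic (E i)) = s (Some i)" for i
    by (simp add: ch pic_nth of_bool_def if_distrib[of "\<lambda>x. _ powi x"] cong: if_cong)
  have "torus_char s (pic l) * section_at \<delta> x t l = section_at (\<lambda>i. c * \<delta> i) x' (\<lambda>i. s (Some i) * t i) l" for l
  proof (cases l rule: line_cases)
    case (E i)
    then show ?thesis by (simp add: psec_simps tE)
  next
    case (F i j)
    then have "pic l = axis None 1 - pic (E i) - pic (E j)" by (simp add: pic_F pic_E)
    then have "pic l + pic (E i) + pic (E j) = axis None 1" by simp
    then have "torus_char s (pic l) * s (Some i) * s (Some j) = torus_char s (axis None 1)"
      using torus_char_add[of s, OF s, of "pic l + pic (E i)" "pic (E j)"] torus_char_add[of s, OF s, of "pic l" "pic (E i)"]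
      by (simp add: tE)
    also have "\<dots> = a"
      by (simp add: torus_char_def axis_def a_def if_distrib[of "\<lambda>x. _ powi x"] cong: if_cong)
    finally have "torus_char s (pic l) = a / (s (Some i) * s (Some j))" using s by (simp add: field_simps)
    then have "torus_char s (pic (F i j)) = a / (s (Some i) * s (Some j))" unfolding F(2) .
    then show ?thesis using F s t by (simp add: psec_simps sphi divide_inverse)
  next
    case (G j)
    then have "pic l + (\<Sum>i\<in>UNIV - {j}. pic (E i)) = axis None 2" by (simp add: pic_G pic_E)
    then have "torus_char s (pic l) * (\<Prod>i\<in>UNIV - {j}. s (Some i)) = torus_char s (axis None 2)"
      using torus_char_add[of s, OF s, of "pic l" "\<Sum>i\<in>UNIV - {j}. pic (E i)"]
      by (simp add: torus_char_sum[of s, OF s] tE)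
    also have "\<dots> = a ^ 2"
      by (simp add: torus_char_def axis_def a_def if_distrib[of "\<lambda>x. _ powi x"] cong: if_cong)
    finally have "torus_char s (pic l) * (\<Prod>i\<in>UNIV - {j}. s (Some i)) = a ^ 2" .
    moreover have "(\<Prod>i\<in>UNIV - {j}. s (Some i)) * (\<Prod>i\<in>UNIV - {j}. inverse (s (Some i))) = 1"
      using s by (simp flip: prod.distrib)
    ultimately have "torus_char s (pic l) * 1 = a ^ 2 * (\<Prod>i\<in>UNIV - {j}. inverse (s (Some i)))"
      by (simp only: mult.assoc flip: \<open>(\<Prod>i\<in>UNIV - {j}. s (Some i)) * (\<Prod>i\<in>UNIV - {j}. inverse (s (Some i))) = 1\<close>
        \<open>torus_char s (pic l) * (\<Prod>i\<in>UNIV - {j}. s (Some i)) = a ^ 2\<close>)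
    then have "torus_char s (pic l) = a ^ 2 * (\<Prod>i\<in>UNIV - {j}. inverse (s (Some i)))" by simp
    then show ?thesis using G by (simp add: psec_simps sconic prod.distrib)
  qed
  then show ?thesis using that by blast
qed

text \<open>On the orbit of a section under scalings and torus, each component is multiplied by its
  own character, and independence of characters separates them.\<close>

lemma section_ideal_component:
  fixes h :: "'a::field_char_0 lpoly"
  assumes h: "h \<in> section_ideal"
  shows "bisum {k \<in> keys2 h. bidegree k = d} (coeff2 h) \<in> section_ideal"
  unfolding section_ideal_def
proof (intro CollectI allI impI)
  fix \<delta> :: "idx \<Rightarrow> 'a" and x and t :: "idx \<Rightarrow> 'a"
  assume roots: "0 \<notin> roots (\<chi> i. \<delta> i)" and t: "\<forall>i. t i \<noteq> 0"
  let ?z = "section_at \<delta> x t"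
  let ?T = "\<lambda>k. coeff2 h k * (monom_val \<delta> (snd k) * monom_val ?z (fst k))"
  let ?a = "\<lambda>d. \<Sum>k\<in>{k \<in> keys2 h. bidegree k = d}. ?T k"
  let ?ch = "\<lambda>(d :: nat \<times> (int ^ (idx option))) (c :: 'a, s). c ^ fst d * torus_char s (snd d)"
  have sum0: "(\<Sum>d\<in>bidegree ` keys2 h. ?a d * ?ch d (c, s)) = 0" if cs: "c \<noteq> 0" "\<And>k. s k \<noteq> 0" for c s
  proof -
    obtain x' where x': "(\<lambda>l. torus_char s (pic l) * ?z l) = section_at (\<lambda>i. c * \<delta> i) x' (\<lambda>i. s (Some i) * t i)"
      using psec_scale[of c s t \<delta> x] cs t by metis
    have "eval2 (\<lambda>i. c * \<delta> i) (\<lambda>l. torus_char s (pic l) * ?z l) h = 0"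
    proof -
      have "0 \<notin> roots (\<chi> i. c * \<delta> i)" using roots cs(1) by (simp add: roots_scale)
      moreover have "\<forall>i. s (Some i) * t i \<noteq> 0" using cs(2) t by simp
      ultimately show ?thesis unfolding x' by (intro section_idealD[OF h]) auto
    qed
    then have "(\<Sum>k\<in>keys2 h. ?T k * ?ch (bidegree k) (c, s)) = 0"
      unfolding eval2_torus_expand[of s, OF cs(2)] by simp
    then have "(\<Sum>d\<in>bidegree ` keys2 h. \<Sum>k\<in>{k \<in> keys2 h. bidegree k = d}. ?T k * ?ch (bidegree k) (c, s)) = 0"
      by (subst sum.image_gen[of _ _ bidegree, symmetric]) simp_all
    then show ?thesis by (simp add: sum_distrib_right)
  qed
  have "?a d = 0"
  proof (cases "d \<in> bidegree ` keys2 h")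
    case True
    show ?thesis
    proof (rule independence_of_characters[where S = "bidegree ` keys2 h" and ch = ?ch and e = "(1, \<lambda>_. 1)"
          and Y = "{(c, s). c \<noteq> 0 \<and> (\<forall>k. s k \<noteq> 0)}" and f = "\<lambda>(c, s) (c', s'). (c * c', \<lambda>k. s k * s' k)"])
      fix d e :: "nat \<times> (int ^ (idx option))" assume "d \<noteq> e"
      then consider "fst d \<noteq> fst e" | k where "snd d $ k \<noteq> snd e $ k"
        by (metis prod_eqI vec_eq_iff)
      then show "\<exists>y\<in>{(c :: 'a, s). c \<noteq> 0 \<and> (\<forall>k. s k \<noteq> 0)}. ?ch d y \<noteq> ?ch e y"
      proof cases
        case 1
        then have "(2::'a) powi int (fst d) \<noteq> 2 powi int (fst e)" using power_int_two_inject by fastforce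
        then show ?thesis by (intro bexI[of _ "(2, \<lambda>_. 1)"]) (auto simp: torus_char_def)
      next
        case (2 k)
        let ?s = "\<lambda>j. if j = k then 2 else 1 :: 'a"
        have "torus_char ?s D = 2 powi (D $ k)" for D
        proof -
          have "torus_char ?s D = (\<Prod>j\<in>UNIV. if j = k then 2 powi (D $ k) else 1)"
            unfolding torus_char_def by (intro prod.cong) auto
          then show ?thesis by simp
        qed
        then show ?thesis using 2 power_int_two_inject by (intro bexI[of _ "(1, ?s)"]) auto
      qed
    qed (use True sum0 in \<open>auto simp: torus_char_def power_int_mult_distrib prod.distrib power_mult_distrib\<close>)
  next
    case False
    then have "{k \<in> keys2 h. bidegree k = d} = {}" by blast
    then show ?thesis by (simp only: sum.empty)
  qed
  then show "eval2 \<delta> ?z (bisum {k \<in> keys2 h. bidegree k = d} (coeff2 h)) = 0"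
    unfolding peval2_bisum[OF rhom_id] .
qed

lemma eval2_by_components:
  "eval2 \<delta> z h = (\<Sum>d\<in>bidegree ` keys2 h. eval2 \<delta> z (bisum {k \<in> keys2 h. bidegree k = d} (coeff2 h)))"
  unfolding peval2_bisum[OF rhom_id] unfolding eval2_expand
  by (rule sum.image_gen) simp

text \<open>One direction is the descent \<open>section_ideal_vanish\<close>. For the other, an
  integral polynomial is the sum of its bihomogeneous components, which stay in
  \<open>section_ideal\<close>. It follows that the variety of the Cox ideal is closed.\<close>

lemma cox_point_iff:
  fixes \<delta> :: "idx \<Rightarrow> 'a::field_char_0"
  shows "(\<forall>f\<in>cox_ideal. eval_at \<delta> z f = 0) \<longleftrightarrow> (\<forall>h\<in>{h \<in> section_ideal. bihomogeneous h}. eval2 \<delta> z h = 0)"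
proof
  assume "\<forall>f\<in>cox_ideal. eval_at \<delta> z f = 0"
  then show "\<forall>h\<in>{h \<in> section_ideal. bihomogeneous h}. eval2 \<delta> z h = 0"
    using section_ideal_vanish by blast
next
  assume *: "\<forall>h\<in>{h \<in> section_ideal. bihomogeneous h}. eval2 \<delta> z h = 0"
  show "\<forall>f\<in>cox_ideal. eval_at \<delta> z f = 0"
  proof
    fix f assume "f \<in> cox_ideal"
    let ?h = "Poly_Mapping.map (Poly_Mapping.map of_int) f :: 'a lpoly"
    have h: "?h \<in> section_ideal" using \<open>f \<in> cox_ideal\<close> by (rule map_cox_ideal_section_ideal)
    have "bihomogeneous (bisum {k \<in> keys2 ?h. bidegree k = d} (coeff2 ?h))" for d
      unfolding bihomogeneous_iff by (intro exI[of _ d] bihom_bisum) auto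
    then have "eval2 \<delta> z ?h = 0"
      unfolding eval2_by_components[of \<delta> z ?h] using * section_ideal_component[OF h] by (intro sum.neutral) blast
    then show "eval_at \<delta> z f = 0" by (simp add: eval2_map_of_int)
  qed
qed

lemma variety_cox_ideal:
  "(variety of_int cox_ideal :: 'a::field_char_0 ambient_point set)
    = variety (\<lambda>a. a) {h \<in> section_ideal. bihomogeneous h}"
  unfolding variety_pt cox_point_iff ..

section \<open>The family over the root complement and its Zariski closure\<close>

section \<open>The family of very affine surfaces\<close>

abbreviation usec :: "(idx \<Rightarrow> 'b::comm_ring_1) \<Rightarrow> 'b ^ 3 \<Rightarrow> line \<Rightarrow> 'b" where
  "usec \<delta> x \<equiv> psec \<delta> x (\<lambda>_. 1) (\<lambda>_. 1)"

definition nondegenerate :: "(idx \<Rightarrow> 'a::field) \<Rightarrow> 'a ^ 3 \<Rightarrow> bool" where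
  "nondegenerate \<delta> x \<longleftrightarrow> 0 \<notin> roots (\<chi> i. \<delta> i) \<and> (\<forall>l. usec \<delta> x l \<noteq> 0)"

text \<open>The explicit form of \<open>universal_family\<close>: the exceptional sections are
  normalized to 1 by the torus, and lying off the 27 lines becomes non-vanishing of all
  coordinates.\<close>

definition section_family :: "'a::field ambient_point set" where
  "section_family = {pt \<delta> (usec \<delta> x) | \<delta> x. nondegenerate \<delta> x}"

lemma nonzero_if_roots: "0 \<notin> roots (\<chi> i. \<delta> i) \<Longrightarrow> \<delta> \<noteq> (\<lambda>_. 0)"
  by (auto simp: roots_def)

lemma nondegenerate_proper: "nondegenerate \<delta> x \<Longrightarrow> proper \<delta> (usec \<delta> x)"
  by (simp add: nondegenerate_def proper_def nonzero_if_roots)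

lemma satisfies_trinomials_cox_point:
  assumes "\<forall>f\<in>cox_ideal. eval_at \<delta> z f = 0"
  shows "satisfies_trinomials \<delta> z"
  unfolding satisfies_trinomials_def
proof (intro allI ballI)
  fix l p q r assume pqr: "p \<in> set (pairs l)" "q \<in> set (pairs l)" "r \<in> set (pairs l)"
  show "trinomial \<delta> z p q r = 0"
  proof (cases "distinct [p, q, r]")
    case True
    then have "tripoly p q r \<in> cox_ideal" using tripoly_in_ideal[OF pqr] all_trinomials_cox by blast
    then show ?thesis using assms eval_at_tripoly by metis
  next
    case False
    then show ?thesis by (auto simp: trinomial_def algebra_simps)
  qed
qed

lemma pt_section_normalize:
  fixes \<delta> :: "idx \<Rightarrow> 'a::field"
  assumes "c \<noteq> 0" "\<And>i. t i \<noteq> 0"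
  obtains x' where "pt \<delta> (section_at \<delta> x t) = pt (\<lambda>i. c * \<delta> i) (usec (\<lambda>i. c * \<delta> i) x')"
proof -
  define s where "s = (\<lambda>k. case k of None \<Rightarrow> 1 | Some i \<Rightarrow> inverse (t i))"
  have s: "s k \<noteq> 0" for k using assms(2) by (cases k) (simp_all add: s_def)
  obtain x' where "(\<lambda>l. torus_char s (pic l) * section_at \<delta> x t l)
      = section_at (\<lambda>i. c * \<delta> i) x' (\<lambda>i. s (Some i) * t i)"
    using psec_scale[of c s t \<delta> x] assms s by metis
  also have "(\<lambda>i. s (Some i) * t i) = (\<lambda>_. 1)" using assms(2) by (simp add: s_def)
  finally have eq: "(\<lambda>l. torus_char s (pic l) * section_at \<delta> x t l) = usec (\<lambda>i. c * \<delta> i) x'" by simp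
  have "pt (\<lambda>i. c * \<delta> i) (usec (\<lambda>i. c * \<delta> i) x') = pt \<delta> (section_at \<delta> x t)"
    unfolding eq[symmetric] by (rule pt_scale[OF assms(1) s])
  then show ?thesis by (intro that) (rule sym)
qed

text \<open>Some section has the same base coordinates as \<open>z\<close>; both satisfy the
  trinomials, so the elimination makes them agree everywhere.\<close>

lemma cox_point_section:
  fixes \<delta> :: "idx \<Rightarrow> 'a::field"
  assumes roots: "0 \<notin> roots (\<chi> i. \<delta> i)" and z: "\<And>l. z l \<noteq> 0"
    and cox: "\<forall>f\<in>cox_ideal. eval_at \<delta> z f = 0"
  obtains x where "z = section_at \<delta> x (\<lambda>i. z (E i))"
proof -
  obtain x where x: "\<And>l. l \<in> base_lines \<Longrightarrow> section_at \<delta> x (\<lambda>i. z (E i)) l = z l"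
    using solve_base_sections[OF roots, of z] z by blast
  have "z = section_at \<delta> x (\<lambda>i. z (E i))"
    by (rule satisfies_trinomials_unique[OF roots satisfies_trinomials_cox_point[OF cox]
          satisfies_trinomials_section]) (use z x in auto)
  then show ?thesis by (rule that)
qed

lemma section_family_subset: "section_family \<subseteq> (variety of_int cox_ideal :: 'a::field ambient_point set)"
proof
  fix p :: "'a ambient_point" assume "p \<in> section_family"
  then obtain \<delta> x where p: "p = pt \<delta> (usec \<delta> x)" and nd: "nondegenerate \<delta> x"
    unfolding section_family_def by blast
  have "eval_at \<delta> (usec \<delta> x) f = 0" if "f \<in> cox_ideal" for f
    using nd satisfies_trinomials_section[of "\<lambda>_. 1" \<delta> x]
    by (intro cox_ideal_vanish[OF that]) (auto simp: nondegenerate_def)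
  then show "p \<in> variety of_int cox_ideal"
    unfolding variety_pt p using nondegenerate_proper[OF nd] by blast
qed

lemma fst_pt_root_complement: "fst (pt \<delta> z) \<in> root_complement \<longleftrightarrow> 0 \<notin> roots (\<chi> i. \<delta> i)"
proof
  assume "fst (pt \<delta> z) \<in> root_complement"
  then obtain \<epsilon> where e: "proj_class \<epsilon> = proj_class (\<chi> i. \<delta> i)" "0 \<notin> roots \<epsilon>"
    unfolding root_complement_def pt_def by auto
  then obtain c where "c \<noteq> 0" "(\<chi> i. \<delta> i) = c *s \<epsilon>" using proj_class_eq by blast
  moreover have "0 \<notin> roots (\<chi> i. c * \<epsilon> $ i)"
    using roots_scale[OF \<open>c \<noteq> 0\<close>, of "($) \<epsilon>"] e(2) by (simp add: vec_lambda_eta)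
  ultimately show "0 \<notin> roots (\<chi> i. \<delta> i)" by (simp add: vector_scalar_mult_def)
qed (auto simp: root_complement_def pt_def)

lemma variety_root_complement:
  "{(D, Z) \<in> (variety of_int cox_ideal :: 'a::field ambient_point set). D \<in> root_complement} = section_family"
proof (intro equalityI subsetI)
  fix p :: "'a ambient_point"
  assume "p \<in> {(D, Z) \<in> variety of_int cox_ideal. D \<in> root_complement}"
  then have "p \<in> variety of_int cox_ideal" and rc: "fst p \<in> root_complement" by auto
  then obtain \<delta> z where p: "p = pt \<delta> z" and z: "proper \<delta> z" and cox: "\<forall>f\<in>cox_ideal. eval_at \<delta> z f = 0"
    unfolding variety_pt by blast
  have roots: "0 \<notin> roots (\<chi> i. \<delta> i)" using rc fst_pt_root_complement unfolding p by blast
  obtain x where x: "z = section_at \<delta> x (\<lambda>i. z (E i))"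
    using cox_point_section[OF roots _ cox] z unfolding proper_def by blast
  obtain x' where x': "pt \<delta> (section_at \<delta> x (\<lambda>i. z (E i))) = pt (\<lambda>i. 1 * \<delta> i) (usec (\<lambda>i. 1 * \<delta> i) x')"
    using pt_section_normalize[of 1 "\<lambda>i. z (E i)" \<delta> x] z unfolding proper_def by auto
  then have eq: "p = pt \<delta> (usec \<delta> x')" unfolding p using x by simp
  then have "pt \<delta> z = pt \<delta> (usec \<delta> x')" using p by simp
  then have "usec \<delta> x' l \<noteq> 0" for l
  proof (rule pt_eq)
    fix c s assume "\<And>k. s k \<noteq> 0" "usec \<delta> x' = (\<lambda>l. torus_char s (pic l) * z l)"
    then show ?thesis using z by (simp add: torus_char_nonzero proper_def)
  qed
  then have "nondegenerate \<delta> x'" using roots by (simp add: nondegenerate_def)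
  then show "p \<in> section_family" unfolding section_family_def eq by blast
next
  fix p :: "'a ambient_point" assume p: "p \<in> section_family"
  then have "fst p \<in> root_complement"
    unfolding section_family_def nondegenerate_def using fst_pt_root_complement by blast
  then show "p \<in> {(D, Z) \<in> variety of_int cox_ideal. D \<in> root_complement}"
    using p section_family_subset by (auto simp: case_prod_beta)
qed

section \<open>Lines in parameter space\<close>

definition segment_\<delta> :: "(idx \<Rightarrow> 'a::field) \<Rightarrow> (idx \<Rightarrow> 'a) \<Rightarrow> 'a \<Rightarrow> idx \<Rightarrow> 'a" where
  "segment_\<delta> \<delta>0 \<delta>1 \<tau> i = \<delta>0 i + \<tau> * (\<delta>1 i - \<delta>0 i)"

definition segment_x :: "'a::field ^ 3 \<Rightarrow> 'a ^ 3 \<Rightarrow> 'a \<Rightarrow> 'a ^ 3" where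
  "segment_x x0 x1 \<tau> = (\<chi> k. x0 $ k + \<tau> * (x1 $ k - x0 $ k))"

lemma segment_simps [simp]:
  "segment_\<delta> \<delta>0 \<delta>1 0 = \<delta>0" "segment_\<delta> \<delta>0 \<delta>1 1 = \<delta>1"
  "segment_x x0 x1 0 = x0" "segment_x x0 x1 1 = x1" "segment_\<delta> \<delta>0 \<delta>0 \<tau> = \<delta>0"
  by (simp_all add: segment_\<delta>_def segment_x_def fun_eq_iff vec_eq_iff)

lemma rhom_root_prod_iff:
  fixes h :: "'b::comm_ring_1 \<Rightarrow> 'c::idom"
  assumes "rhom h"
  shows "h (root_prod \<delta>) \<noteq> 0 \<longleftrightarrow> 0 \<notin> roots (\<chi> i. h (\<delta> i))"
proof
  assume nz: "h (root_prod \<delta>) \<noteq> 0"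
  show "0 \<notin> roots (\<chi> i. h (\<delta> i))"
  proof
    assume "0 \<in> roots (\<chi> i. h (\<delta> i))"
    then obtain r where "r \<in> roots (\<chi> i. \<delta> i)" "h r = 0" using roots_image[OF assms, of \<delta>] by force
    then have "h (root_prod \<delta>) = 0"
      unfolding root_prod_def rhom_prod[OF assms] by (auto simp: finite_roots)
    then show False using nz by blast
  qed
qed (rule rhom_root_prod_nonzero[OF assms])

text \<open>\<open>N\<close> tests degeneracy and \<open>H h\<close> is the restriction of
  \<open>h\<close>. Finitely many non-zero polynomials in one variable have a common non-root, which
  replaces density arguments in the parameter space.\<close>

lemma segment_polynomials:
  fixes \<delta>0 \<delta>1 :: "idx \<Rightarrow> 'a::field"
  obtains N :: "'a poly" and H :: "'a lpoly \<Rightarrow> 'a poly" where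
    "\<And>\<tau>. poly N \<tau> \<noteq> 0 \<longleftrightarrow> nondegenerate (segment_\<delta> \<delta>0 \<delta>1 \<tau>) (segment_x x0 x1 \<tau>)"
    "\<And>h \<tau>. poly (H h) \<tau> = eval2 (segment_\<delta> \<delta>0 \<delta>1 \<tau>) (usec (segment_\<delta> \<delta>0 \<delta>1 \<tau>) (segment_x x0 x1 \<tau>)) h"
proof -
  define \<Delta> where "\<Delta> = (\<lambda>i. [:\<delta>0 i, \<delta>1 i - \<delta>0 i:])"
  define \<Xi> :: "'a poly ^ 3" where "\<Xi> = (\<chi> k. [:x0 $ k, x1 $ k - x0 $ k:])"
  have sec: "poly (usec \<Delta> \<Xi> l) \<tau> = usec (segment_\<delta> \<delta>0 \<delta>1 \<tau>) (segment_x x0 x1 \<tau>) l" for l \<tau>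
    unfolding rhom_psec[OF rhom_poly] by (simp add: \<Delta>_def \<Xi>_def segment_\<delta>_def[abs_def] segment_x_def)
  have seg: "(\<lambda>i. poly (\<Delta> i) \<tau>) = segment_\<delta> \<delta>0 \<delta>1 \<tau>" for \<tau>
    by (simp add: \<Delta>_def segment_\<delta>_def fun_eq_iff)
  show ?thesis
  proof (rule that)
    show "poly (root_prod \<Delta> * (\<Prod>l\<in>UNIV. usec \<Delta> \<Xi> l)) \<tau> \<noteq> 0
        \<longleftrightarrow> nondegenerate (segment_\<delta> \<delta>0 \<delta>1 \<tau>) (segment_x x0 x1 \<tau>)" for \<tau>
      using rhom_root_prod_iff[OF rhom_poly, of \<Delta> \<tau>]
      by (auto simp: nondegenerate_def poly_prod sec seg)
    show "poly (peval (peval (\<lambda>a. [:a:]) \<Delta>) (usec \<Delta> \<Xi>) h) \<tau>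
        = eval2 (segment_\<delta> \<delta>0 \<delta>1 \<tau>) (usec (segment_\<delta> \<delta>0 \<delta>1 \<tau>) (segment_x x0 x1 \<tau>)) h" for h \<tau>
      unfolding peval_comp[OF rhom_poly[of \<tau>]] by (simp add: sec seg)
  qed
qed

lemma poly_nonroot:
  assumes "(p :: 'a::field_char_0 poly) \<noteq> 0"
  obtains \<tau> where "poly p \<tau> \<noteq> 0"
  using assms poly_all_0_iff_0[of p] by blast

text \<open>The cusp of the cubic \<open>(1 : a : a^3)\<close>. With \<open>t = 1\<close> every
  \<open>F\<close> and \<open>G\<close> section takes the value -1 there, so it avoids all lines
  whatever the parameters are.\<close>

definition base_x :: "'a::comm_ring_1 ^ 3" where "base_x = vector [0, 0, 1]"

lemma nondegenerate_base_x: "0 \<notin> roots (\<chi> i. \<delta> i) \<Longrightarrow> nondegenerate \<delta> base_x"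
proof -
  have x: "base_x $ 1 = 0" "base_x $ 2 = 0" "base_x $ 3 = (1 :: 'a)" by (simp_all add: base_x_def)
  have "usec \<delta> base_x l \<noteq> 0" for l
    by (cases l rule: line_cases)
       (simp_all add: psec_simps sphi_def sconic_def Let_def conic_poly_def x)
  then show "0 \<notin> roots (\<chi> i. \<delta> i) \<Longrightarrow> nondegenerate \<delta> base_x" by (simp add: nondegenerate_def)
qed

text \<open>A degenerate \<open>x\<close> is joined to \<open>base_x\<close> inside the same fibre:
  the polynomial vanishes along this segment except possibly at the roots of \<open>N\<close>, hence
  identically.\<close>

lemma section_idealI:
  fixes h :: "'a::field_char_0 lpoly"
  assumes bih: "bihomogeneous h" and zero: "\<And>\<delta> x. nondegenerate \<delta> x \<Longrightarrow> eval2 \<delta> (usec \<delta> x) h = 0"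
  shows "h \<in> section_ideal"
  unfolding section_ideal_def
proof (intro CollectI allI impI)
  fix \<delta> :: "idx \<Rightarrow> 'a" and x and t :: "idx \<Rightarrow> 'a"
  assume roots: "0 \<notin> roots (\<chi> i. \<delta> i)" and t: "\<forall>i. t i \<noteq> 0"
  have u: "eval2 \<delta> (usec \<delta> x) h = 0" for x
  proof -
    obtain N H where N: "\<And>\<tau>. poly N \<tau> \<noteq> 0 \<longleftrightarrow> nondegenerate (segment_\<delta> \<delta> \<delta> \<tau>) (segment_x x base_x \<tau>)"
      and H: "\<And>h \<tau>. poly (H h) \<tau> = eval2 (segment_\<delta> \<delta> \<delta> \<tau>) (usec (segment_\<delta> \<delta> \<delta> \<tau>) (segment_x x base_x \<tau>)) h"
      using segment_polynomials[of \<delta> \<delta> x base_x] by metis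
    have "poly N 1 \<noteq> 0" unfolding N using nondegenerate_base_x[OF roots] by simp
    then have "N \<noteq> 0" by auto
    have "poly (N * H h) \<tau> = 0" for \<tau>
      using N[of \<tau>] H[of h \<tau>] zero by (cases "poly N \<tau> = 0") auto
    then have "N * H h = 0" using poly_all_0_iff_0 by blast
    then have "H h = 0" using \<open>N \<noteq> 0\<close> by simp
    then show ?thesis using H[of h 0] by simp
  qed
  obtain x' where "pt \<delta> (section_at \<delta> x t) = pt (\<lambda>i. 1 * \<delta> i) (usec (\<lambda>i. 1 * \<delta> i) x')"
    using pt_section_normalize[of 1 t \<delta> x] t by auto
  then have "pt \<delta> (section_at \<delta> x t) = pt \<delta> (usec \<delta> x')" by simp
  from eval2_pt_invariant[OF bih this] show "eval2 \<delta> (section_at \<delta> x t) h = 0" using u by simp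
qed

section \<open>Zariski topology\<close>

lemma zariski_closed_variety: "(\<forall>f\<in>P. bihomogeneous f) \<Longrightarrow> zariski_closed (variety (\<lambda>a. a) P)"
  unfolding zariski_closed_def by blast

lemma zariski_closedE:
  assumes "zariski_closed Z"
  obtains P where "\<forall>f\<in>P. bihomogeneous f" "Z = variety (\<lambda>a. a) P"
  using assms unfolding zariski_closed_def by blast

lemma zariski_closure_least: "zariski_closed Z \<Longrightarrow> A \<subseteq> Z \<Longrightarrow> zariski_closure A \<subseteq> Z"
  unfolding zariski_closure_def by blast

lemma zariski_closure_superset: "A \<subseteq> zariski_closure A"
  unfolding zariski_closure_def by blast

lemma variety_subset: "variety c P \<subseteq> {pt \<delta> z | \<delta> z. proper \<delta> z}"
  unfolding variety_pt by blast

lemma zariski_closed_Inter: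
  assumes "\<And>Z. Z \<in> \<Z> \<Longrightarrow> zariski_closed Z" "\<Z> \<noteq> {}"
  shows "zariski_closed (\<Inter>\<Z>)"
proof -
  \<comment> \<open>Taking every polynomial that vanishes on a member avoids choosing equations for
    the members.\<close>
  define P where "P = {f. bihomogeneous f \<and> (\<exists>Z\<in>\<Z>. Z \<subseteq> variety (\<lambda>a. a) {f})}"
  have bih: "\<forall>f\<in>P. bihomogeneous f" by (simp add: P_def)
  have "\<Inter>\<Z> = variety (\<lambda>a. a) P"
  proof (intro equalityI subsetI)
    fix p assume p: "p \<in> \<Inter>\<Z>"
    obtain Z where "Z \<in> \<Z>" using assms(2) by blast
    then have "p \<in> Z" "zariski_closed Z" using p assms(1) by auto
    then obtain \<delta> z where pz: "p = pt \<delta> z" "proper \<delta> z"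
      using variety_subset by (auto elim!: zariski_closedE) blast
    have "eval2 \<delta> z f = 0" if f: "f \<in> P" for f
    proof -
      obtain Z where "Z \<in> \<Z>" "Z \<subseteq> variety (\<lambda>a. a) {f}" using f unfolding P_def by blast
      then have "pt \<delta> z \<in> variety (\<lambda>a. a) {f}" using p pz by blast
      then show ?thesis using pt_in_variety[of "{f}" \<delta> z] bih f pz by blast
    qed
    then show "p \<in> variety (\<lambda>a. a) P" using pt_in_variety[OF bih pz(2)] pz(1) by blast
  next
    fix p assume p: "p \<in> variety (\<lambda>a. a) P"
    then obtain \<delta> z where pz: "p = pt \<delta> z" "proper \<delta> z" using variety_subset by blast
    show "p \<in> \<Inter>\<Z>"
    proof
      fix Z assume Z: "Z \<in> \<Z>"
      then obtain Q where Q: "\<forall>f\<in>Q. bihomogeneous f" "Z = variety (\<lambda>a. a) Q"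
        using assms(1) zariski_closedE by metis
      have "Q \<subseteq> P"
      proof
        fix f assume "f \<in> Q"
        moreover from this have "variety (\<lambda>a. a) Q \<subseteq> variety (\<lambda>a. a) {f}"
          unfolding variety_pt by blast
        ultimately show "f \<in> P" using Q Z unfolding P_def by blast
      qed
      then show "p \<in> Z" using p unfolding Q(2) variety_pt by blast
    qed
  qed
  then show ?thesis using zariski_closed_variety[OF bih] by simp
qed

lemma zariski_closed_closure:
  assumes "zariski_closed Z" "A \<subseteq> Z" shows "zariski_closed (zariski_closure A)"
  unfolding zariski_closure_def using assms by (intro zariski_closed_Inter) auto

text \<open>Closures turn a chain in \<open>A\<close> into a chain in \<open>B\<close>: intersecting
  with \<open>A\<close> gives back the original sets, so closures stay distinct, and a decomposition
  of a closure restricts to one of the original set. Closedness of \<open>B\<close> keeps the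
  closures inside it.\<close>

lemma krull_dim_mono:
  fixes A B :: "'a::field ambient_point set"
  assumes AB: "A \<subseteq> B" and B: "zariski_closed B"
  shows "krull_dim A \<le> krull_dim B"
  unfolding krull_dim_def
proof (rule Sup_subset_mono, rule subsetI)
  fix e assume "e \<in> {enat n |n. \<exists>C :: nat \<Rightarrow> 'a ambient_point set.
     (\<forall>i\<le>n. irreducible_closed_in A (C i)) \<and> (\<forall>i<n. C i \<subset> C (Suc i))}"
  then obtain n and C :: "nat \<Rightarrow> 'a ambient_point set" where e: "e = enat n"
    and irr: "\<And>i. i \<le> n \<Longrightarrow> irreducible_closed_in A (C i)" and chain: "\<And>i. i < n \<Longrightarrow> C i \<subset> C (Suc i)"
    by blast
  let ?D = "\<lambda>i. zariski_closure (C i)"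
  have sub: "C i \<subseteq> A" "C i \<noteq> {}" if "i \<le> n" for i
    using irr[OF that] unfolding irreducible_closed_in_def zariski_closed_in_def by auto
  have closed: "zariski_closed (?D i)" "?D i \<subseteq> B" if "i \<le> n" for i
    using zariski_closed_closure[OF B] zariski_closure_least[OF B] sub[OF that] AB by blast+
  have AD: "A \<inter> ?D i = C i" if i: "i \<le> n" for i
  proof -
    obtain K where K: "zariski_closed K" "C i = A \<inter> K"
      using irr[OF i] unfolding irreducible_closed_in_def zariski_closed_in_def by blast
    then have "?D i \<subseteq> K" using zariski_closure_least by blast
    then show ?thesis using K zariski_closure_superset[of "C i"] by blast
  qed
  have irrD: "irreducible_closed_in B (?D i)" if i: "i \<le> n" for i
    unfolding irreducible_closed_in_def
  proof (intro conjI allI impI)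
    show "zariski_closed_in B (?D i)" using closed[OF i] unfolding zariski_closed_in_def by blast
    show "?D i \<noteq> {}" using sub[OF i] zariski_closure_superset[of "C i"] by blast
    fix Z1 Z2 assume Z: "zariski_closed_in B Z1 \<and> zariski_closed_in B Z2 \<and> ?D i = Z1 \<union> Z2"
    then obtain K1 K2 where K: "zariski_closed K1" "Z1 = B \<inter> K1" "zariski_closed K2" "Z2 = B \<inter> K2"
      unfolding zariski_closed_in_def by blast
    have "C i = (A \<inter> K1) \<union> (A \<inter> K2)" using AD[OF i] Z K AB by blast
    moreover have "zariski_closed_in A (A \<inter> K1)" "zariski_closed_in A (A \<inter> K2)"
      using K unfolding zariski_closed_in_def by blast+
    ultimately have "C i = A \<inter> K1 \<or> C i = A \<inter> K2"
      using irr[OF i] unfolding irreducible_closed_in_def by blast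
    then show "?D i = Z1 \<or> ?D i = Z2"
      using zariski_closure_least[of K1 "C i"] zariski_closure_least[of K2 "C i"] K closed[OF i] Z by blast
  qed
  have chainD: "?D i \<subset> ?D (Suc i)" if i: "i < n" for i
  proof -
    have "?D i \<subseteq> ?D (Suc i)"
      using chain[OF i] closed[of "Suc i"] zariski_closure_superset[of "C (Suc i)"] i
      by (intro zariski_closure_least) auto
    moreover have "?D i \<noteq> ?D (Suc i)"
    proof
      assume "?D i = ?D (Suc i)"
      then have "C i = C (Suc i)"
        by (intro box_equals[OF _ AD[OF less_imp_le[OF i]] AD[OF Suc_leI[OF i]]]) (simp only:)
      then show False using chain[OF i] by blast
    qed
    ultimately show ?thesis by blast
  qed
  have *: "\<exists>C :: nat \<Rightarrow> 'a ambient_point set.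
     (\<forall>i\<le>n. irreducible_closed_in B (C i)) \<and> (\<forall>i<n. C i \<subset> C (Suc i))"
  proof (rule exI[of _ ?D], rule conjI)
    show "\<forall>i\<le>n. irreducible_closed_in B (?D i)" using irrD by blast
    show "\<forall>i<n. ?D i \<subset> ?D (Suc i)" using chainD by blast
  qed
  show "e \<in> {enat n |n. \<exists>C :: nat \<Rightarrow> 'a ambient_point set.
     (\<forall>i\<le>n. irreducible_closed_in B (C i)) \<and> (\<forall>i<n. C i \<subset> C (Suc i))}"
    unfolding e mem_Collect_eq by (rule exI[of _ n], rule conjI[OF HOL.refl *])
qed

text \<open>The equations of a closed set containing the family lie in \<open>section_ideal\<close>,
  and these vanish on the variety by \<open>variety_cox_ideal\<close>.\<close>

lemma closure_section_family:
  "zariski_closure section_family = (variety of_int cox_ideal :: 'a::field_char_0 ambient_point set)"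
proof
  let ?I = "{h \<in> section_ideal. bihomogeneous h} :: 'a lpoly set"
  show "zariski_closure section_family \<subseteq> (variety of_int cox_ideal :: 'a ambient_point set)"
    using section_family_subset[where 'a = 'a] unfolding variety_cox_ideal
    by (intro zariski_closure_least zariski_closed_variety) auto
  show "(variety of_int cox_ideal :: 'a ambient_point set) \<subseteq> zariski_closure section_family"
    unfolding zariski_closure_def
  proof (intro Inter_greatest)
    fix Z :: "'a ambient_point set" assume Z: "Z \<in> {Z. zariski_closed Z \<and> section_family \<subseteq> Z}"
    then obtain P where P: "\<forall>f\<in>P. bihomogeneous f" "Z = variety (\<lambda>a. a) P" using zariski_closedE by blast
    have "f \<in> section_ideal" if f: "f \<in> P" for f
    proof (rule section_idealI)
      show "bihomogeneous f" using P f by blast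
      fix \<delta> :: "idx \<Rightarrow> 'a" and x assume nd: "nondegenerate \<delta> x"
      then have "pt \<delta> (usec \<delta> x) \<in> variety (\<lambda>a. a) P" using Z P(2) unfolding section_family_def by blast
      then show "eval2 \<delta> (usec \<delta> x) f = 0"
        using pt_in_variety[OF P(1) nondegenerate_proper[OF nd]] f by blast
    qed
    then have "P \<subseteq> ?I" using P by blast
    then show "variety of_int cox_ideal \<subseteq> Z" unfolding variety_cox_ideal P(2) unfolding variety_pt by blast
  qed
qed

lemma variety_cox_ideal_closed: "zariski_closed (variety of_int cox_ideal :: 'a::field_char_0 ambient_point set)"
  unfolding variety_cox_ideal by (intro zariski_closed_variety) auto

section \<open>Lower bound for the dimension\<close>

section \<open>A chain of length 7\<close>

text \<open>If two proper closed subsets covered \<open>C\<close>, two polynomials would be non-zero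
  at one end of a segment each. Together with \<open>N\<close> they have a common non-root, which is
  a point of \<open>C\<close> in neither subset.\<close>

lemma irreducible_by_segments:
  fixes C :: "'a::field_char_0 ambient_point set"
  assumes closed: "zariski_closed_in section_family C" and ne: "C \<noteq> {}"
    and seg: "\<And>p q. p \<in> C \<Longrightarrow> q \<in> C \<Longrightarrow> \<exists>\<delta>0 x0 \<delta>1 x1. nondegenerate \<delta>0 x0 \<and> nondegenerate \<delta>1 x1 \<and>
        p = pt \<delta>0 (usec \<delta>0 x0) \<and> q = pt \<delta>1 (usec \<delta>1 x1) \<and>
        (\<forall>\<tau>. nondegenerate (segment_\<delta> \<delta>0 \<delta>1 \<tau>) (segment_x x0 x1 \<tau>) \<longrightarrow>
           pt (segment_\<delta> \<delta>0 \<delta>1 \<tau>) (usec (segment_\<delta> \<delta>0 \<delta>1 \<tau>) (segment_x x0 x1 \<tau>)) \<in> C)"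
  shows "irreducible_closed_in section_family C"
  unfolding irreducible_closed_in_def
proof (intro conjI allI impI closed ne)
  fix Z1 Z2
  assume Z: "zariski_closed_in section_family Z1 \<and> zariski_closed_in section_family Z2 \<and> C = Z1 \<union> Z2"
  show "C = Z1 \<or> C = Z2"
  proof (rule ccontr)
    assume "\<not> ?thesis"
    then obtain p q where pq: "p \<in> C" "p \<notin> Z1" "q \<in> C" "q \<notin> Z2" using Z by blast
    obtain K1 where K1: "zariski_closed K1" "Z1 = section_family \<inter> K1" using Z unfolding zariski_closed_in_def by blast
    obtain K2 where K2: "zariski_closed K2" "Z2 = section_family \<inter> K2" using Z unfolding zariski_closed_in_def by blast
    obtain P1 where P1: "\<forall>f\<in>P1. bihomogeneous f" "K1 = variety (\<lambda>a. a) P1" using zariski_closedE[OF K1(1)] .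
    obtain P2 where P2: "\<forall>f\<in>P2. bihomogeneous f" "K2 = variety (\<lambda>a. a) P2" using zariski_closedE[OF K2(1)] .
    obtain \<delta>0 x0 \<delta>1 x1 where nd: "nondegenerate \<delta>0 x0" "nondegenerate \<delta>1 x1"
      and pts: "p = pt \<delta>0 (usec \<delta>0 x0)" "q = pt \<delta>1 (usec \<delta>1 x1)"
      and path: "\<And>\<tau>. nondegenerate (segment_\<delta> \<delta>0 \<delta>1 \<tau>) (segment_x x0 x1 \<tau>) \<Longrightarrow>
           pt (segment_\<delta> \<delta>0 \<delta>1 \<tau>) (usec (segment_\<delta> \<delta>0 \<delta>1 \<tau>) (segment_x x0 x1 \<tau>)) \<in> C"
      using seg[OF pq(1,3)] by blast
    have "p \<notin> K1" "q \<notin> K2" using pq pts nd K1(2) K2(2) unfolding section_family_def by blast+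
    then obtain h1 h2 where h: "h1 \<in> P1" "eval2 \<delta>0 (usec \<delta>0 x0) h1 \<noteq> 0" "h2 \<in> P2" "eval2 \<delta>1 (usec \<delta>1 x1) h2 \<noteq> 0"
      using pt_in_variety[OF P1(1) nondegenerate_proper[OF nd(1)]] pt_in_variety[OF P2(1) nondegenerate_proper[OF nd(2)]]
      unfolding P1(2) P2(2) pts by blast
    obtain N H where N: "\<And>\<tau>. poly N \<tau> \<noteq> 0 \<longleftrightarrow> nondegenerate (segment_\<delta> \<delta>0 \<delta>1 \<tau>) (segment_x x0 x1 \<tau>)"
      and H: "\<And>h \<tau>. poly (H h) \<tau> = eval2 (segment_\<delta> \<delta>0 \<delta>1 \<tau>) (usec (segment_\<delta> \<delta>0 \<delta>1 \<tau>) (segment_x x0 x1 \<tau>)) h"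
      using segment_polynomials[of \<delta>0 \<delta>1 x0 x1] by metis
    have "poly N 0 \<noteq> 0" "poly (H h1) 0 \<noteq> 0" "poly (H h2) 1 \<noteq> 0" unfolding N H using nd h by simp_all
    then have "N * H h1 * H h2 \<noteq> 0" by auto
    then obtain \<tau> where "poly (N * H h1 * H h2) \<tau> \<noteq> 0" by (rule poly_nonroot)
    then have \<tau>: "nondegenerate (segment_\<delta> \<delta>0 \<delta>1 \<tau>) (segment_x x0 x1 \<tau>)"
      "eval2 (segment_\<delta> \<delta>0 \<delta>1 \<tau>) (usec (segment_\<delta> \<delta>0 \<delta>1 \<tau>) (segment_x x0 x1 \<tau>)) h1 \<noteq> 0"
      "eval2 (segment_\<delta> \<delta>0 \<delta>1 \<tau>) (usec (segment_\<delta> \<delta>0 \<delta>1 \<tau>) (segment_x x0 x1 \<tau>)) h2 \<noteq> 0"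
      unfolding N[symmetric] H[symmetric] by auto
    let ?r = "pt (segment_\<delta> \<delta>0 \<delta>1 \<tau>) (usec (segment_\<delta> \<delta>0 \<delta>1 \<tau>) (segment_x x0 x1 \<tau>))"
    have "?r \<notin> K1" "?r \<notin> K2"
      using pt_in_variety[OF P1(1) nondegenerate_proper[OF \<tau>(1)]] pt_in_variety[OF P2(1) nondegenerate_proper[OF \<tau>(1)]]
        \<tau>(2,3) h(1,3) unfolding P1(2) P2(2) by blast+
    then show False using path[OF \<tau>(1)] Z K1(2) K2(2) by blast
  qed
qed

definition base_\<delta> :: "idx \<Rightarrow> 'a::comm_ring_1" where "base_\<delta> i = of_nat (2 ^ idx_nat i)"

text \<open>Scaled so that \<open>d_1 - d_2\<close> has its value at \<open>base_\<delta>\<close>,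
  the first five conditions say that the parameters are \<open>base_\<delta>\<close>; they are
  homogenized with that root. The last two are linear in \<open>x\<close> and cut the plane down to
  the point \<open>base_x\<close>.\<close>

definition flag_value :: "nat \<Rightarrow> (idx \<Rightarrow> 'a::comm_ring_1) \<Rightarrow> 'a ^ 3 \<Rightarrow> 'a" where
  "flag_value m \<delta> x =
     (if m < 5 then (base_\<delta> I1 - base_\<delta> I2) * \<delta> (idxs ! Suc m) - base_\<delta> (idxs ! Suc m) * (\<delta> I1 - \<delta> I2)
      else if m = 5 then sphi \<delta> x I1 I2 - sphi \<delta> x I1 I3
      else sphi \<delta> x I1 I2 - sphi \<delta> x I2 I3)"

text \<open>The variables \<open>E i\<close> have value 1 on \<open>usec\<close>; they are inserted
  to give the two terms of each difference the same class.\<close>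

definition flag_poly :: "nat \<Rightarrow> 'a::field lpoly" where
  "flag_poly m =
     (if m < 5 then pconst (pconst (base_\<delta> I1 - base_\<delta> I2)) * pconst (pvar (idxs ! Suc m))
        + (pconst (pconst (- base_\<delta> (idxs ! Suc m))) * pconst (pvar I1)
        + pconst (pconst (base_\<delta> (idxs ! Suc m))) * pconst (pvar I2))
      else if m = 5 then pvar (F I1 I2) * pvar (E I2) + pconst (pconst (- 1)) * (pvar (F I1 I3) * pvar (E I3))
      else pvar (F I1 I2) * pvar (E I1) + pconst (pconst (- 1)) * (pvar (F I2 I3) * pvar (E I3)))"

lemma eval2_flag_poly: "eval2 \<delta> (usec \<delta> x) (flag_poly m) = flag_value m \<delta> x"
  unfolding flag_poly_def flag_value_def
  by (simp add: rhom_simps[OF rhom_eval2] peval_pconst peval_pvar rhom_simps[OF rhom_peval[OF rhom_id]]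
      psec_simps algebra_simps)

lemma bihomogeneous_flag_poly: "bihomogeneous (flag_poly m :: 'a::field lpoly)"
proof -
  have lin: "bihom (1, 0) (pconst (pconst a) * pconst (pvar i) :: 'a lpoly)" for a i
    using bihom_mult[OF bihom_const[of a] bihom_pconst_pvar[of i]] by simp
  have quad: "bihom (0, pic l + pic k) (pvar l * pvar k :: 'a lpoly)" for l k
    using bihom_mult[OF bihom_pvar[of l] bihom_pvar[of k]] by simp
  have quad': "bihom (0, pic l + pic k) (pconst (pconst a) * (pvar l * pvar k) :: 'a lpoly)" for a l k
    using bihom_mult[OF bihom_const[of a] quad[of l k]] by simp
  have deg: "pic (F I1 I3) + pic (E I3) = pic (F I1 I2) + pic (E I2)"
    "pic (F I2 I3) + pic (E I3) = pic (F I1 I2) + pic (E I1)"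
    by (simp_all add: pic_F pic_E)
  have "\<exists>d. bihom d (flag_poly m :: 'a lpoly)"
  proof (cases "m < 5")
    case True
    then show ?thesis unfolding flag_poly_def by (auto intro!: exI[of _ "(1, 0)"] bihom_add lin)
  next
    case False
    show ?thesis
    proof (cases "m = 5")
      case True
      then show ?thesis unfolding flag_poly_def
        using bihom_add[OF quad[of "F I1 I2" "E I2"] quad'[of "F I1 I3" "E I3" "- 1", unfolded deg]] by auto
    next
      case m: False
      then show ?thesis unfolding flag_poly_def
        using False bihom_add[OF quad[of "F I1 I2" "E I1"] quad'[of "F I2 I3" "E I3" "- 1", unfolded deg]] by auto
    qed
  qed
  then show ?thesis unfolding bihomogeneous_iff .
qed

definition flag :: "nat \<Rightarrow> 'a::field ambient_point set" where
  "flag n = section_family \<inter> variety (\<lambda>a. a) (flag_poly ` {..<n})"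

lemma flag_closed: "zariski_closed_in section_family (flag n)"
  unfolding zariski_closed_in_def flag_def
  by (intro exI[of _ "variety (\<lambda>a. a) (flag_poly ` {..<n})"] conjI HOL.refl zariski_closed_variety)
     (simp add: bihomogeneous_flag_poly)

lemma pt_in_flag:
  assumes "nondegenerate \<delta> x"
  shows "pt \<delta> (usec \<delta> x) \<in> flag n \<longleftrightarrow> (\<forall>m<n. flag_value m \<delta> x = 0)"
proof -
  have "pt \<delta> (usec \<delta> x) \<in> section_family" using assms unfolding section_family_def by blast
  then show ?thesis
    unfolding flag_def using pt_in_variety[of "flag_poly ` {..<n}" \<delta> "usec \<delta> x"] nondegenerate_proper[OF assms]
    by (auto simp: bihomogeneous_flag_poly eval2_flag_poly)
qed

lemma nondegenerate_rescale:
  assumes nd: "nondegenerate \<delta> x" and c: "c \<noteq> 0"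
  obtains x' where "nondegenerate (\<lambda>i. c * \<delta> i) x'" "pt \<delta> (usec \<delta> x) = pt (\<lambda>i. c * \<delta> i) (usec (\<lambda>i. c * \<delta> i) x')"
proof -
  obtain x' where x': "pt \<delta> (section_at \<delta> x (\<lambda>_. 1)) = pt (\<lambda>i. c * \<delta> i) (usec (\<lambda>i. c * \<delta> i) x')"
    using pt_section_normalize[of c "\<lambda>_. 1" \<delta> x] c by auto
  then have eq: "pt \<delta> (usec \<delta> x) = pt (\<lambda>i. c * \<delta> i) (usec (\<lambda>i. c * \<delta> i) x')" by simp
  then have "usec (\<lambda>i. c * \<delta> i) x' l \<noteq> 0" for l
  proof (rule pt_eq)
    fix b s assume "\<And>k. s k \<noteq> 0" "usec (\<lambda>i. c * \<delta> i) x' = (\<lambda>l. torus_char s (pic l) * usec \<delta> x l)"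
    then show ?thesis using nd by (simp add: torus_char_nonzero nondegenerate_def)
  qed
  then have "nondegenerate (\<lambda>i. c * \<delta> i) x'"
    using nd roots_scale[OF c] by (simp add: nondegenerate_def)
  then show ?thesis using that eq by blast
qed

lemma base_\<delta>_roots: "0 \<notin> roots (\<chi> i. (base_\<delta> i :: 'a::field_char_0))"
  unfolding base_\<delta>_def by (rule generic_roots)

lemma root_diff_nonzero: "0 \<notin> roots (\<chi> i. \<delta> i) \<Longrightarrow> i \<noteq> j \<Longrightarrow> \<delta> i - \<delta> j \<noteq> 0"
  using uroot_diff[of i j \<delta>] unfolding uroot_def by auto

lemma root_sum_nonzero: "0 \<notin> roots (\<chi> i. \<delta> i) \<Longrightarrow> distinct [i, j, k] \<Longrightarrow> \<delta> i + \<delta> j + \<delta> k \<noteq> 0"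
  using uroot_sum3[of i j k \<delta>] by (metis add.inverse_neutral uroot_def)

lemma sphi_segment_x: "sphi \<delta> (segment_x x0 x1 \<tau>) i j = (1 - \<tau>) * sphi \<delta> x0 i j + \<tau> * sphi \<delta> x1 i j"
  by (simp add: sphi_def segment_x_def algebra_simps)

text \<open>The root \<open>d_1 - d_2\<close> never vanishes on the family, so it can be scaled to a
  fixed value. With this normalization the conditions become affine and survive along
  segments.\<close>

lemma flag_rep:
  fixes p :: "'a::field_char_0 ambient_point"
  assumes "p \<in> flag n"
  obtains \<delta> x where "nondegenerate \<delta> x" "p = pt \<delta> (usec \<delta> x)" "\<delta> I1 - \<delta> I2 = base_\<delta> I1 - base_\<delta> I2"
    "\<forall>m<n. flag_value m \<delta> x = 0"
proof -
  obtain \<delta> x where p: "p = pt \<delta> (usec \<delta> x)" and nd: "nondegenerate \<delta> x"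
    using assms unfolding flag_def section_family_def by blast
  have l: "\<delta> I1 - \<delta> I2 \<noteq> 0" using nd by (intro root_diff_nonzero) (auto simp: nondegenerate_def)
  have b: "(base_\<delta> I1 - base_\<delta> I2 :: 'a) \<noteq> 0" by (intro root_diff_nonzero base_\<delta>_roots) simp
  define c where "c = (base_\<delta> I1 - base_\<delta> I2) / (\<delta> I1 - \<delta> I2)"
  have c: "c \<noteq> 0" "c * (\<delta> I1 - \<delta> I2) = base_\<delta> I1 - base_\<delta> I2" using l b by (simp_all add: c_def)
  obtain x' where x': "nondegenerate (\<lambda>i. c * \<delta> i) x'"
    "pt \<delta> (usec \<delta> x) = pt (\<lambda>i. c * \<delta> i) (usec (\<lambda>i. c * \<delta> i) x')"
    using nondegenerate_rescale[OF nd c(1)] by metis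
  show ?thesis
  proof (rule that)
    show "\<forall>m<n. flag_value m (\<lambda>i. c * \<delta> i) x' = 0"
      using pt_in_flag[OF x'(1)] assms unfolding p x'(2) by blast
    show "c * \<delta> I1 - c * \<delta> I2 = base_\<delta> I1 - base_\<delta> I2" using c(2) by (simp add: algebra_simps)
  qed (use x' p in auto)
qed

lemma flag_nonempty: "pt base_\<delta> (usec base_\<delta> base_x) \<in> (flag n :: 'a::field_char_0 ambient_point set)"
  unfolding pt_in_flag[OF nondegenerate_base_x[OF base_\<delta>_roots]]
  by (simp add: flag_value_def sphi_def base_x_def)

lemma flag_segment:
  fixes \<delta>0 \<delta>1 :: "idx \<Rightarrow> 'a::field_char_0"
  assumes "\<delta>0 I1 - \<delta>0 I2 = base_\<delta> I1 - base_\<delta> I2" "\<delta>1 I1 - \<delta>1 I2 = base_\<delta> I1 - base_\<delta> I2"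
    and "\<forall>m<n. flag_value m \<delta>0 x0 = 0" "\<forall>m<n. flag_value m \<delta>1 x1 = 0" "m < n"
  shows "flag_value m (segment_\<delta> \<delta>0 \<delta>1 \<tau>) (segment_x x0 x1 \<tau>) = 0"
proof (cases "m < 5")
  case True
  then have "flag_value m (segment_\<delta> \<delta>0 \<delta>1 \<tau>) (segment_x x0 x1 \<tau>)
      = (1 - \<tau>) * flag_value m \<delta>0 x0 + \<tau> * flag_value m \<delta>1 x1"
    by (simp add: flag_value_def segment_\<delta>_def algebra_simps)
  then show ?thesis using assms(3-5) by simp
next
  case False
  have b: "(base_\<delta> I1 - base_\<delta> I2 :: 'a) \<noteq> 0" by (intro root_diff_nonzero base_\<delta>_roots) simp
  \<comment> \<open>Once the first five conditions hold, the parameters equal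
    \<open>base_\<delta>\<close> and stay constant along the segment, so that the last two
    conditions are linear in \<open>x\<close> alone.\<close>
  have base: "\<delta> = base_\<delta>" if l: "\<delta> I1 - \<delta> I2 = base_\<delta> I1 - base_\<delta> I2" and fl: "\<forall>m<n. flag_value m \<delta> x = 0"
    for \<delta> :: "idx \<Rightarrow> 'a" and x
  proof
    fix i
    have eq: "\<delta> (idxs ! Suc k) = base_\<delta> (idxs ! Suc k)" if "k < 5" for k
    proof -
      have "k < n" using that False assms(5) by simp
      then have "(base_\<delta> I1 - base_\<delta> I2) * \<delta> (idxs ! Suc k) = (base_\<delta> I1 - base_\<delta> I2) * base_\<delta> (idxs ! Suc k)"
        using fl that by (auto simp: flag_value_def l mult.commute)
      then show ?thesis using b by simp
    qed
    have "\<delta> I2 = base_\<delta> I2" "\<delta> I3 = base_\<delta> I3" "\<delta> I4 = base_\<delta> I4" "\<delta> I5 = base_\<delta> I5" "\<delta> I6 = base_\<delta> I6"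
      using eq[of 0] eq[of 1] eq[of 2] eq[of 3] eq[of 4] by (simp_all add: idxs_def numeral_eq_Suc)
    moreover from this have "\<delta> I1 = base_\<delta> I1" using l by simp
    ultimately show "\<delta> i = base_\<delta> i" by (cases i) simp_all
  qed
  have "\<delta>0 = base_\<delta>" "\<delta>1 = base_\<delta>" using base assms(1-4) by blast+
  then have "flag_value m (segment_\<delta> \<delta>0 \<delta>1 \<tau>) (segment_x x0 x1 \<tau>)
      = (1 - \<tau>) * flag_value m \<delta>0 x0 + \<tau> * flag_value m \<delta>1 x1"
    using False by (simp add: flag_value_def sphi_segment_x algebra_simps)
  then show ?thesis using assms(3-5) by simp
qed

lemma flag_irreducible: "irreducible_closed_in section_family (flag n :: 'a::field_char_0 ambient_point set)"
proof (rule irreducible_by_segments[OF flag_closed])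
  show "flag n \<noteq> ({} :: 'a ambient_point set)" using flag_nonempty by blast
  fix p q :: "'a ambient_point" assume "p \<in> flag n" "q \<in> flag n"
  obtain \<delta>0 x0 where 0: "nondegenerate \<delta>0 x0" "p = pt \<delta>0 (usec \<delta>0 x0)" "\<delta>0 I1 - \<delta>0 I2 = base_\<delta> I1 - base_\<delta> I2"
    "\<forall>m<n. flag_value m \<delta>0 x0 = 0" using flag_rep[OF \<open>p \<in> flag n\<close>] .
  obtain \<delta>1 x1 where 1: "nondegenerate \<delta>1 x1" "q = pt \<delta>1 (usec \<delta>1 x1)" "\<delta>1 I1 - \<delta>1 I2 = base_\<delta> I1 - base_\<delta> I2"
    "\<forall>m<n. flag_value m \<delta>1 x1 = 0" using flag_rep[OF \<open>q \<in> flag n\<close>] .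
  have "pt (segment_\<delta> \<delta>0 \<delta>1 \<tau>) (usec (segment_\<delta> \<delta>0 \<delta>1 \<tau>) (segment_x x0 x1 \<tau>)) \<in> flag n"
    if "nondegenerate (segment_\<delta> \<delta>0 \<delta>1 \<tau>) (segment_x x0 x1 \<tau>)" for \<tau>
    unfolding pt_in_flag[OF that] using flag_segment[OF 0(3) 1(3) 0(4) 1(4)] by blast
  then show "\<exists>\<delta>0 x0 \<delta>1 x1. nondegenerate \<delta>0 x0 \<and> nondegenerate \<delta>1 x1 \<and>
        p = pt \<delta>0 (usec \<delta>0 x0) \<and> q = pt \<delta>1 (usec \<delta>1 x1) \<and>
        (\<forall>\<tau>. nondegenerate (segment_\<delta> \<delta>0 \<delta>1 \<tau>) (segment_x x0 x1 \<tau>) \<longrightarrow>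
           pt (segment_\<delta> \<delta>0 \<delta>1 \<tau>) (usec (segment_\<delta> \<delta>0 \<delta>1 \<tau>) (segment_x x0 x1 \<tau>)) \<in> flag n)"
    using 0(1,2) 1(1,2) by blast
qed

text \<open>A direction at the base point along which the earlier conditions remain zero while
  condition \<open>m\<close> grows linearly; it will show that the inclusions are strict.\<close>

lemma flag_direction:
  assumes "m < 7"
  obtains \<delta>1 x1 and \<kappa> :: "'a::field_char_0" where "\<kappa> \<noteq> 0"
    "\<And>\<tau> k. k < m \<Longrightarrow> flag_value k (segment_\<delta> base_\<delta> \<delta>1 \<tau>) (segment_x base_x x1 \<tau>) = 0"
    "\<And>\<tau>. flag_value m (segment_\<delta> base_\<delta> \<delta>1 \<tau>) (segment_x base_x x1 \<tau>) = \<tau> * \<kappa>"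
proof -
  let ?b = "base_\<delta> :: idx \<Rightarrow> 'a"
  note nz = root_diff_nonzero[OF base_\<delta>_roots[where 'a = 'a]] root_sum_nonzero[OF base_\<delta>_roots[where 'a = 'a]]
  have bx: "base_x $ 1 = (0::'a)" "base_x $ 2 = (0::'a)" "base_x $ 3 = (1::'a)" by (simp_all add: base_x_def)
  have l: "?b I1 - ?b I2 \<noteq> 0" by (rule nz) simp
  consider "m = 0" | "0 < m" "m < 5" | "m = 5" | "m = 6" using assms by linarith
  then show ?thesis
  proof cases
    case 1
    \<comment> \<open>The condition is on \<open>d_2\<close>; moving \<open>d_1\<close> along with
      it keeps the normalizing difference fixed.\<close>
    show ?thesis
      by (rule that[OF l, of "?b(I1 := ?b I1 + 1, I2 := ?b I2 + 1)" base_x])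
         (auto simp: 1 flag_value_def segment_\<delta>_def idxs_def algebra_simps)
  next
    case 2
    define i where "i = idxs ! Suc m"
    have i: "i \<noteq> I1" "i \<noteq> I2"
      unfolding i_def using 2 by (auto simp: idxs_def numeral_eq_Suc less_Suc_eq)
    have ne: "idxs ! Suc k \<noteq> i" if "k < m" for k
      unfolding i_def using that 2 by (subst nth_eq_iff_index_eq) (auto simp: idxs_def)
    show ?thesis
      by (rule that[OF l, of "?b(i := ?b i + 1)" base_x])
         (use 2 i ne in \<open>auto simp: flag_value_def segment_\<delta>_def i_def[symmetric] algebra_simps\<close>)
  next
    case 3
    define \<kappa> where "\<kappa> = (?b I2 - ?b I3) * (?b I1 + ?b I2 + ?b I3)"
    have "\<kappa> \<noteq> 0" unfolding \<kappa>_def using nz(1)[of I2 I3] nz(2)[of I1 I2 I3] by simp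
    then show ?thesis
      by (rule that[of _ ?b "vector [0, 1, 1]"])
         (auto simp: 3 flag_value_def sphi_def segment_x_def bx \<kappa>_def algebra_simps power2_eq_square)
  next
    case 4
    \<comment> \<open>Moving \<open>x\<close> along \<open>(1, d_1, 0)\<close> keeps
      \<open>x_2 - d_1 * x_1\<close>, and with it condition 5, equal to zero.\<close>
    define \<kappa> where "\<kappa> = (?b I1 - ?b I2) * ((?b I1 - ?b I3) * (?b I1 + ?b I2 + ?b I3))"
    have "\<kappa> \<noteq> 0" unfolding \<kappa>_def using l nz(1)[of I1 I3] nz(2)[of I1 I2 I3] by simp
    then show ?thesis
      by (rule that[of _ ?b "vector [1, ?b I1, 1]"])
         (auto simp: 4 flag_value_def sphi_def segment_x_def bx \<kappa>_def algebra_simps power2_eq_square)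
  qed
qed

lemma flag_strict:
  assumes "m < 7" shows "flag (Suc m) \<subset> (flag m :: 'a::field_char_0 ambient_point set)"
proof
  show "flag (Suc m) \<subseteq> (flag m :: 'a ambient_point set)"
    unfolding flag_def variety_pt by fastforce
  obtain \<delta>1 x1 and \<kappa> :: 'a where k: "\<kappa> \<noteq> 0"
    "\<And>\<tau> k. k < m \<Longrightarrow> flag_value k (segment_\<delta> base_\<delta> \<delta>1 \<tau>) (segment_x base_x x1 \<tau>) = 0"
    "\<And>\<tau>. flag_value m (segment_\<delta> base_\<delta> \<delta>1 \<tau>) (segment_x base_x x1 \<tau>) = \<tau> * \<kappa>"
    by (rule flag_direction[OF assms]) blast
  obtain N H where N: "\<And>\<tau>. poly N \<tau> \<noteq> 0 \<longleftrightarrow> nondegenerate (segment_\<delta> base_\<delta> \<delta>1 \<tau>) (segment_x base_x x1 \<tau>)"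
    and "\<And>h \<tau>. poly (H h) \<tau> = eval2 (segment_\<delta> base_\<delta> \<delta>1 \<tau>) (usec (segment_\<delta> base_\<delta> \<delta>1 \<tau>) (segment_x base_x x1 \<tau>)) h"
    using segment_polynomials[of base_\<delta> \<delta>1 base_x x1] by metis
  have "poly N 0 \<noteq> 0" unfolding N using nondegenerate_base_x[OF base_\<delta>_roots] by simp
  then have "N * [:0, 1:] \<noteq> 0" by auto
  then obtain \<tau> where "poly (N * [:0, 1:]) \<tau> \<noteq> 0" by (rule poly_nonroot)
  then have nd: "nondegenerate (segment_\<delta> base_\<delta> \<delta>1 \<tau>) (segment_x base_x x1 \<tau>)" and "\<tau> \<noteq> 0"
    unfolding N[symmetric] by auto
  let ?p = "pt (segment_\<delta> base_\<delta> \<delta>1 \<tau>) (usec (segment_\<delta> base_\<delta> \<delta>1 \<tau>) (segment_x base_x x1 \<tau>))"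
  have "?p \<in> flag m" "?p \<notin> flag (Suc m)"
    unfolding pt_in_flag[OF nd] using k \<open>\<tau> \<noteq> 0\<close> by auto
  then show "flag (Suc m) \<noteq> (flag m :: 'a ambient_point set)" by blast
qed

lemma krull_dim_section_family_ge: "7 \<le> krull_dim (section_family :: 'a::field_char_0 ambient_point set)"
proof -
  let ?C = "\<lambda>j. flag (7 - j) :: 'a ambient_point set"
  have "?C i \<subset> ?C (Suc i)" if "i < 7" for i
  proof -
    have "7 - i = Suc (6 - i)" "7 - Suc i = 6 - i" "6 - i < 7" using that by simp_all
    then show ?thesis using flag_strict[of "6 - i"] by metis
  qed
  then have "\<exists>C :: nat \<Rightarrow> 'a ambient_point set.
     (\<forall>i\<le>7. irreducible_closed_in section_family (C i)) \<and> (\<forall>i<7. C i \<subset> C (Suc i))"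
    by (intro exI[of _ ?C]) (simp add: flag_irreducible)
  then have "enat 7 \<le> krull_dim (section_family :: 'a ambient_point set)"
    unfolding krull_dim_def by (intro Sup_upper) blast
  then show ?thesis by (simp add: numeral_eq_enat)
qed

section \<open>Upper bound for the dimension\<close>

section \<open>Algebraic dependence\<close>

text \<open>Gaussian elimination, one equation at a time: a pivot unknown is removed together with
  its equation, so the unknowns stay in excess.\<close>

lemma linear_system_nontrivial:
  fixes A :: "'i \<Rightarrow> 'j \<Rightarrow> 'a::field"
  assumes "finite J" "finite I" "card J < card I"
  shows "\<exists>c. (\<exists>i\<in>I. c i \<noteq> 0) \<and> (\<forall>j\<in>J. (\<Sum>i\<in>I. c i * A i j) = 0)"
  using assms
proof (induction J arbitrary: I A rule: finite_induct)
  case empty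
  then obtain i where "i \<in> I" by (metis card.empty ex_in_conv less_irrefl)
  then show ?case by (intro exI[of _ "\<lambda>_. 1"]) auto
next
  case (insert j J)
  show ?case
  proof (cases "\<forall>i\<in>I. A i j = 0")
    case True
    moreover have "card J < card I" using insert by simp
    ultimately show ?thesis using insert.IH[OF insert.prems(1), of A] by auto
  next
    case False
    then obtain k where k: "k \<in> I" "A k j \<noteq> 0" by blast
    define B where "B i n = A i n - A i j / A k j * A k n" for i n
    have "card J < card (I - {k})" using insert k by simp
    then obtain c where c: "\<exists>i\<in>I - {k}. c i \<noteq> 0" "\<forall>n\<in>J. (\<Sum>i\<in>I - {k}. c i * B i n) = 0"
      using insert.IH[of "I - {k}" B] insert.prems(1) by auto
    define d where "d i = (if i = k then - (\<Sum>i\<in>I - {k}. c i * A i j) / A k j else c i)" for i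
    have split: "(\<Sum>i\<in>I. d i * A i n) = d k * A k n + (\<Sum>i\<in>I - {k}. c i * A i n)" for n
      using k insert.prems(1) by (subst sum.remove[of I k]) (auto simp: d_def intro!: sum.cong)
    have "(\<Sum>i\<in>I. d i * A i n) = 0" if n: "n \<in> insert j J" for n
    proof (cases "n = j")
      case True
      then show ?thesis unfolding split using k by (simp add: d_def)
    next
      case False
      have "(\<Sum>i\<in>I - {k}. c i * B i n) = (\<Sum>i\<in>I - {k}. c i * A i n) - (\<Sum>i\<in>I - {k}. c i * A i j) / A k j * A k n"
        by (simp add: B_def algebra_simps sum_subtractf sum_distrib_left sum_distrib_right sum_divide_distrib)
      also have "\<dots> = (\<Sum>i\<in>I. d i * A i n)" unfolding split by (simp add: d_def)
      finally show ?thesis using c(2) False n by simp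
    qed
    moreover have "\<exists>i\<in>I. d i \<noteq> 0" using c(1) by (auto simp: d_def)
    ultimately show ?thesis by blast
  qed
qed

definition exponents_le :: "nat \<Rightarrow> (('v \<Rightarrow>\<^sub>0 nat) \<Rightarrow>\<^sub>0 'a::comm_ring_1) \<Rightarrow> bool" where
  "exponents_le T p \<longleftrightarrow> (\<forall>m\<in>Poly_Mapping.keys p. \<forall>v. Poly_Mapping.lookup m v \<le> T)"

lemma exponents_le_mult: "exponents_le S p \<Longrightarrow> exponents_le T q \<Longrightarrow> exponents_le (S + T) (p * q)"
  unfolding exponents_le_def
proof (intro ballI allI)
  fix m v assume p: "\<forall>m\<in>Poly_Mapping.keys p. \<forall>v. Poly_Mapping.lookup m v \<le> S"
    and q: "\<forall>m\<in>Poly_Mapping.keys q. \<forall>v. Poly_Mapping.lookup m v \<le> T" and "m \<in> Poly_Mapping.keys (p * q)"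
  then obtain a b where "m = a + b" "a \<in> Poly_Mapping.keys p" "b \<in> Poly_Mapping.keys q"
    using keys_mult[of p q] by blast
  then show "Poly_Mapping.lookup m v \<le> S + T"
    using p q by (simp add: lookup_add add_mono)
qed

lemma exponents_le_1: "exponents_le 0 1"
  using keys_one by (auto simp: exponents_le_def)

lemma exponents_le_power: "exponents_le T p \<Longrightarrow> exponents_le (k * T) (p ^ k)"
proof (induction k)
  case (Suc k)
  then show ?case using exponents_le_mult[OF Suc.prems Suc.IH] by simp
qed (simp add: exponents_le_1)

lemma exponents_le_prod:
  "(\<And>i. i \<in> A \<Longrightarrow> exponents_le (T i) (p i)) \<Longrightarrow> exponents_le (\<Sum>i\<in>A. T i) (\<Prod>i\<in>A. p i)"
proof (induction A rule: infinite_finite_induct)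
  case (insert x F)
  then show ?case using exponents_le_mult[of "T x" "p x" "sum T F" "prod p F"] by simp
qed (simp_all add: exponents_le_1)

lemma exponents_le_mono: "exponents_le S p \<Longrightarrow> S \<le> T \<Longrightarrow> exponents_le T p"
  unfolding exponents_le_def by (meson le_trans)

lemma exponents_le_exists: "\<exists>T. exponents_le T (p :: ('v::finite \<Rightarrow>\<^sub>0 nat) \<Rightarrow>\<^sub>0 'a::comm_ring_1)"
proof -
  have "Poly_Mapping.lookup m v \<le> (\<Sum>m\<in>Poly_Mapping.keys p. \<Sum>v\<in>UNIV. Poly_Mapping.lookup m v)"
    if "m \<in> Poly_Mapping.keys p" for m v
  proof -
    have "Poly_Mapping.lookup m v \<le> (\<Sum>v\<in>UNIV. Poly_Mapping.lookup m v)" by (rule member_le_sum) auto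
    also have "\<dots> \<le> (\<Sum>m\<in>Poly_Mapping.keys p. \<Sum>v\<in>UNIV. Poly_Mapping.lookup m v)"
      by (rule member_le_sum) (use that in auto)
    finally show ?thesis .
  qed
  then show ?thesis unfolding exponents_le_def by blast
qed

lemma card_bounded_monomials:
  "finite {m :: 'v::finite \<Rightarrow>\<^sub>0 nat. \<forall>v. Poly_Mapping.lookup m v \<le> L}"
  "card {m :: 'v::finite \<Rightarrow>\<^sub>0 nat. \<forall>v. Poly_Mapping.lookup m v \<le> L} \<le> (L + 1) ^ CARD('v)"
proof -
  let ?S = "{m :: 'v \<Rightarrow>\<^sub>0 nat. \<forall>v. Poly_Mapping.lookup m v \<le> L}"
  let ?T = "PiE (UNIV :: 'v set) (\<lambda>_. {..L})"
  have inj: "inj_on Poly_Mapping.lookup ?S" by (rule inj_onI) (simp only: poly_mapping.lookup_inject)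
  have sub: "Poly_Mapping.lookup ` ?S \<subseteq> ?T" by auto
  have fin: "finite ?T" by (rule finite_PiE) auto
  show "finite ?S" using finite_imageD[OF finite_subset[OF sub fin] inj] .
  have "card ?S \<le> card ?T" by (rule card_inj_on_le[OF inj sub fin])
  then show "card ?S \<le> (L + 1) ^ CARD('v)" by (simp add: card_PiE)
qed

text \<open>Counting: the \<open>M ^ n\<close> monomials in the \<open>P i\<close> with exponents
  below \<open>M\<close> lie in a space of dimension at most \<open>(n * M * T + 1) ^ d\<close>,
  with \<open>d\<close> the number of variables, and \<open>n > d\<close> wins for large
  \<open>M\<close>. The relation is returned with its exact support, since its exponents are
  analysed later.\<close>

lemma algebraic_dependence:
  fixes P :: "nat \<Rightarrow> ('v::finite \<Rightarrow>\<^sub>0 nat) \<Rightarrow>\<^sub>0 'a::field"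
  assumes n: "CARD('v) < n"
  obtains M S and c :: "(nat \<Rightarrow> nat) \<Rightarrow> 'a" where "S \<noteq> {}" "S \<subseteq> PiE {..<n} (\<lambda>_. {..<M})"
    "\<And>k. k \<in> S \<Longrightarrow> c k \<noteq> 0" "(\<Sum>k\<in>S. pconst (c k) * (\<Prod>i<n. P i ^ k i)) = 0"
proof -
  let ?d = "CARD('v)"
  have "\<forall>i. \<exists>T. exponents_le T (P i)" using exponents_le_exists by blast
  then obtain T' where T': "\<And>i. exponents_le (T' i) (P i)" by metis
  define T where "T = (\<Sum>i<n. T' i)"
  have T: "exponents_le T (P i)" if "i < n" for i
    using exponents_le_mono[OF T'[of i]] member_le_sum[of i "{..<n}" T'] that by (simp add: T_def)
  \<comment> \<open>As \<open>L + 1\<close> is at most \<open>M * (n * T + 1)\<close>, it suffices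
    that \<open>M\<close> exceeds \<open>(n * T + 1) ^ d\<close>.\<close>
  define M where "M = (n * T + 1) ^ ?d + 1"
  define L where "L = n * (M * T)"
  let ?I = "PiE {..<n} (\<lambda>_. {..<M})"
  let ?J = "{m :: 'v \<Rightarrow>\<^sub>0 nat. \<forall>v. Poly_Mapping.lookup m v \<le> L}"
  let ?Q = "\<lambda>k. \<Prod>i<n. P i ^ k i"
  have Q: "exponents_le L (?Q k)" if k: "k \<in> ?I" for k
  proof -
    have "exponents_le (\<Sum>i<n. M * T) (?Q k)"
    proof (rule exponents_le_prod)
      fix i assume i: "i \<in> {..<n}"
      then have "k i < M" using k by (auto simp: PiE_iff)
      then show "exponents_le (M * T) (P i ^ k i)"
        using exponents_le_mono[OF exponents_le_power[OF T, of i "k i"]] i by simp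
    qed
    then show ?thesis by (simp add: L_def)
  qed
  have "card ?J < card ?I"
  proof -
    have "L + 1 \<le> M * (n * T + 1)" by (simp add: L_def M_def algebra_simps)
    then have "(L + 1) ^ ?d \<le> (M * (n * T + 1)) ^ ?d" by (rule power_mono) simp
    also have "\<dots> = M ^ ?d * (n * T + 1) ^ ?d" by (rule power_mult_distrib)
    also have "\<dots> < M ^ ?d * M" by (simp add: M_def)
    also have "\<dots> = M ^ Suc ?d" by simp
    also have "\<dots> \<le> M ^ n" using n by (intro power_increasing) (auto simp: M_def)
    also have "\<dots> = card ?I" by (simp add: card_PiE)
    finally show ?thesis using card_bounded_monomials(2)[of L, where 'v = 'v] by linarith
  qed
  moreover have "finite ?I" by (rule finite_PiE) auto
  ultimately obtain c where c: "\<exists>k\<in>?I. c k \<noteq> 0"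
    "\<forall>m\<in>?J. (\<Sum>k\<in>?I. c k * Poly_Mapping.lookup (?Q k) m) = 0"
    using linear_system_nontrivial[OF card_bounded_monomials(1), of ?I L "\<lambda>k m. Poly_Mapping.lookup (?Q k) m"] by blast
  define S where "S = {k \<in> ?I. c k \<noteq> 0}"
  have lk: "Poly_Mapping.lookup (pconst a * p) m = a * Poly_Mapping.lookup p m" for a m and p :: "('v \<Rightarrow>\<^sub>0 nat) \<Rightarrow>\<^sub>0 'a"
  proof (induction p rule: poly_mapping_single_induct)
    case (single m' b)
    then show ?case by (simp add: pconst_def mult_single lookup_single when_def)
  qed (simp add: algebra_simps lookup_add)
  have "(\<Sum>k\<in>?I. pconst (c k) * ?Q k) = 0"
  proof (rule poly_mapping_eqI)
    fix m
    have "(\<Sum>k\<in>?I. c k * Poly_Mapping.lookup (?Q k) m) = 0"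
    proof (cases "m \<in> ?J")
      case False
      then have "Poly_Mapping.lookup (?Q k) m = 0" if "k \<in> ?I" for k
        using Q[OF that] unfolding exponents_le_def by (auto simp: in_keys_iff)
      then show ?thesis by (intro sum.neutral) simp
    qed (use c in blast)
    then show "Poly_Mapping.lookup (\<Sum>k\<in>?I. pconst (c k) * ?Q k) m = Poly_Mapping.lookup 0 m"
      by (simp add: lookup_sum lk)
  qed
  moreover have "(\<Sum>k\<in>?I. pconst (c k) * ?Q k) = (\<Sum>k\<in>S. pconst (c k) * ?Q k)"
    using \<open>finite ?I\<close> by (intro sum.mono_neutral_right) (auto simp: S_def rhom_zero[OF rhom_pconst])
  ultimately show ?thesis using c(1) by (intro that[of S M c]) (auto simp: S_def)
qed

section \<open>Upper bound for the dimension\<close>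

lemma torus_char_split:
  fixes s :: "idx option \<Rightarrow> 'a::field"
  shows "torus_char s (pic l) = s None powi (pic l $ None) * (\<Prod>i\<in>UNIV. s (Some i) powi (pic l $ Some i))"
  unfolding torus_char_def UNIV_option by (subst prod.insert) (auto simp: prod.reindex)

text \<open>Replacing \<open>x\<close> by \<open>x\<close> times the product of all
  \<open>t i\<close> clears the negative powers of \<open>t\<close>: the exponent of
  \<open>t i\<close> becomes the sum of the \<open>i\<close>-th and the hyperplane coefficient of
  the class, which is never negative. Algebraic dependence needs honest polynomials.\<close>

definition monic_section :: "(idx \<Rightarrow> 'b::comm_ring_1) \<Rightarrow> 'b ^ 3 \<Rightarrow> (idx \<Rightarrow> 'b) \<Rightarrow> line \<Rightarrow> 'b" where
  "monic_section \<delta> x t l = usec \<delta> x l * (\<Prod>i\<in>UNIV. t i ^ nat (pic l $ Some i + pic l $ None))"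

lemma rhom_monic_section:
  assumes "rhom h"
  shows "h (monic_section \<delta> x t l) = monic_section (\<lambda>i. h (\<delta> i)) (\<chi> k. h (x $ k)) (\<lambda>i. h (t i)) l"
  unfolding monic_section_def by (simp add: rhom_simps[OF assms] rhom_psec[OF assms])

lemma usec_scale_x: "usec \<delta> (c *s x) l = c ^ nat (pic l $ None) * usec \<delta> x l"
proof (cases l rule: line_cases)
  case (F i j)
  then show ?thesis by (simp add: psec_simps pic_F_nth sphi_def algebra_simps)
qed (simp_all add: psec_simps pic_nth sconic_def Let_def conic_poly_def algebra_simps power2_eq_square)

lemma section_at_monic:
  fixes t :: "idx \<Rightarrow> 'a::field"
  assumes t: "\<And>i. t i \<noteq> 0"
  shows "section_at \<delta> x t = monic_section \<delta> (inverse (\<Prod>i\<in>UNIV. t i) *s x) t"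
proof
  fix l
  let ?T = "\<Prod>i\<in>UNIV. t i"
  have T: "?T \<noteq> 0" using t by simp
  have n: "nat (of_bool P) = of_bool P" for P by simp
  show "section_at \<delta> x t l = monic_section \<delta> (inverse ?T *s x) t l"
  proof (cases l rule: line_cases)
    case (E i)
    have "(\<Prod>k\<in>UNIV. t k ^ nat (pic l $ Some k + pic l $ None)) = (\<Prod>k\<in>UNIV. if k = i then t k else 1)"
      unfolding E by (intro prod.cong) (auto simp: pic_nth)
    then show ?thesis by (simp add: E monic_section_def psec_simps)
  next
    case (F i j)
    have "(\<Prod>k\<in>UNIV. t k ^ nat (pic l $ Some k + pic l $ None)) * (t i * t j)
        = (\<Prod>k\<in>UNIV. t k ^ nat (pic l $ Some k + pic l $ None)) * (\<Prod>k\<in>UNIV. (if k = i then t k else 1) * (if k = j then t k else 1))"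
      by (simp add: prod.distrib)
    also have "\<dots> = ?T"
      unfolding prod.distrib[symmetric] F(2) using F(1) by (intro prod.cong) (auto simp: pic_F_nth)
    finally have "inverse ?T * (\<Prod>k\<in>UNIV. t k ^ nat (pic l $ Some k + pic l $ None)) = inverse (t i) * inverse (t j)"
      using t T by (simp add: field_simps)
    moreover have "monic_section \<delta> (inverse ?T *s x) t l
        = sphi \<delta> x i j * (inverse ?T * (\<Prod>k\<in>UNIV. t k ^ nat (pic l $ Some k + pic l $ None)))"
      unfolding monic_section_def usec_scale_x using F by (simp add: psec_simps pic_F_nth)
    ultimately show ?thesis using F by (simp add: psec_simps)
  next
    case (G j)
    have "(\<Prod>k\<in>UNIV. t k ^ nat (pic l $ Some k + pic l $ None)) * (\<Prod>k\<in>UNIV - {j}. t k)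
        = (\<Prod>k\<in>UNIV. t k ^ nat (pic l $ Some k + pic l $ None)) * (\<Prod>k\<in>UNIV. if k = j then 1 else t k)"
      by (subst prod.mono_neutral_right[of UNIV "UNIV - {j}"]) auto
    also have "\<dots> = (\<Prod>k\<in>UNIV. t k ^ 2)"
      unfolding prod.distrib[symmetric] G by (intro prod.cong) (auto simp: pic_nth power2_eq_square)
    also have "\<dots> = ?T ^ 2" by (simp add: prod_power_distrib)
    finally have eq: "(\<Prod>k\<in>UNIV. t k ^ nat (pic l $ Some k + pic l $ None)) * (\<Prod>k\<in>UNIV - {j}. t k) = ?T ^ 2" .
    have "(\<Prod>k\<in>UNIV - {j}. t k) * (\<Prod>k\<in>UNIV - {j}. inverse (t k)) = 1"
      using t by (simp flip: prod.distrib)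
    then have "(\<Prod>k\<in>UNIV. t k ^ nat (pic l $ Some k + pic l $ None)) = ?T ^ 2 * (\<Prod>k\<in>UNIV - {j}. inverse (t k))"
      unfolding eq[symmetric] mult.assoc by simp
    then have "inverse ?T ^ 2 * (\<Prod>k\<in>UNIV. t k ^ nat (pic l $ Some k + pic l $ None)) = (\<Prod>k\<in>UNIV - {j}. inverse (t k))"
      using T by (simp add: field_simps)
    moreover have "monic_section \<delta> (inverse ?T *s x) t l
        = sconic \<delta> x j * (inverse ?T ^ 2 * (\<Prod>k\<in>UNIV. t k ^ nat (pic l $ Some k + pic l $ None)))"
      unfolding monic_section_def usec_scale_x using G by (simp add: psec_simps pic_nth)
    ultimately show ?thesis using G by (simp add: psec_simps)
  qed
qed

text \<open>Restriction to the affine cone over the family, parametrized by 6 + 3 + 6 = 15 variables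
  for \<delta>, \<open>x\<close> and \<open>t\<close>.\<close>

definition pullback :: "'a::field lpoly \<Rightarrow> (idx + 3 + idx \<Rightarrow>\<^sub>0 nat) \<Rightarrow>\<^sub>0 'a" where
  "pullback = peval (peval pconst (\<lambda>i. pvar (Inl i)))
     (monic_section (\<lambda>i. pvar (Inl i)) (\<chi> k. pvar (Inr (Inl k))) (\<lambda>i. pvar (Inr (Inr i))))"

lemma rhom_pullback: "rhom pullback"
  unfolding pullback_def by (intro rhom_peval rhom_pconst)

lemma pullback_const: "pullback (pconst (pconst c)) = pconst c"
  by (simp add: pullback_def peval_pconst)

lemma peval_pullback:
  fixes x :: "'a::field ^ 3"
  shows "peval (\<lambda>a. a) (case_sum \<delta> (case_sum (($) x) t)) (pullback h) = eval2 \<delta> (monic_section \<delta> x t) h"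
  unfolding pullback_def peval_comp[OF rhom_peval[OF rhom_id]] rhom_monic_section[OF rhom_peval[OF rhom_id]]
  by (simp add: peval_pconst peval_pvar vec_lambda_eta)

lemma pullback_eq_0_section_ideal:
  fixes h :: "'a::field_char_0 lpoly"
  assumes "pullback h = 0" shows "h \<in> section_ideal"
  unfolding section_ideal_def
proof (intro CollectI allI impI)
  fix \<delta> :: "idx \<Rightarrow> 'a" and x and t :: "idx \<Rightarrow> 'a" assume "\<forall>i. t i \<noteq> 0"
  then show "eval2 \<delta> (section_at \<delta> x t) h = 0"
    using peval_pullback[of \<delta> "inverse (\<Prod>i\<in>UNIV. t i) *s x" t h] section_at_monic[of t \<delta> x]
    by (simp add: assms rhom_zero[OF rhom_peval[OF rhom_id]])
qed

definition weight :: "(nat \<Rightarrow> nat \<times> (int ^ (idx option))) \<Rightarrow> nat \<Rightarrow> (nat \<Rightarrow> nat) \<Rightarrow> nat \<times> (int ^ (idx option))" where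
  "weight d n k = (\<Sum>i<n. k i * fst (d i), \<Sum>i<n. of_nat (k i) *s snd (d i))"

lemma bihom_power: "bihom d f \<Longrightarrow> bihom (k * fst d, of_nat k *s snd d) (f ^ k)"
proof (induction k)
  case 0
  then show ?case using bihom_const[of 1] by (simp add: rhom_one[OF rhom_pconst])
next
  case (Suc k)
  then show ?case using bihom_mult[OF Suc.prems Suc.IH[OF Suc.prems]]
    by (simp add: vector_sadd_rdistrib)
qed

lemma bihom_monomial:
  assumes "\<And>i. i < n \<Longrightarrow> bihom (d i) (q i)"
  shows "bihom (weight d n k) (\<Prod>i<n. q i ^ k i)"
  using assms
proof (induction n)
  case 0
  then show ?case using bihom_const[of 1] by (simp add: weight_def rhom_one[OF rhom_pconst])
next
  case (Suc n)
  have "bihom (weight d n k) (\<Prod>i<n. q i ^ k i)" using Suc by simp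
  from bihom_mult[OF this bihom_power[OF Suc.prems[of n], of "k n"]] show ?case
    by (simp add: weight_def)
qed

lemma bihom_component_sum:
  assumes "finite S" "\<And>k. k \<in> S \<Longrightarrow> bihom (w k) (T k)"
  shows "bisum {m \<in> keys2 (sum T S). bidegree m = e} (coeff2 (sum T S)) = sum T {k \<in> S. w k = e}"
proof (rule coeff2_eqI)
  fix m
  have z: "coeff2 (T k) m = 0" if "k \<in> S" "w k \<noteq> bidegree m" for k
    using assms(2)[OF that(1)] that(2) unfolding bihom_def by (metis in_keys2_iff)
  have "coeff2 (sum T {k \<in> S. w k = e}) m = (if bidegree m = e then coeff2 (sum T S) m else 0)"
  proof (cases "bidegree m = e")
    case True
    have "(\<Sum>k\<in>{k \<in> S. w k = e}. coeff2 (T k) m) = (\<Sum>k\<in>S. coeff2 (T k) m)"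
      using assms(1) z True by (intro sum.mono_neutral_left) auto
    then show ?thesis using True by (simp add: coeff2_sum)
  next
    case False
    then show ?thesis using z by (auto simp: coeff2_sum intro!: sum.neutral)
  qed
  moreover have "finite {m \<in> keys2 (sum T S). bidegree m = e}" by simp
  ultimately show "coeff2 (bisum {m \<in> keys2 (sum T S). bidegree m = e} (coeff2 (sum T S))) m
      = coeff2 (sum T {k \<in> S. w k = e}) m"
    using coeff2_bisum[of "{m \<in> keys2 (sum T S). bidegree m = e}" "coeff2 (sum T S)" m]
    by (auto simp: in_keys2_iff)
qed

text \<open>
  The coordinates that parametrize the cone over a point with non-zero coordinate \<open>d\<^sub>a\<close>: their
  degrees form a basis of the group of bidegrees.
\<close>

definition chart_poly :: "idx \<Rightarrow> nat \<Rightarrow> 'a::field lpoly" where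
  "chart_poly a m = (if m = 0 then pconst (pvar a) else if m = 1 then pvar (F I1 I2) else pvar (E (idxs ! (m - 2))))"

definition chart_degree :: "nat \<Rightarrow> nat \<times> (int ^ (idx option))" where
  "chart_degree m = (if m = 0 then (1, 0) else if m = 1 then (0, pic (F I1 I2)) else (0, pic (E (idxs ! (m - 2)))))"

lemma bihom_chart_poly: "bihom (chart_degree m) (chart_poly a m)"
  using bihom_pconst_pvar[of a] by (auto simp: chart_poly_def chart_degree_def bihom_pvar)

lemma eval2_chart_poly: "proper \<delta> z \<Longrightarrow> \<delta> a \<noteq> 0 \<Longrightarrow> eval2 \<delta> z (chart_poly a m) \<noteq> 0"
  by (simp add: chart_poly_def peval_pconst peval_pvar proper_def)

lemma chart_weight_inj:
  assumes eq: "weight chart_degree 8 k = weight chart_degree 8 k'" and m: "m < 8"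
  shows "k m = k' m"
proof -
  have set: "{..<8} = {0, 1, 2, 3, 4, 5, 6, 7::nat}" by auto
  note defs = weight_def set chart_degree_def idxs_def pic_nth pic_F_nth
  have 0: "k 0 = k' 0" using arg_cong[OF eq, of fst] by (simp add: defs)
  have s: "snd (weight chart_degree 8 k) $ i = snd (weight chart_degree 8 k') $ i" for i using eq by simp
  have 1: "k 1 = k' 1" using s[of None] by (simp add: defs)
  show ?thesis
    using s[of "Some I1"] s[of "Some I2"] s[of "Some I3"] s[of "Some I4"] s[of "Some I5"] s[of "Some I6"] 0 1 m
    by (auto simp: defs less_Suc_eq numeral_eq_Suc)
qed

lemma pt_in_hypersurface:
  "bihomogeneous f \<Longrightarrow> proper \<delta> z \<Longrightarrow> pt \<delta> z \<in> variety (\<lambda>a. a) {f} \<longleftrightarrow> eval2 \<delta> z f = 0"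
  using pt_in_variety[of "{f}" \<delta> z] by simp

lemma closed_in_subset: "zariski_closed_in Y Z \<Longrightarrow> Z \<subseteq> Y \<and> Z \<subseteq> {pt \<delta> z | \<delta> z. proper \<delta> z}"
  unfolding zariski_closed_in_def zariski_closed_def using variety_subset by fastforce

lemma zariski_closed_in_Int:
  assumes "zariski_closed_in Y Z" "zariski_closed K" shows "zariski_closed_in Y (Z \<inter> K)"
proof -
  obtain K' where K': "zariski_closed K'" "Z = Y \<inter> K'" using assms(1) unfolding zariski_closed_in_def by blast
  have "zariski_closed (K' \<inter> K)" using zariski_closed_Inter[of "{K', K}"] K'(1) assms(2) by auto
  then show ?thesis unfolding zariski_closed_in_def K'(2) by (intro exI[of _ "K' \<inter> K"]) auto
qed

text \<open>The prime property: the zeros of the two factors cover \<open>C\<close> by two closed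
  subsets, and one of these must be everything.\<close>

lemma irreducible_mult:
  assumes irr: "irreducible_closed_in Y C" and f: "bihomogeneous f" and g: "bihomogeneous g"
    and sub: "C \<subseteq> variety (\<lambda>a. a) {f * g}"
  shows "C \<subseteq> variety (\<lambda>a. a) {f} \<or> C \<subseteq> variety (\<lambda>a. a) {g}"
proof -
  have closed: "zariski_closed_in Y C" using irr unfolding irreducible_closed_in_def by blast
  have "C = C \<inter> variety (\<lambda>a. a) {f} \<union> C \<inter> variety (\<lambda>a. a) {g}"
  proof
    show "C \<subseteq> C \<inter> variety (\<lambda>a. a) {f} \<union> C \<inter> variety (\<lambda>a. a) {g}"
    proof
      fix p assume p: "p \<in> C"
      then obtain \<delta> z where pz: "p = pt \<delta> z" "proper \<delta> z" using closed_in_subset[OF closed] by blast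
      have "eval2 \<delta> z (f * g) = 0"
        using p sub pt_in_hypersurface[OF bihomogeneous_mult[OF f g] pz(2)] pz(1) by blast
      then have "eval2 \<delta> z f = 0 \<or> eval2 \<delta> z g = 0" by (simp add: rhom_mult[OF rhom_eval2])
      then show "p \<in> C \<inter> variety (\<lambda>a. a) {f} \<union> C \<inter> variety (\<lambda>a. a) {g}"
        using p pz pt_in_hypersurface[OF f pz(2)] pt_in_hypersurface[OF g pz(2)] by blast
    qed
  qed blast
  moreover have "zariski_closed_in Y (C \<inter> variety (\<lambda>a. a) {f})" "zariski_closed_in Y (C \<inter> variety (\<lambda>a. a) {g})"
    using f g by (auto intro!: zariski_closed_in_Int[OF closed] zariski_closed_variety)
  ultimately show ?thesis using irr unfolding irreducible_closed_in_def by blast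
qed

lemma irreducible_power_mult:
  assumes "irreducible_closed_in Y C" "bihomogeneous f" "bihomogeneous g" "\<not> C \<subseteq> variety (\<lambda>a. a) {f}"
    and "C \<subseteq> variety (\<lambda>a. a) {f ^ e * g}"
  shows "C \<subseteq> variety (\<lambda>a. a) {g}"
  using assms(5)
proof (induction e)
  case (Suc e)
  have "bihomogeneous (f ^ e * g)"
    using assms(2) by (intro bihomogeneous_mult[OF _ assms(3)]) (auto simp: bihomogeneous_iff intro: bihom_power)
  then have "C \<subseteq> variety (\<lambda>a. a) {f ^ e * g}"
    using irreducible_mult[OF assms(1,2), of "f ^ e * g"] Suc.prems assms(4) by (simp add: mult.assoc)
  then show ?case by (rule Suc.IH)
qed simp

lemma prod_lessThan_split: "(\<Prod>i<m + n. g i) = (\<Prod>i<m. g i) * (\<Prod>i<n. g (m + i))" for n :: nat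
  by (induction n) (simp_all add: mult.assoc)

lemma separating_polynomial:
  assumes C: "zariski_closed_in Y C" and D: "D \<subseteq> Y" "D \<subseteq> {pt \<delta> z | \<delta> z. proper \<delta> z}" "\<not> D \<subseteq> C"
  obtains f d where "bihom d f" "C \<subseteq> variety (\<lambda>a. a) {f}" "\<not> D \<subseteq> variety (\<lambda>a. a) {f}"
proof -
  obtain P where P: "\<forall>f\<in>P. bihomogeneous f" "C = Y \<inter> variety (\<lambda>a. a) P"
    using C unfolding zariski_closed_in_def zariski_closed_def by blast
  obtain p where p: "p \<in> D" "p \<notin> variety (\<lambda>a. a) P" using D P(2) by blast
  obtain \<delta> z where pz: "p = pt \<delta> z" "proper \<delta> z" using p(1) D(2) by blast
  obtain f where f: "f \<in> P" "eval2 \<delta> z f \<noteq> 0" using p pz pt_in_variety[OF P(1) pz(2)] by blast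
  have bih: "bihomogeneous f" using P f by blast
  then obtain d where d: "bihom d f" unfolding bihomogeneous_iff by blast
  have "p \<notin> variety (\<lambda>a. a) {f}" using pt_in_hypersurface[OF bih pz(2)] f(2) pz(1) by blast
  moreover have "variety (\<lambda>a. a) P \<subseteq> variety (\<lambda>a. a) {f}" unfolding variety_pt using f(1) by blast
  ultimately show ?thesis using that d p(1) P(2) by blast
qed

text \<open>A relation on the family is pushed down the chain. From \<open>C (Suc i)\<close> to
  \<open>C i\<close>, first the common power of \<open>f i\<close> is cancelled, which
  irreducibility permits because \<open>f i\<close> does not vanish on \<open>C (Suc i)\<close>; on
  \<open>C i\<close>, where it does vanish, only the terms of lowest exponent in \<open>f i\<close>
  remain. At the bottom a single monomial in the chart coordinates is left, and it is non-zero at a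
  point of \<open>C 0\<close>.\<close>

lemma no_long_chain:
  fixes C :: "nat \<Rightarrow> 'a::field_char_0 ambient_point set"
  defines "V \<equiv> (variety of_int cox_ideal :: 'a ambient_point set)"
  assumes irr: "\<And>i. i \<le> 8 \<Longrightarrow> irreducible_closed_in V (C i)" and chain: "\<And>i. i < 8 \<Longrightarrow> C i \<subset> C (Suc i)"
  shows False
proof -
  have closed: "zariski_closed_in V (C i)" if "i \<le> 8" for i
    using irr[OF that] unfolding irreducible_closed_in_def by blast
  note sub = closed_in_subset[OF closed]
  have "\<exists>f d. bihom d f \<and> C i \<subseteq> variety (\<lambda>a. a) {f} \<and> \<not> C (Suc i) \<subseteq> variety (\<lambda>a. a) {f}" if i: "i < 8" for i
  proof -
    have le: "i \<le> 8" "Suc i \<le> 8" and "\<not> C (Suc i) \<subseteq> C i" using i chain[OF i] by auto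
    obtain f d where "bihom d f" "C i \<subseteq> variety (\<lambda>a. a) {f}" "\<not> C (Suc i) \<subseteq> variety (\<lambda>a. a) {f}"
      by (rule separating_polynomial[OF closed[OF le(1)] conjunct1[OF sub[OF le(2)]] conjunct2[OF sub[OF le(2)]]
            \<open>\<not> C (Suc i) \<subseteq> C i\<close>])
    then show ?thesis by blast
  qed
  then obtain f d where fd: "\<And>i. i < 8 \<Longrightarrow> bihom (d i) (f i)" and fC: "\<And>i. i < 8 \<Longrightarrow> C i \<subseteq> variety (\<lambda>a. a) {f i}"
    and fC': "\<And>i. i < 8 \<Longrightarrow> \<not> C (Suc i) \<subseteq> variety (\<lambda>a. a) {f i}" by metis
  have fb: "bihomogeneous (f i)" if "i < 8" for i using fd[OF that] bihomogeneous_iff by blast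
  obtain p0 where p0: "p0 \<in> C 0" using irr[of 0] unfolding irreducible_closed_in_def by auto
  then obtain \<delta>0 z0 where pz0: "p0 = pt \<delta>0 z0" "proper \<delta>0 z0" using sub[of 0] by auto
  \<comment> \<open>A chart around \<open>p0\<close>, chosen so that no chart coordinate vanishes at
    this point.\<close>
  then obtain a where a: "\<delta>0 a \<noteq> 0" unfolding proper_def by auto
  \<comment> \<open>Eight separating polynomials and eight chart coordinates: one more than the 15
    parameters.\<close>
  define q where "q i = (if i < 8 then f i else chart_poly a (i - 8))" for i
  have cd: "CARD(idx + 3 + idx) < 16" by (simp add: card_idx)
  obtain M S and c :: "(nat \<Rightarrow> nat) \<Rightarrow> 'a" where S: "S \<noteq> {}" "S \<subseteq> PiE {..<16} (\<lambda>_. {..<M})"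
    and c: "\<And>k. k \<in> S \<Longrightarrow> c k \<noteq> 0" and rel: "(\<Sum>k\<in>S. pconst (c k) * (\<Prod>i<16. pullback (q i) ^ k i)) = 0"
    by (rule algebraic_dependence[OF cd, of "\<lambda>i. pullback (q i)"]) (rule that, assumption+)
  have finS: "finite S" using S(2) by (rule finite_subset) (intro finite_PiE, auto)
  \<comment> \<open>The term of \<open>k\<close> with the factors \<open>f j, ..., f 7\<close>
    stripped off; \<open>w j k\<close> is its bidegree. Keeping the terms of one bidegree together
    is what allows their sum to define a closed set.\<close>
  define T where "T j k = pconst (pconst (c k)) * ((\<Prod>i<j. f i ^ k i) * (\<Prod>m<8. chart_poly a m ^ k (8 + m)))" for j k
  define w where "w j k = weight d j k + weight chart_degree 8 (\<lambda>m. k (8 + m))" for j k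
  have bT: "bihom (w j k) (T j k)" if "j \<le> 8" for j k
  proof -
    have 1: "bihom (weight d j k) (\<Prod>i<j. f i ^ k i)" using that by (intro bihom_monomial fd) simp
    have 2: "bihom (weight chart_degree 8 (\<lambda>m. k (8 + m))) (\<Prod>m<8. chart_poly a m ^ k (8 + m) :: 'a lpoly)"
      by (rule bihom_monomial[OF bihom_chart_poly])
    have "bihom (w j k) ((\<Prod>i<j. f i ^ k i) * (\<Prod>m<8. chart_poly a m ^ k (8 + m)))"
      using bihom_mult[OF 1 2] unfolding w_def plus_prod_def .
    from bihom_mult[OF bihom_const[of "c k"] this]
    show ?thesis by (simp add: T_def)
  qed
  have "sum (T 8) S \<in> section_ideal"
  proof (rule pullback_eq_0_section_ideal)
    have "T 8 k = pconst (pconst (c k)) * (\<Prod>i<16. q i ^ k i)" for k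
      using prod_lessThan_split[of "\<lambda>i. q i ^ k i" 8 8] by (simp add: T_def q_def)
    then show "pullback (sum (T 8) S) = 0"
      using rel by (simp add: rhom_simps[OF rhom_pullback] pullback_const)
  qed
  note component = section_ideal_component[OF this]
  have comp: "sum (T 8) {k \<in> S. w 8 k = e} \<in> section_ideal" for e
  proof -
    have "bisum {m \<in> keys2 (sum (T 8) S). bidegree m = e} (coeff2 (sum (T 8) S)) = sum (T 8) {k \<in> S. w 8 k = e}"
      using finS bT[of 8] by (intro bihom_component_sum) simp_all
    then show ?thesis using component[of e] by (simp only:)
  qed
  obtain k0 where k0: "k0 \<in> S" using S by blast
  \<comment> \<open>Agreement at the stripped exponents ensures that different members of
    \<open>S'\<close> still differ in the exponents that remain.\<close>
  have "\<exists>S'\<subseteq>S. S' \<noteq> {} \<and> (\<forall>k\<in>S'. \<forall>k'\<in>S'. w j k = w j k' \<and> (\<forall>i\<in>{j..<8}. k i = k' i))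
      \<and> C j \<subseteq> variety (\<lambda>a. a) {sum (T j) S'}" if "j \<le> 8" for j
    using that
  proof (induction j rule: inc_induct)
    case base
    let ?S = "{k \<in> S. w 8 k = w 8 k0}"
    have "bihom (w 8 k0) (sum (T 8) ?S)"
    proof (rule bihom_sum)
      fix k assume "k \<in> ?S"
      then show "bihom (w 8 k0) (T 8 k)" using bT[of 8 k] by simp
    qed
    then have "V \<subseteq> variety (\<lambda>a. a) {sum (T 8) ?S}"
      unfolding V_def variety_cox_ideal unfolding variety_pt using comp[of "w 8 k0"] bihomogeneous_iff by blast
    then show ?case using k0 sub[of 8] by (intro exI[of _ ?S]) auto
  next
    case (step i)
    then have i: "i < 8" "i \<le> 8" "Suc i \<le> 8" by auto
    obtain S' where S': "S' \<subseteq> S" "S' \<noteq> {}" and const: "\<And>k k'. k \<in> S' \<Longrightarrow> k' \<in> S' \<Longrightarrow> w (Suc i) k = w (Suc i) k'"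
      "\<And>k k' m. k \<in> S' \<Longrightarrow> k' \<in> S' \<Longrightarrow> m \<in> {Suc i..<8} \<Longrightarrow> k m = k' m"
      and van: "C (Suc i) \<subseteq> variety (\<lambda>a. a) {sum (T (Suc i)) S'}" using step.IH by blast
    have finS': "finite S'" using S'(1) finS by (rule finite_subset)
    \<comment> \<open>The largest power of \<open>f i\<close> common to all remaining terms.\<close>
    define e where "e = Min ((\<lambda>k. k i) ` S')"
    have e: "e \<le> k i" if "k \<in> S'" for k unfolding e_def using finS' that by (intro Min_le) auto
    have "e \<in> (\<lambda>k. k i) ` S'" unfolding e_def using finS' S' by (intro Min_in) auto
    then obtain k1 where k1: "k1 \<in> S'" "k1 i = e" by blast
    define R where "R k = f i ^ (k i - e) * T i k" for k
    have TR: "T (Suc i) k = f i ^ e * R k" if "k \<in> S'" for k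
    proof -
      have "f i ^ k i = f i ^ e * f i ^ (k i - e)" using e[OF that] by (simp flip: power_add)
      then show ?thesis by (simp add: T_def R_def mult_ac)
    qed
    have wi: "w (Suc i) k = w i k + (k i * fst (d i), of_nat (k i) *s snd (d i))" for k
      by (simp add: w_def weight_def plus_prod_def algebra_simps)
    have bR: "bihom (w i k1) (R k)" if k: "k \<in> S'" for k
    proof -
      have "bihom (((k i - e) * fst (d i), of_nat (k i - e) *s snd (d i)) + w i k) (R k)"
        unfolding R_def plus_prod_def using bihom_mult[OF bihom_power[OF fd[OF i(1)], of "k i - e"] bT[OF i(2), of k]] by simp
      also have "((k i - e) * fst (d i), of_nat (k i - e) *s snd (d i)) + w i k = w i k1"
      proof -
        have eq: "w i k + (k i * fst (d i), of_nat (k i) *s snd (d i)) = w i k1 + (e * fst (d i), of_nat e *s snd (d i))"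
          using const(1)[OF k k1(1)] k1(2) unfolding wi by simp
        obtain m where m: "k i = e + m" using e[OF k] le_Suc_ex by blast
        show ?thesis
        proof (rule prod_eqI)
          show "fst (((k i - e) * fst (d i), of_nat (k i - e) *s snd (d i)) + w i k) = fst (w i k1)"
            using arg_cong[OF eq, of fst] by (simp add: m algebra_simps)
          show "snd (((k i - e) * fst (d i), of_nat (k i - e) *s snd (d i)) + w i k) = snd (w i k1)"
            using arg_cong[OF eq, of snd] by (simp add: m vec_eq_iff algebra_simps)
        qed
      qed
      finally show ?thesis .
    qed
    have bRs: "bihomogeneous (sum R S')" unfolding bihomogeneous_iff using bihom_sum[of S' "w i k1" R] bR by blast
    have "sum (T (Suc i)) S' = f i ^ e * sum R S'" using TR by (simp add: sum_distrib_left)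
    then have CR: "C (Suc i) \<subseteq> variety (\<lambda>a. a) {sum R S'}"
      using irreducible_power_mult[OF irr[OF i(3)] fb[OF i(1)] bRs fC'[OF i(1)], of e] van by simp
    let ?S = "{k \<in> S'. k i = e}"
    have wS: "w i k = w i k1" if "k \<in> ?S" for k
      using const(1)[of k k1] that k1 unfolding wi by simp
    have "bihom (w i k1) (sum (T i) ?S)"
    proof (rule bihom_sum)
      fix k assume "k \<in> ?S"
      then show "bihom (w i k1) (T i k)" using bT[OF i(2), of k] wS by metis
    qed
    then have bTs: "bihomogeneous (sum (T i) ?S)" unfolding bihomogeneous_iff by blast
    have "C i \<subseteq> variety (\<lambda>a. a) {sum (T i) ?S}"
    proof
      fix p assume p: "p \<in> C i"
      then obtain \<delta> z where pz: "p = pt \<delta> z" "proper \<delta> z" using sub[OF i(2)] by blast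
      have f0: "eval2 \<delta> z (f i) = 0" using fC[OF i(1)] p pt_in_hypersurface[OF fb[OF i(1)] pz(2)] pz(1) by blast
      have "eval2 \<delta> z (sum R S') = 0"
        using CR chain[OF i(1)] p pt_in_hypersurface[OF bRs pz(2)] pz(1) by blast
      \<comment> \<open>Here \<open>f i\<close> is zero, and \<open>0 ^ 0 = 1\<close> retains
        exactly the terms whose exponent is the minimum.\<close>
      also have "eval2 \<delta> z (sum R S') = (\<Sum>k\<in>S'. 0 ^ (k i - e) * eval2 \<delta> z (T i k))"
        by (simp add: rhom_simps[OF rhom_eval2] R_def f0)
      also have "\<dots> = (\<Sum>k\<in>?S. 0 ^ (k i - e) * eval2 \<delta> z (T i k))"
        using finS' e by (intro sum.mono_neutral_right) (auto simp: le_antisym)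
      also have "\<dots> = eval2 \<delta> z (sum (T i) ?S)" by (simp add: rhom_simps[OF rhom_eval2])
      finally show "p \<in> variety (\<lambda>a. a) {sum (T i) ?S}" using pt_in_hypersurface[OF bTs pz(2)] pz(1) by blast
    qed
    moreover have "\<forall>k\<in>?S. \<forall>k'\<in>?S. w i k = w i k' \<and> (\<forall>m\<in>{i..<8}. k m = k' m)"
    proof (intro ballI conjI)
      fix k k' m assume k: "k \<in> ?S" "k' \<in> ?S"
      show "w i k = w i k'" using wS k by metis
      assume "m \<in> {i..<8}"
      then show "k m = k' m" using k const(2)[of k k' m] by (cases "m = i") auto
    qed
    moreover have "?S \<subseteq> S" "?S \<noteq> {}" using S' k1 by auto
    ultimately show ?case by (intro exI[of _ ?S]) blast
  qed
  from this[of 0] obtain S' where S': "S' \<subseteq> S" "S' \<noteq> {}"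
    and const: "\<And>k k'. k \<in> S' \<Longrightarrow> k' \<in> S' \<Longrightarrow> w 0 k = w 0 k' \<and> (\<forall>i\<in>{0..<8}. k i = k' i)"
    and van: "C 0 \<subseteq> variety (\<lambda>a. a) {sum (T 0) S'}" by blast
  obtain k where k: "k \<in> S'" using S' by blast
  \<comment> \<open>At stage 0 equal bidegree determines the chart exponents, because the chart
    degrees are independent; the invariant fixes the other eight.\<close>
  have "k' = k" if k': "k' \<in> S'" for k'
  proof (rule PiE_ext)
    show "k' \<in> PiE {..<16} (\<lambda>_. {..<M})" "k \<in> PiE {..<16} (\<lambda>_. {..<M})" using k k' S' S by blast+
    have "weight chart_degree 8 (\<lambda>m. k' (8 + m)) = weight chart_degree 8 (\<lambda>m. k (8 + m))"
      using const[OF k' k] by (simp add: w_def weight_def)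
    then have hi: "k' (8 + m) = k (8 + m)" if "m < 8" for m using chart_weight_inj that by blast
    fix i :: nat assume "i \<in> {..<16}"
    then show "k' i = k i" using const[OF k' k] hi[of "i - 8"] by (cases "i < 8") auto
  qed
  then have "S' = {k}" using k by blast
  then have "p0 \<in> variety (\<lambda>a. a) {T 0 k}" using van p0 by auto
  moreover have "bihomogeneous (T 0 k)" using bT[of 0 k] bihomogeneous_iff by blast
  ultimately have "eval2 \<delta>0 z0 (T 0 k) = 0" using pt_in_hypersurface pz0 by blast
  moreover have "c k \<noteq> 0" using c k S' by blast
  ultimately show False
    using eval2_chart_poly[of \<delta>0 z0 a, OF pz0(2) a] by (auto simp: T_def rhom_simps[OF rhom_eval2] peval_pconst)
qed

lemma krull_dim_variety_le: "krull_dim (variety of_int cox_ideal :: 'a::field_char_0 ambient_point set) \<le> 7"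
  unfolding krull_dim_def
proof (rule Sup_least)
  fix e assume "e \<in> {enat n | n. \<exists>C :: nat \<Rightarrow> 'a ambient_point set.
     (\<forall>i\<le>n. irreducible_closed_in (variety of_int cox_ideal) (C i)) \<and> (\<forall>i<n. C i \<subset> C (Suc i))}"
  then obtain n and C :: "nat \<Rightarrow> 'a ambient_point set" where e: "e = enat n"
    and irr: "\<And>i. i \<le> n \<Longrightarrow> irreducible_closed_in (variety of_int cox_ideal) (C i)"
    and chain: "\<And>i. i < n \<Longrightarrow> C i \<subset> C (Suc i)" by blast
  have "n \<le> 7"
  proof (rule ccontr)
    assume "\<not> n \<le> 7"
    then show False using no_long_chain[of C] irr chain by auto
  qed
  then show "e \<le> 7" unfolding e by (simp add: numeral_eq_enat)
qed

lemma krull_dims: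
  "krull_dim (variety of_int cox_ideal :: 'a::field_char_0 ambient_point set) = 7"
  "krull_dim (section_family :: 'a::field_char_0 ambient_point set) = 7"
proof -
  have "krull_dim (section_family :: 'a ambient_point set) \<le> krull_dim (variety of_int cox_ideal :: 'a ambient_point set)"
    by (rule krull_dim_mono[OF section_family_subset variety_cox_ideal_closed])
  then show "krull_dim (variety of_int cox_ideal :: 'a ambient_point set) = 7"
    "krull_dim (section_family :: 'a ambient_point set) = 7"
    using krull_dim_variety_le[where 'a = 'a] krull_dim_section_family_ge[where 'a = 'a] by order+
qed

section \<open>Plane geometry of the six points and the very affine surfaces\<close>

section \<open>Lines and conics through the blown-up points\<close>

lemma cubic_point_nth: "cubic_point a $ 1 = 1" "cubic_point a $ 2 = a" "cubic_point a $ 3 = a ^ 3"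
  by (simp_all add: cubic_point_def)

lemma dot_3: "dot h x = h $ 1 * x $ 1 + h $ 2 * x $ 2 + h $ 3 * x $ 3"
  by (simp add: dot_def sum_3)

lemma vec3_eq_iff: "x = y \<longleftrightarrow> x $ 1 = y $ 1 \<and> x $ 2 = y $ 2 \<and> x $ 3 = (y :: 'a ^ 3) $ 3"
  by (simp add: vec_eq_iff forall_3)

text \<open>The cross product of \<open>cubic_point a\<close> and \<open>x\<close>, which gives the
  dual coordinates of the line joining them.\<close>

definition join_line :: "'a::field \<Rightarrow> 'a ^ 3 \<Rightarrow> 'a ^ 3" where
  "join_line a x = vector [a * x $ 3 - a ^ 3 * x $ 2, a ^ 3 * x $ 1 - x $ 3, x $ 2 - a * x $ 1]"

lemma join_line_nth:
  "join_line a x $ 1 = a * x $ 3 - a ^ 3 * x $ 2" "join_line a x $ 2 = a ^ 3 * x $ 1 - x $ 3"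
  "join_line a x $ 3 = x $ 2 - a * x $ 1"
  by (simp_all add: join_line_def)

lemma join_line_incident: "dot (join_line a x) (cubic_point a) = 0" "dot (join_line a x) x = 0"
  by (simp_all add: dot_3 cubic_point_nth join_line_nth algebra_simps)

lemma join_line_scale: "join_line a (c *s x) = c *s join_line a x"
  by (simp add: vec3_eq_iff join_line_nth algebra_simps)

lemma join_line_eq_0_iff: "join_line a x = 0 \<longleftrightarrow> x = x $ 1 *s cubic_point a"
  by (auto simp: vec3_eq_iff join_line_nth cubic_point_nth algebra_simps power3_eq_cube)

lemma join_line_unique:
  assumes h: "h \<noteq> 0" "dot h (cubic_point a) = 0" "dot h x = 0" and ln: "join_line a x \<noteq> 0"
  shows "proj_class h = proj_class (join_line a x)"
proof -
  let ?l = "join_line a x"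
  have h1: "h $ 1 = - (h $ 2 * a) - h $ 3 * a ^ 3" and l1: "?l $ 1 = - (?l $ 2 * a) - ?l $ 3 * a ^ 3"
    using h(2) join_line_incident(1)[of a x] by (simp_all add: dot_3 cubic_point_nth algebra_simps eq_neg_iff_add_eq_0)
  have par: "h $ 2 * ?l $ 3 = h $ 3 * ?l $ 2"
    using h(3) by (simp add: dot_3 h1 join_line_nth algebra_simps)
  have "\<exists>c. h = c *s ?l"
  proof (cases "?l $ 3 = 0")
    case False
    then have "h = (h $ 3 / ?l $ 3) *s ?l"
      using par by (simp add: vec3_eq_iff h1 l1 field_simps)
    then show ?thesis by blast
  next
    case True
    then have l2: "?l $ 2 \<noteq> 0" using ln l1 by (auto simp: vec3_eq_iff)
    then have "h $ 3 = 0" using par True by simp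
    then have "h = (h $ 2 / ?l $ 2) *s ?l"
      using True l2 by (simp add: vec3_eq_iff h1 l1 field_simps)
    then show ?thesis by blast
  qed
  then obtain c where c: "h = c *s ?l" by blast
  then have "c \<noteq> 0" using h(1) by auto
  then show ?thesis unfolding c by (rule proj_class_scale)
qed

lemma collinear_iff:
  assumes "\<delta> i \<noteq> \<delta> j"
  shows "(\<exists>h. h \<noteq> 0 \<and> dot h (cubic_point (\<delta> i)) = 0 \<and> dot h (cubic_point (\<delta> j)) = 0 \<and> dot h x = 0)
    \<longleftrightarrow> sphi \<delta> x i j = 0"
proof
  let ?a = "\<delta> i" and ?b = "\<delta> j"
  assume "\<exists>h. h \<noteq> 0 \<and> dot h (cubic_point ?a) = 0 \<and> dot h (cubic_point ?b) = 0 \<and> dot h x = 0"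
  then obtain h where h: "h \<noteq> 0" "dot h (cubic_point ?a) = 0" "dot h (cubic_point ?b) = 0" "dot h x = 0" by blast
  have "(?a - ?b) * (h $ 2 + h $ 3 * (?a ^ 2 + ?a * ?b + ?b ^ 2)) = dot h (cubic_point ?a) - dot h (cubic_point ?b)"
    by (simp add: dot_3 cubic_point_nth algebra_simps power2_eq_square power3_eq_cube)
  then have h2: "h $ 2 = - (h $ 3 * (?a ^ 2 + ?a * ?b + ?b ^ 2))" using h assms by (simp add: eq_neg_iff_add_eq_0)
  have h1: "h $ 1 = h $ 3 * (?a * ?b * (?a + ?b))"
    using h(2) unfolding dot_3 cubic_point_nth h2
    by (simp add: algebra_simps power2_eq_square power3_eq_cube eq_neg_iff_add_eq_0)
  have "h $ 3 \<noteq> 0" using h(1) h1 h2 by (auto simp: vec3_eq_iff)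
  moreover have "dot h x = - (h $ 3 * sphi \<delta> x i j)"
    unfolding dot_3 h1 h2 sphi_def by (simp add: algebra_simps)
  ultimately show "sphi \<delta> x i j = 0" using h(4) by simp
next
  let ?a = "\<delta> i" and ?b = "\<delta> j"
  assume s: "sphi \<delta> x i j = 0"
  \<comment> \<open>The cross product of the two cubic points divided by the difference of their
    parameters, up to sign.\<close>
  define h :: "'a ^ 3" where "h = vector [?a * ?b * (?a + ?b), - (?a ^ 2 + ?a * ?b + ?b ^ 2), 1]"
  have "h \<noteq> 0" "dot h (cubic_point ?a) = 0" "dot h (cubic_point ?b) = 0" "dot h x = - sphi \<delta> x i j"
    by (simp_all add: h_def vec3_eq_iff dot_3 cubic_point_nth sphi_def algebra_simps power2_eq_square power3_eq_cube)
  then show "\<exists>h. h \<noteq> 0 \<and> dot h (cubic_point ?a) = 0 \<and> dot h (cubic_point ?b) = 0 \<and> dot h x = 0"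
    using s by (metis neg_0_equal_iff_equal)
qed

lemma symmetric_nth: "transpose Q = Q \<Longrightarrow> Q $ i $ j = Q $ j $ i"
proof -
  assume "transpose Q = Q"
  moreover have "transpose Q $ j $ i = Q $ i $ j" by (simp add: transpose_def)
  ultimately show ?thesis by simp
qed

lemma quadratic_form_3:
  assumes "transpose Q = Q"
  shows "dot x (Q *v x) = Q $ 1 $ 1 * x $ 1 ^ 2 + Q $ 2 $ 2 * x $ 2 ^ 2 + Q $ 3 $ 3 * x $ 3 ^ 2
    + 2 * (Q $ 1 $ 2 * x $ 1 * x $ 2 + Q $ 1 $ 3 * x $ 1 * x $ 3 + Q $ 2 $ 3 * x $ 2 * x $ 3)"
proof -
  have "Q $ 2 $ 1 = Q $ 1 $ 2" "Q $ 3 $ 1 = Q $ 1 $ 3" "Q $ 3 $ 2 = Q $ 2 $ 3"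
    using symmetric_nth[OF assms] by blast+
  then show ?thesis
    by (simp add: dot_3 matrix_vector_mult_def sum_3 algebra_simps power2_eq_square)
qed

lemma symmetric_eq_0:
  assumes "transpose Q = Q" "Q $ 1 $ 1 = 0" "Q $ 2 $ 2 = 0" "Q $ 3 $ 3 = 0" "Q $ 1 $ 2 = 0" "Q $ 1 $ 3 = 0" "Q $ 2 $ 3 = 0"
  shows "(Q :: 'a::zero ^ 3 ^ 3) = 0"
proof -
  have "Q $ 2 $ 1 = 0" "Q $ 3 $ 1 = 0" "Q $ 3 $ 2 = 0" using symmetric_nth[OF assms(1)] assms(5-7) by metis+
  then show ?thesis using assms by (simp add: vec_eq_iff forall_3)
qed

lemma sconic_at_point:
  assumes "i \<noteq> j"
  shows "sconic \<delta> (cubic_point (\<delta> i)) j = 0"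
proof -
  have *: "esym (insert i S) (Suc k) \<delta> = esym S (Suc k) \<delta> + \<delta> i * esym S k \<delta>" if "i \<notin> S" for k S
    using that by (rule esym_insert)
  let ?S = "UNIV - {j} - {i}"
  have S: "UNIV - {j} = insert i ?S" "i \<notin> ?S" using assms by auto
  have c: "card ?S = 4" using assms by (simp add: card_Diff_singleton card_idx)
  have "esym ?S 5 \<delta> = 0" by (rule esym_large) (simp add: c)
  then have e: "esym (UNIV - {j}) 1 \<delta> = esym ?S 1 \<delta> + \<delta> i" "esym (UNIV - {j}) 2 \<delta> = esym ?S 2 \<delta> + \<delta> i * esym ?S 1 \<delta>"
    "esym (UNIV - {j}) 3 \<delta> = esym ?S 3 \<delta> + \<delta> i * esym ?S 2 \<delta>" "esym (UNIV - {j}) 4 \<delta> = esym ?S 4 \<delta> + \<delta> i * esym ?S 3 \<delta>"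
    "esym (UNIV - {j}) 5 \<delta> = \<delta> i * esym ?S 4 \<delta>"
    using *[OF S(2), of 0] *[OF S(2), of 1] *[OF S(2), of 2] *[OF S(2), of 3] *[OF S(2), of 4]
    unfolding S(1)[symmetric] by (simp_all add: numeral_eq_Suc esym_0)
  show ?thesis
    unfolding sconic_def Let_def conic_poly_def cubic_point_nth e by (simp add: algebra_simps eval_nat_numeral)
qed

text \<open>
  A quadratic form restricts to the cuspidal cubic as a sextic without term of degree 5, so it is
  determined by its leading coefficient and five of its zeros.
\<close>

lemma conic_unique:
  fixes Q :: "'a::field_char_0 ^ 3 ^ 3"
  assumes inj: "inj \<delta>" and sym: "transpose Q = Q"
    and zero: "\<And>i. i \<noteq> j \<Longrightarrow> dot (cubic_point (\<delta> i)) (Q *v cubic_point (\<delta> i)) = 0"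
  shows "dot x (Q *v x) = - (Q $ 3 $ 3 * sconic \<delta> x j)" and "Q $ 3 $ 3 = 0 \<Longrightarrow> Q = 0"
proof -
  define e where "e k = esym (UNIV - {j}) k \<delta>" for k
  \<comment> \<open>The restriction to the cubic of the form plus \<open>Q $ 3 $ 3\<close> times
    \<open>sconic\<close>: the sixth powers cancel and there is no fifth power, so five zeros force
    this quartic to vanish.\<close>
  define r where "r = [:Q $ 1 $ 1 + Q $ 3 $ 3 * (e 1 * e 5), 2 * Q $ 1 $ 2 + Q $ 3 $ 3 * (e 5 - e 1 * e 4),
    Q $ 2 $ 2 + Q $ 3 $ 3 * (e 1 * e 3 - e 4), 2 * Q $ 1 $ 3 + Q $ 3 $ 3 * (e 3 - e 1 * e 2),
    2 * Q $ 2 $ 3 + Q $ 3 $ 3 * (e 1 ^ 2 - e 2):]"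
  have "poly r a = dot (cubic_point a) (Q *v cubic_point a) + Q $ 3 $ 3 * sconic \<delta> (cubic_point a) j" for a
    unfolding quadratic_form_3[OF sym] r_def sconic_def Let_def conic_poly_def cubic_point_nth e_def[symmetric]
    by (simp add: algebra_simps eval_nat_numeral)
  then have "\<delta> ` (UNIV - {j}) \<subseteq> {a. poly r a = 0}" using zero sconic_at_point[of _ j \<delta>] by auto
  moreover have "card (\<delta> ` (UNIV - {j})) = 5"
    using inj by (subst card_image) (auto simp: inj_on_def card_Diff_singleton card_idx)
  moreover have "degree r \<le> 4" unfolding r_def by (simp add: degree_pCons_eq_if)
  ultimately have "r = 0"
    using card_poly_roots_bound[of r] poly_roots_finite[of r] card_mono[of "{a. poly r a = 0}" "\<delta> ` (UNIV - {j})"]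
    by fastforce
  then have c: "Q $ 1 $ 1 = - (Q $ 3 $ 3 * (e 1 * e 5))" "2 * Q $ 1 $ 2 = - (Q $ 3 $ 3 * (e 5 - e 1 * e 4))"
    "Q $ 2 $ 2 = - (Q $ 3 $ 3 * (e 1 * e 3 - e 4))" "2 * Q $ 1 $ 3 = - (Q $ 3 $ 3 * (e 3 - e 1 * e 2))"
    "2 * Q $ 2 $ 3 = - (Q $ 3 $ 3 * (e 1 ^ 2 - e 2))"
    unfolding r_def by (simp_all only: pCons_eq_0_iff eq_neg_iff_add_eq_0)
  have "dot x (Q *v x) = Q $ 1 $ 1 * x $ 1 ^ 2 + Q $ 2 $ 2 * x $ 2 ^ 2 + Q $ 3 $ 3 * x $ 3 ^ 2
    + ((2 * Q $ 1 $ 2) * x $ 1 * x $ 2 + (2 * Q $ 1 $ 3) * x $ 1 * x $ 3 + (2 * Q $ 2 $ 3) * x $ 2 * x $ 3)"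
    unfolding quadratic_form_3[OF sym] by (simp add: algebra_simps)
  then show "dot x (Q *v x) = - (Q $ 3 $ 3 * sconic \<delta> x j)"
    unfolding c sconic_def Let_def conic_poly_def e_def[symmetric] by (simp add: algebra_simps)
  show "Q = 0" if "Q $ 3 $ 3 = 0" using c that by (intro symmetric_eq_0[OF sym]) simp_all
qed

lemma conic_iff:
  fixes \<delta> :: "idx \<Rightarrow> 'a::field_char_0"
  assumes inj: "inj \<delta>"
  shows "(\<exists>Q :: 'a ^ 3 ^ 3. Q \<noteq> 0 \<and> transpose Q = Q \<and>
      (\<forall>i. i \<noteq> j \<longrightarrow> dot (cubic_point (\<delta> i)) (Q *v cubic_point (\<delta> i)) = 0) \<and> dot x (Q *v x) = 0)
    \<longleftrightarrow> sconic \<delta> x j = 0"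
proof
  assume "\<exists>Q :: 'a ^ 3 ^ 3. Q \<noteq> 0 \<and> transpose Q = Q \<and>
      (\<forall>i. i \<noteq> j \<longrightarrow> dot (cubic_point (\<delta> i)) (Q *v cubic_point (\<delta> i)) = 0) \<and> dot x (Q *v x) = 0"
  then show "sconic \<delta> x j = 0" using conic_unique(1)[OF inj, of _ j x] conic_unique(2)[OF inj, of _ j]
    by (metis mult_eq_0_iff neg_equal_0_iff_equal)
next
  assume s: "sconic \<delta> x j = 0"
  define e where "e k = esym (UNIV - {j}) k \<delta>" for k
  \<comment> \<open>The matrix of twice \<open>sconic\<close>, which avoids halves in the
    off-diagonal entries.\<close>
  define Q :: "'a ^ 3 ^ 3" where "Q = vector [
    vector [2 * (e 1 * e 5), e 5 - e 1 * e 4, e 3 - e 1 * e 2],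
    vector [e 5 - e 1 * e 4, 2 * (e 1 * e 3 - e 4), e 1 ^ 2 - e 2],
    vector [e 3 - e 1 * e 2, e 1 ^ 2 - e 2, - 2]]"
  have "transpose Q = Q" by (simp add: vec_eq_iff forall_3 transpose_def Q_def)
  moreover have "dot y (Q *v y) = 2 * sconic \<delta> y j" for y
    unfolding quadratic_form_3[OF \<open>transpose Q = Q\<close>] sconic_def Let_def conic_poly_def e_def[symmetric]
    by (simp add: Q_def algebra_simps)
  moreover have "Q $ 3 $ 3 = - 2" by (simp add: Q_def)
  then have "Q \<noteq> 0" by auto
  ultimately show "\<exists>Q :: 'a ^ 3 ^ 3. Q \<noteq> 0 \<and> transpose Q = Q \<and>
      (\<forall>i. i \<noteq> j \<longrightarrow> dot (cubic_point (\<delta> i)) (Q *v cubic_point (\<delta> i)) = 0) \<and> dot x (Q *v x) = 0"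
    using s sconic_at_point[of _ j \<delta>] by (intro exI[of _ Q]) simp
qed

section \<open>The very affine surface\<close>

definition surface_pt :: "'a::field ^ idx \<Rightarrow> 'a ^ 3 \<Rightarrow> 'a surface_point" where
  "surface_pt \<delta> x = (proj_class x, \<lambda>i. proj_class (join_line (\<delta> $ i) x))"

text \<open>A blown-up point lies on the lines \<open>F i j\<close> through it.\<close>

lemma nondegenerate_not_blown_up:
  assumes "nondegenerate \<delta> x" shows "x \<noteq> c *s cubic_point (\<delta> i)"
proof
  assume x: "x = c *s cubic_point (\<delta> i)"
  obtain j where j: "j \<noteq> i" using that[of "if i = I1 then I2 else I1"] by auto
  have "sphi \<delta> x i j = 0"
    by (simp add: x sphi_def cubic_point_nth algebra_simps power2_eq_square power3_eq_cube)
  then have "usec \<delta> x (F i j) = 0" using j by (simp add: psec_simps)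
  then show False using assms by (simp add: nondegenerate_def)
qed

lemma dot_proj_class: "(\<forall>y\<in>proj_class x. dot h y = 0) \<longleftrightarrow> dot h x = 0"
proof -
  have "dot h (c *s x) = c * dot h x" for c by (simp add: dot_3 algebra_simps)
  then show ?thesis using proj_class_self[of x] by (auto simp: proj_class_def)
qed

lemma quadric_proj_class: "(\<forall>y\<in>proj_class x. dot y (Q *v y) = 0) \<longleftrightarrow> dot x (Q *v x) = 0"
proof -
  have "dot (c *s x) (Q *v (c *s x)) = c ^ 2 * dot x (Q *v x)" for c
    by (simp add: dot_3 matrix_vector_mult_def sum_3 algebra_simps power2_eq_square)
  then show ?thesis using proj_class_self[of x] by (auto simp: proj_class_def)
qed

lemma very_affine_surface_eq:
  fixes \<delta> :: "'a::field_char_0 ^ idx"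
  assumes roots: "0 \<notin> roots \<delta>"
  shows "very_affine_surface \<delta> = {surface_pt \<delta> x | x. nondegenerate (($) \<delta>) x}"
proof -
  have roots': "0 \<notin> roots (\<chi> i. \<delta> $ i)" using roots by (simp add: vec_lambda_eta)
  have inj: "inj (($) \<delta>)" using root_diff_nonzero[OF roots'] by (intro injI) force
  have ne: "\<delta> $ i \<noteq> \<delta> $ j" if "i \<noteq> j" for i j using inj that by (auto simp: inj_def)
  \<comment> \<open>Away from the blown-up points the tangent conditions in
    \<open>surface_line\<close> are vacuous, so lying on a line is the vanishing of its
    section.\<close>
  have off: "(p, L) \<notin> surface_line \<delta> m \<longleftrightarrow> usec (($) \<delta>) x m \<noteq> 0"
    if P: "(p, L) \<in> cubic_surface \<delta>" "p = proj_class x" "\<And>i. p \<noteq> proj_class (blown_up_point \<delta> i)" for p L x m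
  proof (cases m rule: line_cases)
    case (E i)
    then show ?thesis using P by (simp add: surface_line_def psec_simps)
  next
    case (F i j)
    have "(p, L) \<in> surface_line \<delta> m \<longleftrightarrow> (\<exists>h. h \<noteq> 0 \<and> dot h (cubic_point (\<delta> $ i)) = 0 \<and>
        dot h (cubic_point (\<delta> $ j)) = 0 \<and> dot h x = 0)"
      using P unfolding F(2) F_eq_F_pair[OF F(1)]
      by (simp add: surface_line_def Rep_Abs_idx_pair[OF F(1)] dot_proj_class)
    then show ?thesis using collinear_iff[of "($) \<delta>" i j x] ne[of i j] F by (simp add: psec_simps)
  next
    case (G j)
    have "(p, L) \<in> surface_line \<delta> m \<longleftrightarrow> (\<exists>Q :: 'a ^ 3 ^ 3. Q \<noteq> 0 \<and> transpose Q = Q \<and>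
      (\<forall>i. i \<noteq> j \<longrightarrow> dot (cubic_point (\<delta> $ i)) (Q *v cubic_point (\<delta> $ i)) = 0) \<and> dot x (Q *v x) = 0)"
      using P unfolding G by (simp add: surface_line_def quadric_proj_class)
    then show ?thesis using conic_iff[OF inj, of j x] G by (simp add: psec_simps)
  qed
  show ?thesis
  proof (intro equalityI subsetI)
    fix P assume P: "P \<in> very_affine_surface \<delta>"
    then obtain x l where x: "P = (proj_class x, \<lambda>i. proj_class (l i))" "x \<noteq> 0"
      and l: "\<And>i. l i \<noteq> 0 \<and> dot (l i) (blown_up_point \<delta> i) = 0 \<and> dot (l i) x = 0"
      unfolding very_affine_surface_def cubic_surface_def by blast
    have in_surface: "P \<in> cubic_surface \<delta>" using P unfolding very_affine_surface_def by blast
    have off_E: "proj_class x \<noteq> proj_class (blown_up_point \<delta> i)" for i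
    proof -
      have "P \<notin> surface_line \<delta> (E i)" using P unfolding very_affine_surface_def by blast
      then show ?thesis using in_surface unfolding x(1) by (simp add: surface_line_def)
    qed
    have nz: "usec (($) \<delta>) x m \<noteq> 0" for m
      using off[OF in_surface[unfolded x(1)] HOL.refl off_E, of m] P unfolding very_affine_surface_def x(1) by blast
    then have nd: "nondegenerate (($) \<delta>) x" using roots' by (simp add: nondegenerate_def)
    have "proj_class (l i) = proj_class (join_line (\<delta> $ i) x)" for i
      using l[of i] nondegenerate_not_blown_up[OF nd] join_line_eq_0_iff[of "\<delta> $ i" x]
      by (intro join_line_unique) auto
    then have "P = surface_pt \<delta> x" unfolding surface_pt_def x(1) by simp
    then show "P \<in> {surface_pt \<delta> x | x. nondegenerate (($) \<delta>) x}" using nd by blast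
  next
    fix P assume "P \<in> {surface_pt \<delta> x | x. nondegenerate (($) \<delta>) x}"
    then obtain x where P: "P = surface_pt \<delta> x" and nd: "nondegenerate (($) \<delta>) x" by blast
    have "x \<noteq> 0" using nondegenerate_not_blown_up[OF nd, of 0] by simp
    moreover have "join_line (\<delta> $ i) x \<noteq> 0" for i
      using nondegenerate_not_blown_up[OF nd] join_line_eq_0_iff[of "\<delta> $ i" x] by auto
    ultimately have "P \<in> cubic_surface \<delta>"
      unfolding P surface_pt_def cubic_surface_def
      by (intro CollectI exI[of _ x] exI[of _ "\<lambda>i. join_line (\<delta> $ i) x"]) (simp add: join_line_incident)
    moreover have "proj_class x \<noteq> proj_class (blown_up_point \<delta> i)" for i
    proof
      assume "proj_class x = proj_class (blown_up_point \<delta> i)"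
      from proj_class_eq[OF this[symmetric]] show False using nondegenerate_not_blown_up[OF nd] by blast
    qed
    ultimately have "P \<notin> surface_line \<delta> m" for m
      using off[of "fst P" "snd P" x m] nd unfolding P surface_pt_def nondegenerate_def by simp
    then show "P \<in> very_affine_surface \<delta>"
      using \<open>P \<in> cubic_surface \<delta>\<close> unfolding very_affine_surface_def by blast
  qed
qed

lemma torus_char_None:
  assumes "\<And>i. s (Some i) = (1 :: 'a::field)"
  shows "torus_char s (pic l) = s None ^ nat (pic l $ None)"
proof -
  have "0 \<le> pic l $ None" by (cases l rule: line_cases) (simp_all add: pic_nth pic_F_nth)
  then show ?thesis by (simp add: torus_char_split assms) (simp add: power_int_def)
qed

lemma cox_embedding_surface_pt:
  assumes "0 \<notin> roots \<delta>"
  shows "cox_embedding \<delta> (surface_pt \<delta> x) = torus_orbit (usec (($) \<delta>) x)"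
proof -
  have sec: "cox_section (\<lambda>a. a) \<delta> y (\<lambda>_. 1) (\<lambda>_. 1) = usec (($) \<delta>) y" for y
    using cox_section_eq_psec[OF rhom_id assms] by (intro ext) simp
  have "torus_orbit (usec (($) \<delta>) (c *s x)) = torus_orbit (usec (($) \<delta>) x)" if c: "c \<noteq> 0" for c
  proof -
    \<comment> \<open>Rescaling \<open>x\<close> is the action of the torus coordinate of the
      hyperplane class.\<close>
    let ?s = "\<lambda>k. case k of None \<Rightarrow> c | Some i \<Rightarrow> 1"
    have "usec (($) \<delta>) (c *s x) = (\<lambda>l. torus_char ?s (pic l) * usec (($) \<delta>) x l)"
      by (rule ext) (simp add: usec_scale_x torus_char_None)
    then show ?thesis using torus_orbit_scale[of ?s "usec (($) \<delta>) x"] c by (simp split: option.split)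
  qed
  then show ?thesis
    unfolding cox_embedding_def surface_pt_def sec using proj_class_self[of x] by (auto simp: proj_class_def)
qed

lemma universal_family_eq: "(universal_family :: 'a::field_char_0 ambient_point set) = section_family"
proof (intro equalityI subsetI)
  fix q :: "'a ambient_point" assume "q \<in> universal_family"
  then obtain \<delta> P where q: "q = (proj_class \<delta>, cox_embedding \<delta> P)" "0 \<notin> roots \<delta>" "P \<in> very_affine_surface \<delta>"
    unfolding universal_family_def by blast
  then obtain x where x: "P = surface_pt \<delta> x" "nondegenerate (($) \<delta>) x"
    using very_affine_surface_eq[OF q(2)] by blast
  have "q = pt (($) \<delta>) (usec (($) \<delta>) x)"
    unfolding q(1) x(1) cox_embedding_surface_pt[OF q(2)] by (simp add: pt_def vec_lambda_eta)
  then show "q \<in> section_family" unfolding section_family_def using x(2) by blast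
next
  fix q :: "'a ambient_point" assume "q \<in> section_family"
  then obtain \<delta> x where q: "q = pt \<delta> (usec \<delta> x)" "nondegenerate \<delta> x" unfolding section_family_def by blast
  let ?\<delta> = "\<chi> i. \<delta> i"
  have d: "($) ?\<delta> = \<delta>" by (simp add: fun_eq_iff)
  have roots: "0 \<notin> roots ?\<delta>" using q(2) by (simp add: nondegenerate_def)
  have "surface_pt ?\<delta> x \<in> very_affine_surface ?\<delta>" unfolding very_affine_surface_eq[OF roots] d using q(2) by blast
  moreover have "q = (proj_class ?\<delta>, cox_embedding ?\<delta> (surface_pt ?\<delta> x))"
    unfolding cox_embedding_surface_pt[OF roots] d q(1) pt_def ..
  ultimately show "q \<in> universal_family" unfolding universal_family_def using roots by blast
qed

text \<open>The sides of a non-degenerate triangle have no common point; this is the uniqueness that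
  accompanies \<open>solve_base_sections\<close>.\<close>

lemma point_determined_by_lines:
  assumes roots: "0 \<notin> roots (\<chi> i. \<delta> i)"
    and "sphi \<delta> x I1 I2 = 0" "sphi \<delta> x I1 I3 = 0" "sphi \<delta> x I2 I3 = 0"
  shows "x = (0 :: 'a::field ^ 3)"
proof -
  let ?S = "\<delta> I1 + \<delta> I2 + \<delta> I3"
  have "(\<delta> I2 - \<delta> I3) * (?S * (x $ 2 - x $ 1 * \<delta> I1)) = sphi \<delta> x I1 I2 - sphi \<delta> x I1 I3"
    "(\<delta> I1 - \<delta> I3) * (?S * (x $ 2 - x $ 1 * \<delta> I2)) = sphi \<delta> x I1 I2 - sphi \<delta> x I2 I3"
    by (simp_all add: sphi_def algebra_simps power2_eq_square)
  moreover have nz: "\<delta> I2 - \<delta> I3 \<noteq> 0" "\<delta> I1 - \<delta> I3 \<noteq> 0" "\<delta> I1 - \<delta> I2 \<noteq> 0" "?S \<noteq> 0"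
    using root_diff_nonzero[OF roots] root_sum_nonzero[OF roots] by auto
  ultimately have x2: "x $ 2 = x $ 1 * \<delta> I1" "x $ 2 = x $ 1 * \<delta> I2" using assms(2-4) by simp_all
  have "x $ 1 * (\<delta> I1 - \<delta> I2) = x $ 1 * \<delta> I1 - x $ 1 * \<delta> I2" by (rule right_diff_distrib)
  also have "\<dots> = 0" using x2 by (metis diff_self)
  finally have "x $ 1 = 0" using nz by simp
  then show ?thesis using x2 assms(2) by (simp add: vec3_eq_iff sphi_def)
qed

text \<open>The \<open>E\<close> coordinates are 1 on both sides, so the torus element is trivial
  except at the hyperplane class and merely rescales \<open>x\<close>; the \<open>F\<close>
  coordinates are linear in \<open>x\<close> and determine it.\<close>

lemma cox_embedding_inj:
  fixes \<delta> :: "'a::field_char_0 ^ idx"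
  assumes roots: "0 \<notin> roots \<delta>" and eq: "torus_orbit (usec (($) \<delta>) x) = torus_orbit (usec (($) \<delta>) y)"
  shows "surface_pt \<delta> x = surface_pt \<delta> y"
proof -
  obtain s where s: "\<forall>k. s k \<noteq> 0" "usec (($) \<delta>) y = (\<lambda>l. torus_char s (pic l) * usec (($) \<delta>) x l)"
    using torus_orbit_eq[OF eq] by blast
  have u: "usec (($) \<delta>) y l = torus_char s (pic l) * usec (($) \<delta>) x l" for l using s(2) by (rule fun_cong)
  have s1: "s (Some i) = 1" for i
  proof -
    have "torus_char s (pic (E i)) = s (Some i)"
      by (simp add: torus_char_split pic_nth of_bool_def if_distrib[of "\<lambda>x. _ powi x"] cong: if_cong)
    then show ?thesis using u[of "E i"] by (simp add: psec_simps)
  qed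
  define c where "c = s None"
  have c: "c \<noteq> 0" using s(1) by (simp add: c_def)
  have "sphi (($) \<delta>) (y - c *s x) i j = 0" if "i \<noteq> j" for i j
    using u[of "F i j"] that
    by (simp add: psec_simps torus_char_None[of s, OF s1] pic_F_nth c_def[symmetric]) (simp add: sphi_def algebra_simps)
  then have "y - c *s x = 0"
    using roots by (intro point_determined_by_lines[of "($) \<delta>"]) (simp_all add: vec_lambda_eta)
  then have y: "y = c *s x" by simp
  show ?thesis unfolding surface_pt_def y join_line_scale proj_class_scale[OF c] ..
qed

lemma cox_embedding_bij:
  fixes \<delta> :: "'a::field_char_0 ^ idx"
  assumes roots: "0 \<notin> roots \<delta>"
  shows "bij_betw (cox_embedding \<delta>) (very_affine_surface \<delta>) {Z. (proj_class \<delta>, Z) \<in> variety of_int cox_ideal}"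
  unfolding bij_betw_def
proof
  show "inj_on (cox_embedding \<delta>) (very_affine_surface \<delta>)"
  proof (rule inj_onI)
    fix P P' assume "P \<in> very_affine_surface \<delta>" "P' \<in> very_affine_surface \<delta>"
      and eq: "cox_embedding \<delta> P = cox_embedding \<delta> P'"
    then obtain x y where P: "P = surface_pt \<delta> x" "P' = surface_pt \<delta> y"
      unfolding very_affine_surface_eq[OF roots] by blast
    show "P = P'"
      using eq unfolding P cox_embedding_surface_pt[OF roots] by (rule cox_embedding_inj[OF roots])
  qed
  show "cox_embedding \<delta> ` very_affine_surface \<delta> = {Z. (proj_class \<delta>, Z) \<in> variety of_int cox_ideal}"
  proof (intro equalityI subsetI)
    fix Z assume "Z \<in> cox_embedding \<delta> ` very_affine_surface \<delta>"
    then have "(proj_class \<delta>, Z) \<in> universal_family" unfolding universal_family_def using roots by blast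
    then show "Z \<in> {Z. (proj_class \<delta>, Z) \<in> variety of_int cox_ideal}"
      using section_family_subset unfolding universal_family_eq by blast
  next
    fix Z assume "Z \<in> {Z. (proj_class \<delta>, Z) \<in> variety of_int cox_ideal}"
    then have "(proj_class \<delta>, Z) \<in> {(D, Z) \<in> variety of_int cox_ideal. D \<in> root_complement}"
      using roots by (auto simp: root_complement_def)
    then have "(proj_class \<delta>, Z) \<in> section_family" unfolding variety_root_complement .
    then obtain \<epsilon> x where Z: "(proj_class \<delta>, Z) = pt \<epsilon> (usec \<epsilon> x)" and nd: "nondegenerate \<epsilon> x"
      unfolding section_family_def by blast
    then have "proj_class (\<chi> i. \<epsilon> i) = proj_class \<delta>" by (simp add: pt_def)
    \<comment> \<open>The family supplies parameters proportional to \<delta>; rescaling moves the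
      representative into the fibre over \<delta> itself.\<close>
    then obtain c where c: "c \<noteq> 0" "\<delta> = c *s (\<chi> i. \<epsilon> i)" using proj_class_eq by blast
    then have d: "(\<lambda>i. c * \<epsilon> i) = ($) \<delta>" by (simp add: fun_eq_iff)
    obtain y where y: "nondegenerate (($) \<delta>) y" "pt \<epsilon> (usec \<epsilon> x) = pt (($) \<delta>) (usec (($) \<delta>) y)"
      using nondegenerate_rescale[OF nd c(1)] unfolding d by blast
    have "Z = cox_embedding \<delta> (surface_pt \<delta> y)"
      using Z unfolding y(2) cox_embedding_surface_pt[OF roots] by (simp add: pt_def)
    then show "Z \<in> cox_embedding \<delta> ` very_affine_surface \<delta>"
      unfolding very_affine_surface_eq[OF roots] using y(1) by blast
  qed
qed

text \<open>The witness is \<open>all_trinomials\<close>, which contains one trinomial of each sign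
  class met by the orbit. The dimension 7 is composed of 5 projective parameters and 2 dimensions of
  the surface.\<close>

theorem proposition2p2:
  fixes val :: "'k::field_char_0 \<Rightarrow> ereal"
  assumes "nonarchimedean_valuation val"
  defines "V \<equiv> (variety of_int cox_ideal :: 'k alg_closure ambient_point set)"
  defines "cluster \<equiv> (\<lambda>B l. {f \<in> B. pic_homogeneous (anticanonical - pic l) f})"
  shows
    "(\<exists>B :: int lpoly set.
        card B = 270 \<and> B \<subseteq> cox_ideal \<and>
        (\<forall>f\<in>B. card (Poly_Mapping.keys f) = 3) \<and>
        saturation (ideal_generated B) saturating_element
          = saturation cox_ideal saturating_element \<and>
        inj (\<lambda>l. anticanonical - pic l) \<and>
        B = (\<Union>l. cluster B l) \<and>
        (\<forall>l. card (cluster B l) = 10 \<and>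
             card {m. meets l m} = 10 \<and>
             (\<Union>f\<in>cluster B l. occurring_lines f) = {m. meets l m}) \<and>
        cluster B (G I1) = G1_trinomials \<and>
        B \<subseteq> weyl_orbit G1_trinomials \<and>
        weyl_orbit G1_trinomials \<subseteq> B \<union> uminus ` B \<and>
        B \<inter> uminus ` B = {}) \<and>
     krull_dim V = 7 \<and>
     krull_dim (universal_family :: 'k alg_closure ambient_point set) = 7 \<and>
     {(D, Z) \<in> V. D \<in> root_complement} = universal_family \<and>
     (\<forall>\<delta> :: 'k alg_closure ^ idx. 0 \<notin> roots \<delta> \<longrightarrow>
        bij_betw (cox_embedding \<delta>) (very_affine_surface \<delta>) {Z. (proj_class \<delta>, Z) \<in> V}) \<and>
     V = zariski_closure universal_family"
proof -
  have subset: "all_trinomials \<subseteq> cox_ideal"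
    using all_trinomials_cox ideal_generated_base by blast
  have keys: "\<forall>f\<in>all_trinomials. card (Poly_Mapping.keys f) = 3"
    using card_keys_trinomials_at unfolding all_trinomials_def by blast
  have cluster: "cluster all_trinomials l = trinomials_at l" for l
    unfolding cluster_def by (rule cluster_trinomials)
  have B: "card all_trinomials = 270 \<and> all_trinomials \<subseteq> cox_ideal \<and>
        (\<forall>f\<in>all_trinomials. card (Poly_Mapping.keys f) = 3) \<and>
        saturation (ideal_generated all_trinomials) saturating_element
          = saturation cox_ideal saturating_element \<and>
        inj (\<lambda>l. anticanonical - pic l) \<and>
        all_trinomials = (\<Union>l. cluster all_trinomials l) \<and>
        (\<forall>l. card (cluster all_trinomials l) = 10 \<and>
             card {m. meets l m} = 10 \<and>
             (\<Union>f\<in>cluster all_trinomials l. occurring_lines f) = {m. meets l m}) \<and>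
        cluster all_trinomials (G I1) = G1_trinomials \<and>
        all_trinomials \<subseteq> weyl_orbit G1_trinomials \<and>
        weyl_orbit G1_trinomials \<subseteq> all_trinomials \<union> uminus ` all_trinomials \<and>
        all_trinomials \<inter> uminus ` all_trinomials = {}"
    unfolding cluster
    by (intro conjI allI card_all_trinomials subset keys saturation_eq inj_anticanonical_minus_pic
        all_trinomials_def card_trinomials_at card_meets G1_trinomials_eq[symmetric]
        all_trinomials_subset_weyl_orbit weyl_orbit_subset all_trinomials_inter_uminus)
      (simp add: occurring_trinomials_at meets_iff)
  show ?thesis
    unfolding V_def universal_family_eq
    by (intro conjI allI impI exI[of _ all_trinomials] B krull_dims variety_root_complement cox_embedding_bij
        closure_section_family[symmetric])
qed

end
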